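(* Let $p_X\colon M_X\to X$ be a control map, let $X=A\cup B$ be the union of two closed subsets with intersection $N=A\cap B$, let $n\ge1$ and $\delta\ge\epsilon$. For an element $[C,\psi]\in L_n^{\delta,\epsilon}(X,B;p_X,R)$ let $C'\subset C$ be the geometric subcomplex $C'_r=C_r(B\cup N^{(n+2-r)4\epsilon})$ and let $p\colon C\to C/C'$ be the projection. Then $$\mathrm{exc}\colon L_n^{\delta,\epsilon}(X,B;p_X,R)\to L_n^{\delta,\epsilon}(A,A\cap N^{(n+5)4\delta};p_A,R),\qquad [C,\psi]\mapsto[C/C',p_\%\psi]$$ is a well-defined homomorphism, and it is a stable inverse of the inclusion-induced homomorphism $i_*$; that is: (a) the composite of $i_*\colon L_n^{\delta,\epsilon}(A,N;p_A,R)\to L_n^{\delta,\epsilon}(X,B;p_X,R)$ with $\mathrm{exc}$ is the homomorphism $L_n^{\delta,\epsilon}(A,N;p_A,R)\to L_n^{\delta,\epsilon}(A,A\cap N^{(n+5)4\delta};p_A,R)$ induced by inclusion; (b) the composite of $\mathrm{exc}$ with $i_*\colon L_n^{\delta,\epsilon}(A,A\cap N^{(n+5)4\delta};p_A,R)\to L_n^{\delta,\epsilon}(X,B\cup N^{(n+5)4\delta};p_X,R)$ is the homomorphism $L_n^{\delta,\epsilon}(X,B;p_X,R)\to L_n^{\delta,\epsilon}(X,B\cup N^{(n+5)4\delta};p_X,R)$ induced by inclusion.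
   Context: $R$ is a ring with unity and involution $a\mapsto\bar a$; a control map $p_X$ is a continuous map from a space to a metric space $X$; $p_S\colon p_X^{-1}(S)\to S$ is the restriction for $S\subset X$. $S^\epsilon$ is the closed $\epsilon$-neighbourhood of $S$ in $X$. A geometric module on $p_X$ is a free $R$-module with a basis (its generators) and a function from the basis to the domain of $p_X$; $G(S)$ is the geometric submodule of $G$ generated by generators lying over $S$. A geometric morphism $f\colon G\to H$ is a formal $R$-linear combination $\sum a_\lambda\rho_\lambda$ of paths in the domain of $p_X$ from generators of $G$ to generators of $H$, finitely many from each generator; composition is concatenation, $1$ is the sum of constant paths. $f$ has radius $\epsilon$ if for each path $\rho$ occurring in $f$, $p_X\rho$ lies in the closed $\epsilon$-balls about the images of both end points. $f\sim_\epsilon g$ means that $f-g$ is a linear combination of differences $\rho-\rho'$ of paths homotopic rel end points by a homotopy whose image in $X$ lies in the closed $\epsilon$-balls about both end points. $f|W$ is the part of $f$ made of paths starting over $W$; "over $W$" means after restriction to $W$. Duals: $G^*=G$, $f^*=\sum\bar a_\lambda\bar\rho_\lambda$ ($\bar\rho$ = reversed path). A (free) $\epsilon$ chain complex $C$ has geometric modules $C_r$ and $d$ of radius $\epsilon$ with $d^2\sim_{2\epsilon}0$; it is $n$-dimensional if $C_r=0$ unless $0\le r\le n$. An $\epsilon$ chain map $f$: $f,df,fd$ have radius $\epsilon$, $df\sim_\epsilon fd$. $C$ is $\epsilon$ contractible (over $W$) if there is $\Gamma\colon C_r\to C_{r+1}$ of radius $\epsilon$ with $d\Gamma+\Gamma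 d\sim_{2\epsilon}1$ (over $W$). $\mathcal C(f)_r=D_r\oplus C_{r-1}$ with $d=\begin{pmatrix}d_D&(-)^{r-1}f\\0&d_C\end{pmatrix}$ is the mapping cone of $f\colon C\to D$; $C^r=(C_r)^*$; $C^{n-*}$ has $(C^{n-*})_r=C^{n-r}$ and differential $(-)^rd^*$. If $C_r=C'_r\oplus C''_r$ (geometric submodules) and $d=\begin{pmatrix}d_{C'}&*\\0&d_{C''}\end{pmatrix}$, then $C'$ is a geometric subcomplex and $C''=C/C'$ is the quotient. For $\psi\colon C^p\to C_q$, $T\psi=(-)^{pq}\psi^*$. An $n$-dimensional $\epsilon$ quadratic structure on $C$ is a family $\psi_s\colon C^{n-r-s}\to C_r$ ($s\ge0$, $r\in\mathbb Z$) of radius $\epsilon$ with $d\psi_s+(-)^r\psi_sd^*+(-)^{n-s-1}(\psi_{s+1}+(-)^{s+1}T\psi_{s+1})\sim_{3\epsilon}0$. An $n$-dimensional $\epsilon$ quadratic complex is an $n$-dimensional free $\epsilon$ chain complex with such a structure. An $(n+1)$-dimensional $\epsilon$ quadratic structure on $f\colon C\to D$ is $(\delta\psi,\psi)$ with $\psi$ as before and $\delta\psi_s\colon D^{n+1-r-s}\to D_r$ of radius $\epsilon$ with $d\delta\psi_s+(-)^r\delta\psi_sd^*+(-)^{n-s}(\delta\psi_{s+1}+(-)^{s+1}T\delta\psi_{s+1})+(-)^nf\psi_sf^*\sim_{3\epsilon}0$; an $\epsilon$ quadratic pair is an $\epsilon$ chain map from an $n$- to an $(n+1)$-dimensional free $\epsilon$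 chain complex with such a structure. An $\epsilon$ cobordism of $(C,\psi)$, $(C',\psi')$ is an $\epsilon$ quadratic pair with boundary $(C\oplus C',\psi\oplus-\psi')$. Put $\mathcal D_\psi=(1+T)\psi_0\colon C^{n-*}\to C$ and $\mathcal D_{(\delta\psi,\psi)}=\begin{pmatrix}(1+T)\delta\psi_0\\(-)^{n+1-r}(1+T)\psi_0f^*\end{pmatrix}\colon D^{n+1-r}\to\mathcal C(f)_r$. $(C,\psi)$ is $\epsilon$ Poincaré (over $W$) if $\mathcal C(\mathcal D_\psi)$ is $4\epsilon$ contractible (over $W$); a pair is if moreover $\mathcal C(\mathcal D_{(\delta\psi,\psi)})$ is. A positive complex $E$ is $\epsilon$ connected if there is a $4\epsilon$ morphism $h\colon E_0\to E_1$ with $dh\sim_{8\epsilon}1$; a chain map is $\epsilon$ connected if its cone is; $(C,\psi)$ is $\epsilon$ connected if $\mathcal D_\psi$ is; a pair is if $\mathcal D_\psi$ and $\mathcal D_{(\delta\psi,\psi)}$ are. $p_\%\psi=\{p\psi_sp^*\}$. For $Y\subset X$, $L_n^{\delta,\epsilon}(X,Y;p_X,R)$ is the abelian group (under direct sum) of equivalence classes of finitely generated $n$-dimensional $\epsilon$ connected $\epsilon$ quadratic complexes on $p_X$ that are $\epsilon$ Poincaré over $X-Y$; the equivalence relation is generated by finitely generated $\delta$ connected $\delta$ cobordisms that are $\delta$ Poincaré over $X-Y$. *)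

theory Defs
  imports "HOL-Analysis.Analysis" "HOL-Algebra.Group" "HOL-Library.Function_Algebras"
    "HOL-Library.Nat_Bijection"
begin

section \<open>Rings with involution\<close>

text \<open>Rings are unital and not necessarily commutative. Class \<open>ring_1\<close> is avoided because
  it excludes the zero ring.\<close>

class involution_ring = ring + monoid_mult +
  fixes bar :: "'a \<Rightarrow> 'a"
  assumes bar_add: "bar (a + b) = bar a + bar b"
    and bar_mult: "bar (a * b) = bar b * bar a"
    and bar_bar: "bar (bar a) = a"

definition msign :: "int \<Rightarrow> 'a::uminus \<Rightarrow> 'a" where
  "msign k a = (if even k then a else - a)"

section \<open>Control maps\<close>

text \<open>Spaces are subsets of types, so that a control map can be restricted.\<close>

record ('m, 'x) control =
  cdom :: "'m set"
  cbase :: "'x set"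
  cmap :: "'m \<Rightarrow> 'x"

definition control_map :: "('m::topological_space, 'x::metric_space) control \<Rightarrow> bool" where
  "control_map P \<longleftrightarrow> continuous_on (cdom P) (cmap P) \<and> cmap P ` cdom P \<subseteq> cbase P"

definition restr :: "('m, 'x) control \<Rightarrow> 'x set \<Rightarrow> ('m, 'x) control" where
  "restr P S = \<lparr>cdom = cdom P \<inter> cmap P -` S, cbase = S, cmap = cmap P\<rparr>"

text \<open>The condition \<open>S \<noteq> {}\<close> is needed since \<open>infdist x {} = 0\<close> by convention.\<close>

definition closed_nbhd :: "'x::metric_space set \<Rightarrow> 'x set \<Rightarrow> real \<Rightarrow> 'x set" where
  "closed_nbhd X S e = {x \<in> X. S \<noteq> {} \<and> infdist x S \<le> e}"

section \<open>Geometric modules and morphisms\<close>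

text \<open>A geometric module is given by its set of generators, the domain of the partial map, and
  their positions in the domain of the control map.\<close>

type_synonym ('g, 'm) gmod = "'g \<Rightarrow> 'm option"

definition gmodule :: "('m, 'x) control \<Rightarrow> ('g, 'm) gmod \<Rightarrow> bool" where
  "gmodule P G \<longleftrightarrow> ran G \<subseteq> cdom P"

definition over :: "('m, 'x) control \<Rightarrow> ('g, 'm) gmod \<Rightarrow> 'x set \<Rightarrow> ('g, 'm) gmod" where
  "over P G S = G |` {x. \<exists>u. G x = Some u \<and> cmap P u \<in> S}"

definition msum :: "('g, 'm) gmod \<Rightarrow> ('h, 'm) gmod \<Rightarrow> ('g + 'h, 'm) gmod" where
  "msum G H = case_sum G H"

text \<open>Paths are maps on the unit interval, represented by functions that are undefined outside
  it, so that equal paths are equal functions.\<close>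

definition gpaths :: "'m::topological_space set \<Rightarrow> (real \<Rightarrow> 'm) set" where
  "gpaths M = {\<rho>. path \<rho> \<and> path_image \<rho> \<subseteq> M \<and> \<rho> \<in> extensional {0..1}}"

definition pjoin :: "(real \<Rightarrow> 'm::topological_space) \<Rightarrow> (real \<Rightarrow> 'm) \<Rightarrow> real \<Rightarrow> 'm" where
  "pjoin \<rho> \<sigma> = restrict (\<rho> +++ \<sigma>) {0..1}"

definition prev :: "(real \<Rightarrow> 'm::topological_space) \<Rightarrow> real \<Rightarrow> 'm" where
  "prev \<rho> = restrict (reversepath \<rho>) {0..1}"

definition pconst :: "'m \<Rightarrow> real \<Rightarrow> 'm" where
  "pconst u = restrict (\<lambda>_. u) {0..1}"

text \<open>The value \<open>f x y \<rho>\<close> is the coefficient in \<open>f\<close> of the path \<open>\<rho>\<close> from the generator \<open>x\<close> to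
  the generator \<open>y\<close> (distinct generators may have the same position).\<close>

type_synonym ('g, 'h, 'm, 'r) gmor = "'g \<Rightarrow> 'h \<Rightarrow> (real \<Rightarrow> 'm) \<Rightarrow> 'r"

definition gmorphism ::
  "('m::topological_space, 'x) control \<Rightarrow> ('g, 'm) gmod \<Rightarrow> ('h, 'm) gmod
    \<Rightarrow> ('g, 'h, 'm, 'r::involution_ring) gmor \<Rightarrow> bool" where
  "gmorphism P G H f \<longleftrightarrow>
     (\<forall>x y \<rho>. f x y \<rho> \<noteq> 0 \<longrightarrow> \<rho> \<in> gpaths (cdom P) \<and>
        G x = Some (pathstart \<rho>) \<and> H y = Some (pathfinish \<rho>)) \<and>
     (\<forall>x. finite {(y, \<rho>). f x y \<rho> \<noteq> 0})"

definition has_radius ::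
  "('m::topological_space, 'x::metric_space) control \<Rightarrow> real
    \<Rightarrow> ('g, 'h, 'm, 'r::involution_ring) gmor \<Rightarrow> bool" where
  "has_radius P e f \<longleftrightarrow> (\<forall>x y \<rho>. f x y \<rho> \<noteq> 0 \<longrightarrow>
     cmap P ` path_image \<rho> \<subseteq>
       cball (cmap P (pathstart \<rho>)) e \<inter> cball (cmap P (pathfinish \<rho>)) e)"

definition emorphism ::
  "('m::topological_space, 'x::metric_space) control \<Rightarrow> real \<Rightarrow> ('g, 'm) gmod \<Rightarrow> ('h, 'm) gmod
    \<Rightarrow> ('g, 'h, 'm, 'r::involution_ring) gmor \<Rightarrow> bool" where
  "emorphism P e G H f \<longleftrightarrow> gmorphism P G H f \<and> has_radius P e f"

text \<open>\<open>g \<odot> f\<close> is \<open>f\<close> followed by \<open>g\<close>; coefficients are multiplied in the order in which the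
  morphisms are written.\<close>

definition gcomp ::
  "('h, 'k, 'm::topological_space, 'r::involution_ring) gmor \<Rightarrow> ('g, 'h, 'm, 'r) gmor
    \<Rightarrow> ('g, 'k, 'm, 'r) gmor"
    (infixr "\<odot>" 70) where
  "g \<odot> f = (\<lambda>x z \<tau>.
     \<Sum>(y, \<rho>, \<sigma>) \<in> {(y, \<rho>, \<sigma>). f x y \<rho> \<noteq> 0 \<and> g y z \<sigma> \<noteq> 0 \<and> pjoin \<rho> \<sigma> = \<tau>}. g y z \<sigma> * f x y \<rho>)"

definition gid :: "('g, 'm) gmod \<Rightarrow> ('g, 'g, 'm, 'r::involution_ring) gmor" where
  "gid G = (\<lambda>x y \<rho>. if y = x \<and> (\<exists>u. G x = Some u \<and> \<rho> = pconst u) then 1 else 0)"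

definition dual ::
  "('g, 'h, 'm::topological_space, 'r::involution_ring) gmor \<Rightarrow> ('h, 'g, 'm, 'r) gmor" where
  "dual f = (\<lambda>y x \<tau>. \<Sum>\<rho> \<in> {\<rho>. f x y \<rho> \<noteq> 0 \<and> prev \<rho> = \<tau>}. bar (f x y \<rho>))"

definition mrestrict ::
  "('m::topological_space, 'x) control \<Rightarrow> 'x set \<Rightarrow> ('g, 'h, 'm, 'r::involution_ring) gmor
    \<Rightarrow> ('g, 'h, 'm, 'r) gmor" where
  "mrestrict P W f = (\<lambda>x y \<rho>. if cmap P (pathstart \<rho>) \<in> W then f x y \<rho> else 0)"

text \<open>The linear combination is finite for each pair of generators, hence finite from each
  generator.\<close>

definition sim ::
  "('m::topological_space, 'x::metric_space) control \<Rightarrow> real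
    \<Rightarrow> ('g, 'h, 'm, 'r::involution_ring) gmor \<Rightarrow> ('g, 'h, 'm, 'r) gmor \<Rightarrow> bool" where
  "sim P e f g \<longleftrightarrow> (\<forall>x y. \<exists>ks :: ('r \<times> (real \<Rightarrow> 'm) \<times> (real \<Rightarrow> 'm)) list.
     (\<forall>(a, \<rho>, \<rho>') \<in> set ks. \<rho> \<in> gpaths (cdom P) \<and> \<rho>' \<in> gpaths (cdom P) \<and>
        homotopic_paths
          {u \<in> cdom P. cmap P u \<in>
             cball (cmap P (pathstart \<rho>)) e \<inter> cball (cmap P (pathfinish \<rho>)) e} \<rho> \<rho>') \<and>
     (\<forall>\<tau>. f x y \<tau> - g x y \<tau> =
        (\<Sum>(a, \<rho>, \<rho>') \<leftarrow> ks. (if \<tau> = \<rho> then a else 0) - (if \<tau> = \<rho>' then a else 0))))"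

text \<open>\<open>block a b c d\<close> is the matrix with rows \<open>(a b)\<close> and \<open>(c d)\<close>, and \<open>col u v\<close> the column
  with entries \<open>u\<close> and \<open>v\<close>.\<close>

definition block ::
  "('g, 'h, 'm, 'r) gmor \<Rightarrow> ('g', 'h, 'm, 'r) gmor \<Rightarrow> ('g, 'h', 'm, 'r) gmor
    \<Rightarrow> ('g', 'h', 'm, 'r) gmor \<Rightarrow> ('g + 'g', 'h + 'h', 'm, 'r) gmor" where
  "block a b c d = (\<lambda>x y. case x of
      Inl i \<Rightarrow> (case y of Inl j \<Rightarrow> a i j | Inr j \<Rightarrow> c i j)
    | Inr i \<Rightarrow> (case y of Inl j \<Rightarrow> b i j | Inr j \<Rightarrow> d i j))"

definition col ::
  "('g, 'h, 'm, 'r) gmor \<Rightarrow> ('g, 'h', 'm, 'r) gmor \<Rightarrow> ('g, 'h + 'h', 'm, 'r) gmor" where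
  "col u v = (\<lambda>x y. case y of Inl j \<Rightarrow> u x j | Inr j \<Rightarrow> v x j)"

section \<open>Chain complexes\<close>

record ('g, 'm, 'r) cplx =
  mods :: "int \<Rightarrow> ('g, 'm) gmod"
  diff :: "int \<Rightarrow> ('g, 'g, 'm, 'r) gmor"

definition chain_complex ::
  "('m::topological_space, 'x::metric_space) control \<Rightarrow> real
    \<Rightarrow> ('g, 'm, 'r::involution_ring) cplx \<Rightarrow> bool" where
  "chain_complex P e C \<longleftrightarrow>
     (\<forall>r. gmodule P (mods C r) \<and>
          emorphism P e (mods C r) (mods C (r - 1)) (diff C r) \<and>
          sim P (2 * e) (diff C (r - 1) \<odot> diff C r) 0)"

definition dimensional :: "int \<Rightarrow> ('g, 'm, 'r) cplx \<Rightarrow> bool" where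
  "dimensional n C \<longleftrightarrow> (\<forall>r. \<not> (0 \<le> r \<and> r \<le> n) \<longrightarrow> mods C r = Map.empty)"

definition positive_cplx :: "('g, 'm, 'r) cplx \<Rightarrow> bool" where
  "positive_cplx C \<longleftrightarrow> (\<forall>r<0. mods C r = Map.empty)"

definition fin_gen :: "('g, 'm, 'r) cplx \<Rightarrow> bool" where
  "fin_gen C \<longleftrightarrow> (\<forall>r. finite (dom (mods C r)))"

definition chain_map ::
  "('m::topological_space, 'x::metric_space) control \<Rightarrow> real \<Rightarrow> ('g, 'm, 'r::involution_ring) cplx
    \<Rightarrow> ('h, 'm, 'r) cplx \<Rightarrow> (int \<Rightarrow> ('g, 'h, 'm, 'r) gmor) \<Rightarrow> bool" where
  "chain_map P e C D f \<longleftrightarrow>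
     (\<forall>r. emorphism P e (mods C r) (mods D r) (f r) \<and>
          has_radius P e (diff D r \<odot> f r) \<and>
          has_radius P e (f (r - 1) \<odot> diff C r) \<and>
          sim P e (diff D r \<odot> f r) (f (r - 1) \<odot> diff C r))"

definition contractible_over ::
  "('m::topological_space, 'x::metric_space) control \<Rightarrow> real \<Rightarrow> 'x set
    \<Rightarrow> ('g, 'm, 'r::involution_ring) cplx \<Rightarrow> bool" where
  "contractible_over P e W C \<longleftrightarrow>
     (\<exists>\<Gamma>. (\<forall>r. emorphism P e (mods C r) (mods C (r + 1)) (\<Gamma> r)) \<and>
          (\<forall>r. sim P (2 * e)
             (mrestrict P W (diff C (r + 1) \<odot> \<Gamma> r + \<Gamma> (r - 1) \<odot> diff C r))
             (mrestrict P W (gid (mods C r)))))"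

definition connected_cplx ::
  "('m::topological_space, 'x::metric_space) control \<Rightarrow> real
    \<Rightarrow> ('g, 'm, 'r::involution_ring) cplx \<Rightarrow> bool" where
  "connected_cplx P e E \<longleftrightarrow> positive_cplx E \<and>
     (\<exists>h. emorphism P (4 * e) (mods E 0) (mods E 1) h \<and>
          sim P (8 * e) (diff E 1 \<odot> h) (gid (mods E 0)))"

definition mapping_cone ::
  "('g, 'm, 'r::involution_ring) cplx \<Rightarrow> ('h, 'm, 'r) cplx \<Rightarrow> (int \<Rightarrow> ('g, 'h, 'm, 'r) gmor)
    \<Rightarrow> ('h + 'g, 'm, 'r) cplx" where
  "mapping_cone C D f =
     \<lparr>mods = (\<lambda>r. msum (mods D r) (mods C (r - 1))),
      diff = (\<lambda>r. block (diff D r) (msign (r - 1) (f (r - 1))) 0 (diff C (r - 1)))\<rparr>"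

definition dual_cplx ::
  "int \<Rightarrow> ('g, 'm::topological_space, 'r::involution_ring) cplx \<Rightarrow> ('g, 'm, 'r) cplx" where
  "dual_cplx n C =
     \<lparr>mods = (\<lambda>r. mods C (n - r)),
      diff = (\<lambda>r. msign r (dual (diff C (n - r + 1))))\<rparr>"

definition csum ::
  "('g, 'm, 'r::involution_ring) cplx \<Rightarrow> ('h, 'm, 'r) cplx \<Rightarrow> ('g + 'h, 'm, 'r) cplx" where
  "csum C D =
     \<lparr>mods = (\<lambda>r. msum (mods C r) (mods D r)),
      diff = (\<lambda>r. block (diff C r) 0 0 (diff D r))\<rparr>"

text \<open>A geometric subcomplex is given by its modules.\<close>

definition geom_subcomplex ::
  "('g, 'm, 'r::involution_ring) cplx \<Rightarrow> (int \<Rightarrow> ('g, 'm) gmod) \<Rightarrow> bool" where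
  "geom_subcomplex C C' \<longleftrightarrow>
     (\<forall>r. C' r \<subseteq>\<^sub>m mods C r \<and>
        (\<forall>x \<in> dom (C' r). \<forall>y \<in> dom (mods C (r - 1)) - dom (C' (r - 1)). \<forall>\<rho>. diff C r x y \<rho> = 0))"

definition quotient_mod ::
  "('g, 'm, 'r) cplx \<Rightarrow> (int \<Rightarrow> ('g, 'm) gmod) \<Rightarrow> int \<Rightarrow> ('g, 'm) gmod" where
  "quotient_mod C C' r = mods C r |` (- dom (C' r))"

definition quotient_cplx ::
  "('g, 'm, 'r::involution_ring) cplx \<Rightarrow> (int \<Rightarrow> ('g, 'm) gmod) \<Rightarrow> ('g, 'm, 'r) cplx" where
  "quotient_cplx C C' =
     \<lparr>mods = quotient_mod C C',
      diff = (\<lambda>r x y \<rho>.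
        if x \<in> dom (quotient_mod C C' r) \<and> y \<in> dom (quotient_mod C C' (r - 1))
        then diff C r x y \<rho> else 0)\<rparr>"

text \<open>The projection onto the quotient has the same coefficients as the identity of the
  quotient, but the larger source.\<close>

definition quotient_proj ::
  "('g, 'm, 'r::involution_ring) cplx \<Rightarrow> (int \<Rightarrow> ('g, 'm) gmod) \<Rightarrow> int \<Rightarrow> ('g, 'g, 'm, 'r) gmor" where
  "quotient_proj C C' r = gid (quotient_mod C C' r)"

section \<open>Quadratic complexes and pairs\<close>

text \<open>\<open>\<psi> s r\<close> is the component \<open>\<psi>\<^sub>s\<close> with target \<open>C\<^sub>r\<close>; its source is \<open>C\<^sub>n\<^sub>-\<^sub>r\<^sub>-\<^sub>s\<close>. Likewise
  \<open>dualT n \<psi> s r\<close> is the component of \<open>T\<psi>\<^sub>s\<close> with target \<open>C\<^sub>r\<close>.\<close>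

type_synonym ('g, 'm, 'r) qstr = "nat \<Rightarrow> int \<Rightarrow> ('g, 'g, 'm, 'r) gmor"

definition dualT ::
  "int \<Rightarrow> ('g, 'm::topological_space, 'r::involution_ring) qstr \<Rightarrow> ('g, 'm, 'r) qstr" where
  "dualT n \<psi> s r = msign ((n - r - int s) * r) (dual (\<psi> s (n - r - int s)))"

definition qsum ::
  "('g, 'm, 'r::involution_ring) qstr \<Rightarrow> ('h, 'm, 'r) qstr \<Rightarrow> ('g + 'h, 'm, 'r) qstr" where
  "qsum \<psi> \<psi>' s r = block (\<psi> s r) 0 0 (\<psi>' s r)"

definition push ::
  "int \<Rightarrow> (int \<Rightarrow> ('g, 'h, 'm::topological_space, 'r) gmor) \<Rightarrow> ('g, 'm, 'r::involution_ring) qstr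
    \<Rightarrow> ('h, 'm, 'r) qstr" where
  "push n p \<psi> s r = p r \<odot> \<psi> s r \<odot> dual (p (n - r - int s))"

text \<open>The left-hand side, with source \<open>C\<^sub>n\<^sub>-\<^sub>r\<^sub>-\<^sub>s\<^sub>-\<^sub>1\<close> and target \<open>C\<^sub>r\<close>, of the relation that
  defines an \<open>n\<close>-dimensional quadratic structure.\<close>

definition qrel ::
  "int \<Rightarrow> ('g, 'm::topological_space, 'r::involution_ring) cplx \<Rightarrow> ('g, 'm, 'r) qstr
    \<Rightarrow> ('g, 'm, 'r) qstr" where
  "qrel n C \<psi> s r =
     diff C (r + 1) \<odot> \<psi> s (r + 1) + msign r (\<psi> s r \<odot> dual (diff C (n - r - int s))) +
     msign (n - int s - 1) (\<psi> (s + 1) r + msign (int s + 1) (dualT n \<psi> (s + 1) r))"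

definition qfamily ::
  "('m::topological_space, 'x::metric_space) control \<Rightarrow> int \<Rightarrow> real
    \<Rightarrow> ('g, 'm, 'r::involution_ring) cplx \<Rightarrow> ('g, 'm, 'r) qstr \<Rightarrow> bool" where
  "qfamily P n e C \<psi> \<longleftrightarrow>
     (\<forall>s r. emorphism P e (mods C (n - r - int s)) (mods C r) (\<psi> s r))"

definition quad_structure ::
  "('m::topological_space, 'x::metric_space) control \<Rightarrow> int \<Rightarrow> real
    \<Rightarrow> ('g, 'm, 'r::involution_ring) cplx \<Rightarrow> ('g, 'm, 'r) qstr \<Rightarrow> bool" where
  "quad_structure P n e C \<psi> \<longleftrightarrow>
     qfamily P n e C \<psi> \<and> (\<forall>s r. sim P (3 * e) (qrel n C \<psi> s r) 0)"

definition quad_complex ::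
  "('m::topological_space, 'x::metric_space) control \<Rightarrow> int \<Rightarrow> real
    \<Rightarrow> ('g, 'm, 'r::involution_ring) cplx \<Rightarrow> ('g, 'm, 'r) qstr \<Rightarrow> bool" where
  "quad_complex P n e C \<psi> \<longleftrightarrow>
     chain_complex P e C \<and> dimensional n C \<and> quad_structure P n e C \<psi>"

text \<open>The pair has dimension \<open>n + 1\<close> and the boundary has dimension \<open>n\<close>.\<close>

definition quad_pair ::
  "('m::topological_space, 'x::metric_space) control \<Rightarrow> int \<Rightarrow> real
    \<Rightarrow> ('g, 'm, 'r::involution_ring) cplx \<Rightarrow> ('h, 'm, 'r) cplx
    \<Rightarrow> (int \<Rightarrow> ('g, 'h, 'm, 'r) gmor) \<Rightarrow> ('h, 'm, 'r) qstr \<Rightarrow> ('g, 'm, 'r) qstr \<Rightarrow> bool" where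
  "quad_pair P n e C D f \<delta>\<psi> \<psi> \<longleftrightarrow>
     quad_complex P n e C \<psi> \<and>
     chain_complex P e D \<and> dimensional (n + 1) D \<and>
     chain_map P e C D f \<and>
     qfamily P (n + 1) e D \<delta>\<psi> \<and>
     (\<forall>s r. sim P (3 * e) (qrel (n + 1) D \<delta>\<psi> s r + msign n (push n f \<psi> s r)) 0)"

definition symm ::
  "int \<Rightarrow> ('g, 'm::topological_space, 'r::involution_ring) qstr \<Rightarrow> int \<Rightarrow> ('g, 'g, 'm, 'r) gmor" where
  "symm n \<psi> r = \<psi> 0 r + dualT n \<psi> 0 r"

definition dcone ::
  "int \<Rightarrow> ('g, 'm::topological_space, 'r::involution_ring) cplx \<Rightarrow> ('g, 'm, 'r) qstr
    \<Rightarrow> ('g + 'g, 'm, 'r) cplx" where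
  "dcone n C \<psi> = mapping_cone (dual_cplx n C) C (symm n \<psi>)"

definition dcone_pair ::
  "int \<Rightarrow> ('g, 'm::topological_space, 'r::involution_ring) cplx \<Rightarrow> ('h, 'm, 'r) cplx
    \<Rightarrow> (int \<Rightarrow> ('g, 'h, 'm, 'r) gmor) \<Rightarrow> ('h, 'm, 'r) qstr \<Rightarrow> ('g, 'm, 'r) qstr
    \<Rightarrow> (('h + 'g) + 'h, 'm, 'r) cplx" where
  "dcone_pair n C D f \<delta>\<psi> \<psi> =
     mapping_cone (dual_cplx (n + 1) D) (mapping_cone C D f)
       (\<lambda>r. col (symm (n + 1) \<delta>\<psi> r)
                (msign (n + 1 - r) (symm n \<psi> (r - 1) \<odot> dual (f (n + 1 - r)))))"

definition poincare_over ::
  "('m::topological_space, 'x::metric_space) control \<Rightarrow> int \<Rightarrow> real \<Rightarrow> 'x set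
    \<Rightarrow> ('g, 'm, 'r::involution_ring) cplx \<Rightarrow> ('g, 'm, 'r) qstr \<Rightarrow> bool" where
  "poincare_over P n e W C \<psi> \<longleftrightarrow> contractible_over P (4 * e) W (dcone n C \<psi>)"

definition poincare_pair_over ::
  "('m::topological_space, 'x::metric_space) control \<Rightarrow> int \<Rightarrow> real \<Rightarrow> 'x set
    \<Rightarrow> ('g, 'm, 'r::involution_ring) cplx \<Rightarrow> ('h, 'm, 'r) cplx
    \<Rightarrow> (int \<Rightarrow> ('g, 'h, 'm, 'r) gmor) \<Rightarrow> ('h, 'm, 'r) qstr \<Rightarrow> ('g, 'm, 'r) qstr \<Rightarrow> bool" where
  "poincare_pair_over P n e W C D f \<delta>\<psi> \<psi> \<longleftrightarrow>
     poincare_over P n e W C \<psi> \<and> contractible_over P (4 * e) W (dcone_pair n C D f \<delta>\<psi> \<psi>)"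

definition connected_quad ::
  "('m::topological_space, 'x::metric_space) control \<Rightarrow> int \<Rightarrow> real
    \<Rightarrow> ('g, 'm, 'r::involution_ring) cplx \<Rightarrow> ('g, 'm, 'r) qstr \<Rightarrow> bool" where
  "connected_quad P n e C \<psi> \<longleftrightarrow> connected_cplx P e (dcone n C \<psi>)"

definition connected_pair ::
  "('m::topological_space, 'x::metric_space) control \<Rightarrow> int \<Rightarrow> real
    \<Rightarrow> ('g, 'm, 'r::involution_ring) cplx \<Rightarrow> ('h, 'm, 'r) cplx
    \<Rightarrow> (int \<Rightarrow> ('g, 'h, 'm, 'r) gmor) \<Rightarrow> ('h, 'm, 'r) qstr \<Rightarrow> ('g, 'm, 'r) qstr \<Rightarrow> bool" where
  "connected_pair P n e C D f \<delta>\<psi> \<psi> \<longleftrightarrow>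
     connected_quad P n e C \<psi> \<and> connected_cplx P e (dcone_pair n C D f \<delta>\<psi> \<psi>)"

section \<open>Controlled L-groups\<close>

text \<open>Every finitely generated complex is isomorphic to one whose generators are natural
  numbers, so representatives are taken of this form.\<close>

type_synonym ('m, 'r) qcplx = "(nat, 'm, 'r) cplx \<times> (nat, 'm, 'r) qstr"

definition Lreps ::
  "int \<Rightarrow> real \<Rightarrow> ('m::topological_space, 'x::metric_space) control \<Rightarrow> 'x set
    \<Rightarrow> ('m, 'r::involution_ring) qcplx set" where
  "Lreps n e P Y = {(C, \<psi>). fin_gen C \<and> quad_complex P n e C \<psi> \<and> connected_quad P n e C \<psi> \<and>
     poincare_over P n e (cbase P - Y) C \<psi>}"

definition Lcobordant ::
  "int \<Rightarrow> real \<Rightarrow> ('m::topological_space, 'x::metric_space) control \<Rightarrow> 'x set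
    \<Rightarrow> ('m, 'r::involution_ring) qcplx \<Rightarrow> ('m, 'r) qcplx \<Rightarrow> bool" where
  "Lcobordant n d P Y = (\<lambda>(C, \<psi>) (C', \<psi>').
     \<exists>(D :: (nat, 'm, 'r) cplx) f \<delta>\<psi>. fin_gen D \<and>
       quad_pair P n d (csum C C') D f \<delta>\<psi> (qsum \<psi> (- \<psi>')) \<and>
       connected_pair P n d (csum C C') D f \<delta>\<psi> (qsum \<psi> (- \<psi>')) \<and>
       poincare_pair_over P n d (cbase P - Y) (csum C C') D f \<delta>\<psi> (qsum \<psi> (- \<psi>')))"

definition Lrel ::
  "int \<Rightarrow> real \<Rightarrow> real \<Rightarrow> ('m::topological_space, 'x::metric_space) control \<Rightarrow> 'x set
    \<Rightarrow> (('m, 'r::involution_ring) qcplx \<times> ('m, 'r) qcplx) set" where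
  "Lrel n d e P Y = {(a, b). a \<in> Lreps n e P Y \<and> b \<in> Lreps n e P Y \<and>
     equivclp (\<lambda>x y. x \<in> Lreps n e P Y \<and> y \<in> Lreps n e P Y \<and> Lcobordant n d P Y x y) a b}"

definition Lclass ::
  "int \<Rightarrow> real \<Rightarrow> real \<Rightarrow> ('m::topological_space, 'x::metric_space) control \<Rightarrow> 'x set
    \<Rightarrow> ('m, 'r::involution_ring) qcplx \<Rightarrow> ('m, 'r) qcplx set" where
  "Lclass n d e P Y a = Lrel n d e P Y `` {a}"

text \<open>Direct sums have generators in \<open>nat + nat\<close>; they are renumbered by the bijection
  \<open>sum_decode :: nat \<Rightarrow> nat + nat\<close>.\<close>

definition Lsum ::
  "('m, 'r::involution_ring) qcplx \<Rightarrow> ('m, 'r) qcplx \<Rightarrow> ('m, 'r) qcplx" where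
  "Lsum = (\<lambda>(C, \<psi>) (C', \<psi>').
     (\<lparr>mods = (\<lambda>r. mods (csum C C') r \<circ> sum_decode),
       diff = (\<lambda>r x y. diff (csum C C') r (sum_decode x) (sum_decode y))\<rparr>,
      \<lambda>s r x y. qsum \<psi> \<psi>' s r (sum_decode x) (sum_decode y)))"

definition Lzero :: "('m, 'r::involution_ring) qcplx" where
  "Lzero = (\<lparr>mods = (\<lambda>r. Map.empty), diff = 0\<rparr>, 0)"

definition Lgroup ::
  "int \<Rightarrow> real \<Rightarrow> real \<Rightarrow> ('m::topological_space, 'x::metric_space) control \<Rightarrow> 'x set
    \<Rightarrow> ('m, 'r::involution_ring) qcplx set monoid" where
  "Lgroup n d e P Y =
     \<lparr>carrier = Lreps n e P Y // Lrel n d e P Y,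
      monoid.mult = (\<lambda>U V. \<Union>a\<in>U. \<Union>b\<in>V. Lclass n d e P Y (Lsum a b)),
      one = Lclass n d e P Y Lzero\<rparr>"

text \<open>The map induced by an inclusion sends the class of \<open>a\<close> to the class of \<open>a\<close> in
  \<open>Lgroup n d e P Y\<close>.\<close>

definition Lincl ::
  "int \<Rightarrow> real \<Rightarrow> real \<Rightarrow> ('m::topological_space, 'x::metric_space) control \<Rightarrow> 'x set
    \<Rightarrow> ('m, 'r::involution_ring) qcplx set \<Rightarrow> ('m, 'r) qcplx set" where
  "Lincl n d e P Y U = (\<Union>a\<in>U. Lclass n d e P Y a)"

end

(* A connected set over X that meets the part of A at distance more than k from N, and whose image
   lies within e <= k of that point, cannot leave A, since it would have to cross N. Hence paths and
   homotopies of small radius that touch generators far from N lie over A, and a generator deeper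
   than k is joined by a morphism of radius e only to generators deeper than k - e. Discarding the
   generators over B and over a neighbourhood of N that shrinks by 4 epsilon (or 4 delta) per degree
   therefore gives quotients of complexes and pairs which are defined over A, and the relations, the
   connectedness and the local contractions restrict to them. Applied to a cobordism this shows
   that exc is well defined. Applied to the trivial cobordism C + C -> C, with the quotient taken on
   the second summand only, it gives a cobordism from C to its quotient, hence both composites. *)

theory Submission
  imports Defs
begin

section \<open>Controlled paths: radii under concatenation, reversal and homotopy\<close>

section \<open>Paths\<close>

text \<open>The constants answer three constraints. A differential of radius \<epsilon> would allow
  the thresholds to shrink by \<epsilon> per degree; the step 4\<epsilon> is forced by
  connectedness, whose section from degree 0 to degree 1 of the duality cone has radius 4\<epsilon>.
  The smallest threshold, in the top degree, is 8\<epsilon>, so that even the homotopies of radius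
  8\<epsilon> in the relations of the cones stay over A. A cobordism has one more degree, so its
  largest threshold is (n+3)4\<delta>, and (n+5)4\<delta> leaves room beyond it for the paths of a
  contraction, of radius 4\<delta>. The ends of a cobordism are cut with \<epsilon>, its interior
  with \<delta>; the cuts fit because a generator beyond a \<delta> threshold is beyond the
  \<epsilon> threshold. The obstacle is that concatenation is neither associative nor unital, so
  that p_%\<psi> agrees with the restriction of the coefficients of \<psi> only up to homotopy.
  Restriction of coefficients, in contrast, commutes strictly with composition when no composite
  path passes through a discarded generator, and so costs no radius.\<close>

definition mpath :: "('m::topological_space, 'x::metric_space) control \<Rightarrow> real \<Rightarrow> (real \<Rightarrow> 'm) \<Rightarrow> bool" where
  "mpath P e \<rho> \<longleftrightarrow> \<rho> \<in> gpaths (cdom P) \<and>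
     cmap P ` path_image \<rho> \<subseteq> cball (cmap P (pathstart \<rho>)) e \<inter> cball (cmap P (pathfinish \<rho>)) e"

text \<open>The region in which a homotopy in the definition of \<open>sim\<close> may move. It sees
  a path only through its end points, so it is the same for both members of a homotopic
  pair.\<close>

definition hset :: "('m::topological_space, 'x::metric_space) control \<Rightarrow> real \<Rightarrow> 'm \<Rightarrow> 'm \<Rightarrow> 'm set" where
  "hset P e u v = {w \<in> cdom P. cmap P w \<in> cball (cmap P u) e \<inter> cball (cmap P v) e}"

definition hrel :: "('m::topological_space, 'x::metric_space) control \<Rightarrow> real
    \<Rightarrow> (real \<Rightarrow> 'm) \<Rightarrow> (real \<Rightarrow> 'm) \<Rightarrow> bool" where
  "hrel P e \<rho> \<rho>' \<longleftrightarrow> \<rho> \<in> gpaths (cdom P) \<and> \<rho>' \<in> gpaths (cdom P) \<and>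
     homotopic_paths (hset P e (pathstart \<rho>) (pathfinish \<rho>)) \<rho> \<rho>'"

lemma pjoin_ends [simp]:
  "pathstart (pjoin \<rho> \<sigma>) = pathstart \<rho>" "pathfinish (pjoin \<rho> \<sigma>) = pathfinish \<sigma>"
  by (simp_all add: pjoin_def pathstart_def pathfinish_def joinpaths_def)

lemma prev_ends [simp]:
  "pathstart (prev \<rho>) = pathfinish \<rho>" "pathfinish (prev \<rho>) = pathstart \<rho>"
  by (simp_all add: prev_def pathstart_def pathfinish_def reversepath_def)

lemma pconst_ends [simp]: "pathstart (pconst u) = u" "pathfinish (pconst u) = u"
  by (simp_all add: pconst_def pathstart_def pathfinish_def)

lemma path_image_restrict: "path_image (restrict \<rho> {0..1}) = path_image \<rho>"
  by (force simp: path_image_def)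

lemma path_restrict: "path (restrict \<rho> {0..1}) \<longleftrightarrow> path \<rho>"
  unfolding path_def by (rule continuous_on_cong) auto

lemma path_image_pconst [simp]: "path_image (pconst u) = {u}"
  unfolding pconst_def path_image_restrict by (auto simp: path_image_def)

lemma pconst_gpaths [simp]: "pconst u \<in> gpaths M \<longleftrightarrow> u \<in> M"
  by (auto simp: gpaths_def pconst_def path_restrict path_image_restrict)
    (auto simp: path_def path_image_def)

lemma path_image_pjoin_subset: "path_image (pjoin \<rho> \<sigma>) \<subseteq> path_image \<rho> \<union> path_image \<sigma>"
  unfolding pjoin_def path_image_restrict by (rule path_image_join_subset)

lemma pjoin_gpaths:
  assumes "\<rho> \<in> gpaths M" "\<sigma> \<in> gpaths M" "pathfinish \<rho> = pathstart \<sigma>"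
  shows "pjoin \<rho> \<sigma> \<in> gpaths M"
  using assms path_image_join_subset[of \<rho> \<sigma>]
  by (auto simp: gpaths_def pjoin_def path_restrict path_image_restrict)

lemma path_image_prev [simp]: "path_image (prev \<rho>) = path_image \<rho>"
  by (simp add: prev_def path_image_restrict)

lemma prev_gpaths: "\<rho> \<in> gpaths M \<Longrightarrow> prev \<rho> \<in> gpaths M"
  by (auto simp: gpaths_def prev_def path_restrict path_image_restrict)

lemma prev_pconst [simp]: "prev (pconst u) = pconst u"
  by (auto simp: prev_def pconst_def reversepath_def fun_eq_iff)

lemma mpath_mono: "mpath P d \<rho> \<Longrightarrow> d \<le> e \<Longrightarrow> mpath P e \<rho>"
  unfolding mpath_def using subset_cball by blast

lemma mpath_ends: "mpath P e \<rho> \<Longrightarrow> dist (cmap P (pathstart \<rho>)) (cmap P (pathfinish \<rho>)) \<le> e"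
  unfolding mpath_def by (meson IntD1 image_subset_iff mem_cball pathfinish_in_path_image)

lemma mpath_nonneg: "mpath P e \<rho> \<Longrightarrow> 0 \<le> e"
  using mpath_ends zero_le_dist order_trans by blast

lemma mpath_pconst: "u \<in> cdom P \<Longrightarrow> 0 \<le> e \<Longrightarrow> mpath P e (pconst u)"
  by (simp add: mpath_def)

lemma mpath_prev: "mpath P e \<rho> \<Longrightarrow> mpath P e (prev \<rho>)"
  by (auto simp: mpath_def prev_gpaths)

text \<open>Points of the one path are compared with the far end of the other through the junction,
  which costs the radius of that other path.\<close>

lemma mpath_pjoin:
  assumes "mpath P e \<rho>" "mpath P d \<sigma>" "pathfinish \<rho> = pathstart \<sigma>"
  shows "mpath P (e + d) (pjoin \<rho> \<sigma>)"
proof -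
  have r: "dist (cmap P (pathstart \<rho>)) (cmap P w) \<le> e \<and> dist (cmap P (pathfinish \<rho>)) (cmap P w) \<le> e"
    if "w \<in> path_image \<rho>" for w using assms(1) that by (auto simp: mpath_def)
  have s: "dist (cmap P (pathstart \<sigma>)) (cmap P w) \<le> d \<and> dist (cmap P (pathfinish \<sigma>)) (cmap P w) \<le> d"
    if "w \<in> path_image \<sigma>" for w using assms(2) that by (auto simp: mpath_def)
  have ends: "dist (cmap P (pathstart \<rho>)) (cmap P (pathstart \<sigma>)) \<le> e"
    "dist (cmap P (pathfinish \<sigma>)) (cmap P (pathstart \<sigma>)) \<le> d"
    using mpath_ends[OF assms(1)] mpath_ends[OF assms(2)] assms(3) by (auto simp: dist_commute)
  have nn: "0 \<le> e" "0 \<le> d" using mpath_nonneg assms by blast+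
  have "dist (cmap P (pathstart \<rho>)) (cmap P w) \<le> e + d \<and> dist (cmap P (pathfinish \<sigma>)) (cmap P w) \<le> e + d"
    if w: "w \<in> path_image (pjoin \<rho> \<sigma>)" for w
  proof -
    consider "w \<in> path_image \<rho>" | "w \<in> path_image \<sigma>" using path_image_pjoin_subset w by blast
    then show ?thesis
    proof cases
      case 1
      then show ?thesis using r[of w] ends nn assms(3)
          dist_triangle[of "cmap P (pathfinish \<sigma>)" "cmap P w" "cmap P (pathfinish \<rho>)"] by auto
    next
      case 2
      then show ?thesis using s[of w] ends nn
          dist_triangle[of "cmap P (pathstart \<rho>)" "cmap P w" "cmap P (pathstart \<sigma>)"] by auto
    qed
  qed
  then show ?thesis using assms by (auto simp: mpath_def pjoin_gpaths)
qed

lemma hrel_ends: "hrel P e \<rho> \<rho>' \<Longrightarrow> pathstart \<rho>' = pathstart \<rho> \<and> pathfinish \<rho>' = pathfinish \<rho>"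
  unfolding hrel_def by (metis homotopic_paths_imp_pathstart homotopic_paths_imp_pathfinish)

lemma hset_mono: "d \<le> e \<Longrightarrow> hset P d u v \<subseteq> hset P e u v"
  by (auto simp: hset_def)

lemma hrel_mono: "hrel P d \<rho> \<rho>' \<Longrightarrow> d \<le> e \<Longrightarrow> hrel P e \<rho> \<rho>'"
  unfolding hrel_def by (meson homotopic_paths_subset hset_mono)

lemma hrel_imp_mpath: "hrel P e \<rho> \<rho>' \<Longrightarrow> mpath P e \<rho>"
  using homotopic_paths_imp_subset by (fastforce simp: hrel_def mpath_def hset_def)

lemma mpath_hset: "mpath P e \<rho> \<Longrightarrow> path \<rho> \<and> path_image \<rho> \<subseteq> hset P e (pathstart \<rho>) (pathfinish \<rho>)"
  by (auto simp: mpath_def gpaths_def hset_def)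

lemma hset_swap: "hset P e u v = hset P e v u" by (auto simp: hset_def)

lemma hset_subset_right:
  assumes "dist (cmap P v) (cmap P w) \<le> d" "0 \<le> d"
  shows "hset P e u v \<subseteq> hset P (e + d) u w"
proof
  fix x assume "x \<in> hset P e u v"
  then show "x \<in> hset P (e + d) u w"
    using assms dist_triangle[of "cmap P w" "cmap P x" "cmap P v"] by (auto simp: hset_def dist_commute)
qed

text \<open>\<open>pjoin\<close> is \<open>+++\<close> made undefined outside the unit interval; the
  two agree on the interval and are therefore homotopic, so the library result on \<open>+++\<close>
  carries over.\<close>

lemma homotopic_pjoin:
  assumes "homotopic_paths S \<rho> \<rho>'" "homotopic_paths S \<sigma> \<sigma>'" "pathfinish \<rho> = pathstart \<sigma>"
  shows "homotopic_paths S (pjoin \<rho> \<sigma>) (pjoin \<rho>' \<sigma>')"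
proof -
  have h: "homotopic_paths S (\<rho> +++ \<sigma>) (\<rho>' +++ \<sigma>')" using assms by (rule homotopic_paths_join)
  have r: "homotopic_paths S p (restrict p {0..1})" if "path p" "path_image p \<subseteq> S" for p
    using that by (intro homotopic_paths_eq) auto
  have "homotopic_paths S (\<rho> +++ \<sigma>) (pjoin \<rho> \<sigma>)" "homotopic_paths S (\<rho>' +++ \<sigma>') (pjoin \<rho>' \<sigma>')"
    unfolding pjoin_def
    using homotopic_paths_imp_path[OF h] homotopic_paths_imp_subset[OF h] by (auto intro!: r)
  then show ?thesis using h by (meson homotopic_paths_sym homotopic_paths_trans)
qed

text \<open>Appending \<sigma> moves the final end point by at most d, so balls enlarged by d about
  the new end points contain the old homotopy and, by the bound e on \<rho>, the path \<sigma> as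
  well.\<close>

lemma hrel_pjoin_left:
  assumes "hrel P e \<rho> \<rho>'" "mpath P d \<sigma>" "pathfinish \<rho> = pathstart \<sigma>"
  shows "hrel P (e + d) (pjoin \<rho> \<sigma>) (pjoin \<rho>' \<sigma>)"
proof -
  note m = hrel_imp_mpath[OF assms(1)]
  have nn: "0 \<le> d" "0 \<le> e"
    using mpath_nonneg[OF assms(2)] mpath_nonneg[OF m] by auto
  let ?S = "hset P (e + d) (pathstart \<rho>) (pathfinish \<sigma>)"
  have \<sigma>: "dist (cmap P (pathfinish \<rho>)) (cmap P (pathfinish \<sigma>)) \<le> d"
    using mpath_ends[OF assms(2)] assms(3) by simp
  have \<rho>: "dist (cmap P (pathstart \<sigma>)) (cmap P (pathstart \<rho>)) \<le> e"
    using mpath_ends[OF m] assms(3) by (simp add: dist_commute)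
  have "homotopic_paths ?S \<rho> \<rho>'"
    using assms(1) hset_subset_right[OF \<sigma> nn(1)] homotopic_paths_subset unfolding hrel_def by blast
  moreover have "path_image \<sigma> \<subseteq> ?S"
    using mpath_hset[OF assms(2)] hset_subset_right[OF \<rho> nn(2), of d "pathfinish \<sigma>"]
    by (auto simp: add.commute hset_swap)
  ultimately have "homotopic_paths ?S (pjoin \<rho> \<sigma>) (pjoin \<rho>' \<sigma>)"
    using assms(3) mpath_hset[OF assms(2)] by (intro homotopic_pjoin) auto
  then show ?thesis
    using assms hrel_ends[OF assms(1)] by (auto simp: hrel_def mpath_def pjoin_gpaths)
qed

lemma hrel_prev: "hrel P e \<rho> \<rho>' \<Longrightarrow> hrel P e (prev \<rho>) (prev \<rho>')"
proof -
  assume h: "hrel P e \<rho> \<rho>'"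
  have r: "homotopic_paths S p (restrict p {0..1})" if "path p" "path_image p \<subseteq> S" for p :: "real \<Rightarrow> 'a" and S
    using that by (intro homotopic_paths_eq) auto
  let ?S = "hset P e (pathstart \<rho>) (pathfinish \<rho>)"
  have h': "homotopic_paths ?S (reversepath \<rho>) (reversepath \<rho>')"
    using h by (simp add: hrel_def homotopic_paths_reversepath)
  have "homotopic_paths ?S (reversepath \<rho>) (prev \<rho>)" "homotopic_paths ?S (reversepath \<rho>') (prev \<rho>')"
    unfolding prev_def
    using homotopic_paths_imp_path[OF h'] homotopic_paths_imp_subset[OF h'] by (auto intro!: r)
  then have "homotopic_paths ?S (prev \<rho>) (prev \<rho>')"
    using h' by (meson homotopic_paths_sym homotopic_paths_trans)
  then show ?thesis using h by (simp add: hrel_def prev_gpaths hset_swap)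
qed

lemma hrel_pjoin_right:
  assumes "hrel P e \<sigma> \<sigma>'" "mpath P d \<rho>" "pathfinish \<rho> = pathstart \<sigma>"
  shows "hrel P (e + d) (pjoin \<rho> \<sigma>) (pjoin \<rho> \<sigma>')"
proof -
  note m = hrel_imp_mpath[OF assms(1)]
  have nn: "0 \<le> d" "0 \<le> e"
    using mpath_nonneg[OF assms(2)] mpath_nonneg[OF m] by auto
  let ?S = "hset P (e + d) (pathstart \<rho>) (pathfinish \<sigma>)"
  have \<rho>: "dist (cmap P (pathstart \<sigma>)) (cmap P (pathstart \<rho>)) \<le> d"
    using mpath_ends[OF assms(2)] assms(3) by (simp add: dist_commute)
  have \<sigma>: "dist (cmap P (pathfinish \<rho>)) (cmap P (pathfinish \<sigma>)) \<le> e"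
    using mpath_ends[OF m] assms(3) by simp
  have "hset P e (pathstart \<sigma>) (pathfinish \<sigma>) \<subseteq> ?S"
    using hset_subset_right[OF \<rho> nn(1), of e "pathfinish \<sigma>"] by (auto simp: hset_swap)
  then have "homotopic_paths ?S \<sigma> \<sigma>'"
    using assms(1) homotopic_paths_subset unfolding hrel_def by blast
  moreover have "path_image \<rho> \<subseteq> ?S"
    using mpath_hset[OF assms(2)] hset_subset_right[OF \<sigma> nn(2), of d "pathstart \<rho>"]
    by (auto simp: add.commute)
  ultimately have "homotopic_paths ?S (pjoin \<rho> \<sigma>) (pjoin \<rho> \<sigma>')"
    using assms(3) mpath_hset[OF assms(2)] by (intro homotopic_pjoin) auto
  then show ?thesis
    using assms hrel_ends[OF assms(1)] by (auto simp: hrel_def mpath_def pjoin_gpaths)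
qed

text \<open>A constant tail is a reparametrization of \<rho> and never leaves its image. This is why
  composition with an identity costs no radius.\<close>

lemma hrel_pconst_right:
  assumes "mpath P e \<rho>"
  shows "hrel P e (pjoin \<rho> (pconst (pathfinish \<rho>))) \<rho>"
proof -
  have \<rho>: "\<rho> \<in> gpaths (cdom P)" using assms by (simp add: mpath_def)
  then have ends: "pathstart \<rho> \<in> cdom P" "pathfinish \<rho> \<in> cdom P" by (auto simp: gpaths_def)
  let ?S = "hset P e (pathstart \<rho>) (pathfinish \<rho>)"
  have "homotopic_paths ?S \<rho> (pjoin \<rho> (pconst (pathfinish \<rho>)))"
  proof (rule homotopic_paths_reparametrize[where f = "\<lambda>t. min (2 * t) 1"])
    show "continuous_on {0..1} (\<lambda>t::real. min (2 * t) 1)" by (intro continuous_intros)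
  qed (use mpath_hset[OF assms] in \<open>auto
         simp: pjoin_def joinpaths_def pconst_def pathfinish_def min_def split: if_splits\<close>)
  moreover have "pjoin \<rho> (pconst (pathfinish \<rho>)) \<in> gpaths (cdom P)"
    using \<rho> ends by (intro pjoin_gpaths) auto
  ultimately show ?thesis using \<rho> by (auto simp: hrel_def homotopic_paths_sym_eq)
qed

lemma hrel_pconst_left:
  assumes "mpath P e \<rho>"
  shows "hrel P e (pjoin (pconst (pathstart \<rho>)) \<rho>) \<rho>"
proof -
  have \<rho>: "\<rho> \<in> gpaths (cdom P)" using assms by (simp add: mpath_def)
  then have ends: "pathstart \<rho> \<in> cdom P" "pathfinish \<rho> \<in> cdom P" by (auto simp: gpaths_def)
  let ?S = "hset P e (pathstart \<rho>) (pathfinish \<rho>)"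
  have "homotopic_paths ?S \<rho> (pjoin (pconst (pathstart \<rho>)) \<rho>)"
  proof (rule homotopic_paths_reparametrize[where f = "\<lambda>t. max (2 * t - 1) 0"])
    show "continuous_on {0..1} (\<lambda>t::real. max (2 * t - 1) 0)" by (intro continuous_intros)
  qed (use mpath_hset[OF assms] in \<open>auto
         simp: pjoin_def joinpaths_def pconst_def pathstart_def max_def split: if_splits\<close>)
  moreover have "pjoin (pconst (pathstart \<rho>)) \<rho> \<in> gpaths (cdom P)"
    using \<rho> ends by (intro pjoin_gpaths) auto
  ultimately show ?thesis using \<rho> by (auto simp: hrel_def homotopic_paths_sym_eq)
qed

section \<open>Formal combinations of paths modulo controlled homotopy\<close>

section \<open>Linear combinations of paths\<close>

lemma bar_zero [simp]: "bar (0::'a::involution_ring) = 0"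
  using bar_add[of "0::'a" 0] by simp

lemma bar_uminus: "bar (- a) = - bar (a::'a::involution_ring)"
  using bar_add[of a "- a"] by (simp add: eq_neg_iff_add_eq_0 add.commute)

lemma bar_one [simp]: "bar (1::'a::involution_ring) = 1"
  using bar_mult[of "bar 1" "1::'a"] by (simp add: bar_bar)

lemma sum_fun_apply: "(\<Sum>i\<in>A. f i) x = (\<Sum>i\<in>A. f i x)"
  by (induction A rule: infinite_finite_induct) auto

definition dl :: "'r \<Rightarrow> 'p \<Rightarrow> 'p \<Rightarrow> 'r::zero" where
  "dl a \<rho> = (\<lambda>\<tau>. if \<tau> = \<rho> then a else 0)"

text \<open>The formal sums of differences of homotopic paths whose end points lie in \<open>K\<close>.\<close>

inductive nulp :: "('m::topological_space, 'x::metric_space) control \<Rightarrow> real \<Rightarrow> ('m \<times> 'm) set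
    \<Rightarrow> ((real \<Rightarrow> 'm) \<Rightarrow> 'r::involution_ring) \<Rightarrow> bool" for P e K where
  zero: "nulp P e K 0"
| step: "nulp P e K \<phi> \<Longrightarrow> hrel P e \<rho> \<rho>' \<Longrightarrow> (pathstart \<rho>, pathfinish \<rho>) \<in> K
    \<Longrightarrow> nulp P e K (\<phi> + (dl a \<rho> - dl a \<rho>'))"

definition nul :: "('m::topological_space, 'x::metric_space) control \<Rightarrow> real \<Rightarrow> ('m \<times> 'm) set
    \<Rightarrow> ((real \<Rightarrow> 'm) \<Rightarrow> 'r::involution_ring) set" where
  "nul P e K = Collect (nulp P e K)"

lemma nul_zero: "0 \<in> nul P e K" by (simp add: nul_def nulp.zero)

lemma nul_step: "\<phi> \<in> nul P e K \<Longrightarrow> hrel P e \<rho> \<rho>' \<Longrightarrow> (pathstart \<rho>, pathfinish \<rho>) \<in> K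
    \<Longrightarrow> \<phi> + (dl a \<rho> - dl a \<rho>') \<in> nul P e K"
  by (simp add: nul_def nulp.step)

lemma nul_induct [consumes 1, case_names zero step]:
  assumes "\<phi> \<in> nul P e K" "Q 0"
    "\<And>\<phi> \<rho> \<rho>' a. \<phi> \<in> nul P e K \<Longrightarrow> hrel P e \<rho> \<rho>' \<Longrightarrow> (pathstart \<rho>, pathfinish \<rho>) \<in> K
       \<Longrightarrow> Q \<phi> \<Longrightarrow> Q (\<phi> + (dl a \<rho> - dl a \<rho>'))"
  shows "Q \<phi>"
proof -
  have "nulp P e K \<phi>" using assms(1) by (simp add: nul_def)
  then show ?thesis
  proof (induction rule: nulp.induct)
    case (step \<phi> \<rho> \<rho>' a)
    then show ?case by (intro assms(3)) (simp_all add: nul_def)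
  qed (rule assms(2))
qed

lemma nul_single: "hrel P e \<rho> \<rho>' \<Longrightarrow> (pathstart \<rho>, pathfinish \<rho>) \<in> K \<Longrightarrow> dl a \<rho> - dl a \<rho>' \<in> nul P e K"
  using nul_step[OF nul_zero] by fastforce

lemma nul_add: "\<phi> \<in> nul P e K \<Longrightarrow> \<xi> \<in> nul P e K \<Longrightarrow> \<phi> + \<xi> \<in> nul P e K"
proof (induction rule: nul_induct)
  case (step \<phi> \<rho> \<rho>' a)
  have "(\<phi> + \<xi>) + (dl a \<rho> - dl a \<rho>') \<in> nul P e K"
    by (rule nul_step[OF step.IH[OF step.prems] step.hyps(2,3)])
  moreover have "(\<phi> + \<xi>) + (dl a \<rho> - dl a \<rho>') = \<phi> + (dl a \<rho> - dl a \<rho>') + \<xi>"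
    by (simp add: algebra_simps)
  ultimately show ?case by metis
qed simp

lemma dl_uminus: "dl (- a) \<rho> = - dl (a::'r::group_add) \<rho>"
  by (auto simp: dl_def fun_eq_iff)

lemma nul_uminus: "\<phi> \<in> nul P e K \<Longrightarrow> - \<phi> \<in> nul P e K"
proof (induction rule: nul_induct)
  case (step \<phi> \<rho> \<rho>' a)
  have "- \<phi> + (dl (- a) \<rho> - dl (- a) \<rho>') = - (\<phi> + (dl a \<rho> - dl a \<rho>'))"
    by (simp add: dl_uminus)
  then show ?case using nul_step[OF step.IH step.hyps(2,3), of "- a"] by metis
qed (metis nul_zero minus_zero)

lemma nul_sum: "(\<And>i. i \<in> A \<Longrightarrow> \<phi> i \<in> nul P e K) \<Longrightarrow> (\<Sum>i\<in>A. \<phi> i) \<in> nul P e K"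
  by (induction A rule: infinite_finite_induct) (auto intro: nul_zero nul_add)

lemma nul_mono:
  assumes "\<phi> \<in> nul P d K" "\<And>\<rho> \<rho>'. (pathstart \<rho>, pathfinish \<rho>) \<in> K \<Longrightarrow> hrel P d \<rho> \<rho>' \<Longrightarrow> hrel Q e \<rho> \<rho>'" "K \<subseteq> L"
  shows "\<phi> \<in> nul Q e L"
  using assms(1)
proof (induction rule: nul_induct)
  case (step \<phi> \<rho> \<rho>' a)
  then show ?case using assms(3) by (intro nul_step assms(2)) auto
qed (rule nul_zero)

lemma nul_finite: "\<phi> \<in> nul P e K \<Longrightarrow> finite {\<rho>. \<phi> \<rho> \<noteq> 0}"
proof (induction rule: nul_induct)
  case (step \<phi> \<rho> \<rho>' a)
  have "{\<tau>. (\<phi> + (dl a \<rho> - dl a \<rho>')) \<tau> \<noteq> 0} \<subseteq> {\<rho>. \<phi> \<rho> \<noteq> 0} \<union> {\<rho>, \<rho>'}"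
    by (auto simp: dl_def split: if_splits)
  then show ?case using step by (meson finite.emptyI finite.insertI finite_UnI finite_subset)
qed auto

text \<open>Homotopic paths share their end points, so a test on end points keeps or discards both
  terms of a difference together.\<close>

lemma nul_filter:
  fixes \<phi> :: "_ \<Rightarrow> 'r::involution_ring"
  shows "\<phi> \<in> nul P e L \<Longrightarrow> (\<lambda>\<tau>. if (pathstart \<tau>, pathfinish \<tau>) \<in> K then \<phi> \<tau> else 0) \<in> nul P e (L \<inter> K)"
proof (induction rule: nul_induct)
  case zero
  have "(\<lambda>\<tau>. if (pathstart \<tau>, pathfinish \<tau>) \<in> K then 0 \<tau> else 0) = (0 :: _ \<Rightarrow> 'r)"
    by (simp add: fun_eq_iff)
  then show ?case using nul_zero by metis
next
  case (step \<phi> \<rho> \<rho>' a)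
  let ?f = "\<lambda>\<phi> \<tau>. if (pathstart \<tau>, pathfinish \<tau>) \<in> K then \<phi> \<tau> else 0"
  have eq: "?f (\<phi> + (dl a \<rho> - dl a \<rho>')) =
      (if (pathstart \<rho>, pathfinish \<rho>) \<in> K then ?f \<phi> + (dl a \<rho> - dl a \<rho>') else ?f \<phi>)"
    using hrel_ends[OF step.hyps(2)] by (intro ext) (auto simp: dl_def)
  have "?f \<phi> + (dl a \<rho> - dl a \<rho>') \<in> nul P e (L \<inter> K)" if "(pathstart \<rho>, pathfinish \<rho>) \<in> K"
    by (rule nul_step[OF step.IH step.hyps(2)]) (use that step.hyps in auto)
  then show ?case unfolding eq using step.IH by simp
qed

text \<open>The differences witnessing that \<phi> is null may involve paths with other end points,
  which cancel. Filtering removes them and leaves \<phi> itself unchanged. All localisation of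
  relations rests on this.\<close>

lemma nul_restrict:
  assumes "\<phi> \<in> nul P e L" "\<And>\<tau>. \<phi> \<tau> \<noteq> 0 \<Longrightarrow> (pathstart \<tau>, pathfinish \<tau>) \<in> K"
  shows "\<phi> \<in> nul P e K"
proof -
  have "(\<lambda>\<tau>. if (pathstart \<tau>, pathfinish \<tau>) \<in> K then \<phi> \<tau> else 0) = \<phi>" using assms(2) by (auto simp: fun_eq_iff)
  then show ?thesis using nul_filter[OF assms(1), of K] nul_mono[of \<phi> P e "L \<inter> K" P e K] by auto
qed

text \<open>Pushforward of a combination along \<open>T\<close>, with coefficients changed by
  \<open>m\<close>. Duals are the case of \<open>prev\<close> and \<open>bar\<close>; composition
  with a single path is the case of concatenation and multiplication by its coefficient.\<close>

definition pushf :: "('p \<Rightarrow> 'q) \<Rightarrow> ('r \<Rightarrow> 'r) \<Rightarrow> ('p \<Rightarrow> 'r) \<Rightarrow> 'q \<Rightarrow> 'r::comm_monoid_add" where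
  "pushf T m \<phi> = (\<lambda>\<tau>. \<Sum>\<rho> \<in> {\<rho>. \<phi> \<rho> \<noteq> 0 \<and> T \<rho> = \<tau>}. m (\<phi> \<rho>))"

lemma pushf_eq:
  assumes "finite A" "{\<rho>. \<phi> \<rho> \<noteq> 0} \<subseteq> A" "m 0 = 0"
  shows "pushf T m \<phi> = (\<Sum>\<rho>\<in>A. dl (m (\<phi> \<rho>)) (T \<rho>))"
proof
  fix \<tau>
  have "pushf T m \<phi> \<tau> = (\<Sum>\<rho> \<in> A \<inter> {\<rho>. T \<rho> = \<tau>}. m (\<phi> \<rho>))"
    unfolding pushf_def by (rule sum.mono_neutral_left) (use assms in auto)
  also have "\<dots> = (\<Sum>\<rho>\<in>A. if T \<rho> = \<tau> then m (\<phi> \<rho>) else 0)"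
    using assms(1) by (simp add: sum.inter_restrict)
  finally show "pushf T m \<phi> \<tau> = (\<Sum>\<rho>\<in>A. dl (m (\<phi> \<rho>)) (T \<rho>)) \<tau>"
    by (auto simp: sum_fun_apply dl_def intro!: sum.cong)
qed

lemma pushf_add:
  assumes "finite {\<rho>. \<phi> \<rho> \<noteq> 0}" "finite {\<rho>. \<xi> \<rho> \<noteq> 0}" "\<And>a b. m (a + b) = m a + m b" "m 0 = (0::'r::comm_monoid_add)"
  shows "pushf T m (\<phi> + \<xi>) = pushf T m \<phi> + pushf T m \<xi>"
proof -
  let ?A = "{\<rho>. \<phi> \<rho> \<noteq> 0} \<union> {\<rho>. \<xi> \<rho> \<noteq> 0}"
  have A: "finite ?A" using assms by auto
  have dl: "dl (a + b) \<rho> = dl a \<rho> + dl b \<rho>" for a b :: 'r and \<rho> :: 'b by (auto simp: dl_def fun_eq_iff)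
  show ?thesis
    by (subst pushf_eq[OF A], use assms in auto)+ (auto simp: assms(3) dl sum.distrib)
qed

lemma pushf_dl: "m 0 = 0 \<Longrightarrow> pushf T m (dl a \<rho>) = dl (m a) (T \<rho>)"
  by (subst pushf_eq[of "{\<rho>}"]) (auto simp: dl_def split: if_splits)

text \<open>The pushforward is additive, so it suffices to treat one difference; the set
  \<open>K\<close> is there because concatenation with a given path respects only homotopies between
  paths that end, or start, at its end point.\<close>

lemma nul_pushf:
  assumes "\<phi> \<in> nul P e K" and m: "\<And>a b. m (a + b) = m a + m b"
    and T: "\<And>\<rho> \<rho>'. hrel P e \<rho> \<rho>' \<Longrightarrow> (pathstart \<rho>, pathfinish \<rho>) \<in> K \<Longrightarrow> hrel P d (T \<rho>) (T \<rho>')"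
  shows "pushf T m (\<phi> :: _ \<Rightarrow> 'r::involution_ring) \<in> nul P d UNIV"
  using assms(1)
proof (induction rule: nul_induct)
  have m0: "m 0 = 0" using m[of 0 0] by simp
  case zero
  show ?case using nul_zero by (simp add: pushf_def zero_fun_def)
next
  have m0: "m 0 = 0" using m[of 0 0] by simp
  case (step \<phi> \<rho> \<rho>' a)
  have fd: "finite {\<tau>. dl b \<sigma> \<tau> \<noteq> 0}" for b :: 'r and \<sigma> :: "real \<Rightarrow> 'a"
    by (rule finite_subset[of _ "{\<sigma>}"]) (auto simp: dl_def split: if_splits)
  have fd': "finite {\<tau>. (dl a \<rho> + dl (-a) \<rho>') \<tau> \<noteq> 0}"
    by (rule finite_subset[of _ "{\<rho>,\<rho>'}"]) (auto simp: dl_def split: if_splits)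
  have mu: "m (- a) = - m a" using m[of a "- a"] m0 by (simp add: eq_neg_iff_add_eq_0 add.commute)
  have "pushf T m (\<phi> + (dl a \<rho> - dl a \<rho>')) = pushf T m (\<phi> + (dl a \<rho> + dl (- a) \<rho>'))"
    by (simp add: dl_uminus)
  also have "\<dots> = pushf T m \<phi> + (pushf T m (dl a \<rho>) + pushf T m (dl (- a) \<rho>'))"
    using nul_finite[OF step.hyps(1)] fd fd' m m0 by (simp add: pushf_add)
  also have "\<dots> = pushf T m \<phi> + (dl (m a) (T \<rho>) - dl (m a) (T \<rho>'))"
    by (simp only: pushf_dl[of m, OF m0] mu) (simp add: dl_uminus)
  finally have eq: "pushf T m (\<phi> + (dl a \<rho> - dl a \<rho>')) = pushf T m \<phi> + (dl (m a) (T \<rho>) - dl (m a) (T \<rho>'))" .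
  show ?case unfolding eq by (rule nul_step[OF step.IH T[OF step.hyps(2,3)]]) simp
qed

lemma sum_dl: "finite A \<Longrightarrow> {\<rho>. \<phi> \<rho> \<noteq> 0} \<subseteq> A \<Longrightarrow> (\<Sum>\<rho>\<in>A. dl (\<phi> \<rho>) \<rho>) = \<phi>"
  by (rule ext) (auto simp: sum_fun_apply dl_def)

text \<open>Applied with \<open>T\<close> inserting a constant path at one end, this shows that
  identities act trivially up to homotopy.\<close>

lemma nul_reparam:
  assumes "finite {\<rho>. \<phi> \<rho> \<noteq> 0}" "\<And>\<rho>. \<phi> \<rho> \<noteq> 0 \<Longrightarrow> hrel P e (T \<rho>) \<rho>"
  shows "pushf T (\<lambda>a. a) \<phi> - \<phi> \<in> nul P e UNIV"
proof -
  let ?A = "{\<rho>. \<phi> \<rho> \<noteq> 0}"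
  have "pushf T (\<lambda>a. a) \<phi> - \<phi> = (\<Sum>\<rho>\<in>?A. dl (\<phi> \<rho>) (T \<rho>)) - (\<Sum>\<rho>\<in>?A. dl (\<phi> \<rho>) \<rho>)"
    using assms(1) by (simp add: pushf_eq[of ?A] sum_dl)
  also have "\<dots> = (\<Sum>\<rho>\<in>?A. dl (\<phi> \<rho>) (T \<rho>) - dl (\<phi> \<rho>) \<rho>)" by (simp add: sum_subtractf)
  also have "\<dots> \<in> nul P e UNIV" using assms(2) by (auto intro!: nul_sum nul_single)
  finally show ?thesis .
qed

text \<open>The lists in the definition of \<open>sim\<close> become membership in an inductively
  generated subgroup, so that from here on \<open>sim\<close> is handled by closure properties and
  induction.\<close>

lemma sim_iff_nul:
  fixes P :: "('m::topological_space, 'x::metric_space) control" and f :: "('g, 'h, 'm, 'r::involution_ring) gmor"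
  shows "sim P e f g \<longleftrightarrow> (\<forall>x y. f x y - g x y \<in> nul P e UNIV)"
proof -
  have 1: "(\<forall>(a, \<rho>, \<rho>') \<in> set ks. hrel P e \<rho> \<rho>') \<Longrightarrow>
      (\<lambda>\<tau>. \<Sum>(a, \<rho>, \<rho>') \<leftarrow> ks. (if \<tau> = \<rho> then a else 0) - (if \<tau> = \<rho>' then a else 0)) \<in> nul P e UNIV"
    for ks :: "('r \<times> (real \<Rightarrow> 'm) \<times> (real \<Rightarrow> 'm)) list"
  proof (induction ks)
    case Nil
    then show ?case using nul_zero by (simp add: zero_fun_def)
  next
    case (Cons k ks)
    obtain a \<rho> \<rho>' where k: "k = (a, \<rho>, \<rho>')" by (cases k)
    have "(\<lambda>\<tau>. \<Sum>(a, \<rho>, \<rho>') \<leftarrow> k # ks. (if \<tau> = \<rho> then a else 0) - (if \<tau> = \<rho>' then a else 0)) =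
       (\<lambda>\<tau>. \<Sum>(a, \<rho>, \<rho>') \<leftarrow> ks. (if \<tau> = \<rho> then a else 0) - (if \<tau> = \<rho>' then a else 0)) + (dl a \<rho> - dl a \<rho>')"
      by (auto simp: k dl_def fun_eq_iff)
    then show ?case using nul_step[OF Cons.IH, of \<rho> \<rho>' a] Cons.prems k by simp
  qed
  have 2: "\<phi> \<in> nul P e UNIV \<Longrightarrow> \<exists>ks. (\<forall>(a, \<rho>, \<rho>') \<in> set ks. hrel P e \<rho> \<rho>') \<and>
      (\<forall>\<tau>. \<phi> \<tau> = (\<Sum>(a, \<rho>, \<rho>') \<leftarrow> ks. (if \<tau> = \<rho> then a else 0) - (if \<tau> = \<rho>' then a else 0)))"
    for \<phi> :: "(real \<Rightarrow> 'm) \<Rightarrow> 'r"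
  proof (induction rule: nul_induct)
    case zero
    then show ?case by (intro exI[of _ "[]"]) auto
  next
    case (step \<phi> \<rho> \<rho>' a)
    then obtain ks where "\<forall>(a, \<rho>, \<rho>') \<in> set ks. hrel P e \<rho> \<rho>'"
      "\<forall>\<tau>. \<phi> \<tau> = (\<Sum>(a, \<rho>, \<rho>') \<leftarrow> ks. (if \<tau> = \<rho> then a else 0) - (if \<tau> = \<rho>' then a else 0))" by blast
    then show ?case using step.hyps by (intro exI[of _ "(a, \<rho>, \<rho>') # ks"]) (auto simp: dl_def)
  qed
  have eq: "sim P e f g \<longleftrightarrow> (\<forall>x y. \<exists>ks. (\<forall>(a, \<rho>, \<rho>') \<in> set ks. hrel P e \<rho> \<rho>') \<and>
      (\<forall>\<tau>. (f x y - g x y) \<tau> = (\<Sum>(a, \<rho>, \<rho>') \<leftarrow> ks. (if \<tau> = \<rho> then a else 0) - (if \<tau> = \<rho>' then a else 0))))"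
    by (simp add: sim_def hrel_def hset_def)
  show ?thesis
  proof
    assume s: "sim P e f g"
    show "\<forall>x y. f x y - g x y \<in> nul P e UNIV"
    proof (intro allI)
      fix x y
      obtain ks where ks: "\<forall>(a, \<rho>, \<rho>') \<in> set ks. hrel P e \<rho> \<rho>'"
        "\<forall>\<tau>. (f x y - g x y) \<tau> = (\<Sum>(a, \<rho>, \<rho>') \<leftarrow> ks. (if \<tau> = \<rho> then a else 0) - (if \<tau> = \<rho>' then a else 0))"
        using s unfolding eq by blast
      then have "f x y - g x y = (\<lambda>\<tau>. \<Sum>(a, \<rho>, \<rho>') \<leftarrow> ks. (if \<tau> = \<rho> then a else 0) - (if \<tau> = \<rho>' then a else 0))"
        by blast
      then show "f x y - g x y \<in> nul P e UNIV" using 1[OF ks(1)] by simp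
    qed
  next
    assume "\<forall>x y. f x y - g x y \<in> nul P e UNIV"
    then show "sim P e f g" unfolding eq using 2 by blast
  qed
qed

section \<open>Finitely supported morphisms and their matrix blocks\<close>

section \<open>Calculus of geometric morphisms\<close>

text \<open>A geometric morphism has finitely many paths from each generator. Over finitely
  generated modules the whole support is finite; then the sums in \<open>\<odot>\<close> are
  genuine, since a sum over an infinite set would be 0 by convention, and composition is
  bilinear.\<close>

definition fs :: "('g, 'h, 'm, 'r::zero) gmor \<Rightarrow> bool" where
  "fs f \<longleftrightarrow> finite {(x, y, \<rho>). f x y \<rho> \<noteq> 0}"

text \<open>The block of \<open>f\<close> between two geometric submodules, kept on the original
  types of generators, so that a quotient and the complex it comes from can be compared
  directly.\<close>

definition mask :: "'g set \<Rightarrow> 'h set \<Rightarrow> ('g, 'h, 'm, 'r::zero) gmor \<Rightarrow> ('g, 'h, 'm, 'r) gmor" where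
  "mask S T f = (\<lambda>x y \<rho>. if x \<in> S \<and> y \<in> T then f x y \<rho> else 0)"

definition mor :: "('m::topological_space, 'x::metric_space) control \<Rightarrow> real \<Rightarrow> ('g, 'm) gmod \<Rightarrow> ('h, 'm) gmod
    \<Rightarrow> ('g, 'h, 'm, 'r::involution_ring) gmor \<Rightarrow> bool" where
  "mor P e G H f \<longleftrightarrow> fs f \<and> (\<forall>x y \<rho>. f x y \<rho> \<noteq> 0 \<longrightarrow>
     mpath P e \<rho> \<and> G x = Some (pathstart \<rho>) \<and> H y = Some (pathfinish \<rho>))"

lemma morD:
  assumes "mor P e G H f" "f x y \<rho> \<noteq> 0"
  shows "mpath P e \<rho>" "G x = Some (pathstart \<rho>)" "H y = Some (pathfinish \<rho>)"
  using assms by (auto simp: mor_def)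

lemma mor_fs: "mor P e G H f \<Longrightarrow> fs f" by (simp add: mor_def)

lemma fs_imageI: "finite A \<Longrightarrow> (\<And>x y \<rho>. f x y \<rho> \<noteq> 0 \<Longrightarrow> (x, y, \<rho>) \<in> A) \<Longrightarrow> fs f"
  unfolding fs_def by (erule finite_subset[rotated]) auto

lemma mor_imp_emorphism: "mor P e G H f \<Longrightarrow> emorphism P e G H f"
proof -
  assume f: "mor P e G H f"
  have "finite {(y, \<rho>). f x y \<rho> \<noteq> 0}" for x
  proof (rule finite_subset)
    show "{(y, \<rho>). f x y \<rho> \<noteq> 0} \<subseteq> snd ` {(x, y, \<rho>). f x y \<rho> \<noteq> 0}" by force
    show "finite (snd ` {(x, y, \<rho>). f x y \<rho> \<noteq> 0})" using f by (simp add: mor_def fs_def)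
  qed
  then show ?thesis using f
    unfolding mor_def emorphism_def gmorphism_def has_radius_def mpath_def by blast
qed

lemma emorphism_imp_mor: "emorphism P e G H f \<Longrightarrow> finite (dom G) \<Longrightarrow> mor P e G H f"
proof -
  assume f: "emorphism P e G H f" and G: "finite (dom G)"
  have "fs f"
  proof (rule fs_imageI)
    show "finite (SIGMA x:dom G. {(y, \<rho>). f x y \<rho> \<noteq> 0})"
      using G f by (auto simp: emorphism_def gmorphism_def)
    show "(x, y, \<rho>) \<in> (SIGMA x:dom G. {(y, \<rho>). f x y \<rho> \<noteq> 0})" if "f x y \<rho> \<noteq> 0" for x y \<rho>
      using that f by (auto simp: emorphism_def gmorphism_def)
  qed
  then show ?thesis using f
    unfolding mor_def emorphism_def gmorphism_def has_radius_def mpath_def by blast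
qed

lemma fs_supports:
  assumes "fs f"
  obtains X Y R where "finite X" "finite Y" "finite R" "\<And>x y \<rho>. f x y \<rho> \<noteq> 0 \<Longrightarrow> x \<in> X \<and> y \<in> Y \<and> \<rho> \<in> R"
proof
  let ?A = "{(x, y, \<rho>). f x y \<rho> \<noteq> 0}"
  show "finite (fst ` ?A)" "finite (fst ` snd ` ?A)" "finite (snd ` snd ` ?A)"
    using assms by (auto simp: fs_def)
  show "x \<in> fst ` ?A \<and> y \<in> fst ` snd ` ?A \<and> \<rho> \<in> snd ` snd ` ?A" if "f x y \<rho> \<noteq> 0" for x y \<rho>
    using that by force
qed

lemma fs_pair: "fs f \<Longrightarrow> finite {\<rho>. f x y \<rho> \<noteq> 0}"
  by (erule fs_supports) (auto elim: finite_subset[rotated])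

lemma fs_zero [simp]: "fs 0" by (rule fs_imageI[of "{}"]) auto

lemma fs_add [simp]: "fs f \<Longrightarrow> fs g \<Longrightarrow> fs (f + g :: ('g, 'h, 'm, 'r::monoid_add) gmor)"
  by (rule fs_imageI[of "{(x, y, \<rho>). f x y \<rho> \<noteq> 0} \<union> {(x, y, \<rho>). g x y \<rho> \<noteq> 0}"])
    (auto simp: fs_def)

lemma fs_uminus [simp]: "fs (- f) \<longleftrightarrow> fs (f :: ('g, 'h, 'm, 'r::group_add) gmor)"
  by (simp add: fs_def)

lemma fs_diff [simp]: "fs f \<Longrightarrow> fs g \<Longrightarrow> fs (f - g :: ('g, 'h, 'm, 'r::group_add) gmor)"
  by (rule fs_imageI[of "{(x, y, \<rho>). f x y \<rho> \<noteq> 0} \<union> {(x, y, \<rho>). g x y \<rho> \<noteq> 0}"])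
    (auto simp: fs_def)

lemma fs_msign [simp]: "fs (msign k f) \<longleftrightarrow> fs (f :: ('g, 'h, 'm, 'r::group_add) gmor)"
  by (simp add: msign_def)

lemma fs_mask [simp]: "fs f \<Longrightarrow> fs (mask S T f)"
  by (rule fs_imageI[of "{(x, y, \<rho>). f x y \<rho> \<noteq> 0}"]) (auto simp: fs_def mask_def split: if_splits)

lemma gcomp_nz:
  assumes "(g \<odot> f) x z \<tau> \<noteq> 0"
  obtains y \<rho> \<sigma> where "f x y \<rho> \<noteq> 0" "g y z \<sigma> \<noteq> 0" "\<tau> = pjoin \<rho> \<sigma>"
  using assms unfolding gcomp_def by (auto elim!: sum.not_neutral_contains_not_neutral)

lemma fs_gcomp [simp]: "fs f \<Longrightarrow> fs g \<Longrightarrow> fs (g \<odot> f)"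
  by (rule fs_imageI[of "(\<lambda>((x, y, \<rho>), (y', z, \<sigma>)). (x, z, pjoin \<rho> \<sigma>)) `
      ({(x, y, \<rho>). f x y \<rho> \<noteq> 0} \<times> {(x, y, \<rho>). g x y \<rho> \<noteq> 0})"])
    (force simp: fs_def elim!: gcomp_nz)+

lemma dual_pushf: "dual f y x = pushf prev bar (f x y)"
  by (simp add: dual_def pushf_def)

lemma dual_nz:
  assumes "dual f y x \<tau> \<noteq> 0"
  obtains \<rho> where "f x y \<rho> \<noteq> 0" "\<tau> = prev \<rho>"
  using assms unfolding dual_def by (auto elim!: sum.not_neutral_contains_not_neutral)

lemma fs_dual [simp]: "fs f \<Longrightarrow> fs (dual f)"
  by (rule fs_imageI[of "(\<lambda>(x, y, \<rho>). (y, x, prev \<rho>)) ` {(x, y, \<rho>). f x y \<rho> \<noteq> 0}"])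
    (force simp: fs_def elim!: dual_nz)+

text \<open>The index sets may be larger than the supports, because a zero coefficient contributes a
  zero term. Composites of morphisms with different supports can thus be expanded over common sets
  and added termwise.\<close>

lemma gcomp_expand:
  assumes "finite Y" "finite R" "finite Q"
    "\<And>y \<rho>. f x y \<rho> \<noteq> 0 \<Longrightarrow> y \<in> Y \<and> \<rho> \<in> R" "\<And>y \<sigma>. g y z \<sigma> \<noteq> 0 \<Longrightarrow> \<sigma> \<in> Q"
  shows "(g \<odot> f) x z = (\<Sum>y\<in>Y. \<Sum>\<rho>\<in>R. \<Sum>\<sigma>\<in>Q. dl (g y z \<sigma> * f x y \<rho>) (pjoin \<rho> \<sigma>))"
proof
  fix \<tau>
  have "(g \<odot> f) x z \<tau> = (\<Sum>(y, \<rho>, \<sigma>) \<in> (Y \<times> R \<times> Q) \<inter> {(y, \<rho>, \<sigma>). pjoin \<rho> \<sigma> = \<tau>}. g y z \<sigma> * f x y \<rho>)"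
    unfolding gcomp_def by (rule sum.mono_neutral_left) (use assms in auto)
  also have "\<dots> = (\<Sum>(y, \<rho>, \<sigma>) \<in> Y \<times> R \<times> Q. if pjoin \<rho> \<sigma> = \<tau> then g y z \<sigma> * f x y \<rho> else 0)"
    by (subst sum.inter_restrict) (use assms in \<open>auto intro!: sum.cong\<close>)
  also have "\<dots> = (\<Sum>y\<in>Y. \<Sum>\<rho>\<in>R. \<Sum>\<sigma>\<in>Q. if pjoin \<rho> \<sigma> = \<tau> then g y z \<sigma> * f x y \<rho> else 0)"
    by (simp add: sum.cartesian_product)
  finally show "(g \<odot> f) x z \<tau> = (\<Sum>y\<in>Y. \<Sum>\<rho>\<in>R. \<Sum>\<sigma>\<in>Q. dl (g y z \<sigma> * f x y \<rho>) (pjoin \<rho> \<sigma>)) \<tau>"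
    by (auto simp: sum_fun_apply dl_def intro!: sum.cong)
qed

lemma dl_add: "dl (a + b) \<rho> = dl a \<rho> + dl b (\<rho>::'p)" for a b :: "'r::monoid_add"
  by (auto simp: dl_def fun_eq_iff)

lemma gcomp_add_right:
  assumes "fs f" "fs f'" "fs g"
  shows "g \<odot> (f + f') = g \<odot> f + g \<odot> f'"
proof (intro ext)
  fix x z \<tau>
  obtain X' Y R where Y: "finite X'" "finite Y" "finite R" "\<And>x y \<rho>. f x y \<rho> \<noteq> 0 \<Longrightarrow> x \<in> X' \<and> y \<in> Y \<and> \<rho> \<in> R"
    using fs_supports[OF assms(1)] by blast
  obtain X'' Y' R' where Y': "finite X''" "finite Y'" "finite R'" "\<And>x y \<rho>. f' x y \<rho> \<noteq> 0 \<Longrightarrow> x \<in> X'' \<and> y \<in> Y' \<and> \<rho> \<in> R'"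
    using fs_supports[OF assms(2)] by blast
  obtain X Z Q where Q: "finite X" "finite Z" "finite Q" "\<And>x y \<rho>. g x y \<rho> \<noteq> 0 \<Longrightarrow> x \<in> X \<and> y \<in> Z \<and> \<rho> \<in> Q" 
    using fs_supports[OF assms(3)] by blast
  have nz: "(f + f') x y \<rho> \<noteq> 0 \<Longrightarrow> f x y \<rho> \<noteq> 0 \<or> f' x y \<rho> \<noteq> 0" for y \<rho> by auto
  have YR: "finite (Y \<union> Y')" "finite (R \<union> R')" using Y Y' by auto
  have *: "(f + f') x y \<rho> \<noteq> 0 \<Longrightarrow> y \<in> Y \<union> Y' \<and> \<rho> \<in> R \<union> R'" "f x y \<rho> \<noteq> 0 \<Longrightarrow> y \<in> Y \<union> Y' \<and> \<rho> \<in> R \<union> R'"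
     "f' x y \<rho> \<noteq> 0 \<Longrightarrow> y \<in> Y \<union> Y' \<and> \<rho> \<in> R \<union> R'" "g y z \<sigma> \<noteq> 0 \<Longrightarrow> \<sigma> \<in> Q" for y \<rho> \<sigma>
    using nz Y(4) Y'(4) Q(4) by blast+
  show "(g \<odot> (f + f')) x z \<tau> = (g \<odot> f + g \<odot> f') x z \<tau>"
    using gcomp_expand[of "Y \<union> Y'" "R \<union> R'" Q "f + f'" x g z, OF YR Q(3) *(1,4)]
      gcomp_expand[of "Y \<union> Y'" "R \<union> R'" Q f x g z, OF YR Q(3) *(2,4)]
      gcomp_expand[of "Y \<union> Y'" "R \<union> R'" Q f' x g z, OF YR Q(3) *(3,4)]
    by (simp add: distrib_left dl_add sum.distrib)
qed

lemma gcomp_add_left: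
  assumes "fs f" "fs g" "fs g'"
  shows "(g + g') \<odot> f = g \<odot> f + g' \<odot> f"
proof (intro ext)
  fix x z \<tau>
  obtain X' Y R where Y: "finite X'" "finite Y" "finite R" "\<And>x y \<rho>. f x y \<rho> \<noteq> 0 \<Longrightarrow> x \<in> X' \<and> y \<in> Y \<and> \<rho> \<in> R"
    using fs_supports[OF assms(1)] by blast
  obtain X Z Q where Q: "finite X" "finite Z" "finite Q" "\<And>x y \<rho>. g x y \<rho> \<noteq> 0 \<Longrightarrow> x \<in> X \<and> y \<in> Z \<and> \<rho> \<in> Q" 
    using fs_supports[OF assms(2)] by blast
  obtain X'' Z' Q' where Q': "finite X''" "finite Z'" "finite Q'" "\<And>x y \<rho>. g' x y \<rho> \<noteq> 0 \<Longrightarrow> x \<in> X'' \<and> y \<in> Z' \<and> \<rho> \<in> Q'" 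
    using fs_supports[OF assms(3)] by blast
  have nz: "(g + g') y z \<sigma> \<noteq> 0 \<Longrightarrow> g y z \<sigma> \<noteq> 0 \<or> g' y z \<sigma> \<noteq> 0" for y \<sigma> by auto
  have QQ: "finite (Q \<union> Q')" using Q Q' by auto
  have *: "f x y \<rho> \<noteq> 0 \<Longrightarrow> y \<in> Y \<and> \<rho> \<in> R" "(g + g') y z \<sigma> \<noteq> 0 \<Longrightarrow> \<sigma> \<in> Q \<union> Q'"
     "g y z \<sigma> \<noteq> 0 \<Longrightarrow> \<sigma> \<in> Q \<union> Q'" "g' y z \<sigma> \<noteq> 0 \<Longrightarrow> \<sigma> \<in> Q \<union> Q'" for y \<rho> \<sigma>
    using nz Y(4) Q(4) Q'(4) by blast+
  show "((g + g') \<odot> f) x z \<tau> = (g \<odot> f + g' \<odot> f) x z \<tau>"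
    using gcomp_expand[of Y R "Q \<union> Q'" f x "g + g'" z, OF Y(2,3) QQ *(1,2)]
      gcomp_expand[of Y R "Q \<union> Q'" f x g z, OF Y(2,3) QQ *(1,3)]
      gcomp_expand[of Y R "Q \<union> Q'" f x g' z, OF Y(2,3) QQ *(1,4)]
    by (simp add: distrib_right dl_add sum.distrib)
qed

lemma gcomp_uminus [simp]: "g \<odot> (- f) = - (g \<odot> f)" "(- g) \<odot> f = - (g \<odot> f)"
  by (auto simp: gcomp_def fun_eq_iff sum_negf[symmetric] intro!: sum.cong)

lemma gcomp_zero [simp]: "g \<odot> 0 = 0" "0 \<odot> f = 0"
  by (auto simp: gcomp_def fun_eq_iff)

lemma gcomp_msign [simp]: "g \<odot> msign k f = msign k (g \<odot> f)" "msign k g \<odot> f = msign k (g \<odot> f)"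
  by (auto simp: msign_def)

lemma dual_zero [simp]: "dual 0 = 0" by (auto simp: dual_def fun_eq_iff)

lemma dual_uminus [simp]: "dual (- f) = - dual f"
  by (auto simp: dual_def fun_eq_iff bar_uminus sum_negf[symmetric] intro!: sum.cong)

lemma dual_add: "fs f \<Longrightarrow> fs g \<Longrightarrow> dual (f + g) = dual f + dual g"
  by (intro ext) (simp add: dual_pushf pushf_add fs_pair bar_add)

lemma pushf_zero [simp]: "pushf T m 0 = 0"
  by (auto simp: pushf_def fun_eq_iff)

lemma gid_dl: "gid G x y = (case G x of Some u \<Rightarrow> if y = x then dl 1 (pconst u) else 0 | None \<Rightarrow> 0)"
  by (auto simp: gid_def dl_def fun_eq_iff split: option.splits)

lemma dual_gid [simp]: "dual (gid G :: ('g, 'g, 'm::topological_space, 'r::involution_ring) gmor) = gid G"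
proof (intro ext)
  fix y x \<tau>
  show "dual (gid G) y x \<tau> = (gid G y x \<tau> :: 'r)"
    by (cases "y = x") (auto simp: dual_pushf gid_dl pushf_dl split: option.splits)
qed

lemma msign_add [simp]: "msign k (f + g) = msign k f + msign k (g :: 'a::ab_group_add)"
  by (simp add: msign_def)

lemma msign_uminus [simp]: "msign k (- f) = - msign k (f :: 'a::ab_group_add)"
  by (simp add: msign_def)

lemma msign_zero [simp]: "msign k 0 = (0 :: 'a::ab_group_add)"
  by (simp add: msign_def)

lemma msign_msign: "msign k (msign l f) = msign (k + l) (f :: 'a::ab_group_add)"
  by (simp add: msign_def)

lemma msign_self [simp]: "msign k (msign k f) = (f :: 'a::ab_group_add)"
  by (simp add: msign_def)

lemma msign_nz [simp]: "msign k a \<noteq> 0 \<longleftrightarrow> (a :: 'a::ab_group_add) \<noteq> 0" "msign k a = 0 \<longleftrightarrow> a = 0"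
  by (simp_all add: msign_def)

lemma dl_zero [simp]: "dl 0 \<rho> = 0" by (auto simp: dl_def fun_eq_iff)

lemma sim_refl [simp]: "sim P e f f"
  by (simp add: sim_iff_nul nul_zero)

lemma sim_sym: "sim P e f g \<Longrightarrow> sim P e g f"
  unfolding sim_iff_nul by (metis minus_diff_eq nul_uminus)

lemma sim_trans [trans]:
  assumes "sim P e f g" "sim P e g h"
  shows "sim P e f h"
proof -
  have "f x y - h x y = (f x y - g x y) + (g x y - h x y)" for x y by simp
  then show ?thesis using assms nul_add unfolding sim_iff_nul by metis
qed

lemma sim_add: "sim P e f g \<Longrightarrow> sim P e f' g' \<Longrightarrow> sim P e (f + f') (g + g')"
  unfolding sim_iff_nul
proof (intro allI)
  fix x y
  assume a: "\<forall>x y. f x y - g x y \<in> nul P e UNIV" "\<forall>x y. f' x y - g' x y \<in> nul P e UNIV"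
  have "(f + f') x y - (g + g') x y = (f x y - g x y) + (f' x y - g' x y)" by simp
  then show "(f + f') x y - (g + g') x y \<in> nul P e UNIV" using nul_add a by metis
qed

lemma sim_uminus: "sim P e f g \<Longrightarrow> sim P e (- f) (- g)"
  unfolding sim_iff_nul
proof (intro allI)
  fix x y
  assume a: "\<forall>x y. f x y - g x y \<in> nul P e UNIV"
  have "(- f) x y - (- g) x y = - (f x y - g x y)" by simp
  then show "(- f) x y - (- g) x y \<in> nul P e UNIV" using nul_uminus a by metis
qed

lemma sim_msign: "sim P e f g \<Longrightarrow> sim P e (msign k f) (msign k g)"
  by (simp add: msign_def sim_uminus)

lemma sim_mono: "sim P d f g \<Longrightarrow> d \<le> e \<Longrightarrow> sim P e f g"
  unfolding sim_iff_nul by (meson hrel_mono nul_mono subset_refl)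

lemma sim_mask: "sim P e f g \<Longrightarrow> sim P e (mask S T f) (mask S T g)"
  unfolding sim_iff_nul
proof (intro allI)
  fix x y
  assume a: "\<forall>x y. f x y - g x y \<in> nul P e UNIV"
  have "mask S T f x y - mask S T g x y = (if x \<in> S \<and> y \<in> T then f x y - g x y else 0)"
    by (auto simp: mask_def fun_eq_iff)
  then show "mask S T f x y - mask S T g x y \<in> nul P e UNIV" using nul_zero a by metis
qed

lemma sim_zero_iff: "sim P e f 0 \<longleftrightarrow> (\<forall>x y. f x y \<in> nul P e UNIV)"
  by (simp add: sim_iff_nul)

lemma sim_diff_iff: "sim P e f g \<longleftrightarrow> sim P e (f - g) 0"
  by (simp add: sim_iff_nul)

text \<open>The composite is split into the contributions of the single paths \<sigma> of
  \<open>g\<close>; each is a pushforward under concatenation with \<sigma>, which enlarges the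
  radius of a homotopy by that of \<sigma>.\<close>

lemma nul_gcomp_right:
  assumes "\<And>y. \<phi> x y \<in> nul P e UNIV" "fs \<phi>" "\<And>y \<tau>. \<phi> x y \<tau> \<noteq> 0 \<Longrightarrow> H y = Some (pathfinish \<tau>)"
    and g: "mor P d H K g"
  shows "(g \<odot> \<phi>) x z \<in> nul P (e + d) UNIV"
proof -
  obtain X Y R where Y: "finite X" "finite Y" "finite R" "\<And>x y \<rho>. \<phi> x y \<rho> \<noteq> 0 \<Longrightarrow> x \<in> X \<and> y \<in> Y \<and> \<rho> \<in> R"
    using fs_supports[OF assms(2)] by blast
  obtain X' Z Q where Q: "finite X'" "finite Z" "finite Q" "\<And>x y \<rho>. g x y \<rho> \<noteq> 0 \<Longrightarrow> x \<in> X' \<and> y \<in> Z \<and> \<rho> \<in> Q" 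
    using fs_supports[OF mor_fs[OF g]] by blast
  have "(g \<odot> \<phi>) x z = (\<Sum>y\<in>Y. \<Sum>\<rho>\<in>R. \<Sum>\<sigma>\<in>Q. dl (g y z \<sigma> * \<phi> x y \<rho>) (pjoin \<rho> \<sigma>))"
    by (rule gcomp_expand) (use Y Q in blast)+
  also have "\<dots> = (\<Sum>y\<in>Y. \<Sum>\<sigma>\<in>Q. pushf (\<lambda>\<rho>. pjoin \<rho> \<sigma>) (\<lambda>a. g y z \<sigma> * a) (\<phi> x y))"
  proof (rule sum.cong[OF refl])
    fix y
    show "(\<Sum>\<rho>\<in>R. \<Sum>\<sigma>\<in>Q. dl (g y z \<sigma> * \<phi> x y \<rho>) (pjoin \<rho> \<sigma>)) =
        (\<Sum>\<sigma>\<in>Q. pushf (\<lambda>\<rho>. pjoin \<rho> \<sigma>) (\<lambda>a. g y z \<sigma> * a) (\<phi> x y))"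
      by (subst sum.swap) (rule sum.cong[OF refl], rule pushf_eq[symmetric], use Y in auto)
  qed
  also have "\<dots> \<in> nul P (e + d) UNIV"
  proof (intro nul_sum)
    fix y \<sigma>
    show "pushf (\<lambda>\<rho>. pjoin \<rho> \<sigma>) (\<lambda>a. g y z \<sigma> * a) (\<phi> x y) \<in> nul P (e + d) UNIV"
    proof (cases "g y z \<sigma> = 0")
      case True
      have "pushf (\<lambda>\<rho>. pjoin \<rho> \<sigma>) (\<lambda>a. g y z \<sigma> * a) (\<phi> x y) = 0"
        by (auto simp: pushf_def True fun_eq_iff)
      then show ?thesis using nul_zero by metis
    next
      case False
      note s = morD[OF g False]
      \<comment> \<open>Only homotopies between paths ending where \<sigma> starts survive
        concatenation, so the null witness is first confined to such paths.\<close>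
      have "\<phi> x y \<in> nul P e {(u, v). v = pathstart \<sigma>}"
        by (rule nul_restrict[OF assms(1)]) (use assms(3) s(2) in auto)
      then show ?thesis
        by (rule nul_pushf) (use s(1) hrel_pjoin_left in \<open>auto simp: distrib_left\<close>)
    qed
  qed
  finally show ?thesis .
qed

lemma nul_gcomp_left:
  assumes "\<And>y. \<phi> y z \<in> nul P e UNIV" "fs \<phi>" "\<And>y \<tau>. \<phi> y z \<tau> \<noteq> 0 \<Longrightarrow> H y = Some (pathstart \<tau>)"
    and f: "mor P d G H f"
  shows "(\<phi> \<odot> f) x z \<in> nul P (e + d) UNIV"
proof -
  obtain X Z Q where Q: "finite X" "finite Z" "finite Q" "\<And>x y \<rho>. \<phi> x y \<rho> \<noteq> 0 \<Longrightarrow> x \<in> X \<and> y \<in> Z \<and> \<rho> \<in> Q"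
    using fs_supports[OF assms(2)] by blast
  obtain X' Y R where Y: "finite X'" "finite Y" "finite R" "\<And>x y \<rho>. f x y \<rho> \<noteq> 0 \<Longrightarrow> x \<in> X' \<and> y \<in> Y \<and> \<rho> \<in> R" 
    using fs_supports[OF mor_fs[OF f]] by blast
  have "(\<phi> \<odot> f) x z = (\<Sum>y\<in>Y. \<Sum>\<rho>\<in>R. \<Sum>\<sigma>\<in>Q. dl (\<phi> y z \<sigma> * f x y \<rho>) (pjoin \<rho> \<sigma>))"
    by (rule gcomp_expand) (use Y Q in blast)+
  also have "\<dots> = (\<Sum>y\<in>Y. \<Sum>\<rho>\<in>R. pushf (\<lambda>\<sigma>. pjoin \<rho> \<sigma>) (\<lambda>a. a * f x y \<rho>) (\<phi> y z))"
    by (intro sum.cong[OF refl], rule pushf_eq[symmetric], use Q in auto)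
  also have "\<dots> \<in> nul P (e + d) UNIV"
  proof (intro nul_sum)
    fix y \<rho>
    show "pushf (\<lambda>\<sigma>. pjoin \<rho> \<sigma>) (\<lambda>a. a * f x y \<rho>) (\<phi> y z) \<in> nul P (e + d) UNIV"
    proof (cases "f x y \<rho> = 0")
      case True
      have "pushf (\<lambda>\<sigma>. pjoin \<rho> \<sigma>) (\<lambda>a. a * f x y \<rho>) (\<phi> y z) = 0"
        by (auto simp: pushf_def True fun_eq_iff)
      then show ?thesis using nul_zero by metis
    next
      case False
      note s = morD[OF f False]
      have "\<phi> y z \<in> nul P e {(u, v). u = pathfinish \<rho>}"
        by (rule nul_restrict[OF assms(1)]) (use assms(3) s(3) in auto)
      then show ?thesis
        by (rule nul_pushf) (use hrel_pjoin_right[OF _ s(1)] in \<open>auto simp: distrib_right\<close>)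
    qed
  qed
  finally show ?thesis .
qed

lemma diff_nz: "(f - g) x y \<tau> \<noteq> 0 \<Longrightarrow> f x y \<tau> \<noteq> 0 \<or> g x y (\<tau>::'p) \<noteq> (0::'r::group_add)" by auto

lemma sim_gcomp_right:
  assumes s: "sim P e f f'" and f: "mor P a G H f" "mor P a' G' H f'" and g: "mor P d H K g" and e: "e + d \<le> e'"
  shows "sim P e' (g \<odot> f) (g \<odot> f')"
proof -
  have eq: "g \<odot> f - g \<odot> f' = g \<odot> (f - f')"
    using gcomp_add_right[of f "- f'" g] f g by (simp add: mor_fs)
  have "sim P (e + d) (g \<odot> (f - f')) 0" unfolding sim_zero_iff
  proof (intro allI, rule nul_gcomp_right[OF _ _ _ g])
    show "(f - f') x y \<in> nul P e UNIV" for x y using s by (simp add: sim_iff_nul)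
    show "fs (f - f')" using f by (simp add: mor_fs)
    show "H y = Some (pathfinish \<tau>)" if "(f - f') x y \<tau> \<noteq> 0" for x y \<tau>
      using diff_nz[OF that] morD(3)[OF f(1)] morD(3)[OF f(2)] by blast
  qed
  then show ?thesis using eq e sim_mono sim_diff_iff by metis
qed

lemma sim_gcomp_left:
  assumes s: "sim P e g g'" and g: "mor P a H K g" "mor P a' H K' g'" and f: "mor P d G H f" and e: "e + d \<le> e'"
  shows "sim P e' (g \<odot> f) (g' \<odot> f)"
proof -
  have eq: "g \<odot> f - g' \<odot> f = (g - g') \<odot> f"
    using gcomp_add_left[of f g "- g'"] f g by (simp add: mor_fs)
  have "sim P (e + d) ((g - g') \<odot> f) 0" unfolding sim_zero_iff
  proof (intro allI, rule nul_gcomp_left[OF _ _ _ f])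
    show "(g - g') x y \<in> nul P e UNIV" for x y using s by (simp add: sim_iff_nul)
    show "fs (g - g')" using g by (simp add: mor_fs)
    show "H y = Some (pathstart \<tau>)" if "(g - g') y z \<tau> \<noteq> 0" for y z \<tau>
      using diff_nz[OF that] morD(2)[OF g(1)] morD(2)[OF g(2)] by blast
  qed
  then show ?thesis using eq e sim_mono sim_diff_iff by metis
qed

lemma sim_dual:
  assumes s: "sim P e f f'" and f: "fs f" "fs f'"
  shows "sim P e (dual f) (dual f')"
proof -
  have eq: "dual f - dual f' = dual (f - f')"
    using dual_add[of f "- f'"] f by simp
  have "sim P e (dual (f - f')) 0" unfolding sim_zero_iff dual_pushf
  proof (intro allI, rule nul_pushf)
    show "(f - f') x y \<in> nul P e UNIV" for x y using s by (simp add: sim_iff_nul)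
  qed (auto simp: bar_add hrel_prev)
  then show ?thesis using eq sim_diff_iff by metis
qed

lemma mor_zero [simp]: "mor P e G H 0" by (simp add: mor_def)

lemma mor_add: "mor P e G H f \<Longrightarrow> mor P e G H g \<Longrightarrow> mor P e G H (f + g)"
  unfolding mor_def by (auto, (metis add.right_neutral)+)

lemma mor_uminus [simp]: "mor P e G H (- f) \<longleftrightarrow> mor P e G H f" by (simp add: mor_def)

lemma mor_msign [simp]: "mor P e G H (msign k f) \<longleftrightarrow> mor P e G H f" by (simp add: msign_def)

lemma mor_mono: "mor P d G H f \<Longrightarrow> d \<le> e \<Longrightarrow> mor P e G H f"
  unfolding mor_def using mpath_mono by blast

lemma mor_dual: "mor P e G H f \<Longrightarrow> mor P e H G (dual f)"
  unfolding mor_def by (auto elim!: dual_nz simp: mpath_prev)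

lemma mor_gcomp: "mor P e G H f \<Longrightarrow> mor P d H K g \<Longrightarrow> e + d \<le> e' \<Longrightarrow> mor P e' G K (g \<odot> f)"
proof -
  assume a: "mor P e G H f" "mor P d H K g" "e + d \<le> e'"
  have "mpath P e' \<tau> \<and> G x = Some (pathstart \<tau>) \<and> K z = Some (pathfinish \<tau>)"
    if nz: "(g \<odot> f) x z \<tau> \<noteq> 0" for x z \<tau>
  proof -
    obtain y \<rho> \<sigma> where n: "f x y \<rho> \<noteq> 0" "g y z \<sigma> \<noteq> 0" "\<tau> = pjoin \<rho> \<sigma>" using nz by (rule gcomp_nz)
    note m = morD[OF a(1) n(1)] morD[OF a(2) n(2)]
    then show ?thesis using mpath_mono[OF mpath_pjoin[OF m(1,4)] a(3)] n(3) by simp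
  qed
  then show ?thesis using a by (simp add: mor_def)
qed

lemma mor_mask_le: "mor P e G H f \<Longrightarrow> G' \<subseteq>\<^sub>m G \<Longrightarrow> H' \<subseteq>\<^sub>m H \<Longrightarrow> mor P e G' H' (mask (dom G') (dom H') f)"
  unfolding mor_def by (simp add: map_le_def) (simp add: mask_def)

lemma mor_mask_same: "mor P e G H f \<Longrightarrow> mor P e G H (mask S T f)"
  unfolding mor_def by simp (simp add: mask_def)

lemma mor_le: "mor P e G' H' f \<Longrightarrow> G' \<subseteq>\<^sub>m G \<Longrightarrow> H' \<subseteq>\<^sub>m H \<Longrightarrow> mor P e G H f"
  unfolding mor_def map_le_def by (metis domI)

lemma mor_gid: "finite (dom G) \<Longrightarrow> gmodule P G \<Longrightarrow> 0 \<le> e \<Longrightarrow> mor P e G G (gid G)"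
proof -
  assume a: "finite (dom G)" "gmodule P G" "0 \<le> e"
  have "fs (gid G)"
    by (rule fs_imageI[of "(\<lambda>x. (x, x, pconst (the (G x)))) ` dom G"])
      (use a(1) in \<open>auto simp: gid_def image_iff split: if_splits\<close>)
  moreover have "mpath P e (pconst u)" if "G x = Some u" for x u
    by (rule mpath_pconst) (use that a(2,3) in \<open>auto simp: gmodule_def intro: ranI\<close>)
  ultimately show ?thesis by (auto simp: mor_def gid_def split: if_splits)
qed

lemma mask_mask [simp]: "mask S T (mask S' T' f) = mask (S \<inter> S') (T \<inter> T') f"
  by (auto simp: mask_def fun_eq_iff)

lemma mask_add [simp]: "mask S T (f + g) = mask S T f + mask S T (g :: ('g,'h,'m,'r::monoid_add) gmor)"
  by (intro ext) (simp add: mask_def)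

lemma mask_uminus [simp]: "mask S T (- f) = - mask S T (f :: ('g,'h,'m,'r::group_add) gmor)"
  by (intro ext) (simp add: mask_def)

lemma mask_zero [simp]: "mask S T 0 = 0"
  by (intro ext) (simp add: mask_def)

lemma mask_msign [simp]: "mask S T (msign k f) = msign k (mask S T (f :: ('g,'h,'m,'r::ab_group_add) gmor))"
  by (simp add: msign_def)

lemma mask_dual: "dual (mask S T f) = mask T S (dual f)"
  by (intro ext) (auto simp: mask_def dual_def)

lemma mask_mor_id: "mor P e G H f \<Longrightarrow> dom G \<subseteq> S \<Longrightarrow> dom H \<subseteq> T \<Longrightarrow> mask S T f = f"
  unfolding mor_def mask_def by (intro ext) (auto, blast+)

text \<open>If no composite path from S to U runs through a generator outside T, then deleting those
  generators changes no coefficient. Being an equality and not a homotopy, this transfers the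
  relations of a complex to its quotient at the same radius.\<close>

lemma gcomp_mask:
  assumes "\<And>x y z. x \<in> S \<Longrightarrow> z \<in> U \<Longrightarrow> y \<notin> T \<Longrightarrow> (\<forall>\<rho>. f x y \<rho> = 0) \<or> (\<forall>\<sigma>. g y z \<sigma> = 0)"
  shows "mask T U g \<odot> mask S T f = mask S U (g \<odot> f)"
proof (intro ext)
  fix x z \<tau>
  show "(mask T U g \<odot> mask S T f) x z \<tau> = mask S U (g \<odot> f) x z \<tau>"
  proof (cases "x \<in> S \<and> z \<in> U")
    case True
    have "{(y, \<rho>, \<sigma>). mask S T f x y \<rho> \<noteq> 0 \<and> mask T U g y z \<sigma> \<noteq> 0 \<and> pjoin \<rho> \<sigma> = \<tau>} =
      {(y, \<rho>, \<sigma>). f x y \<rho> \<noteq> 0 \<and> g y z \<sigma> \<noteq> 0 \<and> pjoin \<rho> \<sigma> = \<tau>}"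
      using True assms[of x z] by (auto simp: mask_def)
    moreover have "(\<Sum>(y, \<rho>, \<sigma>)\<in>{(y, \<rho>, \<sigma>). f x y \<rho> \<noteq> 0 \<and> g y z \<sigma> \<noteq> 0 \<and> pjoin \<rho> \<sigma> = \<tau>}.
         mask T U g y z \<sigma> * mask S T f x y \<rho>) =
       (\<Sum>(y, \<rho>, \<sigma>)\<in>{(y, \<rho>, \<sigma>). f x y \<rho> \<noteq> 0 \<and> g y z \<sigma> \<noteq> 0 \<and> pjoin \<rho> \<sigma> = \<tau>}. g y z \<sigma> * f x y \<rho>)"
      using True assms[of x z] by (intro sum.cong) (auto simp: mask_def, blast+)
    ultimately show ?thesis using True by (simp add: gcomp_def mask_def)
  next
    case False
    have "(mask T U g \<odot> mask S T f) x z \<tau> = 0"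
    proof (rule ccontr)
      assume "(mask T U g \<odot> mask S T f) x z \<tau> \<noteq> 0"
      then obtain y \<rho> \<sigma> where "mask S T f x y \<rho> \<noteq> 0" "mask T U g y z \<sigma> \<noteq> 0" by (rule gcomp_nz)
      then show False using False by (auto simp: mask_def split: if_splits)
    qed
    then show ?thesis using False by (auto simp: mask_def[of S U])
  qed
qed

text \<open>The identity of a submodule acts as the projection onto it; the constant paths that it
  inserts are removed by reparametrization, hence within the radius of \<open>g\<close>.\<close>

lemma gcomp_gid_right:
  fixes g :: "('g, 'h, 'm::topological_space, 'r::involution_ring) gmor"
  assumes g: "mor P e G H g" and G': "G' \<subseteq>\<^sub>m G" "finite (dom G')"
  shows "sim P e (g \<odot> gid G') (mask (dom G') UNIV g)"
  unfolding sim_iff_nul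
proof (intro allI)
  fix x z
  obtain X Y R where Q: "finite X" "finite Y" "finite R" "\<And>x y \<rho>. g x y \<rho> \<noteq> 0 \<Longrightarrow> x \<in> X \<and> y \<in> Y \<and> \<rho> \<in> R"
    using fs_supports[OF mor_fs[OF g]] by blast
  show "(g \<odot> gid G') x z - mask (dom G') UNIV g x z \<in> nul P e UNIV"
  proof (cases "G' x")
    case None
    have "(g \<odot> gid G') x z = 0"
    proof
      fix \<tau>
      have "\<And>y \<rho>. gid G' x y \<rho> = (0::'r)" using None by (simp add: gid_def)
      then show "(g \<odot> gid G') x z \<tau> = 0 \<tau>" using gcomp_nz[of g "gid G'" x z \<tau>] by fastforce
    qed
    moreover have "mask (dom G') UNIV g x z = 0"
      using None by (auto simp: fun_eq_iff mask_def)
    ultimately show ?thesis by (simp only: diff_self nul_zero)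
  next
    case (Some u)
    have m: "mask (dom G') UNIV g x z = g x z" using Some by (auto simp: mask_def fun_eq_iff)
    have g1: "gid G' x y \<rho> = (if y = x \<and> \<rho> = pconst u then 1 else 0)" for y \<rho>
      using Some by (auto simp: gid_def)
    have "(g \<odot> gid G') x z = (\<Sum>y\<in>{x}. \<Sum>\<rho>\<in>{pconst u}. \<Sum>\<sigma>\<in>R. dl (g y z \<sigma> * gid G' x y \<rho>) (pjoin \<rho> \<sigma>))"
      by (rule gcomp_expand) (use Q(3,4) in \<open>auto simp: g1 split: if_splits\<close>)
    also have "\<dots> = (\<Sum>\<sigma>\<in>R. dl (g x z \<sigma>) (pjoin (pconst u) \<sigma>))" by (simp add: g1)
    also have "\<dots> = pushf (pjoin (pconst u)) (\<lambda>a. a) (g x z)"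
      by (rule pushf_eq[symmetric]) (use Q in auto)
    finally have eq: "(g \<odot> gid G') x z = pushf (pjoin (pconst u)) (\<lambda>a. a) (g x z)" .
    show ?thesis unfolding eq m
    proof (rule nul_reparam)
      show "finite {\<rho>. g x z \<rho> \<noteq> 0}" using g by (simp add: fs_pair mor_fs)
      fix \<rho> assume "g x z \<rho> \<noteq> 0"
      note r = morD[OF g this]
      have "G x = Some u" using Some G'(1) by (auto simp: map_le_def dom_def)
      then show "hrel P e (pjoin (pconst u) \<rho>) \<rho>" using r hrel_pconst_left[OF r(1)] by simp
    qed
  qed
qed

lemma gcomp_gid_left:
  fixes g :: "('g, 'h, 'm::topological_space, 'r::involution_ring) gmor"
  assumes g: "mor P e G H g" and H': "H' \<subseteq>\<^sub>m H" "finite (dom H')"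
  shows "sim P e (gid H' \<odot> g) (mask UNIV (dom H') g)"
  unfolding sim_iff_nul
proof (intro allI)
  fix x z
  obtain X Y R where Q: "finite X" "finite Y" "finite R" "\<And>x y \<rho>. g x y \<rho> \<noteq> 0 \<Longrightarrow> x \<in> X \<and> y \<in> Y \<and> \<rho> \<in> R"
    using fs_supports[OF mor_fs[OF g]] by blast
  show "(gid H' \<odot> g) x z - mask UNIV (dom H') g x z \<in> nul P e UNIV"
  proof (cases "H' z")
    case None
    have "(gid H' \<odot> g) x z = 0"
    proof
      fix \<tau>
      have "\<And>y \<rho>. gid H' y z \<rho> = (0::'r)" using None by (auto simp: gid_def)
      then show "(gid H' \<odot> g) x z \<tau> = 0 \<tau>" using gcomp_nz[of "gid H'" g x z \<tau>] by fastforce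
    qed
    moreover have "mask UNIV (dom H') g x z = 0"
      using None by (auto simp: fun_eq_iff mask_def)
    ultimately show ?thesis by (simp only: diff_self nul_zero)
  next
    case (Some u)
    have m: "mask UNIV (dom H') g x z = g x z" using Some by (auto simp: mask_def fun_eq_iff)
    have g1: "gid H' y z \<rho> = (if y = z \<and> \<rho> = pconst u then 1 else 0)" for y \<rho>
      using Some by (auto simp: gid_def)
    \<comment> \<open>The index z is added because no path of \<open>g\<close> need end there; the
      sum over y can then be evaluated at z in every case.\<close>
    have "(gid H' \<odot> g) x z = (\<Sum>y\<in>insert z Y. \<Sum>\<rho>\<in>R. \<Sum>\<sigma>\<in>{pconst u}. dl (gid H' y z \<sigma> * g x y \<rho>) (pjoin \<rho> \<sigma>))"
      by (rule gcomp_expand) (use Q(2,3,4) in \<open>auto simp: g1 split: if_splits\<close>)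
    also have "\<dots> = (\<Sum>y\<in>insert z Y. if y = z then \<Sum>\<rho>\<in>R. dl (g x z \<rho>) (pjoin \<rho> (pconst u)) else 0)"
      by (rule sum.cong[OF refl]) (simp add: g1)
    also have "\<dots> = (\<Sum>\<rho>\<in>R. dl (g x z \<rho>) (pjoin \<rho> (pconst u)))" using Q by (simp add: sum.delta)
    also have "\<dots> = pushf (\<lambda>\<rho>. pjoin \<rho> (pconst u)) (\<lambda>a. a) (g x z)"
      by (rule pushf_eq[symmetric]) (use Q in auto)
    finally have eq: "(gid H' \<odot> g) x z = pushf (\<lambda>\<rho>. pjoin \<rho> (pconst u)) (\<lambda>a. a) (g x z)" .
    show ?thesis unfolding eq m
    proof (rule nul_reparam)
      show "finite {\<rho>. g x z \<rho> \<noteq> 0}" using g by (simp add: fs_pair mor_fs)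
      fix \<rho> assume "g x z \<rho> \<noteq> 0"
      note r = morD[OF g this]
      have "H z = Some u" using Some H'(1) by (auto simp: map_le_def dom_def)
      then show "hrel P e (pjoin \<rho> (pconst u)) \<rho>" using r hrel_pconst_right[OF r(1)] by simp
    qed
  qed
qed

text \<open>Paths start at the positions of generators, so restriction over W is a choice of source
  generators and the calculus of masks applies to it.\<close>

lemma mrestrict_mor:
  "mor P e G H f \<Longrightarrow> mrestrict P W f = mask {x. \<exists>u. G x = Some u \<and> cmap P u \<in> W} UNIV f"
  by (intro ext) (auto simp: mrestrict_def mask_def dest: morD(2))

lemma mask_UNIV [simp]: "mask UNIV UNIV f = f"
  by (simp add: mask_def)

lemma gcomp_mask_left: "g \<odot> mask S UNIV f = mask S UNIV (g \<odot> f)"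
  using gcomp_mask[of S UNIV UNIV f g] by simp

lemma mask_gid: "G' \<subseteq>\<^sub>m G \<Longrightarrow> M \<subseteq> dom G' \<Longrightarrow> mask M (dom G') (gid G) = mask M UNIV (gid G')"
proof (intro ext)
  fix x y \<rho>
  assume a: "G' \<subseteq>\<^sub>m G" "M \<subseteq> dom G'"
  then have "G x = G' x" if "x \<in> M" using that by (auto simp: map_le_def subset_iff)
  then show "mask M (dom G') (gid G) x y \<rho> = mask M UNIV (gid G') x y \<rho>"
    using a(2) by (auto simp: mask_def gid_def)
qed

section \<open>Blocks and columns under radius, homotopy and restriction\<close>

section \<open>Matrices\<close>

lemma block_simps [simp]:
  "block a b c d (Inl i) (Inl j) = a i j" "block a b c d (Inr i') (Inl j) = b i' j"
  "block a b c d (Inl i) (Inr j') = c i j'" "block a b c d (Inr i') (Inr j') = d i' j'"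
  by (simp_all add: block_def)

lemma col_simps [simp]: "col u v x (Inl j) = u x j" "col u v x (Inr j') = v x j'"
  by (simp_all add: col_def)

lemma msum_simps [simp]: "msum G H (Inl i) = G i" "msum G H (Inr j) = H j"
  by (simp_all add: msum_def)

lemma dom_msum: "dom (msum G H) = Inl ` dom G \<union> Inr ` dom H"
proof (rule subset_antisym)
  show "dom (msum G H) \<subseteq> Inl ` dom G \<union> Inr ` dom H"
  proof
    fix x assume "x \<in> dom (msum G H)"
    then show "x \<in> Inl ` dom G \<union> Inr ` dom H" by (cases x) auto
  qed
qed auto

lemma msum_le: "G \<subseteq>\<^sub>m G' \<Longrightarrow> H \<subseteq>\<^sub>m H' \<Longrightarrow> msum G H \<subseteq>\<^sub>m msum G' H'"
  unfolding map_le_def dom_msum by (auto simp del: dom_def) (metis domI)+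

lemma sum_mor_ext:
  fixes f g :: "('a + 'b, 'c + 'd, 'm, 'r) gmor"
  assumes "\<And>i j. f (Inl i) (Inl j) = g (Inl i) (Inl j)" "\<And>i j. f (Inl i) (Inr j) = g (Inl i) (Inr j)"
    "\<And>i j. f (Inr i) (Inl j) = g (Inr i) (Inl j)" "\<And>i j. f (Inr i) (Inr j) = g (Inr i) (Inr j)"
  shows "f = g"
proof (intro ext)
  fix x y z show "f x y z = g x y z" using assms by (cases x; cases y) auto
qed

lemma fs_block:
  assumes "fs a" "fs b" "fs c" "fs d"
  shows "fs (block a b c d)"
proof (rule fs_imageI[of "(\<lambda>(x, y, \<rho>). (Inl x, Inl y, \<rho>)) ` {(x, y, \<rho>). a x y \<rho> \<noteq> 0} \<union>
    (\<lambda>(x, y, \<rho>). (Inr x, Inl y, \<rho>)) ` {(x, y, \<rho>). b x y \<rho> \<noteq> 0} \<union>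
    (\<lambda>(x, y, \<rho>). (Inl x, Inr y, \<rho>)) ` {(x, y, \<rho>). c x y \<rho> \<noteq> 0} \<union>
    (\<lambda>(x, y, \<rho>). (Inr x, Inr y, \<rho>)) ` {(x, y, \<rho>). d x y \<rho> \<noteq> 0}"], goal_cases)
  case 1
  then show ?case using assms by (simp add: fs_def)
next
  case (2 x y \<rho>)
  then show ?case by (cases x; cases y) (force simp: image_iff)+
qed

lemma fs_col:
  assumes "fs a" "fs b"
  shows "fs (col a b)"
proof (rule fs_imageI[of "(\<lambda>(x, y, \<rho>). (x, Inl y, \<rho>)) ` {(x, y, \<rho>). a x y \<rho> \<noteq> 0} \<union>
    (\<lambda>(x, y, \<rho>). (x, Inr y, \<rho>)) ` {(x, y, \<rho>). b x y \<rho> \<noteq> 0}"], goal_cases)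
  case 1
  then show ?case using assms by (simp add: fs_def)
next
  case (2 x y \<rho>)
  then show ?case by (cases y) (force simp: image_iff)+
qed

lemma mor_block:
  assumes "mor P e G H a" "mor P e G' H b" "mor P e G H' c" "mor P e G' H' d"
  shows "mor P e (msum G G') (msum H H') (block a b c d)"
  unfolding mor_def
proof (intro conjI allI impI)
  show "fs (block a b c d)" using assms by (intro fs_block) (auto simp: mor_fs)
  fix x y \<rho> assume nz: "block a b c d x y \<rho> \<noteq> 0"
  have "mpath P e \<rho> \<and> msum G G' x = Some (pathstart \<rho>) \<and> msum H H' y = Some (pathfinish \<rho>)"
    using nz assms unfolding mor_def by (cases x; cases y) auto
  then show "mpath P e \<rho>" "msum G G' x = Some (pathstart \<rho>)" "msum H H' y = Some (pathfinish \<rho>)" by auto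
qed

lemma mor_col:
  assumes "mor P e G H a" "mor P e G H' b"
  shows "mor P e G (msum H H') (col a b)"
  unfolding mor_def
proof (intro conjI allI impI)
  show "fs (col a b)" using assms by (intro fs_col) (auto simp: mor_fs)
  fix x y \<rho> assume nz: "col a b x y \<rho> \<noteq> 0"
  have "mpath P e \<rho> \<and> G x = Some (pathstart \<rho>) \<and> msum H H' y = Some (pathfinish \<rho>)"
    using nz assms unfolding mor_def by (cases y) auto
  then show "mpath P e \<rho>" "G x = Some (pathstart \<rho>)" "msum H H' y = Some (pathfinish \<rho>)" by auto
qed

lemma sim_block:
  assumes "sim P e a a'" "sim P e b b'" "sim P e c c'" "sim P e d d'"
  shows "sim P e (block a b c d) (block a' b' c' d')"
  unfolding sim_iff_nul
proof (intro allI)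
  fix x y
  show "block a b c d x y - block a' b' c' d' x y \<in> nul P e UNIV"
    using assms by (cases x; cases y) (simp_all add: sim_iff_nul)
qed

lemma sim_col:
  assumes "sim P e a a'" "sim P e b b'"
  shows "sim P e (col a b) (col a' b')"
  unfolding sim_iff_nul
proof (intro allI)
  fix x y
  show "col a b x y - col a' b' x y \<in> nul P e UNIV"
    using assms by (cases y) (simp_all add: sim_iff_nul)
qed

lemma mask_block: "mask (Inl ` S \<union> Inr ` S') (Inl ` T \<union> Inr ` T') (block a b c d) =
    block (mask S T a) (mask S' T b) (mask S T' c) (mask S' T' d)"
  by (rule sum_mor_ext) (auto simp: mask_def fun_eq_iff)

lemma mask_col: "mask S (Inl ` T \<union> Inr ` T') (col a b) = col (mask S T a) (mask S T' b)"
proof (intro ext)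
  fix x y \<rho>
  show "mask S (Inl ` T \<union> Inr ` T') (col a b) x y \<rho> = col (mask S T a) (mask S T' b) x y \<rho>"
    by (cases y) (auto simp: mask_def)
qed

section \<open>When paths and homotopies descend to the part of the domain over A\<close>

section \<open>Restriction of the control space\<close>

text \<open>Paths and homotopies of radius \<open>e\<close> with an end point over \<open>V\<close> lie over \<open>A\<close>.\<close>

definition safe :: "('m::topological_space, 'x::metric_space) control \<Rightarrow> 'x set \<Rightarrow> real \<Rightarrow> 'x set \<Rightarrow> bool" where
  "safe P A e V \<longleftrightarrow> (\<forall>K u. connected K \<and> K \<subseteq> cdom P \<and> u \<in> K \<and> cmap P u \<in> V \<and>
     cmap P ` K \<subseteq> cball (cmap P u) e \<longrightarrow> cmap P ` K \<subseteq> A)"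

lemma restr_simps [simp]:
  "cdom (restr P A) = cdom P \<inter> cmap P -` A" "cbase (restr P A) = A" "cmap (restr P A) = cmap P"
  by (simp_all add: restr_def)

lemma mrestrict_restr [simp]: "mrestrict (restr P A) = mrestrict P"
  by (intro ext) (simp add: mrestrict_def)

lemma safe_mono: "safe P A e V \<Longrightarrow> d \<le> e \<Longrightarrow> V' \<subseteq> V \<Longrightarrow> A \<subseteq> A' \<Longrightarrow> safe P A' d V'"
  unfolding safe_def by (meson order_trans subsetD subset_cball)

lemma hrel_refl: "mpath P e \<rho> \<Longrightarrow> hrel P e \<rho> \<rho>"
  using mpath_hset[of P e \<rho>] by (auto simp: hrel_def mpath_def)

text \<open>The image of the square under a homotopy is connected, contains both end points and lies
  within e of each of them, so \<open>safe\<close> applies to it from whichever end point is over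
  V.\<close>

lemma hrel_restr:
  assumes h: "hrel P e \<rho> \<rho>'" and safe: "safe P A e V"
    and V: "cmap P (pathstart \<rho>) \<in> V \<or> cmap P (pathfinish \<rho>) \<in> V"
  shows "hrel (restr P A) e \<rho> \<rho>'"
proof -
  let ?S = "hset P e (pathstart \<rho>) (pathfinish \<rho>)"
  obtain h where h0: "continuous_on ({0..1} \<times> {0..1}) h" "h \<in> ({0..1} \<times> {0..1}) \<rightarrow> ?S"
      "\<forall>x\<in>{0..1}. h (0, x) = \<rho> x" "\<forall>x\<in>{0..1}. h (1, x) = \<rho>' x"
      "\<forall>t\<in>{0..1::real}. pathstart (h \<circ> Pair t) = pathstart \<rho> \<and> pathfinish (h \<circ> Pair t) = pathfinish \<rho>"
    using h unfolding hrel_def homotopic_paths by blast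
  let ?K = "h ` ({0..1} \<times> {0..1})"
  have cK: "connected ?K"
    by (intro connected_continuous_image h0 connected_Times) auto
  have K: "?K \<subseteq> ?S" using h0(2) by auto
  have ends: "pathstart \<rho> \<in> ?K" "pathfinish \<rho> \<in> ?K"
    using h0(3) imageI[of "(0, 0)" "{0..1} \<times> {0..1}" h] imageI[of "(0, 1)" "{0..1} \<times> {0..1}" h]
    by (simp_all add: pathstart_def pathfinish_def)
  have dom: "?K \<subseteq> cdom P" and balls: "cmap P ` ?K \<subseteq> cball (cmap P (pathstart \<rho>)) e"
      "cmap P ` ?K \<subseteq> cball (cmap P (pathfinish \<rho>)) e"
    using K unfolding hset_def by blast+
  have "cmap P ` ?K \<subseteq> A" using V
  proof
    assume "cmap P (pathstart \<rho>) \<in> V"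
    then show ?thesis using safe cK dom ends(1) balls(1) unfolding safe_def by blast
  next
    assume "cmap P (pathfinish \<rho>) \<in> V"
    then show ?thesis using safe cK dom ends(2) balls(2) unfolding safe_def by blast
  qed
  then have "h \<in> ({0..1} \<times> {0..1}) \<rightarrow> hset (restr P A) e (pathstart \<rho>) (pathfinish \<rho>)"
    using K by (auto simp: hset_def)
  then have hp: "homotopic_paths (hset (restr P A) e (pathstart \<rho>) (pathfinish \<rho>)) \<rho> \<rho>'"
    unfolding homotopic_paths using h0 by blast
  show ?thesis
    using h hp homotopic_paths_imp_subset[OF hp] by (auto simp: hrel_def gpaths_def hset_def)
qed

lemma mpath_restr:
  "mpath P e \<rho> \<Longrightarrow> safe P A e V \<Longrightarrow> cmap P (pathstart \<rho>) \<in> V \<or> cmap P (pathfinish \<rho>) \<in> V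
    \<Longrightarrow> mpath (restr P A) e \<rho>"
  by (meson hrel_imp_mpath hrel_refl hrel_restr)

lemma mor_restr:
  assumes "mor P e G H f" "safe P A e V"
    "\<And>x y \<rho>. f x y \<rho> \<noteq> 0 \<Longrightarrow> cmap P (pathstart \<rho>) \<in> V \<or> cmap P (pathfinish \<rho>) \<in> V"
  shows "mor (restr P A) e G H f"
  using assms mpath_restr unfolding mor_def by blast

text \<open>The homotopies witnessing the relation over P need not lie over A. Since all paths of
  \<open>f\<close> and \<open>g\<close> touch V, those that do not touch V can be filtered out, and
  the remaining ones lie over A.\<close>

lemma sim_restr:
  assumes "sim P e f g" "safe P A e V"
    "\<And>x y \<rho>. f x y \<rho> \<noteq> 0 \<Longrightarrow> cmap P (pathstart \<rho>) \<in> V \<or> cmap P (pathfinish \<rho>) \<in> V"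
    "\<And>x y \<rho>. g x y \<rho> \<noteq> 0 \<Longrightarrow> cmap P (pathstart \<rho>) \<in> V \<or> cmap P (pathfinish \<rho>) \<in> V"
  shows "sim (restr P A) e f g"
  unfolding sim_iff_nul
proof (intro allI)
  fix x y
  let ?K = "{(u, v). cmap P u \<in> V \<or> cmap P v \<in> V}"
  have "f x y - g x y \<in> nul P e UNIV" using assms(1) by (simp add: sim_iff_nul)
  then have "f x y - g x y \<in> nul P e ?K"
  proof (rule nul_restrict)
    fix \<tau> assume "(f x y - g x y) \<tau> \<noteq> 0"
    then have "f x y \<tau> \<noteq> 0 \<or> g x y \<tau> \<noteq> 0" by auto
    then have "cmap P (pathstart \<tau>) \<in> V \<or> cmap P (pathfinish \<tau>) \<in> V" using assms(3,4) by blast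
    then show "(pathstart \<tau>, pathfinish \<tau>) \<in> ?K" by simp
  qed
  then show "f x y - g x y \<in> nul (restr P A) e UNIV"
    by (rule nul_mono) (use hrel_restr[OF _ assms(2)] in auto)
qed

section \<open>Restricting contractions and connectedness to a quotient\<close>

section \<open>Locality\<close>

text \<open>\<open>F\<close> is a duality cone and \<open>E\<close> the cone of a quotient. A
  contraction of \<open>F\<close> is cut down to \<open>E\<close>; over W' nothing is lost, because
  by \<open>near\<close> a path of radius 4e from there ends at a generator kept in
  \<open>E\<close>. The region V is a buffer: the cut contraction starts over V and hence lives over
  A, while the relation is claimed only over W', from which one step stays within V. The radius c of
  the differentials will be e for a complex and 2e for a pair.\<close>

lemma contractible_local:
  fixes E F :: "('g, 'm::topological_space, 'r::involution_ring) cplx" and P :: "('m, 'x::metric_space) control"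
  assumes cF: "contractible_over P (4 * e) W F"
    and finF: "\<And>r. finite (dom (mods F r))"
    and F: "\<And>r. mor P c (mods F r) (mods F (r - 1)) (diff F r)"
    and EF: "\<And>r. mods E r \<subseteq>\<^sub>m mods F r"
    and gE: "\<And>r. gmodule P (mods E r)"
    and E: "\<And>r. mor P c (mods E r) (mods E (r - 1)) (diff E r)"
    and dEF: "\<And>r. sim P c (diff E r) (mask (dom (mods E r)) (dom (mods E (r - 1))) (diff F r))"
    and c: "c \<le> 4 * e" "0 \<le> e"
    and W: "W' \<subseteq> W" "W' \<subseteq> V" and safe: "safe P A (8 * e) V"
    and near: "\<And>r s x y \<rho>. mods E r x = Some (pathstart \<rho>) \<Longrightarrow> cmap P (pathstart \<rho>) \<in> W' \<Longrightarrow>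
       mpath P (4 * e) \<rho> \<Longrightarrow> mods F s y = Some (pathfinish \<rho>) \<Longrightarrow>
       y \<in> dom (mods E s) \<and> cmap P (pathfinish \<rho>) \<in> V"
  shows "contractible_over (restr P A) (4 * e) W' E"
proof -
  obtain \<Gamma> where \<Gamma>0: "\<And>r. emorphism P (4 * e) (mods F r) (mods F (r + 1)) (\<Gamma> r)"
    and \<Gamma>1: "\<And>r. sim P (2 * (4 * e)) (mrestrict P W (diff F (r + 1) \<odot> \<Gamma> r + \<Gamma> (r - 1) \<odot> diff F r))
       (mrestrict P W (gid (mods F r)))"
    using cF unfolding contractible_over_def by blast
  have \<Gamma>: "mor P (4 * e) (mods F r) (mods F (r + 1)) (\<Gamma> r)" for r
    using \<Gamma>0 finF by (rule emorphism_imp_mor)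
  have EFd: "dom (mods E r) \<subseteq> dom (mods F r)" for r using EF map_le_implies_dom_le by blast
  have EFs: "mods E r x = Some u \<Longrightarrow> mods F r x = Some u" for r x u
    using EF[of r] by (auto simp: map_le_def dom_def)
  have EFi: "mods F r x = Some u \<Longrightarrow> x \<in> dom (mods E r) \<Longrightarrow> mods E r x = Some u" for r x u
    using EF[of r] by (auto simp: map_le_def)
  have finE: "finite (dom (mods E r))" for r using EFd finF finite_subset by blast
  \<comment> \<open>Sources of the contraction are cut to V, so that its paths lie over A, and its
    targets to \<open>E\<close>. The set \<open>M r\<close> consists of the generators on which the
    relation has to hold.\<close>
  define S where "S r = {x. \<exists>u. mods E r x = Some u \<and> cmap P u \<in> V}" for r
  define G where "G r = mask (S r) (dom (mods E (r + 1))) (\<Gamma> r)" for r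
  define M where "M r = {x. \<exists>u. mods E r x = Some u \<and> cmap P u \<in> W'}" for r
  have SE: "S r \<subseteq> dom (mods E r)" "M r \<subseteq> S r" for r using W by (auto simp: S_def M_def)
  have "G r = mask (S r) UNIV (mask (dom (mods E r)) (dom (mods E (r + 1))) (\<Gamma> r))" for r
    using SE(1)[of r] by (simp add: G_def Int_absorb2)
  then have G: "mor P (4 * e) (mods E r) (mods E (r + 1)) (G r)" for r
    using mor_mask_same mor_mask_le \<Gamma> EF by metis
  have Gend: "cmap P (pathstart \<rho>) \<in> V" if "G r x y \<rho> \<noteq> 0" for r x y \<rho>
    using that morD(2)[OF G that] by (auto simp: G_def mask_def S_def split: if_splits)
  have "mor (restr P A) (4 * e) (mods E r) (mods E (r + 1)) (G r)" for r
    by (rule mor_restr[OF G safe_mono[OF safe _ subset_refl subset_refl]]) (use c Gend in auto)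
  moreover have "sim (restr P A) (2 * (4 * e)) (mrestrict P W' (diff E (r + 1) \<odot> G r + G (r - 1) \<odot> diff E r))
       (mrestrict P W' (gid (mods E r)))" for r
  proof (rule sim_restr)
    show "safe P A (2 * (4 * e)) V" using safe by simp
    have sup: "cmap P (pathstart \<rho>) \<in> V \<or> cmap P (pathfinish \<rho>) \<in> V" if "mrestrict P W' f x y \<rho> \<noteq> 0"
      for f :: "('g, 'g, 'm, 'r) gmor" and x y \<rho>
      using that W by (auto simp: mrestrict_def split: if_splits)
    have E1: "mor P c (mods E (r + 1)) (mods E r) (diff E (r + 1))" using E[of "r + 1"] by simp
    have F1: "mor P c (mods F (r + 1)) (mods F r) (diff F (r + 1))" using F[of "r + 1"] by simp
    have G1: "mor P (4 * e) (mods E (r - 1)) (mods E r) (G (r - 1))" using G[of "r - 1"] by simp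
    have \<Gamma>': "mor P (4 * e) (mods F (r - 1)) (mods F r) (\<Gamma> (r - 1))" using \<Gamma>[of "r - 1"] by simp
    let ?L = "diff E (r + 1) \<odot> G r + G (r - 1) \<odot> diff E r"
    let ?R = "diff F (r + 1) \<odot> \<Gamma> r + \<Gamma> (r - 1) \<odot> diff F r"
    let ?D = "dom (mods E r)"
    let ?idF = "gid (mods F r) :: ('g, 'g, 'm, 'r) gmor"
    let ?idE = "gid (mods E r) :: ('g, 'g, 'm, 'r) gmor"
    have mL: "mor P (c + 4 * e) (mods E r) (mods E r) ?L"
      by (intro mor_add mor_gcomp[OF G E1] mor_gcomp[OF E G1]) auto
    have mR: "mor P (c + 4 * e) (mods F r) (mods F r) ?R"
      by (intro mor_add mor_gcomp[OF \<Gamma> F1] mor_gcomp[OF F \<Gamma>']) auto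
    have eqM: "mrestrict P W' f = mask (M r) UNIV f" if "mor P k (mods E r) H f"
      for f :: "('g, 'g, 'm, 'r) gmor" and k H
      using mrestrict_mor[OF that] by (simp add: M_def)
    have eqF: "mask (M r) ?D (mrestrict P W f) = mask (M r) ?D f" if "mor P k (mods F r) H f"
      for f :: "('g, 'g, 'm, 'r) gmor" and k H
    proof -
      have "M r \<subseteq> {x. \<exists>u. mods F r x = Some u \<and> cmap P u \<in> W}" using W EFs by (auto simp: M_def)
      then show ?thesis using mrestrict_mor[OF that] by (simp add: Int_absorb2)
    qed
    \<comment> \<open>No path of the contraction from \<open>M r\<close> ends at a discarded
      generator, so cutting its targets does not affect the first summand of the homotopy
      formula.\<close>
    have n1: "\<Gamma> r x y \<rho> = 0" if "x \<in> M r" "y \<notin> dom (mods E (r + 1))" for x y \<rho>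
      using that near[of r x \<rho> "r + 1" y] morD[OF \<Gamma>, of r x y \<rho>] EFs by (fastforce simp: M_def)
    have n2: "diff F r x y \<rho> = 0" if "x \<in> M r" "y \<notin> S (r - 1)" for x y \<rho>
    proof (rule ccontr)
      assume nz: "diff F r x y \<rho> \<noteq> 0"
      note m = morD[OF F nz]
      have "y \<in> dom (mods E (r - 1)) \<and> cmap P (pathfinish \<rho>) \<in> V"
        by (rule near[OF _ _ mpath_mono[OF m(1) c(1)] m(3)]) (use that m EFs in \<open>fastforce simp: M_def\<close>)+
      then have "y \<in> S (r - 1)" using EFi[OF m(3)] by (auto simp: S_def)
      then show False using that by simp
    qed
    have "sim P (2 * (4 * e)) (diff E (r + 1) \<odot> mask (M r) UNIV (G r))
       (mask (dom (mods E (r + 1))) ?D (diff F (r + 1)) \<odot> mask (M r) UNIV (G r))"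
      by (rule sim_gcomp_left[OF _ E1 mor_mask_le[OF F1 EF EF] mor_mask_same[OF G]])
        (use dEF[of "r + 1"] c in auto)
    also have "mask (M r) UNIV (G r) = mask (M r) (dom (mods E (r + 1))) (\<Gamma> r)"
      using SE[of r] by (simp add: G_def Int_absorb2)
    also have "mask (dom (mods E (r + 1))) ?D (diff F (r + 1)) \<odot> mask (M r) (dom (mods E (r + 1))) (\<Gamma> r) =
       mask (M r) ?D (diff F (r + 1) \<odot> \<Gamma> r)"
      by (rule gcomp_mask) (use n1 in auto)
    finally have s1: "sim P (2 * (4 * e)) (mask (M r) UNIV (diff E (r + 1) \<odot> G r))
        (mask (M r) ?D (diff F (r + 1) \<odot> \<Gamma> r))"
      using SE[of r] by (simp add: gcomp_mask_left[symmetric] G_def Int_absorb2)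
    \<comment> \<open>From \<open>M r\<close> the differential lands over V, so cutting the sources
      of \<open>\<Gamma> (r - 1)\<close> to V does not affect the second summand.\<close>
    have m2: "mask (M r) UNIV (mask ?D (dom (mods E (r - 1))) (diff F r)) = mask (M r) (S (r - 1)) (diff F r)"
      using SE n2 by (intro ext) (auto simp: mask_def, blast+)
    have "sim P (2 * (4 * e)) (G (r - 1) \<odot> mask (M r) UNIV (diff E r))
       (G (r - 1) \<odot> mask (M r) UNIV (mask ?D (dom (mods E (r - 1))) (diff F r)))"
      by (rule sim_gcomp_right[OF sim_mask[OF dEF] mor_mask_same[OF E] mor_mask_same[OF mor_mask_le[OF F EF EF]] G1])
        (use c in auto)
    also have "G (r - 1) \<odot> mask (M r) UNIV (mask ?D (dom (mods E (r - 1))) (diff F r)) =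
       mask (M r) ?D (\<Gamma> (r - 1) \<odot> diff F r)"
      unfolding m2 by (simp add: G_def, rule gcomp_mask) (use n2 in auto)
    finally have s2: "sim P (2 * (4 * e)) (mask (M r) UNIV (G (r - 1) \<odot> diff E r))
       (mask (M r) ?D (\<Gamma> (r - 1) \<odot> diff F r))"
      by (simp add: gcomp_mask_left)
    have mg: "mor P 0 (mods E r) (mods E r) (gid (mods E r) :: ('g, 'g, 'm, 'r) gmor)"
      by (rule mor_gid) (use finE gE in auto)
    have "sim P (2 * (4 * e)) (mask (M r) UNIV ?L) (mask (M r) ?D ?R)"
      using sim_add[OF s1 s2] by simp
    also have "mask (M r) ?D ?R = mask (M r) ?D (mrestrict P W ?R)" using eqF[OF mR] by simp
    also have "sim P (2 * (4 * e)) (mask (M r) ?D (mrestrict P W ?R)) (mask (M r) ?D (mrestrict P W ?idF))"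
      by (rule sim_mask[OF \<Gamma>1])
    also have "mask (M r) ?D (mrestrict P W ?idF) = mask (M r) ?D ?idF"
    proof (intro ext)
      fix x y \<rho>
      show "mask (M r) ?D (mrestrict P W ?idF) x y \<rho> = mask (M r) ?D ?idF x y \<rho>"
        using EFs W by (auto simp: mask_def mrestrict_def gid_def M_def)
    qed
    also have "mask (M r) ?D ?idF = mask (M r) UNIV ?idE"
      using SE[of r] by (intro mask_gid EF) auto
    also have "\<dots> = mrestrict P W' ?idE"
      using eqM[OF mg] by simp
    finally show "sim P (2 * (4 * e)) (mrestrict P W' ?L) (mrestrict P W' ?idE)"
      unfolding eqM[OF mL] .
    show "cmap P (pathstart \<rho>) \<in> V \<or> cmap P (pathfinish \<rho>) \<in> V" if "mrestrict P W' ?L x y \<rho> \<noteq> 0" for x y \<rho>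
      using that by (rule sup)
    show "cmap P (pathstart \<rho>) \<in> V \<or> cmap P (pathfinish \<rho>) \<in> V" if "mrestrict P W' ?idE x y \<rho> \<noteq> 0" for x y \<rho>
      using that by (rule sup)
  qed
  ultimately show ?thesis
    unfolding contractible_over_def by (intro exI[of _ G]) (auto intro: mor_imp_emorphism)
qed

text \<open>The same argument between degrees 0 and 1 only, with the relation required on all of
  \<open>E\<close> in degree 0 and not on a smaller region. Hence a path of radius 4e from any
  degree 0 generator of \<open>E\<close> must end in \<open>E\<close>, which forces the thresholds
  in degrees 0 and 1 to differ by 4e.\<close>

lemma connected_local:
  fixes E F :: "('g, 'm::topological_space, 'r::involution_ring) cplx" and P :: "('m, 'x::metric_space) control"
  assumes cF: "connected_cplx P e F"
    and finF: "\<And>r. finite (dom (mods F r))"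
    and F: "mor P c (mods F 1) (mods F 0) (diff F 1)"
    and EF: "\<And>r. mods E r \<subseteq>\<^sub>m mods F r"
    and E: "mor P c (mods E 1) (mods E 0) (diff E 1)"
    and dEF: "sim P c (diff E 1) (mask (dom (mods E 1)) (dom (mods E 0)) (diff F 1))"
    and c: "c \<le> 4 * e" "0 \<le> e"
    and V: "\<And>x u. mods E 0 x = Some u \<Longrightarrow> cmap P u \<in> V" and safe: "safe P A (8 * e) V"
    and near: "\<And>x y \<rho>. mods E 0 x = Some (pathstart \<rho>) \<Longrightarrow>
       mpath P (4 * e) \<rho> \<Longrightarrow> mods F 1 y = Some (pathfinish \<rho>) \<Longrightarrow> y \<in> dom (mods E 1)"
  shows "connected_cplx (restr P A) e E"
proof -
  obtain h where h0: "emorphism P (4 * e) (mods F 0) (mods F 1) h"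
    and h1: "sim P (8 * e) (diff F 1 \<odot> h) (gid (mods F 0))"
    using cF unfolding connected_cplx_def by blast
  have h: "mor P (4 * e) (mods F 0) (mods F 1) h" using h0 finF by (rule emorphism_imp_mor)
  define k where "k = mask (dom (mods E 0)) (dom (mods E 1)) h"
  have k: "mor P (4 * e) (mods E 0) (mods E 1) k" unfolding k_def by (rule mor_mask_le[OF h EF EF])
  have EFs: "mods E r x = Some u \<Longrightarrow> mods F r x = Some u" for r x u
    using EF[of r] by (auto simp: map_le_def dom_def)
  have EFi: "mods F r x = Some u \<Longrightarrow> x \<in> dom (mods E r) \<Longrightarrow> mods E r x = Some u" for r x u
    using EF[of r] by (auto simp: map_le_def)
  have "positive_cplx E" using cF EF unfolding connected_cplx_def positive_cplx_def
    by (metis map_le_empty map_le_antisym)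
  moreover have "mor (restr P A) (4 * e) (mods E 0) (mods E 1) k"
  proof (rule mor_restr[OF k safe_mono[OF safe _ subset_refl subset_refl]])
    show "4 * e \<le> 8 * e" using c by simp
    show "cmap P (pathstart \<rho>) \<in> V \<or> cmap P (pathfinish \<rho>) \<in> V" if "k x y \<rho> \<noteq> 0" for x y \<rho>
      using V[OF morD(2)[OF k that]] by simp
  qed
  moreover have "sim (restr P A) (8 * e) (diff E 1 \<odot> k) (gid (mods E 0))"
  proof -
    let ?idF = "gid (mods F 0) :: ('g, 'g, 'm, 'r) gmor"
    let ?idE = "gid (mods E 0) :: ('g, 'g, 'm, 'r) gmor"
    have mk: "mor P (4 * e + c) (mods E 0) (mods E 0) (diff E 1 \<odot> k)" by (rule mor_gcomp[OF k E order_refl])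
    have n: "h x y \<rho> = 0" if "x \<in> dom (mods E 0)" "y \<notin> dom (mods E 1)" for x y \<rho>
    proof (rule ccontr)
      assume nz: "h x y \<rho> \<noteq> 0"
      note m = morD[OF h nz]
      show False using near[OF EFi[OF m(2) that(1)] m(1,3)] that by simp
    qed
    have "sim P (8 * e) (diff E 1 \<odot> k) (mask (dom (mods E 1)) (dom (mods E 0)) (diff F 1) \<odot> k)"
      by (rule sim_gcomp_left[OF dEF E mor_mask_le[OF F EF EF] k]) (use c in auto)
    also have "mask (dom (mods E 1)) (dom (mods E 0)) (diff F 1) \<odot> k =
        mask (dom (mods E 0)) (dom (mods E 0)) (diff F 1 \<odot> h)"
      unfolding k_def by (rule gcomp_mask) (use n in auto)
    also have "sim P (8 * e) \<dots> (mask (dom (mods E 0)) (dom (mods E 0)) ?idF)"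
      by (rule sim_mask[OF h1])
    also have "mask (dom (mods E 0)) (dom (mods E 0)) ?idF = mask (dom (mods E 0)) UNIV ?idE"
      by (rule mask_gid[OF EF subset_refl])
    also have "\<dots> = ?idE"
    proof (intro ext)
      fix x y \<rho>
      show "mask (dom (mods E 0)) UNIV ?idE x y \<rho> = ?idE x y \<rho>"
        by (cases "mods E 0 x") (simp_all add: mask_def gid_def domIff)
    qed
    finally have s1: "sim P (8 * e) (diff E 1 \<odot> k) ?idE" .
    have v1: "cmap P (pathstart \<rho>) \<in> V \<or> cmap P (pathfinish \<rho>) \<in> V" if "(diff E 1 \<odot> k) x y \<rho> \<noteq> 0" for x y \<rho>
    proof -
      have m: "mods E 0 x = Some (pathstart \<rho>)" using mk that unfolding mor_def by simp
      show ?thesis using V[OF m] by simp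
    qed
    have v2: "cmap P (pathstart \<rho>) \<in> V \<or> cmap P (pathfinish \<rho>) \<in> V" if "?idE x y \<rho> \<noteq> 0" for x y \<rho>
      using V that by (auto simp: gid_def split: if_splits)
    show ?thesis by (rule sim_restr[OF s1 safe]) (fact v1, fact v2)
  qed
  ultimately show ?thesis
    unfolding connected_cplx_def by (auto intro: mor_imp_emorphism)
qed

section \<open>The separation argument at the intersection N\<close>

section \<open>Points far from the intersection\<close>

text \<open>The complement of B and of the k-neighbourhood of N, see \<open>far_eq\<close>. If N is
  empty, nothing is near N and all of A is far; as \<open>infdist\<close> to the empty set is 0 by
  convention, this case has to be named.\<close>

definition far :: "'x::metric_space set \<Rightarrow> 'x set \<Rightarrow> real \<Rightarrow> 'x set" where
  "far A N k = {x \<in> A. N = {} \<or> infdist x N > k}"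

lemma far_mono: "k \<le> l \<Longrightarrow> far A N l \<subseteq> far A N k"
  by (auto simp: far_def)

lemma far_eq:
  assumes "0 \<le> k" "N = A \<inter> B" "X = A \<union> B"
  shows "X - (B \<union> closed_nbhd X N k) = far A N k"
  using assms by (auto simp: far_def closed_nbhd_def)

text \<open>A point of N in the image of K would be within e, hence within k, of the image of u. Off
  N the traces of A and B on the image are disjoint, relatively closed and cover it, so one of them
  is empty. The loss of depth is the triangle inequality for \<open>infdist\<close>.\<close>

lemma far_move:
  assumes P: "control_map P" and A: "closedin (top_of_set (cbase P)) A"
    and B: "closedin (top_of_set (cbase P)) B" and X: "cbase P = A \<union> B" and N: "N = A \<inter> B"
    and K: "connected K" "K \<subseteq> cdom P" "u \<in> K" "cmap P u \<in> far A N k"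
      "cmap P ` K \<subseteq> cball (cmap P u) e" and e: "e \<le> k"
  shows "cmap P ` K \<subseteq> far A N (k - e)"
proof -
  let ?L = "cmap P ` K"
  have d: "dist (cmap P u) w \<le> e" if "w \<in> ?L" for w using K(5) that by auto
  have L: "connected ?L"
    using P K by (intro connected_continuous_image) (auto simp: control_map_def intro: continuous_on_subset)
  have LX: "?L \<subseteq> A \<union> B" using P K(2) X by (auto simp: control_map_def)
  have LN: "?L \<inter> N = {}"
  proof (rule ccontr)
    assume "?L \<inter> N \<noteq> {}"
    then obtain w where w: "w \<in> ?L" "w \<in> N" by blast
    then have "infdist (cmap P u) N \<le> e" using infdist_le[OF w(2)] d[OF w(1)] order_trans by blast
    then show False using K(4) w e by (auto simp: far_def)
  qed
  have cl: "closedin (top_of_set ?L) (?L \<inter> C)" if c: "closedin (top_of_set (cbase P)) C" for C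
  proof -
    have "?L \<subseteq> cbase P" using LX X by simp
    moreover obtain T where "closed T" "C = cbase P \<inter> T" using c unfolding closedin_closed by blast
    ultimately show ?thesis by (auto simp: closedin_closed)
  qed
  have "?L \<subseteq> A"
  proof (rule ccontr)
    assume "\<not> ?L \<subseteq> A"
    then have "?L \<inter> B \<noteq> {}" using LX by blast
    moreover have "?L \<inter> A \<noteq> {}" using K(3,4) by (auto simp: far_def)
    moreover have "?L \<subseteq> cbase P" using LX X by simp
    then have "closedin (top_of_set ?L) (?L \<inter> A)" "closedin (top_of_set ?L) (?L \<inter> B)"
      using cl A B by blast+
    ultimately show False using L LX LN N unfolding connected_closedin_eq by blast
  qed
  moreover have "infdist w N > k - e" if "w \<in> ?L" "N \<noteq> {}" for w
    using infdist_triangle[of "cmap P u" N w] d[OF that(1)] K(4) that(2) by (auto simp: far_def)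
  ultimately show ?thesis by (auto simp: far_def)
qed

section \<open>Quotients as masks: relations and duality cones\<close>

section \<open>Quotient complexes and pairs\<close>

text \<open>The size and finiteness data of a complex without the relation for the square of d. The
  localisation lemmas ask for no more of a cone, so the relation is not established for
  cones.\<close>

definition fcc :: "('m::topological_space, 'x::metric_space) control \<Rightarrow> real
    \<Rightarrow> ('g, 'm, 'r::involution_ring) cplx \<Rightarrow> bool" where
  "fcc P e C \<longleftrightarrow> (\<forall>r. finite (dom (mods C r)) \<and> gmodule P (mods C r) \<and>
     mor P e (mods C r) (mods C (r - 1)) (diff C r))"

definition qmor :: "('m::topological_space, 'x::metric_space) control \<Rightarrow> int \<Rightarrow> real
    \<Rightarrow> ('g, 'm, 'r::involution_ring) cplx \<Rightarrow> ('g, 'm, 'r) qstr \<Rightarrow> bool" where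
  "qmor P n e C \<psi> \<longleftrightarrow> (\<forall>s r. mor P e (mods C (n - r - int s)) (mods C r) (\<psi> s r))"

text \<open>The last clause says that d takes discarded generators to discarded ones, that is, they
  span a geometric subcomplex. As a predicate it covers at once the cut complexes, an uncut complex
  as its own quotient, and direct sums of both.\<close>

definition quot_of :: "('g, 'm, 'r::involution_ring) cplx \<Rightarrow> ('g, 'm, 'r) cplx \<Rightarrow> bool" where
  "quot_of E C \<longleftrightarrow> (\<forall>r. mods E r \<subseteq>\<^sub>m mods C r \<and>
     diff E r = mask (dom (mods E r)) (dom (mods E (r - 1))) (diff C r) \<and>
     (\<forall>x y \<rho>. x \<notin> dom (mods E r) \<longrightarrow> y \<in> dom (mods E (r - 1)) \<longrightarrow> diff C r x y \<rho> = 0))"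

lemma fccD:
  assumes "fcc P e C"
  shows "finite (dom (mods C r))" "gmodule P (mods C r)" "mor P e (mods C r) (mods C (r - 1)) (diff C r)"
    "mor P e (mods C (r + 1)) (mods C r) (diff C (r + 1))"
    "mor P e (mods C (r - 1)) (mods C r) (dual (diff C r))"
    "mor P e (mods C r) (mods C (r + 1)) (dual (diff C (r + 1)))"
  using assms[unfolded fcc_def, rule_format, of r] assms[unfolded fcc_def, rule_format, of "r + 1"]
  by (auto intro!: mor_dual)

lemma fccI: "chain_complex P e C \<Longrightarrow> fin_gen C \<Longrightarrow> fcc P e C"
  unfolding chain_complex_def fin_gen_def fcc_def using emorphism_imp_mor by blast

lemma qmorI: "qfamily P n e C \<psi> \<Longrightarrow> fin_gen C \<Longrightarrow> qmor P n e C \<psi>"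
  unfolding qfamily_def fin_gen_def qmor_def using emorphism_imp_mor by blast

lemma qmorD: "qmor P n e C \<psi> \<Longrightarrow> k = n - r - int s \<Longrightarrow> mor P e (mods C k) (mods C r) (\<psi> s r)"
  by (simp add: qmor_def)

lemma quot_ofD:
  assumes "quot_of E C"
  shows "mods E r \<subseteq>\<^sub>m mods C r" "diff E r = mask (dom (mods E r)) (dom (mods E (r - 1))) (diff C r)"
    "diff E (r + 1) = mask (dom (mods E (r + 1))) (dom (mods E r)) (diff C (r + 1))"
    "x \<notin> dom (mods E r) \<Longrightarrow> y \<in> dom (mods E (r - 1)) \<Longrightarrow> diff C r x y \<rho> = 0"
    "x \<notin> dom (mods E (r + 1)) \<Longrightarrow> y \<in> dom (mods E r) \<Longrightarrow> diff C (r + 1) x y \<rho> = 0"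
  using assms[unfolded quot_of_def, rule_format, of r] assms[unfolded quot_of_def, rule_format, of "r + 1"]
  by auto

lemma quot_of_finite: "quot_of E C \<Longrightarrow> finite (dom (mods C r)) \<Longrightarrow> finite (dom (mods E r))"
  using quot_ofD(1) map_le_implies_dom_le finite_subset by metis

lemma gmodule_le: "gmodule P H \<Longrightarrow> G \<subseteq>\<^sub>m H \<Longrightarrow> gmodule P G"
  unfolding gmodule_def map_le_def ran_def dom_def by force

lemma quot_fcc: "fcc P e C \<Longrightarrow> quot_of E C \<Longrightarrow> fcc P e E"
proof -
  assume C: "fcc P e C" and E: "quot_of E C"
  have "finite (dom (mods E r))" "gmodule P (mods E r)" for r
    by (rule quot_of_finite[OF E fccD(1)[OF C]], rule gmodule_le[OF fccD(2)[OF C] quot_ofD(1)[OF E]])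
  moreover have "mor P e (mods E r) (mods E (r - 1)) (diff E r)" for r
    unfolding quot_ofD(2)[OF E, of r]
    by (rule mor_mask_le[OF fccD(3)[OF C] quot_ofD(1)[OF E] quot_ofD(1)[OF E]])
  ultimately show ?thesis by (simp add: fcc_def)
qed

text \<open>A path of d into a discarded generator cannot be continued by d to a retained one, so
  the product of the masked differentials is the mask of the product.\<close>

lemma quot_dd:
  assumes "quot_of E C"
  shows "diff E (r - 1) \<odot> diff E r =
     mask (dom (mods E r)) (dom (mods E (r - 1 - 1))) (diff C (r - 1) \<odot> diff C r)"
  unfolding quot_ofD(2)[OF assms, of "r - 1"] quot_ofD(2)[OF assms, of r]
  by (rule gcomp_mask) (use quot_ofD(4)[OF assms, of _ "r - 1"] in blast)

lemma dual_eq_0: "(\<And>\<rho>. f x y \<rho> = 0) \<Longrightarrow> dual f y x \<tau> = 0"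
  using dual_nz by metis

lemma qmor_dualT:
  assumes "qmor P n e C \<psi>" "k = n - r - int s"
  shows "mor P e (mods C k) (mods C r) (dualT n \<psi> s r)"
  using assms by (auto simp: dualT_def intro!: mor_dual qmorD[OF assms(1)])

lemma symm_mor: "qmor P n e C \<psi> \<Longrightarrow> k = n - r \<Longrightarrow> mor P e (mods C k) (mods C r) (symm n \<psi> r)"
  unfolding symm_def by (intro mor_add qmorD qmor_dualT) auto

text \<open>The structure \<open>p_%\<close> of a quotient is conjugated by identities and thus
  differs from the restricted coefficients by constant paths. Everything that depends on a structure
  is therefore compared with its mask up to homotopy of radius e.\<close>

definition qsim :: "('m::topological_space, 'x::metric_space) control \<Rightarrow> int \<Rightarrow> real
    \<Rightarrow> ('g, 'm, 'r::involution_ring) cplx \<Rightarrow> ('g, 'm, 'r) qstr \<Rightarrow> ('g, 'm, 'r) qstr \<Rightarrow> bool" where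
  "qsim P n e E \<psi>' \<psi> \<longleftrightarrow>
     (\<forall>s r. sim P e (\<psi>' s r) (mask (dom (mods E (n - r - int s))) (dom (mods E r)) (\<psi> s r)))"

lemma qsimD: "qsim P n e E \<psi>' \<psi> \<Longrightarrow> k = n - r - int s \<Longrightarrow>
    sim P e (\<psi>' s r) (mask (dom (mods E k)) (dom (mods E r)) (\<psi> s r))"
  by (simp add: qsim_def)

lemma dualT_sim:
  assumes "qsim P n e E \<psi>' \<psi>" "qmor P n e E \<psi>'" "qmor P n e C \<psi>" "k = n - r - int s"
  shows "sim P e (dualT n \<psi>' s r) (mask (dom (mods E k)) (dom (mods E r)) (dualT n \<psi> s r))"
proof -
  have "sim P e (\<psi>' s k) (mask (dom (mods E r)) (dom (mods E k)) (\<psi> s k))"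
    by (rule qsimD[OF assms(1)]) (simp add: assms(4))
  then have "sim P e (dual (\<psi>' s k)) (dual (mask (dom (mods E r)) (dom (mods E k)) (\<psi> s k)))"
    by (intro sim_dual fs_mask mor_fs[OF qmorD[OF assms(2) refl]] mor_fs[OF qmorD[OF assms(3) refl]])
  then show ?thesis by (simp add: dualT_def assms(4) mask_dual sim_msign)
qed

lemma symm_sim:
  assumes "qsim P n e E \<psi>' \<psi>" "qmor P n e E \<psi>'" "qmor P n e C \<psi>" "k = n - r"
  shows "sim P e (symm n \<psi>' r) (mask (dom (mods E k)) (dom (mods E r)) (symm n \<psi> r))"
  unfolding symm_def mask_add using assms by (intro sim_add qsimD dualT_sim) auto

text \<open>Replacing \<psi>' by the mask of \<psi> costs radius e + e at most, within 3e; after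
  that the masks pass through the products strictly, since discarded generators cannot map to
  retained ones.\<close>

lemma qrel_sim:
  assumes C: "fcc P e C" and E: "quot_of E C" and \<psi>: "qmor P n e C \<psi>" and \<psi>': "qmor P n e E \<psi>'"
    and s: "qsim P n e E \<psi>' \<psi>" and e: "0 \<le> e"
  shows "sim P (3 * e) (qrel n E \<psi>' s r)
     (mask (dom (mods E (n - r - int s - 1))) (dom (mods E r)) (qrel n C \<psi> s r))"
proof -
  let ?k = "n - r - int s"
  let ?S = "dom (mods E (?k - 1))" and ?T = "dom (mods E r)"
  note Ef = quot_fcc[OF C E]
  have i: "?k - 1 = n - (r + 1) - int s" by simp
  \<comment> \<open>Dually, the adjoint of d takes retained generators to retained ones only, which
    is what the product with the dual differential needs.\<close>
  have d0: "dual (diff C ?k) x y \<rho> = 0" if "y \<notin> dom (mods E ?k)" "x \<in> ?S" for x y \<rho>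
    by (rule dual_eq_0) (rule quot_ofD(4)[OF E that])
  have "sim P (3 * e) (diff E (r + 1) \<odot> \<psi>' s (r + 1))
     (diff E (r + 1) \<odot> mask ?S (dom (mods E (r + 1))) (\<psi> s (r + 1)))"
    by (rule sim_gcomp_right[OF qsimD[OF s i] qmorD[OF \<psi>' i] mor_mask_le[OF qmorD[OF \<psi> i] quot_ofD(1)[OF E] quot_ofD(1)[OF E]] fccD(4)[OF Ef]])
      (use e in simp)
  also have "diff E (r + 1) \<odot> mask ?S (dom (mods E (r + 1))) (\<psi> s (r + 1)) = mask ?S ?T (diff C (r + 1) \<odot> \<psi> s (r + 1))"
    unfolding quot_ofD(3)[OF E] by (rule gcomp_mask) (use quot_ofD(5)[OF E] in blast)
  finally have 1: "sim P (3 * e) (diff E (r + 1) \<odot> \<psi>' s (r + 1)) (mask ?S ?T (diff C (r + 1) \<odot> \<psi> s (r + 1)))" .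
  have "sim P (3 * e) (\<psi>' s r \<odot> dual (diff E ?k)) (mask (dom (mods E ?k)) ?T (\<psi> s r) \<odot> dual (diff E ?k))"
    by (rule sim_gcomp_left[OF qsimD[OF s refl] qmorD[OF \<psi>' refl] mor_mask_le[OF qmorD[OF \<psi> refl] quot_ofD(1)[OF E] quot_ofD(1)[OF E]] fccD(5)[OF Ef]])
      (use e in auto)
  also have "mask (dom (mods E ?k)) ?T (\<psi> s r) \<odot> dual (diff E ?k) = mask ?S ?T (\<psi> s r \<odot> dual (diff C ?k))"
    unfolding quot_ofD(2)[OF E] mask_dual
    by (rule gcomp_mask) (use d0 in blast)
  finally have 2: "sim P (3 * e) (\<psi>' s r \<odot> dual (diff E ?k)) (mask ?S ?T (\<psi> s r \<odot> dual (diff C ?k)))" .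
  have 3: "sim P (3 * e) (\<psi>' (s + 1) r) (mask ?S ?T (\<psi> (s + 1) r))"
    by (rule sim_mono[OF qsimD[OF s]]) (use e in auto)
  have 4: "sim P (3 * e) (dualT n \<psi>' (s + 1) r) (mask ?S ?T (dualT n \<psi> (s + 1) r))"
    by (rule sim_mono[OF dualT_sim[OF s \<psi>' \<psi>]]) (use e in auto)
  show ?thesis unfolding qrel_def mask_add mask_msign
    by (intro sim_add sim_msign 1 2 3 4)
qed

subsection \<open>The duality cones\<close>

text \<open>The cone shifts the dual complex by one degree, so its dual summand in degree r is C in
  degree n - (r - 1). The indices are normalised once here, so that source and target modules match
  in what follows.\<close>

lemma dcone_simps:
  "mods (dcone n C \<psi>) r = msum (mods C r) (mods C (n + 1 - r))"
  "diff (dcone n C \<psi>) r = block (diff C r) (msign (r - 1) (symm n \<psi> (r - 1))) 0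
      (msign (r - 1) (dual (diff C (n + 2 - r))))"
proof -
  have "n - (r - 1) = n + 1 - r" "n - (r - 1) + 1 = n + 2 - r" by simp_all
  then show "mods (dcone n C \<psi>) r = msum (mods C r) (mods C (n + 1 - r))"
    "diff (dcone n C \<psi>) r = block (diff C r) (msign (r - 1) (symm n \<psi> (r - 1))) 0
      (msign (r - 1) (dual (diff C (n + 2 - r))))"
    by (simp_all only: dcone_def mapping_cone_def dual_cplx_def cplx.simps)
qed

lemma dcone_pair_simps:
  "mods (dcone_pair n C D f \<delta>\<psi> \<psi>) r = msum (msum (mods D r) (mods C (r - 1))) (mods D (n + 2 - r))"
  "diff (dcone_pair n C D f \<delta>\<psi> \<psi>) r =
     block (block (diff D r) (msign (r - 1) (f (r - 1))) 0 (diff C (r - 1)))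
       (msign (r - 1) (col (symm (n + 1) \<delta>\<psi> (r - 1))
          (msign (n + 2 - r) (symm n \<psi> (r - 2) \<odot> dual (f (n + 2 - r)))))) 0
       (msign (r - 1) (dual (diff D (n + 3 - r))))"
proof -
  have "n + 1 - (r - 1) = n + 2 - r" "n + 1 - (r - 1) + 1 = n + 3 - r" "r - 1 - 1 = r - 2" by simp_all
  then show "mods (dcone_pair n C D f \<delta>\<psi> \<psi>) r = msum (msum (mods D r) (mods C (r - 1))) (mods D (n + 2 - r))"
  "diff (dcone_pair n C D f \<delta>\<psi> \<psi>) r =
     block (block (diff D r) (msign (r - 1) (f (r - 1))) 0 (diff C (r - 1)))
       (msign (r - 1) (col (symm (n + 1) \<delta>\<psi> (r - 1))
          (msign (n + 2 - r) (symm n \<psi> (r - 2) \<odot> dual (f (n + 2 - r)))))) 0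
       (msign (r - 1) (dual (diff D (n + 3 - r))))"
    by (simp_all only: dcone_pair_def mapping_cone_def dual_cplx_def cplx.simps)
qed

lemma gmodule_msum: "gmodule P G \<Longrightarrow> gmodule P H \<Longrightarrow> gmodule P (msum G H)"
proof -
  have "ran (msum G H) \<subseteq> ran G \<union> ran H"
  proof
    fix u assume "u \<in> ran (msum G H)"
    then obtain x where "msum G H x = Some u" by (auto simp: ran_def)
    then show "u \<in> ran G \<union> ran H" by (cases x) (auto simp: ran_def)
  qed
  then show "gmodule P G \<Longrightarrow> gmodule P H \<Longrightarrow> gmodule P (msum G H)" by (auto simp: gmodule_def)
qed

lemma finite_msum: "finite (dom G) \<Longrightarrow> finite (dom H) \<Longrightarrow> finite (dom (msum G H))"
  by (simp add: dom_msum)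

lemma dcone_fcc: "fcc P e C \<Longrightarrow> qmor P n e C \<psi> \<Longrightarrow> fcc P e (dcone n C \<psi>)"
proof -
  assume C: "fcc P e C" and \<psi>: "qmor P n e C \<psi>"
  have "mor P e (mods (dcone n C \<psi>) r) (mods (dcone n C \<psi>) (r - 1)) (diff (dcone n C \<psi>) r)" for r
  proof -
    have i: "n + 2 - r - 1 = n + 1 - r" "n + 1 - (r - 1) = n + 2 - r" by simp_all
    show ?thesis unfolding dcone_simps i mor_msign
    proof (intro mor_block)
      show "mor P e (mods C r) (mods C (r - 1)) (diff C r)" by (rule fccD[OF C])
      show "mor P e (mods C (n + 1 - r)) (mods C (r - 1)) (msign (r - 1) (symm n \<psi> (r - 1)))"
        unfolding mor_msign by (rule symm_mor[OF \<psi>]) simp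
      show "mor P e (mods C (n + 1 - r)) (mods C (n + 2 - r)) (msign (r - 1) (dual (diff C (n + 2 - r))))"
        using fccD(5)[OF C, of "n + 2 - r"] i by simp
    qed simp
  qed
  then show ?thesis
    using fccD(1,2)[OF C] by (simp add: fcc_def dcone_simps(1) finite_msum gmodule_msum)
qed

lemma dcone_sim:
  assumes C: "fcc P e C" and E: "quot_of E C" and \<psi>: "qmor P n e C \<psi>" and \<psi>': "qmor P n e E \<psi>'"
    and s: "qsim P n e E \<psi>' \<psi>"
  shows "sim P e (diff (dcone n E \<psi>') r)
     (mask (dom (mods (dcone n E \<psi>') r)) (dom (mods (dcone n E \<psi>') (r - 1))) (diff (dcone n C \<psi>) r))"
proof -
  have i: "n + 1 - (r - 1) = n + 2 - r" "n + 2 - r - 1 = n + 1 - r" by simp_all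
  show ?thesis
    unfolding dcone_simps dom_msum mask_block i mask_msign mask_zero
    using symm_sim[OF s \<psi>' \<psi>, of "n + 1 - r" "r - 1"] quot_ofD(2)[OF E, of r]
      quot_ofD(2)[OF E, of "n + 2 - r"] i
    by (intro sim_block sim_msign) (simp_all add: mask_dual)
qed

lemma dcone_le: "quot_of E C \<Longrightarrow> mods (dcone n E \<psi>') r \<subseteq>\<^sub>m mods (dcone n C \<psi>) r"
  by (simp add: dcone_simps msum_le quot_ofD(1))

definition fmor :: "('m::topological_space, 'x::metric_space) control \<Rightarrow> real
    \<Rightarrow> ('g, 'm, 'r::involution_ring) cplx \<Rightarrow> ('h, 'm, 'r) cplx \<Rightarrow> (int \<Rightarrow> ('g, 'h, 'm, 'r) gmor) \<Rightarrow> bool" where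
  "fmor P e C D f \<longleftrightarrow> (\<forall>r. mor P e (mods C r) (mods D r) (f r))"

text \<open>The radius doubles because one entry of the differential, the symmetrization of \<psi>
  after the dual of f, is a composite of two morphisms of radius e.\<close>

lemma dcone_pair_fcc:
  assumes C: "fcc P e C" and D: "fcc P e D" and f: "fmor P e C D f" and \<psi>: "qmor P n e C \<psi>"
    and \<delta>\<psi>: "qmor P (n + 1) e D \<delta>\<psi>" and e: "0 \<le> e"
  shows "fcc P (2 * e) (dcone_pair n C D f \<delta>\<psi> \<psi>)"
proof -
  let ?E = "dcone_pair n C D f \<delta>\<psi> \<psi>"
  have e2: "e \<le> 2 * e" using e by simp
  have "mor P (2 * e) (mods ?E r) (mods ?E (r - 1)) (diff ?E r)" for r
  proof -
    have i: "n + 2 - (r - 1) = n + 3 - r" "n + 3 - r - 1 = n + 2 - r" "r - 1 - 1 = r - 2" by simp_all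
    have 1: "mor P (2 * e) (mods C r) (mods C (r - 1)) (diff C r)" "mor P (2 * e) (mods D r) (mods D (r - 1)) (diff D r)"
      "mor P (2 * e) (mods D (r - 1)) (mods D r) (dual (diff D r))"
      "mor P (2 * e) (mods C r) (mods D r) (f r)" for r
      by (rule mor_mono[OF fccD(3)[OF C] e2], rule mor_mono[OF fccD(3)[OF D] e2],
          rule mor_mono[OF fccD(5)[OF D] e2], rule mor_mono[OF f[unfolded fmor_def, rule_format] e2])
    have 2: "mor P (2 * e) (mods D (n + 2 - r)) (mods C (r - 2)) (symm n \<psi> (r - 2) \<odot> dual (f (n + 2 - r)))"
      by (rule mor_gcomp[OF mor_dual[OF f[unfolded fmor_def, rule_format]] symm_mor[OF \<psi>]]) auto
    have 3: "mor P (2 * e) (mods D (n + 2 - r)) (mods D (r - 1)) (symm (n + 1) \<delta>\<psi> (r - 1))"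
      by (rule mor_mono[OF symm_mor[OF \<delta>\<psi>] e2]) simp
    show ?thesis unfolding dcone_pair_simps i
    proof (intro mor_block)
      show "mor P (2 * e) (mods C (r - 1)) (mods C (r - 2)) (diff C (r - 1))"
        using 1(1)[of "r - 1"] i by simp
      show "mor P (2 * e) (mods D (n + 2 - r)) (mods D (n + 3 - r)) (msign (r - 1) (dual (diff D (n + 3 - r))))"
        using 1(3)[of "n + 3 - r"] i by simp
    qed (use 1 2 3 in \<open>auto intro!: mor_col\<close>)
  qed
  then show ?thesis
    using fccD(1,2)[OF C] fccD(1,2)[OF D] by (simp add: fcc_def dcone_pair_simps(1) finite_msum gmodule_msum)
qed

lemma dcone_pair_sim:
  assumes C: "fcc P e C" and D: "fcc P e D" and f: "fmor P e C D f" and \<psi>: "qmor P n e C \<psi>"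
    and \<delta>\<psi>: "qmor P (n + 1) e D \<delta>\<psi>" and e: "0 \<le> e"
    and C': "quot_of C' C" and D': "quot_of D' D"
    and \<psi>': "qmor P n e C' \<psi>'" "qsim P n e C' \<psi>' \<psi>"
    and \<delta>\<psi>': "qmor P (n + 1) e D' \<delta>\<psi>'" "qsim P (n + 1) e D' \<delta>\<psi>' \<delta>\<psi>"
    and f': "\<And>r. f' r = mask (dom (mods C' r)) (dom (mods D' r)) (f r)"
    and f0: "\<And>r x y \<rho>. x \<notin> dom (mods C' r) \<Longrightarrow> y \<in> dom (mods D' r) \<Longrightarrow> f r x y \<rho> = 0"
  shows "sim P (2 * e) (diff (dcone_pair n C' D' f' \<delta>\<psi>' \<psi>') r)
     (mask (dom (mods (dcone_pair n C' D' f' \<delta>\<psi>' \<psi>') r)) (dom (mods (dcone_pair n C' D' f' \<delta>\<psi>' \<psi>') (r - 1)))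
       (diff (dcone_pair n C D f \<delta>\<psi> \<psi>) r))"
proof -
  have i: "n + 2 - (r - 1) = n + 3 - r" "r - 1 - 1 = r - 2" by simp_all
  have i': "n + 3 - r - 1 = n + 2 - r" by simp
  let ?k = "n + 2 - r"
  have fm: "mor P e (mods C r) (mods D r) (f r)" for r using f by (simp add: fmor_def)
  have fm': "mor P e (mods C' r) (mods D' r) (f' r)" for r
    unfolding f' by (rule mor_mask_le[OF fm quot_ofD(1)[OF C'] quot_ofD(1)[OF D']])
  \<comment> \<open>The dual of f takes retained generators of D to retained generators of C only,
    so its composite with the symmetrization may be masked factor by factor.\<close>
  have d0: "dual (f k) x y \<rho> = 0" if "y \<notin> dom (mods C' k)" "x \<in> dom (mods D' k)" for x y \<rho> k
    by (rule dual_eq_0) (rule f0[OF that])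
  have k: "?k = n - (r - 2)" "?k = n + 1 - (r - 1)" by simp_all
  have "sim P (2 * e) (symm n \<psi>' (r - 2) \<odot> dual (f' ?k))
     (mask (dom (mods C' ?k)) (dom (mods C' (r - 2))) (symm n \<psi> (r - 2)) \<odot> dual (f' ?k))"
    by (rule sim_gcomp_left[OF symm_sim[OF \<psi>'(2,1) \<psi> k(1)] symm_mor[OF \<psi>'(1) k(1)]
          mor_mask_le[OF symm_mor[OF \<psi> k(1)] quot_ofD(1)[OF C'] quot_ofD(1)[OF C']] mor_dual[OF fm']])
      simp
  also have "mask (dom (mods C' ?k)) (dom (mods C' (r - 2))) (symm n \<psi> (r - 2)) \<odot> dual (f' ?k) =
      mask (dom (mods D' ?k)) (dom (mods C' (r - 2))) (symm n \<psi> (r - 2) \<odot> dual (f ?k))"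
    unfolding f' mask_dual by (rule gcomp_mask) (use d0 in blast)
  finally have 1: "sim P (2 * e) (symm n \<psi>' (r - 2) \<odot> dual (f' ?k))
     (mask (dom (mods D' ?k)) (dom (mods C' (r - 2))) (symm n \<psi> (r - 2) \<odot> dual (f ?k)))" .
  have 2: "sim P (2 * e) (symm (n + 1) \<delta>\<psi>' (r - 1)) (mask (dom (mods D' ?k)) (dom (mods D' (r - 1))) (symm (n + 1) \<delta>\<psi> (r - 1)))"
    by (rule sim_mono[OF symm_sim[OF \<delta>\<psi>'(2,1) \<delta>\<psi> k(2)]]) (use e in simp)
  show ?thesis
    unfolding dcone_pair_simps dom_msum mask_block i mask_msign mask_zero mask_col
    using quot_ofD(2)[OF D', of r] quot_ofD(2)[OF C', of "r - 1"] quot_ofD(2)[OF D', of "n + 3 - r"]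
      f'[of "r - 1"] i i' 1 2
    by (intro sim_block sim_msign sim_col) (simp_all add: mask_dual)
qed

lemma dcone_pair_le:
  "quot_of C' C \<Longrightarrow> quot_of D' D \<Longrightarrow>
    mods (dcone_pair n C' D' f' \<delta>\<psi>' \<psi>') r \<subseteq>\<^sub>m mods (dcone_pair n C D f \<delta>\<psi> \<psi>) r"
  by (simp add: dcone_pair_simps msum_le quot_ofD(1))

lemma push_mor:
  assumes "fmor P e C D f" "qmor P n e C \<psi>" "k = n - r - int s"
  shows "mor P (3 * e) (mods D k) (mods D r) (push n f \<psi> s r)"
  unfolding push_def assms(3)[symmetric]
  by (rule mor_gcomp[OF mor_gcomp[OF mor_dual[OF assms(1)[unfolded fmor_def, rule_format]]
        qmorD[OF assms(2,3)] order_refl] assms(1)[unfolded fmor_def, rule_format]]) simp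

text \<open>Only the middle factor changes by a homotopy; by \<open>f0\<close> no discarded
  generator of C is joined by f to a retained one of D, so both outer factors are masked strictly.
  The three radii add up to 3e, the radius allowed in the relation of a pair.\<close>

lemma push_sim:
  assumes C: "fcc P e C" and D: "fcc P e D" and f: "fmor P e C D f" and \<psi>: "qmor P n e C \<psi>" and e: "0 \<le> e"
    and C': "quot_of C' C" and D': "quot_of D' D"
    and \<psi>': "qmor P n e C' \<psi>'" "qsim P n e C' \<psi>' \<psi>"
    and f': "\<And>r. f' r = mask (dom (mods C' r)) (dom (mods D' r)) (f r)"
    and f0: "\<And>r x y \<rho>. x \<notin> dom (mods C' r) \<Longrightarrow> y \<in> dom (mods D' r) \<Longrightarrow> f r x y \<rho> = 0"
  shows "sim P (3 * e) (push n f' \<psi>' s r)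
     (mask (dom (mods D' (n - r - int s))) (dom (mods D' r)) (push n f \<psi> s r))"
proof -
  let ?k = "n - r - int s"
  have fm: "mor P e (mods C r) (mods D r) (f r)" for r using f by (simp add: fmor_def)
  have fm': "mor P e (mods C' r) (mods D' r) (f' r)" for r
    unfolding f' by (rule mor_mask_le[OF fm quot_ofD(1)[OF C'] quot_ofD(1)[OF D']])
  have d0: "dual (f k) x y \<rho> = 0" if "y \<notin> dom (mods C' k)" "x \<in> dom (mods D' k)" for x y \<rho> k
    by (rule dual_eq_0) (rule f0[OF that])
  let ?m = "mask (dom (mods D' ?k)) (dom (mods C' r)) (\<psi> s r \<odot> dual (f ?k))"
  have eq: "mask (dom (mods C' ?k)) (dom (mods C' r)) (\<psi> s r) \<odot> dual (f' ?k) = ?m"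
    unfolding f' mask_dual by (rule gcomp_mask) (use d0 in blast)
  have mm: "mor P e (mods C' ?k) (mods C' r) (mask (dom (mods C' ?k)) (dom (mods C' r)) (\<psi> s r))"
    by (rule mor_mask_le[OF qmorD[OF \<psi> refl] quot_ofD(1)[OF C'] quot_ofD(1)[OF C']])
  have 1: "sim P (2 * e) (\<psi>' s r \<odot> dual (f' ?k)) ?m"
    unfolding eq[symmetric]
    by (rule sim_gcomp_left[OF qsimD[OF \<psi>'(2) refl] qmorD[OF \<psi>'(1) refl] mm mor_dual[OF fm']]) simp
  have m2: "mor P (2 * e) (mods D' ?k) (mods C' r) ?m"
    unfolding eq[symmetric] by (rule mor_gcomp[OF mor_dual[OF fm'] mm]) simp
  have m1: "mor P (2 * e) (mods D' ?k) (mods C' r) (\<psi>' s r \<odot> dual (f' ?k))"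
    by (rule mor_gcomp[OF mor_dual[OF fm'] qmorD[OF \<psi>'(1) refl]]) simp
  have "sim P (3 * e) (f' r \<odot> \<psi>' s r \<odot> dual (f' ?k)) (f' r \<odot> ?m)"
    by (rule sim_gcomp_right[OF 1 m1 m2 fm']) simp
  also have "f' r \<odot> ?m = mask (dom (mods D' ?k)) (dom (mods D' r)) (f r \<odot> \<psi> s r \<odot> dual (f ?k))"
    unfolding f' by (rule gcomp_mask) (use f0 in blast)
  finally show ?thesis by (simp add: push_def)
qed

section \<open>Functoriality in the control space and the radius\<close>

section \<open>Monotonicity in the control space and the radius\<close>

text \<open>Covers the inclusion of the part over A and also the comparison of radii over the same
  space. The base enters the notions at hand through the region W of the Poincare condition, which
  is compared separately.\<close>

definition control_le :: "('m, 'x) control \<Rightarrow> ('m, 'x) control \<Rightarrow> bool" where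
  "control_le P Q \<longleftrightarrow> cdom P \<subseteq> cdom Q \<and> cmap P = cmap Q"

lemma control_le_refl [simp]: "control_le P P" by (simp add: control_le_def)

lemma control_le_restr [simp]: "control_le (restr P A) P" by (simp add: control_le_def)

lemma gpaths_mono: "\<rho> \<in> gpaths M \<Longrightarrow> M \<subseteq> M' \<Longrightarrow> \<rho> \<in> gpaths M'"
  by (auto simp: gpaths_def)

lemma hrel_le: "control_le P Q \<Longrightarrow> d \<le> e \<Longrightarrow> hrel P d \<rho> \<rho>' \<Longrightarrow> hrel Q e \<rho> \<rho>'"
proof -
  assume a: "control_le P Q" "d \<le> e" "hrel P d \<rho> \<rho>'"
  have "hset P d u v \<subseteq> hset Q e u v" for u v using a(1,2) by (auto simp: hset_def control_le_def)
  then show ?thesis using a unfolding hrel_def control_le_def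
    by (meson gpaths_mono homotopic_paths_subset)
qed

lemma gmodule_control_le: "control_le P Q \<Longrightarrow> gmodule P G \<Longrightarrow> gmodule Q G"
  by (auto simp: gmodule_def control_le_def)

lemma has_radius_le: "control_le P Q \<Longrightarrow> d \<le> e \<Longrightarrow> has_radius P d f \<Longrightarrow> has_radius Q e f"
  unfolding has_radius_def control_le_def by (smt (verit) IntI IntE image_subset_iff mem_cball)

lemma emorphism_le: "control_le P Q \<Longrightarrow> d \<le> e \<Longrightarrow> emorphism P d G H f \<Longrightarrow> emorphism Q e G H f"
  unfolding emorphism_def gmorphism_def using has_radius_le gpaths_mono unfolding control_le_def by blast

lemma sim_le: "control_le P Q \<Longrightarrow> d \<le> e \<Longrightarrow> sim P d f g \<Longrightarrow> sim Q e f g"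
  unfolding sim_iff_nul by (meson hrel_le nul_mono subset_refl)

text \<open>Filtering the null witness by starting point turns the relation over W into the one over
  the smaller set.\<close>

lemma sim_mrestrict:
  assumes "sim P e (mrestrict P W f) (mrestrict P W g)" "W' \<subseteq> W"
  shows "sim P e (mrestrict P W' f) (mrestrict P W' g)"
  unfolding sim_iff_nul
proof (intro allI)
  fix x y
  let ?K = "{(u, v). cmap P u \<in> W'}"
  let ?\<phi> = "mrestrict P W f x y - mrestrict P W g x y"
  have "?\<phi> \<in> nul P e UNIV" using assms(1) by (simp add: sim_iff_nul)
  then have n: "(\<lambda>\<tau>. if (pathstart \<tau>, pathfinish \<tau>) \<in> ?K then ?\<phi> \<tau> else 0) \<in> nul P e (UNIV \<inter> ?K)"
    by (rule nul_filter)
  have eq: "(\<lambda>\<tau>. if (pathstart \<tau>, pathfinish \<tau>) \<in> ?K then ?\<phi> \<tau> else 0) = mrestrict P W' f x y - mrestrict P W' g x y"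
    by (rule ext) (use assms(2) in \<open>auto simp: mrestrict_def\<close>)
  show "mrestrict P W' f x y - mrestrict P W' g x y \<in> nul P e UNIV"
    using n unfolding eq by (rule nul_mono) auto
qed

lemma contractible_over_le:
  assumes "control_le P Q" "d \<le> e" "W' \<subseteq> W" "contractible_over P d W C"
  shows "contractible_over Q e W' C"
proof -
  have eq: "mrestrict Q = mrestrict P" using assms(1) by (intro ext) (simp add: mrestrict_def control_le_def)
  have "2 * d \<le> 2 * e" using assms(2) by simp
  then show ?thesis
    using assms(4) sim_le[OF assms(1)] sim_mrestrict[OF _ assms(3)] emorphism_le[OF assms(1,2)]
    unfolding contractible_over_def eq by meson
qed

lemma connected_cplx_le:
  assumes "control_le P Q" "d \<le> e" "connected_cplx P d C"
  shows "connected_cplx Q e C"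
proof -
  have "4 * d \<le> 4 * e" "8 * d \<le> 8 * e" using assms(2) by simp_all
  then show ?thesis
    using assms(3) sim_le[OF assms(1)] emorphism_le[OF assms(1)] unfolding connected_cplx_def by meson
qed

lemma chain_complex_le:
  assumes "control_le P Q" "d \<le> e" "chain_complex P d C"
  shows "chain_complex Q e C"
proof -
  have "2 * d \<le> 2 * e" using assms(2) by simp
  then show ?thesis
    using assms(3) sim_le[OF assms(1)] emorphism_le[OF assms(1,2)] gmodule_control_le[OF assms(1)]
    unfolding chain_complex_def by meson
qed

lemma qfamily_le: "control_le P Q \<Longrightarrow> d \<le> e \<Longrightarrow> qfamily P n d C \<psi> \<Longrightarrow> qfamily Q n e C \<psi>"
  unfolding qfamily_def using emorphism_le by blast

lemma quad_complex_le:
  assumes "control_le P Q" "d \<le> e" "quad_complex P n d C \<psi>"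
  shows "quad_complex Q n e C \<psi>"
proof -
  have "3 * d \<le> 3 * e" using assms(2) by simp
  then show ?thesis
    using assms(3) sim_le[OF assms(1)] chain_complex_le[OF assms(1,2)] qfamily_le[OF assms(1,2)]
    unfolding quad_complex_def quad_structure_def by meson
qed

lemma quad_pair_le:
  assumes "control_le P Q" "d \<le> e" "quad_pair P n d C D f \<delta>\<psi> \<psi>"
  shows "quad_pair Q n e C D f \<delta>\<psi> \<psi>"
proof -
  have "3 * d \<le> 3 * e" using assms(2) by simp
  moreover have "chain_map Q e C D f"
    using assms(3) sim_le[OF assms(1,2)] emorphism_le[OF assms(1,2)] has_radius_le[OF assms(1,2)]
    unfolding quad_pair_def chain_map_def by meson
  ultimately show ?thesis
    using assms(3) sim_le[OF assms(1)] chain_complex_le[OF assms(1,2)] qfamily_le[OF assms(1,2)]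
      quad_complex_le[OF assms(1,2)]
    unfolding quad_pair_def by meson
qed

lemma poincare_over_le:
  assumes "control_le P Q" "d \<le> e" "W' \<subseteq> W" "poincare_over P n d W C \<psi>"
  shows "poincare_over Q n e W' C \<psi>"
  using assms(4) contractible_over_le[OF assms(1) _ assms(3), of "4 * d" "4 * e"] assms(2)
  by (simp add: poincare_over_def)

lemma Lreps_le:
  assumes "control_le P Q" "d \<le> e" "cbase Q - Z \<subseteq> cbase P - Y" "a \<in> Lreps n d P Y"
  shows "a \<in> Lreps n e Q Z"
  using assms(4) quad_complex_le[OF assms(1,2)] connected_cplx_le[OF assms(1,2)] poincare_over_le[OF assms(1,2,3)]
  unfolding Lreps_def connected_quad_def by auto

lemma Lcobordant_le:
  assumes "control_le P Q" "d \<le> e" "cbase Q - Z \<subseteq> cbase P - Y" "Lcobordant n d P Y a b"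
  shows "Lcobordant n e Q Z a b"
proof -
  obtain C \<psi> C' \<psi>' where ab: "a = (C, \<psi>)" "b = (C', \<psi>')" by (metis prod.exhaust)
  obtain D :: "(nat, 'a, 'c) cplx" and f \<delta>\<psi> where D: "fin_gen D"
       "quad_pair P n d (csum C C') D f \<delta>\<psi> (qsum \<psi> (- \<psi>'))"
       "connected_pair P n d (csum C C') D f \<delta>\<psi> (qsum \<psi> (- \<psi>'))"
       "poincare_pair_over P n d (cbase P - Y) (csum C C') D f \<delta>\<psi> (qsum \<psi> (- \<psi>'))"
    using assms(4) unfolding ab Lcobordant_def by blast
  have "4 * d \<le> 4 * e" using assms(2) by simp
  then have "fin_gen D" "quad_pair Q n e (csum C C') D f \<delta>\<psi> (qsum \<psi> (- \<psi>'))"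
       "connected_pair Q n e (csum C C') D f \<delta>\<psi> (qsum \<psi> (- \<psi>'))"
       "poincare_pair_over Q n e (cbase Q - Z) (csum C C') D f \<delta>\<psi> (qsum \<psi> (- \<psi>'))"
    using D quad_pair_le[OF assms(1,2) D(2)] poincare_over_le[OF assms(1,2,3)]
      connected_cplx_le[OF assms(1,2), of "dcone n (csum C C') (qsum \<psi> (- \<psi>'))"]
      connected_cplx_le[OF assms(1,2), of "dcone_pair n (csum C C') D f \<delta>\<psi> (qsum \<psi> (- \<psi>'))"]
      contractible_over_le[OF assms(1) _ assms(3), of "4 * d" "4 * e" "dcone_pair n (csum C C') D f \<delta>\<psi> (qsum \<psi> (- \<psi>'))"]
    unfolding connected_pair_def connected_quad_def poincare_pair_over_def by blast+
  then show ?thesis unfolding ab Lcobordant_def by blast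
qed

section \<open>Cutting quadratic complexes and pairs near N\<close>

section \<open>Excision for complexes and pairs\<close>

text \<open>Its purpose is to locate the end points of all paths in the relation; they lie at
  generators, which is what restricting the relation to A requires.\<close>

lemma qrel_mor:
  assumes C: "fcc P e C" and \<psi>: "qmor P n e C \<psi>" and e: "0 \<le> e"
  shows "mor P (2 * e) (mods C (n - r - int s - 1)) (mods C r) (qrel n C \<psi> s r)"
proof -
  have i: "n - r - int s - 1 = n - (r + 1) - int s" "n - r - int s - 1 = n - r - int (s + 1)" by simp_all
  have "mor P (2 * e) (mods C (n - r - int s - 1)) (mods C r) (diff C (r + 1) \<odot> \<psi> s (r + 1))"
    by (rule mor_gcomp[OF qmorD[OF \<psi> i(1)] fccD(4)[OF C]]) simp
  moreover have "mor P (2 * e) (mods C (n - r - int s - 1)) (mods C r) (\<psi> s r \<odot> dual (diff C (n - r - int s)))"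
    by (rule mor_gcomp[OF fccD(5)[OF C] qmorD[OF \<psi> refl]]) simp
  moreover have "mor P (2 * e) (mods C (n - r - int s - 1)) (mods C r) (\<psi> (s + 1) r)"
    by (rule mor_mono[OF qmorD[OF \<psi> i(2)]]) (use e in simp)
  moreover have "mor P (2 * e) (mods C (n - r - int s - 1)) (mods C r) (dualT n \<psi> (s + 1) r)"
    by (rule mor_mono[OF qmor_dualT[OF \<psi> i(2)]]) (use e in simp)
  ultimately show ?thesis unfolding qrel_def by (intro mor_add mor_msign[THEN iffD2])
qed

definition over_all :: "('m, 'x) control \<Rightarrow> 'x set \<Rightarrow> ('g, 'm) gmod \<Rightarrow> bool" where
  "over_all P V G \<longleftrightarrow> (\<forall>x u. G x = Some u \<longrightarrow> cmap P u \<in> V)"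

lemma mor_restr_source:
  "mor P e G H f \<Longrightarrow> over_all P V G \<Longrightarrow> safe P A e V \<Longrightarrow> mor (restr P A) e G H f"
  by (rule mor_restr, assumption, assumption, unfold over_all_def mor_def, blast)

lemma mor_restr_target:
  "mor P e G H f \<Longrightarrow> over_all P V H \<Longrightarrow> safe P A e V \<Longrightarrow> mor (restr P A) e G H f"
  by (rule mor_restr, assumption, assumption, unfold over_all_def mor_def, blast)

lemma sim_restr_target:
  assumes "sim P e f g" "mor P a G H f" "mor P b G' H g" "over_all P V H" "safe P A e V"
  shows "sim (restr P A) e f g"
  by (rule sim_restr[OF assms(1,5)]; use assms(2,3,4) in \<open>unfold over_all_def mor_def, blast\<close>)

lemma gmodule_restr: "gmodule P G \<Longrightarrow> over_all P V G \<Longrightarrow> safe P A e V \<Longrightarrow> 0 \<le> e \<Longrightarrow> gmodule (restr P A) G"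
proof -
  assume a: "gmodule P G" "over_all P V G" "safe P A e V" "0 \<le> e"
  have "u \<in> cdom P \<and> cmap P u \<in> A" if "G x = Some u" for x u
  proof -
    have u: "u \<in> cdom P" "cmap P u \<in> V" using a(1,2) that by (auto simp: gmodule_def over_all_def intro: ranI)
    have "cmap P ` {u} \<subseteq> A" using a(3,4) u unfolding safe_def by (intro a(3)[unfolded safe_def, rule_format, of "{u}" u]) auto
    then show ?thesis using u by simp
  qed
  then show ?thesis by (auto simp: gmodule_def ran_def)
qed

lemma chain_complex_restr:
  assumes E: "fcc P e E" and dd: "\<And>r. sim P (2 * e) (diff E (r - 1) \<odot> diff E r) 0"
    and V: "\<And>r. over_all P V (mods E r)" and safe: "safe P A (3 * e) V" and e: "0 \<le> e"
  shows "chain_complex (restr P A) e E"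
  unfolding chain_complex_def
proof (intro allI conjI)
  fix r
  have s: "safe P A e V" "safe P A (2 * e) V" by (rule safe_mono[OF safe]; use e in auto)+
  show "gmodule (restr P A) (mods E r)" by (rule gmodule_restr[OF fccD(2)[OF E] V safe]) (use e in simp)
  show "emorphism (restr P A) e (mods E r) (mods E (r - 1)) (diff E r)"
    by (rule mor_imp_emorphism[OF mor_restr_source[OF fccD(3)[OF E] V s(1)]])
  show "sim (restr P A) (2 * e) (diff E (r - 1) \<odot> diff E r) 0"
    by (rule sim_restr_target[OF dd mor_gcomp[OF fccD(3)[OF E] fccD(3)[OF E] order_refl] mor_zero V s(2)])
qed

lemma quad_complex_restr:
  assumes E: "fcc P e E" and dd: "\<And>r. sim P (2 * e) (diff E (r - 1) \<odot> diff E r) 0"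
    and dim: "dimensional n E"
    and \<psi>: "qmor P n e E \<psi>" and q: "\<And>s r. sim P (3 * e) (qrel n E \<psi> s r) 0"
    and V: "\<And>r. over_all P V (mods E r)" and safe: "safe P A (3 * e) V" and e: "0 \<le> e"
  shows "quad_complex (restr P A) n e E \<psi>"
proof -
  have s: "safe P A e V" by (rule safe_mono[OF safe]; use e in auto)
  have "qfamily (restr P A) n e E \<psi>" unfolding qfamily_def
  proof (intro allI)
    fix s r
    show "emorphism (restr P A) e (mods E (n - r - int s)) (mods E r) (\<psi> s r)"
      by (rule mor_imp_emorphism[OF mor_restr_source[OF qmorD[OF \<psi> refl] V \<open>safe P A e V\<close>]])
  qed
  moreover have "sim (restr P A) (3 * e) (qrel n E \<psi> s r) 0" for s r
    by (rule sim_restr_target[OF q qrel_mor[OF E \<psi> e] mor_zero V safe])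
  ultimately show ?thesis
    using chain_complex_restr[OF E dd V safe e] dim by (simp add: quad_complex_def quad_structure_def)
qed

text \<open>The projection and its dual are both the identity of E with a larger source or target.
  Constant paths have radius 0, so p_%\<psi> has the radius of \<psi> and is homotopic, within this
  radius, to the restriction of the coefficients of \<psi>.\<close>

lemma gid_push_sim:
  fixes C E :: "('g, 'm::topological_space, 'r::involution_ring) cplx"
  assumes \<psi>: "qmor P n e C \<psi>" and C: "fcc P e C" and E: "\<And>r. mods E r \<subseteq>\<^sub>m mods C r" and e: "0 \<le> e"
    and p: "\<And>r. p r = gid (mods E r)"
  shows "qmor P n e E (push n p \<psi>)" "qsim P n e E (push n p \<psi>) \<psi>"
proof -
  have fin: "finite (dom (mods E r))" for r
    using fccD(1)[OF C] map_le_implies_dom_le[OF E] finite_subset by blast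
  have gm: "gmodule P (mods E r)" for r by (rule gmodule_le[OF fccD(2)[OF C] E])
  have g: "mor P 0 (mods E r) (mods E r) (gid (mods E r) :: ('g, 'g, 'm, 'r) gmor)" for r
    by (rule mor_gid[OF fin gm order_refl])
  have gC: "mor P 0 (mods E r) (mods C r) (gid (mods E r) :: ('g, 'g, 'm, 'r) gmor)"
    "mor P 0 (mods C r) (mods E r) (gid (mods E r) :: ('g, 'g, 'm, 'r) gmor)" for r
    by (rule mor_le[OF g]; simp add: E)+
  have eq: "push n p \<psi> s r = gid (mods E r) \<odot> \<psi> s r \<odot> gid (mods E (n - r - int s))" for s r
    by (simp add: push_def p)
  have m1: "mor P e (mods E (n - r - int s)) (mods C r) (\<psi> s r \<odot> gid (mods E (n - r - int s)))" for s r
    by (rule mor_gcomp[OF gC(1) qmorD[OF \<psi> refl]]) simp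
  show "qmor P n e E (push n p \<psi>)"
    unfolding qmor_def eq by (intro allI mor_gcomp[OF m1 gC(2)]) simp
  show "qsim P n e E (push n p \<psi>) \<psi>"
    unfolding qsim_def eq
  proof (intro allI)
    fix s r
    let ?k = "n - r - int s"
    have m2: "mor P e (mods C ?k) (mods C r) (mask (dom (mods E ?k)) UNIV (\<psi> s r))"
      by (rule mor_mask_same[OF qmorD[OF \<psi> refl]])
    have "sim P e (gid (mods E r) \<odot> \<psi> s r \<odot> gid (mods E ?k)) (gid (mods E r) \<odot> mask (dom (mods E ?k)) UNIV (\<psi> s r))"
      by (rule sim_gcomp_right[OF gcomp_gid_right[OF qmorD[OF \<psi> refl] E fin] m1 m2 gC(2)]) simp
    also have "sim P e (gid (mods E r) \<odot> mask (dom (mods E ?k)) UNIV (\<psi> s r))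
       (mask UNIV (dom (mods E r)) (mask (dom (mods E ?k)) UNIV (\<psi> s r)))"
      by (rule gcomp_gid_left[OF m2 E fin])
    finally show "sim P e (gid (mods E r) \<odot> \<psi> s r \<odot> gid (mods E ?k)) (mask (dom (mods E ?k)) (dom (mods E r)) (\<psi> s r))"
      by simp
  qed
qed

lemma dim_le: "dimensional n C \<Longrightarrow> mods E r \<subseteq>\<^sub>m mods C r \<Longrightarrow> \<not> (0 \<le> r \<and> r \<le> n) \<Longrightarrow> mods E r = Map.empty"
  unfolding dimensional_def by (metis map_le_antisym map_le_empty)

lemma dimD: "dimensional n C \<Longrightarrow> mods C r x = Some u \<Longrightarrow> 0 \<le> r \<and> r \<le> n"
  unfolding dimensional_def by (metis option.distinct(1))

text \<open>The setting is a locale because it is used twice: for X as the union of A and B, and for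
  A as the union of A and N, which yields composite (a).\<close>

locale excision =
  fixes P :: "('m::topological_space, 'x::metric_space) control" and A B N :: "'x set"
  assumes P: "control_map P"
    and A: "closedin (top_of_set (cbase P)) A"
    and B: "closedin (top_of_set (cbase P)) B"
    and X: "cbase P = A \<union> B"
    and N: "N = A \<inter> B"
begin

lemma safe_far: "e \<le> k \<Longrightarrow> safe P A e (far A N k)"
  unfolding safe_def
proof (intro allI impI)
  fix K u
  assume a: "e \<le> k" "connected K \<and> K \<subseteq> cdom P \<and> u \<in> K \<and> cmap P u \<in> far A N k \<and> cmap P ` K \<subseteq> cball (cmap P u) e"
  then have "cmap P ` K \<subseteq> far A N (k - e)" by (intro far_move[OF P A B X N]) auto
  then show "cmap P ` K \<subseteq> A" by (auto simp: far_def)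
qed

lemma mpath_far:
  assumes "mpath P e \<rho>" "cmap P (pathstart \<rho>) \<in> far A N k" "e \<le> k" "l \<le> k - e"
  shows "cmap P (pathfinish \<rho>) \<in> far A N l"
proof -
  have "cmap P ` path_image \<rho> \<subseteq> far A N (k - e)"
    by (rule far_move[OF P A B X N, where u = "pathstart \<rho>"])
      (use assms in \<open>auto simp: mpath_def gpaths_def intro!: connected_path_image\<close>)
  then show ?thesis using far_mono[OF assms(4)] by blast
qed

lemma mpath_far':
  assumes "mpath P e \<rho>" "cmap P (pathfinish \<rho>) \<in> far A N k" "e \<le> k" "l \<le> k - e"
  shows "cmap P (pathstart \<rho>) \<in> far A N l"
  using mpath_far[OF mpath_prev[OF assms(1)], of k l] assms by simp

text \<open>The thresholds \<open>k\<close> are a parameter: they are built from \<epsilon> for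
  representatives and from \<delta>, with one more step, for cobordisms.\<close>

definition cut :: "('g, 'm, 'r::involution_ring) cplx \<Rightarrow> (int \<Rightarrow> real) \<Rightarrow> int \<Rightarrow> ('g, 'm) gmod" where
  "cut C k r = over P (mods C r) (B \<union> closed_nbhd (cbase P) N (k r))"

lemma dom_cut: "dom (cut C k r) = {x. \<exists>u. mods C r x = Some u \<and> cmap P u \<in> B \<union> closed_nbhd (cbase P) N (k r)}"
proof -
  let ?S = "{x. \<exists>u. mods C r x = Some u \<and> cmap P u \<in> B \<union> closed_nbhd (cbase P) N (k r)}"
  have "?S \<subseteq> dom (mods C r)" by (auto simp only: mem_Collect_eq domI)
  then show ?thesis unfolding cut_def over_def by (simp only: dom_restrict Int_absorb1)
qed

lemma quotient_mods:
  assumes "0 \<le> k r" "gmodule P (mods C r)"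
  shows "mods (quotient_cplx C (cut C k)) r x = Some u \<longleftrightarrow> mods C r x = Some u \<and> cmap P u \<in> far A N (k r)"
proof -
  have "cmap P u \<in> cbase P" if "mods C r x = Some u"
    using that P assms(2) by (auto simp: control_map_def gmodule_def ran_def)
  note u = this
  have eq: "mods (quotient_cplx C (cut C k)) r x = (if x \<in> dom (cut C k r) then None else mods C r x)"
    by (simp add: quotient_cplx_def quotient_mod_def restrict_map_def)
  show ?thesis
  proof (cases "mods C r x = Some u")
    case True
    then have "x \<in> dom (cut C k r) \<longleftrightarrow> cmap P u \<in> B \<union> closed_nbhd (cbase P) N (k r)"
      unfolding dom_cut by simp
    then show ?thesis using u[OF True] True far_eq[OF assms(1) N X] unfolding eq by auto
  next
    case False
    then show ?thesis unfolding eq by simp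
  qed
qed

lemma quotient_mods_le: "mods (quotient_cplx C C') r \<subseteq>\<^sub>m mods C r"
  by (simp add: quotient_cplx_def quotient_mod_def map_le_def)

text \<open>A path of d that ends deeper than \<open>k (r - 1)\<close> starts deeper than
  \<open>k (r - 1) - e\<close>, hence deeper than \<open>k r\<close>. So a retained target forces a
  retained source once the thresholds drop by at least e per degree, as far up as there are
  generators.\<close>

lemma quot_of_quotient:
  assumes C: "fcc P e C" and dim: "dimensional m C" and e: "0 \<le> e"
    and k: "\<And>r. r \<le> m \<Longrightarrow> 0 \<le> k r \<and> k r + e \<le> k (r - 1)"
  shows "quot_of (quotient_cplx C (cut C k)) C"
  unfolding quot_of_def
proof (intro allI conjI impI)
  let ?E = "quotient_cplx C (cut C k)"
  fix r
  show "mods ?E r \<subseteq>\<^sub>m mods C r" by (rule quotient_mods_le)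
  show "diff ?E r = mask (dom (mods ?E r)) (dom (mods ?E (r - 1))) (diff C r)"
    by (simp add: quotient_cplx_def mask_def)
  fix x y \<rho>
  assume x: "x \<notin> dom (mods ?E r)" and y: "y \<in> dom (mods ?E (r - 1))"
  show "diff C r x y \<rho> = 0"
  proof (rule ccontr)
    assume nz: "diff C r x y \<rho> \<noteq> 0"
    note m = morD[OF fccD(3)[OF C] nz]
    have r: "r \<le> m" using dimD[OF dim m(2)] by simp
    have "mods ?E (r - 1) y = Some (pathfinish \<rho>)"
      using y m(3) quotient_mods_le[of C "cut C k" "r - 1"] by (auto simp: map_le_def)
    then have "cmap P (pathfinish \<rho>) \<in> far A N (k (r - 1))"
      using quotient_mods[of k "r - 1" C, OF _ fccD(2)[OF C]] k[of "r - 1"] r by auto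
    then have "cmap P (pathstart \<rho>) \<in> far A N (k r)"
      by (rule mpath_far'[OF m(1)]) (use k[OF r] in auto)
    then have "mods ?E r x = Some (pathstart \<rho>)"
      using quotient_mods[of k r C, OF _ fccD(2)[OF C]] k[OF r] m(2) by simp
    then show False using x by auto
  qed
qed

lemma geom_subcomplex_cut:
  assumes "quot_of (quotient_cplx C (cut C k)) C"
  shows "geom_subcomplex C (cut C k)"
  unfolding geom_subcomplex_def
proof (intro allI conjI ballI)
  fix r
  show "cut C k r \<subseteq>\<^sub>m mods C r" by (auto simp: cut_def over_def map_le_def)
  fix x y \<rho> assume "x \<in> dom (cut C k r)" "y \<in> dom (mods C (r - 1)) - dom (cut C k (r - 1))"
  then show "diff C r x y \<rho> = 0"
    by (intro quot_ofD(4)[OF assms]) (auto simp: quotient_cplx_def quotient_mod_def)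
qed

text \<open>The depth \<open>K\<close> of the Poincare region is left free because the cut made with
  \<epsilon> is later used with the depth (n+5)4\<delta>.\<close>

theorem quotient_complex:
  fixes C :: "('g, 'm, 'r::involution_ring) cplx" and n :: int and e K :: real and \<psi> :: "('g, 'm, 'r) qstr"
  defines "k \<equiv> \<lambda>r. real_of_int (n + 2 - r) * 4 * e"
  defines "E \<equiv> quotient_cplx C (cut C k)"
  defines "\<psi>' \<equiv> push n (quotient_proj C (cut C k)) \<psi>"
  assumes n: "1 \<le> n" and e: "0 \<le> e" and fin: "fin_gen C" and q: "quad_complex P n e C \<psi>"
  shows "quot_of E C" "qmor P n e E \<psi>'" "qsim P n e E \<psi>' \<psi>" "fin_gen E"
    "quad_complex (restr P A) n e E \<psi>'"
    "connected_quad P n e C \<psi> \<Longrightarrow> connected_quad (restr P A) n e E \<psi>'"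
    "poincare_over P n e (cbase P - B) C \<psi> \<Longrightarrow> real_of_int (n + 5) * 4 * e \<le> K \<Longrightarrow>
       poincare_over (restr P A) n e (far A N K) E \<psi>'"
proof -
  have C: "fcc P e C" and dim: "dimensional n C" and \<psi>: "qmor P n e C \<psi>"
    and dd: "\<And>r. sim P (2 * e) (diff C (r - 1) \<odot> diff C r) 0"
    and qr: "\<And>s r. sim P (3 * e) (qrel n C \<psi> s r) 0"
    using q fin fccI qmorI by (auto simp: quad_complex_def quad_structure_def chain_complex_def)
  \<comment> \<open>In the top degree r = n the factor n + 2 - r is 2, which gives 8e, the largest
    radius of a homotopy in the relations treated below.\<close>
  have k0: "8 * e \<le> k r" if "r \<le> n" for r
  proof -
    have "(8::real) \<le> real_of_int (n + 2 - r) * 4" using that by simp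
    then show ?thesis unfolding k_def by (rule mult_right_mono) (rule e)
  qed
  have k1: "k r \<le> l" if "0 \<le> r" "real_of_int (n + 2) * 4 * e \<le> l" for r l
  proof -
    have "k r \<le> real_of_int (n + 2) * 4 * e" unfolding k_def
      by (intro mult_right_mono) (use that e in auto)
    then show ?thesis using that by simp
  qed
  show E: "quot_of E C" unfolding E_def
  proof (rule quot_of_quotient[OF C dim e])
    fix r assume "r \<le> n"
    then show "0 \<le> k r \<and> k r + e \<le> k (r - 1)" using k0[of r] e by (auto simp: k_def algebra_simps)
  qed
  have p: "quotient_proj C (cut C k) r = gid (mods E r)" for r
    by (simp add: quotient_proj_def E_def quotient_cplx_def)
  show \<psi>': "qmor P n e E \<psi>'" "qsim P n e E \<psi>' \<psi>"
    unfolding \<psi>'_def by (rule gid_push_sim[OF \<psi> C quot_ofD(1)[OF E] e p])+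
  show finE: "fin_gen E" using quot_of_finite[OF E fccD(1)[OF C]] by (simp add: fin_gen_def)
  note Ef = quot_fcc[OF C E]
  have Em: "mods E r x = Some u \<longleftrightarrow> mods C r x = Some u \<and> cmap P u \<in> far A N (k r)" if "r \<le> n" for r x u
    unfolding E_def by (rule quotient_mods) (use k0[OF that] e fccD(2)[OF C] in auto)
  have dimE: "dimensional n E" unfolding dimensional_def using dim_le[OF dim quot_ofD(1)[OF E]] by blast
  have V: "over_all P (far A N (8 * e)) (mods E r)" for r
    unfolding over_all_def
  proof (intro allI impI)
    fix x u assume a: "mods E r x = Some u"
    have "r \<le> n" using dimD[OF dimE a] by simp
    then show "cmap P u \<in> far A N (8 * e)" using Em a far_mono[OF k0] by blast
  qed
  \<comment> \<open>Beyond the threshold of degree 0, which is the largest, a generator of any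
    degree survives. The Poincare condition involves all degrees and its dual summand reverses them,
    so this bound is used uniformly.\<close>
  have mem: "y \<in> dom (mods E s)" if "mods C s y = Some u" "cmap P u \<in> far A N l" "real_of_int (n + 2) * 4 * e \<le> l" for s y u l
  proof -
    have "0 \<le> s" "s \<le> n" using dimD[OF dim that(1)] by auto
    then have "cmap P u \<in> far A N (k s)" using far_mono[OF k1[OF _ that(3)]] that(2) by blast
    then show ?thesis using Em[OF \<open>s \<le> n\<close>] that(1) by auto
  qed
  show "quad_complex (restr P A) n e E \<psi>'"
  proof (rule quad_complex_restr[OF Ef _ dimE \<psi>'(1) _ V safe_far e])
    show "sim P (2 * e) (diff E (r - 1) \<odot> diff E r) 0" for r
      using sim_mask[OF dd[of r]] quot_dd[OF E, of r] by (metis mask_zero)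
    show "sim P (3 * e) (qrel n E \<psi>' s r) 0" for s r
      using sim_trans[OF qrel_sim[OF C E \<psi> \<psi>' e] sim_mask[OF qr]] by simp
    show "3 * e \<le> 8 * e" using e by simp
  qed
  note dC = dcone_fcc[OF C \<psi>] and dE = dcone_fcc[OF Ef \<psi>'(1)]
  have c4: "e \<le> 4 * e" using e by simp
  have dE1: "mor P e (mods (dcone n E \<psi>') 1) (mods (dcone n E \<psi>') 0) (diff (dcone n E \<psi>') 1)"
    "mor P e (mods (dcone n C \<psi>) 1) (mods (dcone n C \<psi>) 0) (diff (dcone n C \<psi>) 1)"
    using fccD(3)[OF dE, of 1] fccD(3)[OF dC, of 1] by simp_all
  have s1: "sim P e (diff (dcone n E \<psi>') 1)
     (mask (dom (mods (dcone n E \<psi>') 1)) (dom (mods (dcone n E \<psi>') 0)) (diff (dcone n C \<psi>) 1))"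
    using dcone_sim[OF C E \<psi> \<psi>', of 1] by simp
  show "connected_quad (restr P A) n e E \<psi>'" if c: "connected_quad P n e C \<psi>"
    unfolding connected_quad_def
  proof (rule connected_local[OF c[unfolded connected_quad_def] fccD(1)[OF dC] dE1(2) dcone_le[OF E] dE1(1) s1 c4 e])
    let ?V = "far A N (real_of_int (n + 2) * 4 * e)"
    \<comment> \<open>The dual summand of the cone in degree 0 is C in degree n + 1, which is zero;
      all generators there come from C in degree 0 and lie beyond the largest threshold.\<close>
    have 0: "cmap P u \<in> ?V" if "mods (dcone n E \<psi>') 0 x = Some u" for x u
    proof (cases x)
      case (Inl i)
      then show ?thesis using that Em[of 0 i u] n by (simp add: dcone_simps k_def)
    next
      case (Inr i)
      have "mods E (n + 1) = Map.empty" using dimE by (simp add: dimensional_def)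
      then show ?thesis using that Inr by (simp add: dcone_simps)
    qed
    then show "\<And>x u. mods (dcone n E \<psi>') 0 x = Some u \<Longrightarrow> cmap P u \<in> ?V" .
    have "8 * e \<le> real_of_int (n + 2) * 4 * e" using k0[of 0] n by (simp add: k_def)
    then show "safe P A (8 * e) ?V" by (rule safe_far)
    fix x y \<rho>
    assume a: "mods (dcone n E \<psi>') 0 x = Some (pathstart \<rho>)" "mpath P (4 * e) \<rho>"
      "mods (dcone n C \<psi>) 1 y = Some (pathfinish \<rho>)"
    \<comment> \<open>Here the step 4e per degree is used: it equals the radius of the section
      supplied by connectedness.\<close>
    have kk: "k 1 = real_of_int (n + 2) * 4 * e - 4 * e" by (simp add: k_def algebra_simps)
    have "8 * e \<le> k 1" using k0 n by simp
    then have f: "cmap P (pathfinish \<rho>) \<in> far A N (k 1)"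
      by (intro mpath_far[OF a(2) 0[OF a(1)]]) (use kk e in auto)
    show "y \<in> dom (mods (dcone n E \<psi>') 1)"
    proof (cases y)
      case (Inl i)
      then show ?thesis using a(3) Em[of 1 i "pathfinish \<rho>"] n f by (auto simp: dcone_simps)
    next
      case (Inr i)
      \<comment> \<open>The dual summand in degree 1 is C in degree n. Its generators survive as
        well, because n is at least 1 and the thresholds decrease with the degree.\<close>
      have "k n \<le> k 1" unfolding k_def by (intro mult_right_mono) (use n e in auto)
      then show ?thesis using a(3) Em[of n i "pathfinish \<rho>"] f far_mono[of "k n" "k 1"] Inr by (auto simp: dcone_simps)
    qed
  qed
  show "poincare_over (restr P A) n e (far A N K) E \<psi>'"
    if c: "poincare_over P n e (cbase P - B) C \<psi>" and K: "real_of_int (n + 5) * 4 * e \<le> K"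
    unfolding poincare_over_def
  proof (rule contractible_local[OF c[unfolded poincare_over_def] fccD(1)[OF dC] fccD(3)[OF dC] dcone_le[OF E]
        fccD(2)[OF dE] fccD(3)[OF dE] dcone_sim[OF C E \<psi> \<psi>'] c4 e])
    \<comment> \<open>After a path of a contraction, of radius 4e, starting in the Poincare region,
      the depth still exceeds the largest threshold (n+2)4e.\<close>
    have K0: "real_of_int (n + 2) * 4 * e + 12 * e \<le> K" using K by (simp add: algebra_simps)
    have K8: "8 * e \<le> real_of_int (n + 2) * 4 * e" using k0[of 0] n by (simp add: k_def)
    show "far A N K \<subseteq> cbase P - B"
      using far_eq[OF _ N X, of K] K0 K8 e by auto
    show "far A N K \<subseteq> far A N (8 * e)" by (rule far_mono) (use K0 K8 e in auto)
    show "safe P A (8 * e) (far A N (8 * e))" by (rule safe_far) simp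
    fix r s x y \<rho>
    assume a: "cmap P (pathstart \<rho>) \<in> far A N K" "mpath P (4 * e) \<rho>"
      "mods (dcone n C \<psi>) s y = Some (pathfinish \<rho>)"
    have f: "cmap P (pathfinish \<rho>) \<in> far A N (K - 4 * e)"
      by (rule mpath_far[OF a(2,1)]) (use K0 K8 e in auto)
    have l: "real_of_int (n + 2) * 4 * e \<le> K - 4 * e" using K0 e by simp
    have "y \<in> dom (mods (dcone n E \<psi>') s)"
    proof (cases y)
      case (Inl i)
      then show ?thesis using a(3) mem[OF _ f l, of s i] by (auto simp: dcone_simps)
    next
      case (Inr i)
      then show ?thesis using a(3) mem[OF _ f l, of "n + 1 - s" i] by (auto simp: dcone_simps)
    qed
    moreover have "far A N (K - 4 * e) \<subseteq> far A N (8 * e)" by (rule far_mono) (use K8 l in simp)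
    ultimately show "y \<in> dom (mods (dcone n E \<psi>') s) \<and> cmap P (pathfinish \<rho>) \<in> far A N (8 * e)"
      using f by blast
  qed
qed

end

lemma has_radius_mask: "has_radius P e f \<Longrightarrow> has_radius (restr P A) e (mask S T f)"
  unfolding has_radius_def by (simp add: mask_def)

context excision
begin

text \<open>The quotient of the boundary is a datum and not a cut, since it may be cut with the
  smaller \<epsilon>, or left uncut on one summand. What links it to the cut of D is
  \<open>mem\<close>: generators beyond the thresholds of this radius are retained. An uncut summand
  may have generators over B, so the control space is some A' containing A, whereas the quotient of
  D lies over A.\<close>

theorem quotient_pair:
  fixes C C' :: "('g, 'm, 'r::involution_ring) cplx" and D :: "('h, 'm, 'r) cplx" and n :: int and e K :: real
    and f \<delta>\<psi> \<psi> \<psi>'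
  \<comment> \<open>D has dimension n + 1: with n + 3 its threshold in the top degree is again 8e,
    and in each degree it is one step of 4e above the threshold for C.\<close>
  defines "k \<equiv> \<lambda>r. real_of_int (n + 3 - r) * 4 * e"
  defines "D' \<equiv> quotient_cplx D (cut D k)"
  defines "f' \<equiv> \<lambda>r. mask (dom (mods C' r)) (dom (mods D' r)) (f r)"
  defines "\<delta>\<psi>' \<equiv> \<lambda>s r. mask (dom (mods D' (n + 1 - r - int s))) (dom (mods D' r)) (\<delta>\<psi> s r)"
  assumes n: "1 \<le> n" and e: "0 \<le> e" and fin: "fin_gen C" "fin_gen D"
    and q: "quad_pair P n e C D f \<delta>\<psi> \<psi>" and c: "connected_pair P n e C D f \<delta>\<psi> \<psi>"
    and p: "poincare_pair_over P n e (cbase P - B) C D f \<delta>\<psi> \<psi>"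
    and C': "quot_of C' C"
    and mem: "\<And>r x u. mods C r x = Some u \<Longrightarrow> cmap P u \<in> far A N (real_of_int (n + 2 - r) * 4 * e) \<Longrightarrow> x \<in> dom (mods C' r)"
    and \<psi>': "qmor P n e C' \<psi>'" "qsim P n e C' \<psi>' \<psi>"
    and A': "A \<subseteq> A'" and K: "real_of_int (n + 5) * 4 * e \<le> K"
    and bd: "quad_complex (restr P A') n e C' \<psi>'" "connected_quad (restr P A') n e C' \<psi>'"
      "poincare_over (restr P A') n e (far A N K) C' \<psi>'"
  shows "fin_gen D'" "quad_pair (restr P A') n e C' D' f' \<delta>\<psi>' \<psi>'"
    "connected_pair (restr P A') n e C' D' f' \<delta>\<psi>' \<psi>'"
    "poincare_pair_over (restr P A') n e (far A N K) C' D' f' \<delta>\<psi>' \<psi>'"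
proof -
  have C: "fcc P e C" and dimC: "dimensional n C" and \<psi>: "qmor P n e C \<psi>"
    using q fin fccI qmorI by (auto simp: quad_pair_def quad_complex_def quad_structure_def)
  have D: "fcc P e D" and dim: "dimensional (n + 1) D" and \<delta>\<psi>: "qmor P (n + 1) e D \<delta>\<psi>"
    using q fin fccI qmorI by (auto simp: quad_pair_def)
  have dd: "sim P (2 * e) (diff D (r - 1) \<odot> diff D r) 0" for r
    using q by (simp add: quad_pair_def chain_complex_def)
  have qr: "sim P (3 * e) (qrel (n + 1) D \<delta>\<psi> s r + msign n (push n f \<psi> s r)) 0" for s r
    using q by (simp add: quad_pair_def)
  have cm: "chain_map P e C D f" using q by (simp add: quad_pair_def)
  have fm: "fmor P e C D f" unfolding fmor_def
    by (intro allI emorphism_imp_mor fccD(1)[OF C]) (use cm in \<open>simp add: chain_map_def\<close>)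
  note fr = fm[unfolded fmor_def, rule_format]
  have k0: "8 * e \<le> k r" if "r \<le> n + 1" for r
  proof -
    have "(8::real) \<le> real_of_int (n + 3 - r) * 4" using that by simp
    then show ?thesis unfolding k_def by (rule mult_right_mono) (rule e)
  qed
  have k1: "k r \<le> l" if "0 \<le> r" "real_of_int (n + 3) * 4 * e \<le> l" for r l
  proof -
    have "k r \<le> real_of_int (n + 3) * 4 * e" unfolding k_def
      by (intro mult_right_mono) (use that e in auto)
    then show ?thesis using that by simp
  qed
  have D': "quot_of D' D" unfolding D'_def
  proof (rule quot_of_quotient[OF D dim e])
    fix r assume "r \<le> n + 1"
    then show "0 \<le> k r \<and> k r + e \<le> k (r - 1)" using k0[of r] e by (auto simp: k_def algebra_simps)
  qed
  note Cf = quot_fcc[OF C C'] and Df = quot_fcc[OF D D']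
  show finD: "fin_gen D'" using quot_of_finite[OF D' fccD(1)[OF D]] by (simp add: fin_gen_def)
  have Dm: "mods D' r x = Some u \<longleftrightarrow> mods D r x = Some u \<and> cmap P u \<in> far A N (k r)" if "r \<le> n + 1" for r x u
    unfolding D'_def by (rule quotient_mods) (use k0[OF that] e fccD(2)[OF D] in auto)
  have dimD': "dimensional (n + 1) D'" unfolding dimensional_def using dim_le[OF dim quot_ofD(1)[OF D']] by blast
  have dimC': "dimensional n C'" unfolding dimensional_def using dim_le[OF dimC quot_ofD(1)[OF C']] by blast
  have V: "over_all P (far A N (8 * e)) (mods D' r)" for r
    unfolding over_all_def
  proof (intro allI impI)
    fix x u assume a: "mods D' r x = Some u"
    have "r \<le> n + 1" using dimD[OF dimD' a] by simp
    then show "cmap P u \<in> far A N (8 * e)" using Dm a far_mono[OF k0] by blast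
  qed
  have safe: "safe P A' l (far A N (8 * e))" if "l \<le> 8 * e" for l
    by (rule safe_mono[OF safe_far[OF order_refl] that subset_refl A'])
  \<comment> \<open>The extra step of 4e covers the radius e of f: a path of f that ends at a
    retained generator of D starts beyond the threshold for C in the same degree, and
    \<open>mem\<close> retains its source.\<close>
  have f0: "f r x y \<rho> = 0" if "x \<notin> dom (mods C' r)" "y \<in> dom (mods D' r)" for r x y \<rho>
  proof (rule ccontr)
    assume nz: "f r x y \<rho> \<noteq> 0"
    note m = morD[OF fr nz]
    have r: "r \<le> n + 1" using dimD[OF dim m(3)] by simp
    have "mods D' r y = Some (pathfinish \<rho>)"
      using that(2) m(3) quot_ofD(1)[OF D', of r] by (auto simp: map_le_def)
    then have "cmap P (pathfinish \<rho>) \<in> far A N (k r)" using Dm[OF r] by simp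
    then have "cmap P (pathstart \<rho>) \<in> far A N (real_of_int (n + 2 - r) * 4 * e)"
      by (rule mpath_far'[OF m(1)]) (use k0[OF r] e in \<open>auto simp: k_def algebra_simps\<close>)
    then show False using mem[OF m(2)] that(1) by blast
  qed
  have f'm: "mor P e (mods C' r) (mods D' r) (f' r)" for r
    unfolding f'_def by (rule mor_mask_le[OF fr quot_ofD(1)[OF C'] quot_ofD(1)[OF D']])
  then have f'f: "fmor P e C' D' f'" by (simp add: fmor_def)
  have f'eq: "f' r = mask (dom (mods C' r)) (dom (mods D' r)) (f r)" for r by (simp add: f'_def)
  have \<delta>\<psi>': "qmor P (n + 1) e D' \<delta>\<psi>'" "qsim P (n + 1) e D' \<delta>\<psi>' \<delta>\<psi>"
    unfolding qmor_def qsim_def \<delta>\<psi>'_def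
    by (intro allI mor_mask_le[OF qmorD[OF \<delta>\<psi> refl] quot_ofD(1)[OF D'] quot_ofD(1)[OF D']], simp)
  have df: "diff D' r \<odot> f' r = mask (dom (mods C' r)) (dom (mods D' (r - 1))) (diff D r \<odot> f r)" for r
    unfolding f'eq quot_ofD(2)[OF D', of r] by (rule gcomp_mask) (use quot_ofD(4)[OF D'] in blast)
  have fd: "f' (r - 1) \<odot> diff C' r = mask (dom (mods C' r)) (dom (mods D' (r - 1))) (f (r - 1) \<odot> diff C r)" for r
    unfolding f'eq quot_ofD(2)[OF C', of r] by (rule gcomp_mask) (use f0 in blast)
  have "chain_map (restr P A') e C' D' f'"
    unfolding chain_map_def
  proof (intro allI conjI)
    fix r
    \<comment> \<open>The sources may lie over B, so safety is tested at the targets, all of which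
      are generators of the quotient of D.\<close>
    have s: "safe P A' e (far A N (8 * e))" by (rule safe) (use e in simp)
    show "emorphism (restr P A') e (mods C' r) (mods D' r) (f' r)"
      by (rule mor_imp_emorphism[OF mor_restr_target[OF f'm V s]])
    \<comment> \<open>A chain map has composites with d of radius e, which does not follow from the
      radii of the factors. It is inherited here because the new composites are masks of the old
      ones.\<close>
    show "has_radius (restr P A') e (diff D' r \<odot> f' r)" "has_radius (restr P A') e (f' (r - 1) \<odot> diff C' r)"
      unfolding df fd using cm by (auto simp: chain_map_def intro: has_radius_mask)
    have "sim P e (diff D' r \<odot> f' r) (f' (r - 1) \<odot> diff C' r)"
      unfolding df fd by (rule sim_mask) (use cm in \<open>simp add: chain_map_def\<close>)
    then show "sim (restr P A') e (diff D' r \<odot> f' r) (f' (r - 1) \<odot> diff C' r)"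
      by (rule sim_restr_target[OF _ mor_gcomp[OF f'm fccD(3)[OF Df] order_refl]
            mor_gcomp[OF fccD(3)[OF Cf] f'm order_refl] V s])
  qed
  moreover have "chain_complex (restr P A') e D'"
  proof (rule chain_complex_restr[OF Df _ V safe e])
    show "sim P (2 * e) (diff D' (r - 1) \<odot> diff D' r) 0" for r
      using sim_mask[OF dd[of r]] quot_dd[OF D', of r] by (metis mask_zero)
  qed (use e in simp)
  moreover have "qfamily (restr P A') (n + 1) e D' \<delta>\<psi>'"
    unfolding qfamily_def
    by (intro allI mor_imp_emorphism mor_restr_target[OF qmorD[OF \<delta>\<psi>'(1) refl] V safe]) (use e in simp)
  moreover have "sim (restr P A') (3 * e) (qrel (n + 1) D' \<delta>\<psi>' s r + msign n (push n f' \<psi>' s r)) 0" for s r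
  proof -
    have i: "n + 1 - r - int s - 1 = n - r - int s" by simp
    let ?S = "dom (mods D' (n - r - int s))" and ?T = "dom (mods D' r)"
    have "sim P (3 * e) (qrel (n + 1) D' \<delta>\<psi>' s r + msign n (push n f' \<psi>' s r))
       (mask ?S ?T (qrel (n + 1) D \<delta>\<psi> s r) + msign n (mask ?S ?T (push n f \<psi> s r)))"
      using qrel_sim[OF D D' \<delta>\<psi> \<delta>\<psi>' e, of s r] unfolding i
      by (rule sim_add[OF _ sim_msign[OF push_sim[OF C D fm \<psi> e C' D' \<psi>' f'eq f0]]])
    also have "mask ?S ?T (qrel (n + 1) D \<delta>\<psi> s r) + msign n (mask ?S ?T (push n f \<psi> s r)) =
       mask ?S ?T (qrel (n + 1) D \<delta>\<psi> s r + msign n (push n f \<psi> s r))" by simp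
    also have "sim P (3 * e) \<dots> 0" using sim_mask[OF qr[of s r], of ?S ?T] by simp
    finally have 1: "sim P (3 * e) (qrel (n + 1) D' \<delta>\<psi>' s r + msign n (push n f' \<psi>' s r)) 0" .
    have "mor P (3 * e) (mods D' (n - r - int s)) (mods D' r) (qrel (n + 1) D' \<delta>\<psi>' s r)"
      using qrel_mor[OF Df \<delta>\<psi>'(1) e, of r s] unfolding i by (rule mor_mono) (use e in simp)
    then have 2: "mor P (3 * e) (mods D' (n - r - int s)) (mods D' r) (qrel (n + 1) D' \<delta>\<psi>' s r + msign n (push n f' \<psi>' s r))"
      by (intro mor_add mor_msign[THEN iffD2] push_mor[OF f'f \<psi>'(1) refl])
    show ?thesis by (rule sim_restr_target[OF 1 2 mor_zero V safe]) (use e in simp)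
  qed
  ultimately show "quad_pair (restr P A') n e C' D' f' \<delta>\<psi>' \<psi>'"
    using bd(1) dimD' unfolding quad_pair_def by blast
  let ?F = "dcone_pair n C D f \<delta>\<psi> \<psi>" and ?E = "dcone_pair n C' D' f' \<delta>\<psi>' \<psi>'"
  note F = dcone_pair_fcc[OF C D fm \<psi> \<delta>\<psi> e] and E = dcone_pair_fcc[OF Cf Df f'f \<psi>'(1) \<delta>\<psi>'(1) e]
  note EF = dcone_pair_le[OF C' D', of n f' \<delta>\<psi>' \<psi>' _ f \<delta>\<psi> \<psi>]
  note EFs = dcone_pair_sim[OF C D fm \<psi> \<delta>\<psi> e C' D' \<psi>' \<delta>\<psi>' f'eq f0]
  have c4: "2 * e \<le> 4 * e" using e by simp
  show "connected_pair (restr P A') n e C' D' f' \<delta>\<psi>' \<psi>'"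
    unfolding connected_pair_def
  proof (rule conjI[OF bd(2)], rule connected_local[where F = "?F" and c = "2 * e"])
    let ?V = "far A N (real_of_int (n + 3) * 4 * e)"
    show "connected_cplx P e ?F" using c by (simp add: connected_pair_def)
    show "\<And>r. finite (dom (mods ?F r))" by (rule fccD(1)[OF F])
    show "mor P (2 * e) (mods ?F 1) (mods ?F 0) (diff ?F 1)" "mor P (2 * e) (mods ?E 1) (mods ?E 0) (diff ?E 1)"
      using fccD(3)[OF F, of 1] fccD(3)[OF E, of 1] by simp_all
    show "\<And>r. mods ?E r \<subseteq>\<^sub>m mods ?F r" by (rule EF)
    show "sim P (2 * e) (diff ?E 1) (mask (dom (mods ?E 1)) (dom (mods ?E 0)) (diff ?F 1))"
      using EFs[of 1] by simp
    \<comment> \<open>The cone of the pair in degree 0 is built from D in degree 0, C in degree -1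
      and D in degree n + 2; the last two vanish.\<close>
    have 0: "cmap P u \<in> ?V" if "mods ?E 0 x = Some u" for x u
    proof -
      have e1: "mods C' (- 1) = Map.empty" "mods D' (n + 2) = Map.empty"
        using dimC' dimD' by (auto simp: dimensional_def)
      consider i where "x = Inl (Inl i)" | i where "x = Inl (Inr i)" | i where "x = Inr i"
        by (metis sum.exhaust)
      then show ?thesis
      proof cases
        case 1
        then show ?thesis using that Dm[of 0 i u] n by (simp add: dcone_pair_simps k_def)
      qed (use that e1 in \<open>simp_all add: dcone_pair_simps\<close>)
    qed
    then show "\<And>x u. mods ?E 0 x = Some u \<Longrightarrow> cmap P u \<in> ?V" .
    have "8 * e \<le> real_of_int (n + 3) * 4 * e" using k0[of 0] n by (simp add: k_def)
    then show "safe P A' (8 * e) ?V" by (intro safe_mono[OF safe_far order_refl subset_refl A'])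
    fix x y \<rho>
    assume a: "mods ?E 0 x = Some (pathstart \<rho>)" "mpath P (4 * e) \<rho>" "mods ?F 1 y = Some (pathfinish \<rho>)"
    have kk: "k 1 = real_of_int (n + 3) * 4 * e - 4 * e" by (simp add: k_def algebra_simps)
    have "8 * e \<le> k 1" using k0 n by simp
    then have fk: "cmap P (pathfinish \<rho>) \<in> far A N (k 1)"
      by (intro mpath_far[OF a(2) 0[OF a(1)]]) (use kk e in auto)
    consider i where "y = Inl (Inl i)" | i where "y = Inl (Inr i)" | i where "y = Inr i"
      by (metis sum.exhaust)
    then show "y \<in> dom (mods ?E 1)"
    proof cases
      case 1
      then show ?thesis using a(3) Dm[of 1 i "pathfinish \<rho>"] n fk by (auto simp: dcone_pair_simps)
    next
      case 2
      \<comment> \<open>The threshold for D in degree 1 is the threshold for C in degree 0, so the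
        two summands of the cone in degree 1 are cut at the same depth.\<close>
      have "k 1 = real_of_int (n + 2 - 0) * 4 * e" by (simp add: k_def)
      then show ?thesis using a(3) mem[of 0 i "pathfinish \<rho>"] fk 2 by (auto simp: dcone_pair_simps)
    next
      case 3
      have "k (1 + n) \<le> k 1" unfolding k_def by (intro mult_right_mono) (use n e in auto)
      then show ?thesis using a(3) Dm[of "1 + n" i "pathfinish \<rho>"] fk far_mono[of "k (1 + n)" "k 1"] 3
        by (auto simp: dcone_pair_simps)
    qed
  qed (use e in auto)
  show "poincare_pair_over (restr P A') n e (far A N K) C' D' f' \<delta>\<psi>' \<psi>'"
    unfolding poincare_pair_over_def
  proof (rule conjI[OF bd(3)], rule contractible_local[where F = "?F" and c = "2 * e" and W = "cbase P - B"
        and V = "far A N (8 * e)"])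
    \<comment> \<open>The largest threshold is now (n+3)4e, for D in degree 0; one path of a
      contraction, of radius 4e, still ends beyond it.\<close>
    have K0: "real_of_int (n + 3) * 4 * e + 8 * e \<le> K" using K by (simp add: algebra_simps)
    have K8: "8 * e \<le> real_of_int (n + 3) * 4 * e" using k0[of 0] n by (simp add: k_def)
    show "contractible_over P (4 * e) (cbase P - B) ?F" using p by (simp add: poincare_pair_over_def)
    show "\<And>r. finite (dom (mods ?F r))" "\<And>r. gmodule P (mods ?E r)"
      "\<And>r. mor P (2 * e) (mods ?F r) (mods ?F (r - 1)) (diff ?F r)"
      "\<And>r. mor P (2 * e) (mods ?E r) (mods ?E (r - 1)) (diff ?E r)"
      by (rule fccD[OF F] fccD[OF E])+
    show "\<And>r. mods ?E r \<subseteq>\<^sub>m mods ?F r" by (rule EF)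
    show "\<And>r. sim P (2 * e) (diff ?E r) (mask (dom (mods ?E r)) (dom (mods ?E (r - 1))) (diff ?F r))"
      by (rule EFs)
    show "far A N K \<subseteq> cbase P - B"
      using far_eq[OF _ N X, of K] K0 K8 e by auto
    show "far A N K \<subseteq> far A N (8 * e)" by (rule far_mono) (use K0 K8 e in auto)
    show "safe P A' (8 * e) (far A N (8 * e))" by (rule safe) simp
    fix r s x y \<rho>
    assume a: "cmap P (pathstart \<rho>) \<in> far A N K" "mpath P (4 * e) \<rho>" "mods ?F s y = Some (pathfinish \<rho>)"
    have fk: "cmap P (pathfinish \<rho>) \<in> far A N (K - 4 * e)"
      by (rule mpath_far[OF a(2,1)]) (use K0 K8 e in auto)
    have l: "real_of_int (n + 3) * 4 * e \<le> K - 4 * e" using K0 e by simp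
    have memD: "i \<in> dom (mods D' t)" if i: "mods D t i = Some (pathfinish \<rho>)" for i t
    proof -
      have "0 \<le> t" "t \<le> n + 1" using dimD[OF dim i] by auto
      then have "cmap P (pathfinish \<rho>) \<in> far A N (k t)" using far_mono[OF k1[OF _ l]] fk by blast
      then show ?thesis using Dm[OF \<open>t \<le> n + 1\<close>] i by auto
    qed
    have memC: "i \<in> dom (mods C' t)" if i: "mods C t i = Some (pathfinish \<rho>)" for i t
    proof -
      have "0 \<le> t" using dimD[OF dimC i] by auto
      then have "real_of_int (n + 2 - t) * 4 * e \<le> real_of_int (n + 3) * 4 * e"
        by (intro mult_right_mono) (use e in auto)
      then have "cmap P (pathfinish \<rho>) \<in> far A N (real_of_int (n + 2 - t) * 4 * e)"
        using far_mono[of "real_of_int (n + 2 - t) * 4 * e" "K - 4 * e"] l fk by auto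
      then show ?thesis using mem[OF i] by simp
    qed
    consider i where "y = Inl (Inl i)" | i where "y = Inl (Inr i)" | i where "y = Inr i"
      by (metis sum.exhaust)
    then have "y \<in> dom (mods ?E s)"
    proof cases
      case 1
      then show ?thesis using a(3) memD[of s i] by (auto simp: dcone_pair_simps)
    next
      case 2
      then show ?thesis using a(3) memC[of "s - 1" i] by (auto simp: dcone_pair_simps)
    next
      case 3
      then show ?thesis using a(3) memD[of "n + 2 - s" i] by (auto simp: dcone_pair_simps)
    qed
    moreover have "far A N (K - 4 * e) \<subseteq> far A N (8 * e)" by (rule far_mono) (use K8 l in simp)
    ultimately show "y \<in> dom (mods ?E s) \<and> cmap P (pathfinish \<rho>) \<in> far A N (8 * e)"
      using fk by blast
  qed (use e in auto)
qed

end

section \<open>Block diagonal objects along a splitting of the generators\<close>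

section \<open>Direct sums\<close>

lemma zero_fun_eta [simp]: "(\<lambda>_. 0) = 0"
  by (rule ext) simp

text \<open>Intermediate generators outside the range of \<open>i\<close> are met by
  \<open>f\<close> or by \<open>g\<close> with coefficient 0, so the sum is carried over by the
  injection.\<close>

lemma gcomp_reindex:
  assumes i: "inj i" and f: "\<And>y. f x (i y) = f' x' y" and g: "\<And>y. g (i y) z = g' y z'"
    and out: "\<And>w. w \<notin> range i \<Longrightarrow> f x w = 0 \<or> g w z = 0"
  shows "(g \<odot> f) x z = (g' \<odot> f') x' z'"
proof
  fix \<tau>
  let ?h = "\<lambda>(y, \<rho>, \<sigma>). (i y, \<rho>, \<sigma>)"
  let ?S = "{(y, \<rho>, \<sigma>). f' x' y \<rho> \<noteq> 0 \<and> g' y z' \<sigma> \<noteq> 0 \<and> pjoin \<rho> \<sigma> = \<tau>}"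
  have "{(w, \<rho>, \<sigma>). f x w \<rho> \<noteq> 0 \<and> g w z \<sigma> \<noteq> 0 \<and> pjoin \<rho> \<sigma> = \<tau>} = ?h ` ?S"
  proof (rule subset_antisym; rule subsetI)
    fix t assume t: "t \<in> {(w, \<rho>, \<sigma>). f x w \<rho> \<noteq> 0 \<and> g w z \<sigma> \<noteq> 0 \<and> pjoin \<rho> \<sigma> = \<tau>}"
    obtain w \<rho> \<sigma> where w: "t = (w, \<rho>, \<sigma>)" by (cases t)
    have "f x w \<noteq> 0" "g w z \<noteq> 0" using t w by auto
    then obtain y where "w = i y" using out by blast
    then have "t = ?h (y, \<rho>, \<sigma>)" "(y, \<rho>, \<sigma>) \<in> ?S" using t w f g by auto
    then show "t \<in> ?h ` ?S" by blast
  next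
    fix t assume "t \<in> ?h ` ?S"
    then show "t \<in> {(w, \<rho>, \<sigma>). f x w \<rho> \<noteq> 0 \<and> g w z \<sigma> \<noteq> 0 \<and> pjoin \<rho> \<sigma> = \<tau>}" using f g by auto
  qed
  moreover have "inj_on ?h ?S" using i by (auto simp: inj_on_def)
  ultimately show "(g \<odot> f) x z \<tau> = (g' \<odot> f') x' z' \<tau>"
    unfolding gcomp_def by (simp add: sum.reindex case_prod_unfold f g)
qed

lemma gcomp_eq_0: "(\<And>y. f x y = 0 \<or> g y z = 0) \<Longrightarrow> (g \<odot> f) x z = 0"
proof
  fix \<tau>
  assume a: "\<And>y. f x y = 0 \<or> g y z = 0"
  show "(g \<odot> f) x z \<tau> = 0 \<tau>"
  proof (rule ccontr)
    assume "(g \<odot> f) x z \<tau> \<noteq> 0 \<tau>"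
    then have "(g \<odot> f) x z \<tau> \<noteq> 0" by simp
    then obtain y \<rho> \<sigma> where "f x y \<rho> \<noteq> 0" "g y z \<sigma> \<noteq> 0" by (rule gcomp_nz)
    then show False using a[of y] by auto
  qed
qed

text \<open>A decomposition of a type of generators into two parts. The summands of
  \<open>csum\<close>, the renumbering of natural numbers in \<open>Lsum\<close> and the summands of
  cones are all of this kind, so each statement about direct sums is proved once.\<close>

definition splits :: "('a \<Rightarrow> 'z) \<Rightarrow> ('b \<Rightarrow> 'z) \<Rightarrow> bool" where
  "splits i1 i2 \<longleftrightarrow> inj i1 \<and> inj i2 \<and> range i1 \<inter> range i2 = {} \<and> range i1 \<union> range i2 = UNIV"

definition dsg :: "('a \<Rightarrow> 'z) \<Rightarrow> ('b \<Rightarrow> 'z) \<Rightarrow> ('a, 'm) gmod \<Rightarrow> ('b, 'm) gmod \<Rightarrow> ('z, 'm) gmod \<Rightarrow> bool" where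
  "dsg i1 i2 G1 G2 G \<longleftrightarrow> (\<forall>x. G (i1 x) = G1 x) \<and> (\<forall>x. G (i2 x) = G2 x)"

definition dsm :: "('a \<Rightarrow> 'z) \<Rightarrow> ('b \<Rightarrow> 'z) \<Rightarrow> ('c \<Rightarrow> 'w) \<Rightarrow> ('d \<Rightarrow> 'w) \<Rightarrow> ('a, 'c, 'm, 'r::zero) gmor
    \<Rightarrow> ('b, 'd, 'm, 'r) gmor \<Rightarrow> ('z, 'w, 'm, 'r) gmor \<Rightarrow> bool" where
  "dsm i1 i2 j1 j2 f1 f2 f \<longleftrightarrow> (\<forall>x y. f (i1 x) (j1 y) = f1 x y) \<and> (\<forall>x y. f (i2 x) (j2 y) = f2 x y) \<and>
     (\<forall>x y. f (i1 x) (j2 y) = 0) \<and> (\<forall>x y. f (i2 x) (j1 y) = 0)"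

lemma splits_cases:
  assumes "splits i1 i2"
  obtains x where "z = i1 x" | x where "z = i2 x"
proof -
  have "z \<in> range i1 \<union> range i2" using assms by (simp add: splits_def)
  then show ?thesis using that by blast
qed

lemma splits_simps:
  assumes "splits i1 i2"
  shows "i1 x = i1 y \<longleftrightarrow> x = y" "i2 x' = i2 y' \<longleftrightarrow> x' = y'" "i1 x \<noteq> i2 x'" "i2 x' \<noteq> i1 x"
proof -
  show n: "i1 x \<noteq> i2 x'"
  proof
    assume "i1 x = i2 x'"
    then have "i1 x \<in> range i2" by simp
    then show False using assms by (auto simp: splits_def)
  qed
  then show "i2 x' \<noteq> i1 x" by simp
qed (use assms in \<open>auto simp: splits_def dest: injD\<close>)

lemma splits_Inl_Inr: "splits Inl Inr"
proof -
  have "x \<in> range Inl \<union> range Inr" for x :: "'a + 'b" by (cases x) auto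
  then show ?thesis by (auto simp: splits_def)
qed

lemma splits_map_sum:
  assumes "splits i1 i2" "splits i1' i2'"
  shows "splits (map_sum i1 i1') (map_sum i2 i2')"
proof -
  have "x \<in> range (map_sum i1 i1') \<union> range (map_sum i2 i2')" for x
  proof (cases x)
    case (Inl z)
    show ?thesis by (rule splits_cases[OF assms(1), of z]) (metis Inl UnI1 UnI2 map_sum.simps(1) rangeI)+
  next
    case (Inr z)
    show ?thesis by (rule splits_cases[OF assms(2), of z]) (metis Inr UnI1 UnI2 map_sum.simps(2) rangeI)+
  qed
  moreover have "map_sum i1 i1' x \<noteq> map_sum i2 i2' y" for x y
    using splits_simps[OF assms(1)] splits_simps[OF assms(2)] by (cases x; cases y) auto
  moreover have "inj (map_sum i1 i1')" "inj (map_sum i2 i2')"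
    using assms by (auto simp: splits_def intro: sum.inj_map)
  ultimately show ?thesis by (auto simp: splits_def)
qed

lemma dsmD:
  assumes "dsm i1 i2 j1 j2 f1 f2 f"
  shows "f (i1 x) (j1 y) = f1 x y" "f (i2 x') (j2 y') = f2 x' y'" "f (i1 x) (j2 y') = 0" "f (i2 x') (j1 y) = 0"
  using assms by (simp_all add: dsm_def)

lemma dsm_ext:
  assumes i: "splits i1 i2" and j: "splits j1 j2" and f: "dsm i1 i2 j1 j2 f1 f2 f" and g: "dsm i1 i2 j1 j2 f1 f2 g"
  shows "f = g"
proof (rule ext, rule ext)
  fix z w
  show "f z w = g z w"
    by (rule splits_cases[OF i, of z]; rule splits_cases[OF j, of w]) (simp_all add: dsmD[OF f] dsmD[OF g])
qed

text \<open>Supplies the contractions, sections and chain maps of a direct sum. These occur only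
  under existential quantifiers, so a morphism with the prescribed blocks suffices.\<close>

lemma dsm_ex:
  assumes i: "splits i1 i2" and j: "splits j1 j2"
  shows "\<exists>f. dsm i1 i2 j1 j2 f1 f2 f"
proof -
  define f where "f = (\<lambda>z w. if z \<in> range i1 then if w \<in> range j1 then f1 (inv_into UNIV i1 z) (inv_into UNIV j1 w) else 0
     else if w \<in> range j2 then f2 (inv_into UNIV i2 z) (inv_into UNIV j2 w) else 0)"
  have "inj i1" "inj i2" "inj j1" "inj j2" using i j by (auto simp: splits_def)
  then have "dsm i1 i2 j1 j2 f1 f2 f"
    unfolding dsm_def f_def using splits_simps[OF i] splits_simps[OF j] by auto
  then show ?thesis by blast
qed

lemma dsm_zero [simp]: "dsm i1 i2 j1 j2 0 0 0" by (simp add: dsm_def)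

lemma dsm_add: "dsm i1 i2 j1 j2 f1 f2 f \<Longrightarrow> dsm i1 i2 j1 j2 g1 g2 g \<Longrightarrow>
    dsm i1 i2 j1 j2 (f1 + g1) (f2 + g2) (f + (g :: ('z, 'w, 'm, 'r::monoid_add) gmor))"
  by (simp add: dsm_def)

lemma dsm_uminus: "dsm i1 i2 j1 j2 f1 f2 f \<Longrightarrow> dsm i1 i2 j1 j2 (- f1) (- f2) (- (f :: ('z, 'w, 'm, 'r::group_add) gmor))"
  by (simp add: dsm_def)

lemma dsm_msign: "dsm i1 i2 j1 j2 f1 f2 f \<Longrightarrow>
    dsm i1 i2 j1 j2 (msign k f1) (msign k f2) (msign k (f :: ('z, 'w, 'm, 'r::ab_group_add) gmor))"
  by (simp add: msign_def dsm_uminus)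

lemma dsm_dual: "dsm i1 i2 j1 j2 f1 f2 f \<Longrightarrow> dsm j1 j2 i1 i2 (dual f1) (dual f2) (dual f)"
  by (simp add: dsm_def dual_pushf)

lemma dsm_gid: "splits i1 i2 \<Longrightarrow> dsg i1 i2 G1 G2 G \<Longrightarrow> dsm i1 i2 i1 i2 (gid G1) (gid G2) (gid G)"
  using splits_simps[of i1 i2] by (auto simp: dsm_def dsg_def gid_dl split: option.splits)

lemma dsm_mrestrict: "dsm i1 i2 j1 j2 f1 f2 f \<Longrightarrow>
    dsm i1 i2 j1 j2 (mrestrict P W f1) (mrestrict P W f2) (mrestrict P W f)"
  by (auto simp: dsm_def mrestrict_def fun_eq_iff)

lemma dsm_gcomp:
  assumes j: "splits j1 j2" and g: "dsm j1 j2 k1 k2 g1 g2 g" and f: "dsm i1 i2 j1 j2 f1 f2 f"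
  shows "dsm i1 i2 k1 k2 (g1 \<odot> f1) (g2 \<odot> f2) (g \<odot> f)"
proof -
  have inj: "inj j1" "inj j2" using j by (auto simp: splits_def)
  have "w \<in> range j1 \<or> w \<in> range j2" for w using j by (auto simp: splits_def)
  then have out: "w \<notin> range j1 \<Longrightarrow> \<exists>y. w = j2 y" "w \<notin> range j2 \<Longrightarrow> \<exists>y. w = j1 y" for w by blast+
  have "(g \<odot> f) (i1 x) (k1 z) = (g1 \<odot> f1) x z" for x z
    by (rule gcomp_reindex[OF inj(1)]) (use dsmD[OF f] dsmD[OF g] out in \<open>simp; fail\<close>, use dsmD[OF f] dsmD[OF g] out in \<open>simp; fail\<close>, use dsmD(3)[OF f] out(1) in blast)
  moreover have "(g \<odot> f) (i2 x) (k2 z) = (g2 \<odot> f2) x z" for x z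
    by (rule gcomp_reindex[OF inj(2)]) (use dsmD[OF f] dsmD[OF g] out in \<open>simp; fail\<close>, use dsmD[OF f] dsmD[OF g] out in \<open>simp; fail\<close>, use dsmD(4)[OF f] out(2) in blast)
  moreover have "(g \<odot> f) (i1 x) (k2 z) = 0" for x z
  proof (rule gcomp_eq_0)
    fix y show "f (i1 x) y = 0 \<or> g y (k2 z) = 0"
      by (rule splits_cases[OF j, of y]) (simp_all add: dsmD[OF f] dsmD[OF g])
  qed
  moreover have "(g \<odot> f) (i2 x) (k1 z) = 0" for x z
  proof (rule gcomp_eq_0)
    fix y show "f (i2 x) y = 0 \<or> g y (k1 z) = 0"
      by (rule splits_cases[OF j, of y]) (simp_all add: dsmD[OF f] dsmD[OF g])
  qed
  ultimately show ?thesis by (simp add: dsm_def)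
qed

lemma dsm_block:
  assumes "dsm i1 i2 j1 j2 a1 a2 a" "dsm i1' i2' j1 j2 b1 b2 b" "dsm i1 i2 j1' j2' c1 c2 c" "dsm i1' i2' j1' j2' d1 d2 d"
  shows "dsm (map_sum i1 i1') (map_sum i2 i2') (map_sum j1 j1') (map_sum j2 j2')
    (block a1 b1 c1 d1) (block a2 b2 c2 d2) (block a b c d)"
  unfolding dsm_def
proof (intro conjI allI)
  fix x y
  show "block a b c d (map_sum i1 i1' x) (map_sum j1 j1' y) = block a1 b1 c1 d1 x y"
    using assms by (cases x; cases y) (simp_all add: dsm_def)
next
  fix x y
  show "block a b c d (map_sum i2 i2' x) (map_sum j2 j2' y) = block a2 b2 c2 d2 x y"
    using assms by (cases x; cases y) (simp_all add: dsm_def)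
next
  fix x y
  show "block a b c d (map_sum i1 i1' x) (map_sum j2 j2' y) = 0"
    using assms by (cases x; cases y) (simp_all add: dsm_def)
next
  fix x y
  show "block a b c d (map_sum i2 i2' x) (map_sum j1 j1' y) = 0"
    using assms by (cases x; cases y) (simp_all add: dsm_def)
qed

lemma dsm_col:
  assumes "dsm i1 i2 j1 j2 a1 a2 a" "dsm i1 i2 j1' j2' b1 b2 b"
  shows "dsm i1 i2 (map_sum j1 j1') (map_sum j2 j2') (col a1 b1) (col a2 b2) (col a b)"
  unfolding dsm_def
proof (intro conjI allI)
  fix x y
  show "col a b (i1 x) (map_sum j1 j1' y) = col a1 b1 x y" using assms by (cases y) (simp_all add: dsm_def)
next
  fix x y
  show "col a b (i2 x) (map_sum j2 j2' y) = col a2 b2 x y" using assms by (cases y) (simp_all add: dsm_def)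
next
  fix x y
  show "col a b (i1 x) (map_sum j2 j2' y) = 0" using assms by (cases y) (simp_all add: dsm_def)
next
  fix x y
  show "col a b (i2 x) (map_sum j1 j1' y) = 0" using assms by (cases y) (simp_all add: dsm_def)
qed

lemma dsg_msum:
  assumes "dsg i1 i2 G1 G2 G" "dsg i1' i2' H1 H2 H"
  shows "dsg (map_sum i1 i1') (map_sum i2 i2') (msum G1 H1) (msum G2 H2) (msum G H)"
  unfolding dsg_def
proof (intro conjI allI)
  fix x show "msum G H (map_sum i1 i1' x) = msum G1 H1 x" using assms by (cases x) (simp_all add: dsg_def)
next
  fix x show "msum G H (map_sum i2 i2' x) = msum G2 H2 x" using assms by (cases x) (simp_all add: dsg_def)
qed

lemma dsm_nz:
  assumes i: "splits i1 i2" and j: "splits j1 j2" and f: "dsm i1 i2 j1 j2 f1 f2 f" and nz: "f z w \<rho> \<noteq> 0"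
  obtains x y where "z = i1 x" "w = j1 y" "f1 x y \<rho> \<noteq> 0" | x y where "z = i2 x" "w = j2 y" "f2 x y \<rho> \<noteq> 0"
proof -
  consider x y where "z = i1 x" "w = j1 y" | x y where "z = i1 x" "w = j2 y"
    | x y where "z = i2 x" "w = j1 y" | x y where "z = i2 x" "w = j2 y"
    using splits_cases[OF i, of z] splits_cases[OF j, of w] by metis
  then show ?thesis
    by cases (use that nz dsmD[OF f] in auto)
qed

lemma dsm_has_radius:
  assumes i: "splits i1 i2" and j: "splits j1 j2" and f: "dsm i1 i2 j1 j2 f1 f2 f"
    and "has_radius P e f1" "has_radius P e f2"
  shows "has_radius P e f"
  unfolding has_radius_def
proof (intro allI impI)
  fix z w \<rho> assume nz: "f z w \<rho> \<noteq> 0"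
  show "cmap P ` path_image \<rho> \<subseteq> cball (cmap P (pathstart \<rho>)) e \<inter> cball (cmap P (pathfinish \<rho>)) e"
    by (rule dsm_nz[OF i j f nz]) (use assms(4,5) in \<open>unfold has_radius_def, blast+\<close>)
qed

lemma dsm_emorphism:
  assumes i: "splits i1 i2" and j: "splits j1 j2" and f: "dsm i1 i2 j1 j2 f1 f2 f"
    and G: "dsg i1 i2 G1 G2 G" and H: "dsg j1 j2 H1 H2 H"
    and f1: "emorphism P e G1 H1 f1" and f2: "emorphism P e G2 H2 f2"
  shows "emorphism P e G H f"
  unfolding emorphism_def gmorphism_def
proof (intro conjI allI impI)
  show "has_radius P e f" by (rule dsm_has_radius[OF i j f]) (use f1 f2 in \<open>simp_all add: emorphism_def\<close>)
  fix z
  show "finite {(w, \<rho>). f z w \<rho> \<noteq> 0}"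
  proof (rule splits_cases[OF i, of z])
    fix x assume z: "z = i1 x"
    have "{(w, \<rho>). f z w \<rho> \<noteq> 0} \<subseteq> (\<lambda>(y, \<rho>). (j1 y, \<rho>)) ` {(y, \<rho>). f1 x y \<rho> \<noteq> 0}"
    proof
      fix t assume "t \<in> {(w, \<rho>). f z w \<rho> \<noteq> 0}"
      then obtain w \<rho> where t: "t = (w, \<rho>)" "f z w \<rho> \<noteq> 0" by auto
      show "t \<in> (\<lambda>(y, \<rho>). (j1 y, \<rho>)) ` {(y, \<rho>). f1 x y \<rho> \<noteq> 0}"
        by (rule dsm_nz[OF i j f t(2)]) (use z t splits_simps[OF i] in \<open>auto simp: image_iff\<close>)
    qed
    moreover have "finite {(y, \<rho>). f1 x y \<rho> \<noteq> 0}" using f1 unfolding emorphism_def gmorphism_def by blast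
    ultimately show ?thesis using finite_subset finite_imageI by blast
  next
    fix x assume z: "z = i2 x"
    have "{(w, \<rho>). f z w \<rho> \<noteq> 0} \<subseteq> (\<lambda>(y, \<rho>). (j2 y, \<rho>)) ` {(y, \<rho>). f2 x y \<rho> \<noteq> 0}"
    proof
      fix t assume "t \<in> {(w, \<rho>). f z w \<rho> \<noteq> 0}"
      then obtain w \<rho> where t: "t = (w, \<rho>)" "f z w \<rho> \<noteq> 0" by auto
      show "t \<in> (\<lambda>(y, \<rho>). (j2 y, \<rho>)) ` {(y, \<rho>). f2 x y \<rho> \<noteq> 0}"
        by (rule dsm_nz[OF i j f t(2)]) (use z t splits_simps[OF i] in \<open>auto simp: image_iff\<close>)
    qed
    moreover have "finite {(y, \<rho>). f2 x y \<rho> \<noteq> 0}" using f2 unfolding emorphism_def gmorphism_def by blast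
    ultimately show ?thesis using finite_subset finite_imageI by blast
  qed
next
  fix z w \<rho> assume nz: "f z w \<rho> \<noteq> 0"
  have "\<rho> \<in> gpaths (cdom P) \<and> G z = Some (pathstart \<rho>) \<and> H w = Some (pathfinish \<rho>)"
    by (rule dsm_nz[OF i j f nz]) (use f1 f2 G H in \<open>simp_all add: emorphism_def gmorphism_def dsg_def\<close>)
  then show "\<rho> \<in> gpaths (cdom P)" "G z = Some (pathstart \<rho>)" "H w = Some (pathfinish \<rho>)" by auto
qed

lemma dsm_sim:
  assumes i: "splits i1 i2" and j: "splits j1 j2" and f: "dsm i1 i2 j1 j2 f1 f2 f" and g: "dsm i1 i2 j1 j2 g1 g2 g"
    and "sim P e f1 g1" "sim P e f2 g2"
  shows "sim P e f g"
  unfolding sim_iff_nul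
proof (intro allI)
  fix z w
  show "f z w - g z w \<in> nul P e UNIV"
    by (rule splits_cases[OF i, of z]; rule splits_cases[OF j, of w])
      (use assms(5,6) in \<open>simp_all add: dsmD[OF f] dsmD[OF g] sim_iff_nul nul_zero\<close>)
qed

definition cds :: "('a \<Rightarrow> 'z) \<Rightarrow> ('b \<Rightarrow> 'z) \<Rightarrow> ('a, 'm, 'r::involution_ring) cplx \<Rightarrow> ('b, 'm, 'r) cplx
    \<Rightarrow> ('z, 'm, 'r) cplx \<Rightarrow> bool" where
  "cds i1 i2 C1 C2 C \<longleftrightarrow> splits i1 i2 \<and> (\<forall>r. dsg i1 i2 (mods C1 r) (mods C2 r) (mods C r) \<and>
     dsm i1 i2 i1 i2 (diff C1 r) (diff C2 r) (diff C r))"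

definition qds :: "('a \<Rightarrow> 'z) \<Rightarrow> ('b \<Rightarrow> 'z) \<Rightarrow> ('a, 'm, 'r::involution_ring) qstr \<Rightarrow> ('b, 'm, 'r) qstr
    \<Rightarrow> ('z, 'm, 'r) qstr \<Rightarrow> bool" where
  "qds i1 i2 \<psi>1 \<psi>2 \<psi> \<longleftrightarrow> (\<forall>s r. dsm i1 i2 i1 i2 (\<psi>1 s r) (\<psi>2 s r) (\<psi> s r))"

lemma cdsD:
  assumes "cds i1 i2 C1 C2 C"
  shows "splits i1 i2" "dsg i1 i2 (mods C1 r) (mods C2 r) (mods C r)"
    "dsm i1 i2 i1 i2 (diff C1 r) (diff C2 r) (diff C r)"
  using assms by (simp_all add: cds_def)

lemma qdsD: "qds i1 i2 \<psi>1 \<psi>2 \<psi> \<Longrightarrow> dsm i1 i2 i1 i2 (\<psi>1 s r) (\<psi>2 s r) (\<psi> s r)"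
  by (simp add: qds_def)

lemma dsg_empty:
  assumes "splits i1 i2" "dsg i1 i2 Map.empty Map.empty G"
  shows "G = Map.empty"
proof
  fix z show "G z = None"
    by (rule splits_cases[OF assms(1), of z]) (use assms(2) in \<open>simp_all add: dsg_def\<close>)
qed

lemma dsg_dom:
  assumes "splits i1 i2" "dsg i1 i2 G1 G2 G"
  shows "dom G = i1 ` dom G1 \<union> i2 ` dom G2"
proof (rule subset_antisym; rule subsetI)
  fix z assume "z \<in> dom G"
  then show "z \<in> i1 ` dom G1 \<union> i2 ` dom G2"
    by (rule_tac splits_cases[OF assms(1), of z]) (use assms(2) in \<open>auto simp: dsg_def\<close>)
next
  fix z assume "z \<in> i1 ` dom G1 \<union> i2 ` dom G2"
  then show "z \<in> dom G" using assms(2) by (auto simp: dsg_def)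
qed

lemma dsg_ran:
  assumes "splits i1 i2" "dsg i1 i2 G1 G2 G"
  shows "ran G \<subseteq> ran G1 \<union> ran G2"
proof
  fix u assume "u \<in> ran G"
  then obtain z where z: "G z = Some u" by (auto simp: ran_def)
  show "u \<in> ran G1 \<union> ran G2"
    by (rule splits_cases[OF assms(1), of z]) (use assms(2) z in \<open>auto simp: dsg_def ran_def\<close>)
qed

lemma cds_fin_gen: "cds i1 i2 C1 C2 C \<Longrightarrow> fin_gen C1 \<Longrightarrow> fin_gen C2 \<Longrightarrow> fin_gen C"
proof -
  assume c: "cds i1 i2 C1 C2 C" and f: "fin_gen C1" "fin_gen C2"
  have "finite (dom (mods C r))" for r
    unfolding dsg_dom[OF cdsD(1)[OF c] cdsD(2)[OF c, of r]] using f by (simp add: fin_gen_def)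
  then show ?thesis by (simp add: fin_gen_def)
qed

lemma cds_empty:
  assumes "cds i1 i2 C1 C2 C" "mods C1 r = Map.empty" "mods C2 r = Map.empty"
  shows "mods C r = Map.empty"
  by (rule dsg_empty[OF cdsD(1)[OF assms(1)]]) (use cdsD(2)[OF assms(1), of r] assms(2,3) in simp)

lemma cds_dimensional: "cds i1 i2 C1 C2 C \<Longrightarrow> dimensional n C1 \<Longrightarrow> dimensional n C2 \<Longrightarrow> dimensional n C"
  unfolding dimensional_def using cds_empty by blast

lemma cds_positive: "cds i1 i2 C1 C2 C \<Longrightarrow> positive_cplx C1 \<Longrightarrow> positive_cplx C2 \<Longrightarrow> positive_cplx C"
  unfolding positive_cplx_def using cds_empty by blast

lemma cds_chain_complex:
  assumes c: "cds i1 i2 C1 C2 C" and 1: "chain_complex P e C1" and 2: "chain_complex P e C2"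
  shows "chain_complex P e C"
  unfolding chain_complex_def
proof (intro allI conjI)
  fix r
  note s = cdsD(1)[OF c]
  show "gmodule P (mods C r)"
    using dsg_ran[OF s cdsD(2)[OF c, of r]] 1 2 unfolding gmodule_def chain_complex_def by blast
  show "emorphism P e (mods C r) (mods C (r - 1)) (diff C r)"
    by (rule dsm_emorphism[OF s s cdsD(3)[OF c] cdsD(2)[OF c] cdsD(2)[OF c]])
      (use 1 2 in \<open>simp_all add: chain_complex_def\<close>)
  show "sim P (2 * e) (diff C (r - 1) \<odot> diff C r) 0"
    by (rule dsm_sim[OF s s dsm_gcomp[OF s cdsD(3)[OF c] cdsD(3)[OF c]] dsm_zero])
      (use 1 2 in \<open>simp_all add: chain_complex_def\<close>)
qed

lemma cds_contractible:
  assumes c: "cds i1 i2 C1 C2 C" and 1: "contractible_over P e W C1" and 2: "contractible_over P e W C2"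
  shows "contractible_over P e W C"
proof -
  note s = cdsD(1)[OF c] and d = cdsD(3)[OF c] and m = cdsD(2)[OF c]
  obtain \<Gamma>1 where 1: "\<And>r. emorphism P e (mods C1 r) (mods C1 (r + 1)) (\<Gamma>1 r)"
    "\<And>r. sim P (2 * e) (mrestrict P W (diff C1 (r + 1) \<odot> \<Gamma>1 r + \<Gamma>1 (r - 1) \<odot> diff C1 r)) (mrestrict P W (gid (mods C1 r)))"
    using 1 unfolding contractible_over_def by blast
  obtain \<Gamma>2 where 2: "\<And>r. emorphism P e (mods C2 r) (mods C2 (r + 1)) (\<Gamma>2 r)"
    "\<And>r. sim P (2 * e) (mrestrict P W (diff C2 (r + 1) \<odot> \<Gamma>2 r + \<Gamma>2 (r - 1) \<odot> diff C2 r)) (mrestrict P W (gid (mods C2 r)))"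
    using 2 unfolding contractible_over_def by blast
  have "\<forall>r. \<exists>f. dsm i1 i2 i1 i2 (\<Gamma>1 r) (\<Gamma>2 r) f" using dsm_ex[OF s s] by blast
  from choice[OF this] obtain \<Gamma> where \<Gamma>: "\<And>r. dsm i1 i2 i1 i2 (\<Gamma>1 r) (\<Gamma>2 r) (\<Gamma> r)" by blast
  show ?thesis unfolding contractible_over_def
  proof (intro exI[of _ \<Gamma>] conjI allI)
    fix r
    show "emorphism P e (mods C r) (mods C (r + 1)) (\<Gamma> r)"
      by (rule dsm_emorphism[OF s s \<Gamma> m m 1(1) 2(1)])
    show "sim P (2 * e) (mrestrict P W (diff C (r + 1) \<odot> \<Gamma> r + \<Gamma> (r - 1) \<odot> diff C r)) (mrestrict P W (gid (mods C r)))"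
      by (rule dsm_sim[OF s s dsm_mrestrict[OF dsm_add[OF dsm_gcomp[OF s d \<Gamma>] dsm_gcomp[OF s \<Gamma> d]]]
            dsm_mrestrict[OF dsm_gid[OF s m]] 1(2) 2(2)])
  qed
qed

lemma cds_connected:
  assumes c: "cds i1 i2 C1 C2 C" and 1: "connected_cplx P e C1" and 2: "connected_cplx P e C2"
  shows "connected_cplx P e C"
proof -
  note s = cdsD(1)[OF c] and d = cdsD(3)[OF c] and m = cdsD(2)[OF c]
  obtain h1 where 1: "positive_cplx C1" "emorphism P (4 * e) (mods C1 0) (mods C1 1) h1"
    "sim P (8 * e) (diff C1 1 \<odot> h1) (gid (mods C1 0))"
    using 1 unfolding connected_cplx_def by blast
  obtain h2 where 2: "positive_cplx C2" "emorphism P (4 * e) (mods C2 0) (mods C2 1) h2"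
    "sim P (8 * e) (diff C2 1 \<odot> h2) (gid (mods C2 0))"
    using 2 unfolding connected_cplx_def by blast
  obtain h where h: "dsm i1 i2 i1 i2 h1 h2 h" using dsm_ex[OF s s] by blast
  show ?thesis unfolding connected_cplx_def
  proof (intro exI[of _ h] conjI)
    show "positive_cplx C" by (rule cds_positive[OF c 1(1) 2(1)])
    show "emorphism P (4 * e) (mods C 0) (mods C 1) h" by (rule dsm_emorphism[OF s s h m m 1(2) 2(2)])
    show "sim P (8 * e) (diff C 1 \<odot> h) (gid (mods C 0))"
      by (rule dsm_sim[OF s s dsm_gcomp[OF s d h] dsm_gid[OF s m] 1(3) 2(3)])
  qed
qed

text \<open>The cone of a direct sum is the direct sum of the cones up to an exchange of the middle
  summands. Taking \<open>map_sum\<close> of the injections absorbs the exchange, so no permutation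
  isomorphism appears.\<close>

lemma cds_mapping_cone:
  assumes C: "cds i1 i2 C1 C2 C" and D: "cds j1 j2 D1 D2 D" and f: "\<And>r. dsm i1 i2 j1 j2 (f1 r) (f2 r) (f r)"
  shows "cds (map_sum j1 i1) (map_sum j2 i2) (mapping_cone C1 D1 f1) (mapping_cone C2 D2 f2) (mapping_cone C D f)"
  unfolding cds_def mapping_cone_def cplx.simps
  by (intro conjI allI splits_map_sum dsg_msum dsm_block dsm_msign dsm_zero cdsD[OF C] cdsD[OF D] f)

lemma cds_dual_cplx: "cds i1 i2 C1 C2 C \<Longrightarrow> cds i1 i2 (dual_cplx n C1) (dual_cplx n C2) (dual_cplx n C)"
  unfolding cds_def dual_cplx_def cplx.simps by (intro conjI allI dsm_msign dsm_dual) blast+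

lemma qds_dualT: "qds i1 i2 \<psi>1 \<psi>2 \<psi> \<Longrightarrow> qds i1 i2 (dualT n \<psi>1) (dualT n \<psi>2) (dualT n \<psi>)"
  unfolding qds_def dualT_def by (intro allI dsm_msign dsm_dual) blast

lemma qds_symm: "qds i1 i2 \<psi>1 \<psi>2 \<psi> \<Longrightarrow> dsm i1 i2 i1 i2 (symm n \<psi>1 r) (symm n \<psi>2 r) (symm n \<psi> r)"
  unfolding symm_def by (intro dsm_add qdsD qds_dualT)

lemma cds_dcone:
  "cds i1 i2 C1 C2 C \<Longrightarrow> qds i1 i2 \<psi>1 \<psi>2 \<psi> \<Longrightarrow>
    cds (map_sum i1 i1) (map_sum i2 i2) (dcone n C1 \<psi>1) (dcone n C2 \<psi>2) (dcone n C \<psi>)"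
  unfolding dcone_def by (intro cds_mapping_cone cds_dual_cplx qds_symm)

lemma cds_dcone_pair:
  assumes C: "cds i1 i2 C1 C2 C" and D: "cds j1 j2 D1 D2 D" and f: "\<And>r. dsm i1 i2 j1 j2 (f1 r) (f2 r) (f r)"
    and q: "qds i1 i2 \<psi>1 \<psi>2 \<psi>" and q': "qds j1 j2 \<delta>1 \<delta>2 \<delta>"
  shows "cds (map_sum (map_sum j1 i1) j1) (map_sum (map_sum j2 i2) j2)
    (dcone_pair n C1 D1 f1 \<delta>1 \<psi>1) (dcone_pair n C2 D2 f2 \<delta>2 \<psi>2) (dcone_pair n C D f \<delta> \<psi>)"
  unfolding dcone_pair_def
  by (intro cds_mapping_cone cds_dual_cplx dsm_col dsm_msign dsm_gcomp[OF cdsD(1)[OF C]] dsm_dual qds_symm C D f q q')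

lemma qds_qrel:
  assumes C: "cds i1 i2 C1 C2 C" and q: "qds i1 i2 \<psi>1 \<psi>2 \<psi>"
  shows "qds i1 i2 (qrel n C1 \<psi>1) (qrel n C2 \<psi>2) (qrel n C \<psi>)"
  unfolding qds_def qrel_def
  by (intro allI dsm_add dsm_msign dsm_gcomp[OF cdsD(1)[OF C]] dsm_dual cdsD(3)[OF C] qdsD[OF q] qdsD[OF qds_dualT[OF q]])

lemma qds_push:
  assumes C: "cds i1 i2 C1 C2 C" and f: "\<And>r. dsm i1 i2 j1 j2 (f1 r) (f2 r) (f r)" and q: "qds i1 i2 \<psi>1 \<psi>2 \<psi>"
  shows "qds j1 j2 (push n f1 \<psi>1) (push n f2 \<psi>2) (push n f \<psi>)"
  unfolding qds_def push_def
  by (intro allI dsm_gcomp[OF cdsD(1)[OF C]] dsm_dual f qdsD[OF q])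

lemma cds_qfamily:
  assumes C: "cds i1 i2 C1 C2 C" and q: "qds i1 i2 \<psi>1 \<psi>2 \<psi>"
    and 1: "qfamily P n e C1 \<psi>1" and 2: "qfamily P n e C2 \<psi>2"
  shows "qfamily P n e C \<psi>"
  unfolding qfamily_def
proof (intro allI)
  fix s r
  note s = cdsD(1)[OF C]
  show "emorphism P e (mods C (n - r - int s)) (mods C r) (\<psi> s r)"
    by (rule dsm_emorphism[OF s s qdsD[OF q] cdsD(2)[OF C] cdsD(2)[OF C]])
      (use 1 2 in \<open>simp_all add: qfamily_def\<close>)
qed

lemma cds_quad_complex:
  assumes C: "cds i1 i2 C1 C2 C" and q: "qds i1 i2 \<psi>1 \<psi>2 \<psi>"
    and 1: "quad_complex P n e C1 \<psi>1" and 2: "quad_complex P n e C2 \<psi>2"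
  shows "quad_complex P n e C \<psi>"
proof -
  note s = cdsD(1)[OF C]
  have "sim P (3 * e) (qrel n C \<psi> s r) 0" for s r
    by (rule dsm_sim[OF s s qdsD[OF qds_qrel[OF C q]] dsm_zero])
      (use 1 2 in \<open>simp_all add: quad_complex_def quad_structure_def\<close>)
  then show ?thesis
    using cds_qfamily[OF C q] cds_chain_complex[OF C] cds_dimensional[OF C] 1 2
    unfolding quad_complex_def quad_structure_def by blast
qed

lemma cds_quad_pair:
  assumes C: "cds i1 i2 C1 C2 C" and D: "cds j1 j2 D1 D2 D" and f: "\<And>r. dsm i1 i2 j1 j2 (f1 r) (f2 r) (f r)"
    and q: "qds i1 i2 \<psi>1 \<psi>2 \<psi>" and q': "qds j1 j2 \<delta>1 \<delta>2 \<delta>"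
    and 1: "quad_pair P n e C1 D1 f1 \<delta>1 \<psi>1" and 2: "quad_pair P n e C2 D2 f2 \<delta>2 \<psi>2"
  shows "quad_pair P n e C D f \<delta> \<psi>"
  unfolding quad_pair_def
proof (intro conjI allI)
  note s = cdsD(1)[OF C] and t = cdsD(1)[OF D]
  show "quad_complex P n e C \<psi>" "chain_complex P e D" "dimensional (n + 1) D" "qfamily P (n + 1) e D \<delta>"
    using cds_quad_complex[OF C q] cds_chain_complex[OF D] cds_dimensional[OF D] cds_qfamily[OF D q'] 1 2
    unfolding quad_pair_def by blast+
  have m1: "chain_map P e C1 D1 f1" and m2: "chain_map P e C2 D2 f2" using 1 2 by (auto simp: quad_pair_def)
  show "chain_map P e C D f" unfolding chain_map_def
  proof (intro allI conjI)
    fix r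
    have df: "dsm i1 i2 j1 j2 (diff D1 r \<odot> f1 r) (diff D2 r \<odot> f2 r) (diff D r \<odot> f r)"
      by (rule dsm_gcomp[OF t cdsD(3)[OF D] f])
    have fd: "dsm i1 i2 j1 j2 (f1 (r - 1) \<odot> diff C1 r) (f2 (r - 1) \<odot> diff C2 r) (f (r - 1) \<odot> diff C r)"
      by (rule dsm_gcomp[OF s f cdsD(3)[OF C]])
    show "emorphism P e (mods C r) (mods D r) (f r)"
      by (rule dsm_emorphism[OF s t f cdsD(2)[OF C] cdsD(2)[OF D]]) (use m1 m2 in \<open>simp_all add: chain_map_def\<close>)
    show "has_radius P e (diff D r \<odot> f r)"
      by (rule dsm_has_radius[OF s t df]) (use m1 m2 in \<open>simp_all add: chain_map_def\<close>)
    show "has_radius P e (f (r - 1) \<odot> diff C r)"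
      by (rule dsm_has_radius[OF s t fd]) (use m1 m2 in \<open>simp_all add: chain_map_def\<close>)
    show "sim P e (diff D r \<odot> f r) (f (r - 1) \<odot> diff C r)"
      by (rule dsm_sim[OF s t df fd]) (use m1 m2 in \<open>simp_all add: chain_map_def\<close>)
  qed
  fix u r
  show "sim P (3 * e) (qrel (n + 1) D \<delta> u r + msign n (push n f \<psi> u r)) 0"
    by (rule dsm_sim[OF t t dsm_add[OF qdsD[OF qds_qrel[OF D q']] dsm_msign[OF qdsD[OF qds_push[OF C f q]]]] dsm_zero])
      (use 1 2 in \<open>simp_all add: quad_pair_def\<close>)
qed

lemma cds_csum: "cds Inl Inr C1 C2 (csum C1 C2)"
  unfolding cds_def csum_def cplx.simps
  by (intro conjI allI splits_Inl_Inr) (simp_all add: dsg_def dsm_def)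

lemma qds_qsum: "qds Inl Inr \<psi>1 \<psi>2 (qsum \<psi>1 \<psi>2)"
  by (simp add: qds_def dsm_def qsum_def)

lemma qds_uminus: "qds i1 i2 \<psi>1 \<psi>2 \<psi> \<Longrightarrow> qds i1 i2 (- \<psi>1) (- \<psi>2) (- \<psi>)"
  by (simp add: qds_def dsm_def)

lemma cds_csum_csum:
  assumes "cds i1 i2 C1 C2 C" "cds i1' i2' C1' C2' C'"
  shows "cds (map_sum i1 i1') (map_sum i2 i2') (csum C1 C1') (csum C2 C2') (csum C C')"
  unfolding cds_def csum_def cplx.simps
  by (intro conjI allI splits_map_sum dsg_msum dsm_block dsm_zero cdsD[OF assms(1)] cdsD[OF assms(2)])

lemma qds_qsum_qsum:
  assumes "qds i1 i2 \<psi>1 \<psi>2 \<psi>" "qds i1' i2' \<psi>1' \<psi>2' \<psi>'"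
  shows "qds (map_sum i1 i1') (map_sum i2 i2') (qsum \<psi>1 \<psi>1') (qsum \<psi>2 \<psi>2') (qsum \<psi> \<psi>')"
  unfolding qds_def qsum_def
  by (intro allI dsm_block dsm_zero qdsD[OF assms(1)] qdsD[OF assms(2)])

abbreviation "enl \<equiv> sum_encode \<circ> Inl"
abbreviation "enr \<equiv> sum_encode \<circ> Inr"

lemma splits_en: "splits enl enr"
proof -
  have "z \<in> range enl \<union> range enr" for z
    by (cases "sum_decode z") (metis UnI1 UnI2 comp_apply rangeI sum_decode_inverse)+
  moreover have "inj enl" "inj enr" by (auto intro!: inj_compose inj_sum_encode)
  moreover have "enl x \<noteq> enr y" for x y by (simp add: sum_encode_eq)
  ultimately show ?thesis by (auto simp: splits_def)
qed

lemma cds_Lsum: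
  "cds enl enr C1 C2 (fst (Lsum (C1, \<psi>1) (C2, \<psi>2)))"
  unfolding cds_def Lsum_def
  using splits_en by (auto simp: dsg_def dsm_def csum_def)

lemma qds_Lsum:
  "qds enl enr \<psi>1 \<psi>2 (snd (Lsum (C1, \<psi>1) (C2, \<psi>2)))"
  unfolding qds_def Lsum_def by (auto simp: dsm_def qsum_def)

lemma Lsum_Lreps:
  assumes "a \<in> Lreps n e P Y" "b \<in> Lreps n e P Y"
  shows "Lsum a b \<in> Lreps n e P Y"
proof -
  obtain C1 \<psi>1 C2 \<psi>2 where ab: "a = (C1, \<psi>1)" "b = (C2, \<psi>2)" by (metis prod.exhaust)
  note c = cds_Lsum[of C1 C2 \<psi>1 \<psi>2] and q = qds_Lsum[of \<psi>1 \<psi>2 C1 C2]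
  note d = cds_dcone[OF c q, of n]
  have "(fst (Lsum a b), snd (Lsum a b)) \<in> Lreps n e P Y"
    unfolding Lreps_def using assms cds_fin_gen[OF c] cds_quad_complex[OF c q] cds_connected[OF d] cds_contractible[OF d]
    unfolding ab Lreps_def connected_quad_def poincare_over_def by auto
  then show ?thesis by simp
qed

text \<open>The boundary of the sum of two cobordisms is grouped by cobordism, whereas the
  definition groups it by end. The injections \<open>?i1\<close> and \<open>?i2\<close> select the
  two cobordisms inside the latter grouping, so all properties transfer blockwise.\<close>

lemma Lcobordant_Lsum:
  assumes "Lcobordant n e P Y a a'" "Lcobordant n e P Y b b'"
  shows "Lcobordant n e P Y (Lsum a b) (Lsum a' b')"
proof -
  obtain C1 \<psi>1 C1' \<psi>1' C2 \<psi>2 C2' \<psi>2' where ab: "a = (C1, \<psi>1)" "a' = (C1', \<psi>1')" "b = (C2, \<psi>2)" "b' = (C2', \<psi>2')"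
    by (metis prod.exhaust)
  obtain D1 f1 \<delta>1 where 1: "fin_gen (D1 :: (nat, 'a, 'c) cplx)"
       "quad_pair P n e (csum C1 C1') D1 f1 \<delta>1 (qsum \<psi>1 (- \<psi>1'))"
       "connected_pair P n e (csum C1 C1') D1 f1 \<delta>1 (qsum \<psi>1 (- \<psi>1'))"
       "poincare_pair_over P n e (cbase P - Y) (csum C1 C1') D1 f1 \<delta>1 (qsum \<psi>1 (- \<psi>1'))"
    using assms(1) unfolding ab Lcobordant_def by blast
  obtain D2 f2 \<delta>2 where 2: "fin_gen (D2 :: (nat, 'a, 'c) cplx)"
       "quad_pair P n e (csum C2 C2') D2 f2 \<delta>2 (qsum \<psi>2 (- \<psi>2'))"
       "connected_pair P n e (csum C2 C2') D2 f2 \<delta>2 (qsum \<psi>2 (- \<psi>2'))"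
       "poincare_pair_over P n e (cbase P - Y) (csum C2 C2') D2 f2 \<delta>2 (qsum \<psi>2 (- \<psi>2'))"
    using assms(2) unfolding ab Lcobordant_def by blast
  obtain L \<psi> L' \<psi>' where L: "Lsum a b = (L, \<psi>)" "Lsum a' b' = (L', \<psi>')" by (metis prod.exhaust)
  have L1: "cds enl enr C1 C2 L" "qds enl enr \<psi>1 \<psi>2 \<psi>" "cds enl enr C1' C2' L'" "qds enl enr \<psi>1' \<psi>2' \<psi>'"
    using cds_Lsum[of C1 C2 \<psi>1 \<psi>2] qds_Lsum[of \<psi>1 \<psi>2 C1 C2] cds_Lsum[of C1' C2' \<psi>1' \<psi>2'] qds_Lsum[of \<psi>1' \<psi>2' C1' C2'] L
    unfolding ab by simp_all
  let ?i1 = "map_sum enl enl" and ?i2 = "map_sum enr enr"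
  have c: "cds ?i1 ?i2 (csum C1 C1') (csum C2 C2') (csum L L')"
    by (rule cds_csum_csum[OF L1(1,3)])
  have q: "qds ?i1 ?i2 (qsum \<psi>1 (- \<psi>1')) (qsum \<psi>2 (- \<psi>2')) (qsum \<psi> (- \<psi>'))"
    by (rule qds_qsum_qsum[OF L1(2) qds_uminus[OF L1(4)]])
  obtain D \<delta> where D: "Lsum (D1, \<delta>1) (D2, \<delta>2) = (D, \<delta>)" by (metis prod.exhaust)
  have d: "cds enl enr D1 D2 D" "qds enl enr \<delta>1 \<delta>2 \<delta>"
    using cds_Lsum[of D1 D2 \<delta>1 \<delta>2] qds_Lsum[of \<delta>1 \<delta>2 D1 D2] D by simp_all
  have "\<forall>r. \<exists>f. dsm ?i1 ?i2 enl enr (f1 r) (f2 r) f" using dsm_ex[OF cdsD(1)[OF c] cdsD(1)[OF d(1)]] by blast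
  from choice[OF this] obtain f where f: "\<And>r. dsm ?i1 ?i2 enl enr (f1 r) (f2 r) (f r)" by blast
  have p: "cds (map_sum (map_sum enl ?i1) enl) (map_sum (map_sum enr ?i2) enr)
      (dcone_pair n (csum C1 C1') D1 f1 \<delta>1 (qsum \<psi>1 (- \<psi>1'))) (dcone_pair n (csum C2 C2') D2 f2 \<delta>2 (qsum \<psi>2 (- \<psi>2')))
      (dcone_pair n (csum L L') D f \<delta> (qsum \<psi> (- \<psi>')))"
    by (rule cds_dcone_pair[OF c d(1) f q d(2)])
  note k = cds_dcone[OF c q, of n]
  have "fin_gen D" by (rule cds_fin_gen[OF d(1) 1(1) 2(1)])
  moreover have "quad_pair P n e (csum L L') D f \<delta> (qsum \<psi> (- \<psi>'))"
    by (rule cds_quad_pair[OF c d(1) f q d(2) 1(2) 2(2)])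
  moreover have "connected_pair P n e (csum L L') D f \<delta> (qsum \<psi> (- \<psi>'))"
    using cds_connected[OF p] cds_connected[OF k] 1(3) 2(3) unfolding connected_pair_def connected_quad_def by blast
  moreover have "poincare_pair_over P n e (cbase P - Y) (csum L L') D f \<delta> (qsum \<psi> (- \<psi>'))"
    using cds_contractible[OF p] cds_contractible[OF k] 1(4) 2(4) unfolding poincare_pair_over_def poincare_over_def by blast
  ultimately show ?thesis unfolding L Lcobordant_def by blast
qed

section \<open>Reversing the sign of a quadratic structure\<close>

section \<open>Change of signs of generators\<close>

text \<open>The duality cones of \<open>\<psi>\<close> and \<open>-\<psi>\<close> differ by the change of signs of the generators of one
  summand, so that \<open>(C, -\<psi>)\<close> is connected and Poincare whenever \<open>(C, \<psi>)\<close> is.\<close>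

definition twist :: "('g \<Rightarrow> bool) \<Rightarrow> ('h \<Rightarrow> bool) \<Rightarrow> ('g, 'h, 'm, 'r::uminus) gmor \<Rightarrow> ('g, 'h, 'm, 'r) gmor" where
  "twist p q f = (\<lambda>x y \<rho>. if p x = q y then f x y \<rho> else - f x y \<rho>)"

lemma twist_nz: "twist p q f x y \<rho> \<noteq> 0 \<longleftrightarrow> f x y \<rho> \<noteq> (0::'r::group_add)"
  by (simp add: twist_def)

text \<open>\<open>twist\<close> is conjugation by diagonal sign matrices; the signs at the
  intermediate generators cancel.\<close>

lemma twist_gcomp: "twist p k (g \<odot> f) = twist q k g \<odot> twist p q f"
proof (intro ext)
  fix x z \<tau>
  let ?S = "{(y, \<rho>, \<sigma>). f x y \<rho> \<noteq> 0 \<and> g y z \<sigma> \<noteq> 0 \<and> pjoin \<rho> \<sigma> = \<tau>}"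
  have "(twist q k g \<odot> twist p q f) x z \<tau> =
      (\<Sum>(y, \<rho>, \<sigma>)\<in>?S. twist q k g y z \<sigma> * twist p q f x y \<rho>)"
    unfolding gcomp_def twist_nz ..
  also have "\<dots> = (\<Sum>(y, \<rho>, \<sigma>)\<in>?S. if p x = k z then g y z \<sigma> * f x y \<rho> else - (g y z \<sigma> * f x y \<rho>))"
    by (intro sum.cong refl) (auto simp: twist_def)
  also have "\<dots> = twist p k (g \<odot> f) x z \<tau>"
    by (auto simp: twist_def gcomp_def sum_negf[symmetric] intro!: sum.cong)
  finally show "twist p k (g \<odot> f) x z \<tau> = (twist q k g \<odot> twist p q f) x z \<tau>" by simp
qed

lemma twist_add: "twist p q (f + g) = twist p q f + twist p q (g :: ('g, 'h, 'm, 'r::ab_group_add) gmor)"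
  by (intro ext) (simp add: twist_def)

lemma twist_gid [simp]: "twist p p (gid G) = (gid G :: ('g, 'g, 'm, 'r::involution_ring) gmor)"
  by (intro ext) (simp add: twist_def gid_def)

lemma twist_mrestrict: "twist p q (mrestrict P W f) = mrestrict P W (twist p q f)"
  by (intro ext) (simp add: twist_def mrestrict_def)

lemma twist_emorphism: "emorphism P e G H f \<Longrightarrow> emorphism P e G H (twist p q f)"
  unfolding emorphism_def gmorphism_def has_radius_def twist_nz .

lemma twist_sim: "sim P e f g \<Longrightarrow> sim P e (twist p q f) (twist p q g)"
  unfolding sim_iff_nul
proof (intro allI)
  fix x y
  assume a: "\<forall>x y. f x y - g x y \<in> nul P e UNIV"
  have "twist p q f x y - twist p q g x y = (if p x = q y then f x y - g x y else - (f x y - g x y))"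
    by (auto simp: twist_def fun_eq_iff)
  then show "twist p q f x y - twist p q g x y \<in> nul P e UNIV" using nul_uminus a by metis
qed

lemma contractible_twist:
  assumes "mods F = mods E" "\<And>r. diff F r = twist p p (diff E r)" "contractible_over P e W E"
  shows "contractible_over P e W F"
proof -
  obtain \<Gamma> where \<Gamma>: "\<And>r. emorphism P e (mods E r) (mods E (r + 1)) (\<Gamma> r)"
    "\<And>r. sim P (2 * e) (mrestrict P W (diff E (r + 1) \<odot> \<Gamma> r + \<Gamma> (r - 1) \<odot> diff E r)) (mrestrict P W (gid (mods E r)))"
    using assms(3) unfolding contractible_over_def by blast
  show ?thesis unfolding contractible_over_def assms(1,2)
  proof (intro exI[of _ "\<lambda>r. twist p p (\<Gamma> r)"] conjI allI)
    show "emorphism P e (mods E r) (mods E (r + 1)) (twist p p (\<Gamma> r))" for r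
      by (rule twist_emorphism[OF \<Gamma>(1)])
    show "sim P (2 * e) (mrestrict P W (twist p p (diff E (r + 1)) \<odot> twist p p (\<Gamma> r) + twist p p (\<Gamma> (r - 1)) \<odot> twist p p (diff E r)))
        (mrestrict P W (gid (mods E r)))" for r
      using twist_sim[OF \<Gamma>(2)[of r], of p p] unfolding twist_mrestrict twist_add twist_gid
      by (simp only: twist_gcomp[of p p _ _ p])
  qed
qed

lemma connected_twist:
  assumes "mods F = mods E" "\<And>r. diff F r = twist p p (diff E r)" "connected_cplx P e E"
  shows "connected_cplx P e F"
proof -
  obtain h where h: "positive_cplx E" "emorphism P (4 * e) (mods E 0) (mods E 1) h"
    "sim P (8 * e) (diff E 1 \<odot> h) (gid (mods E 0))"
    using assms(3) unfolding connected_cplx_def by blast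
  have "sim P (8 * e) (twist p p (diff E 1) \<odot> twist p p h) (gid (mods E 0))"
    using twist_sim[OF h(3), of p p] unfolding twist_gid by (simp only: twist_gcomp[of p p _ _ p])
  then show ?thesis
    using h twist_emorphism[OF h(2)] unfolding connected_cplx_def positive_cplx_def assms(1,2) by blast
qed

lemma dualT_uminus: "dualT n (- \<psi>) s r = - dualT n \<psi> s r"
  by (simp add: dualT_def)

lemma symm_uminus: "symm n (- \<psi>) r = - symm n \<psi> r"
  by (simp add: symm_def dualT_uminus)

lemma msign_diff [simp]: "msign k (f - g) = msign k f - msign k (g :: 'a::ab_group_add)"
  by (simp add: msign_def)

lemma qrel_uminus: "qrel n C (- \<psi>) s r = - qrel n C \<psi> s r"
  by (simp add: qrel_def dualT_uminus)

lemma emorphism_uminus: "emorphism P e G H f \<Longrightarrow> emorphism P e G H (- f)"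
  unfolding emorphism_def gmorphism_def has_radius_def by simp

lemma quad_complex_uminus:
  assumes "quad_complex P n e C \<psi>"
  shows "quad_complex P n e C (- \<psi>)"
proof -
  have "sim P (3 * e) (qrel n C (- \<psi>) s r) 0" for s r
    using assms sim_uminus[of P "3 * e" "qrel n C \<psi> s r" 0]
    by (simp add: quad_complex_def quad_structure_def qrel_uminus)
  moreover have "qfamily P n e C (- \<psi>)"
    using assms by (simp add: quad_complex_def quad_structure_def qfamily_def emorphism_uminus)
  ultimately show ?thesis using assms unfolding quad_complex_def quad_structure_def by blast
qed

text \<open>The structure enters only the off-diagonal block of the cone, and this is the block
  whose sign is reversed by changing the signs of one of the two summands.\<close>

lemma dcone_uminus:
  "mods (dcone n C (- \<psi>)) = mods (dcone n C \<psi>)"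
  "diff (dcone n C (- \<psi>)) r = twist isl isl (diff (dcone n C \<psi>) r)"
proof -
  show "mods (dcone n C (- \<psi>)) = mods (dcone n C \<psi>)" by (rule ext) (simp add: dcone_simps)
  show "diff (dcone n C (- \<psi>)) r = twist isl isl (diff (dcone n C \<psi>) r)"
    unfolding dcone_simps symm_uminus
    by (rule sum_mor_ext) (simp_all add: twist_def fun_eq_iff)
qed

text \<open>A cobordism is required to have a connected Poincare boundary. This supplies that
  requirement from its two ends, both for the trivial cobordism and for a cobordism whose ends have
  been cut.\<close>

lemma Lreps_boundary:
  assumes "(C, \<psi>) \<in> Lreps n e P Y" "(C', \<psi>') \<in> Lreps n e P Y"
  shows "quad_complex P n e (csum C C') (qsum \<psi> (- \<psi>'))" "connected_quad P n e (csum C C') (qsum \<psi> (- \<psi>'))"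
    "poincare_over P n e (cbase P - Y) (csum C C') (qsum \<psi> (- \<psi>'))" "fin_gen (csum C C')"
proof -
  note a = assms[unfolded Lreps_def, simplified]
  note c = cds_csum[of C C'] and q = qds_qsum[of \<psi> "- \<psi>'"]
  note k = cds_dcone[OF c q, of n]
  show "quad_complex P n e (csum C C') (qsum \<psi> (- \<psi>'))"
    by (rule cds_quad_complex[OF c q]) (use a quad_complex_uminus in auto)
  have "connected_cplx P e (dcone n C' (- \<psi>'))"
    by (rule connected_twist[OF dcone_uminus]) (use a in \<open>simp add: connected_quad_def\<close>)
  then show "connected_quad P n e (csum C C') (qsum \<psi> (- \<psi>'))"
    using cds_connected[OF k] a unfolding connected_quad_def by blast
  have "contractible_over P (4 * e) (cbase P - Y) (dcone n C' (- \<psi>'))"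
    by (rule contractible_twist[OF dcone_uminus]) (use a in \<open>simp add: poincare_over_def\<close>)
  then show "poincare_over P n e (cbase P - Y) (csum C C') (qsum \<psi> (- \<psi>'))"
    using cds_contractible[OF k] a unfolding poincare_over_def by blast
  show "fin_gen (csum C C')" by (rule cds_fin_gen[OF c]) (use a in auto)
qed

section \<open>Products of block matrices of paths\<close>

section \<open>Matrix calculus\<close>

definition row :: "('g, 'h, 'm, 'r) gmor \<Rightarrow> ('g', 'h, 'm, 'r) gmor \<Rightarrow> ('g + 'g', 'h, 'm, 'r) gmor" where
  "row a b = case_sum a b"

lemma row_simps [simp]: "row a b (Inl x) = a x" "row a b (Inr y) = b y"
  by (simp_all add: row_def)

lemma row_ext:
  fixes f g :: "('a + 'b, 'h, 'm, 'r) gmor"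
  assumes "\<And>x. f (Inl x) = g (Inl x)" "\<And>x. f (Inr x) = g (Inr x)"
  shows "f = g"
proof
  fix x show "f x = g x" using assms by (cases x) auto
qed

lemma col_ext:
  fixes f g :: "('g, 'a + 'b, 'm, 'r) gmor"
  assumes "\<And>x y. f x (Inl y) = g x (Inl y)" "\<And>x y. f x (Inr y) = g x (Inr y)"
  shows "f = g"
proof (intro ext)
  fix x y z show "f x y z = g x y z" using assms by (cases y) auto
qed

lemma dual_row [simp]: "dual (row a b) = col (dual a) (dual b)"
  by (rule col_ext) (simp_all add: dual_pushf)

lemma block_eta: "block (\<lambda>x y. f (Inl x) (Inl y)) (\<lambda>x y. f (Inr x) (Inl y)) (\<lambda>x y. f (Inl x) (Inr y)) (\<lambda>x y. f (Inr x) (Inr y)) = f"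
  by (rule sum_mor_ext) simp_all

lemma block_zero [simp]: "block 0 0 0 0 = 0" by (rule sum_mor_ext) simp_all
lemma row_zero [simp]: "row 0 0 = 0" by (rule row_ext) simp_all
lemma col_zero [simp]: "col 0 0 = 0" by (rule col_ext) simp_all

lemma block_add: "block a b c d + block a' b' c' d' = block (a + a') (b + b') (c + c') (d + d')"
  by (rule sum_mor_ext) (simp_all add: fun_eq_iff)
lemma row_add: "row a b + row a' b' = row (a + a') (b + b')" by (rule row_ext) (simp_all add: fun_eq_iff)
lemma col_add: "col a b + col a' b' = col (a + a') (b + b')" by (rule col_ext) (simp_all add: fun_eq_iff)

lemma row_uminus: "- row a b = row (- a) (- b)" by (rule row_ext) (simp_all add: fun_eq_iff)
lemma col_uminus: "- col a b = col (- a) (- b)" by (rule col_ext) (simp_all add: fun_eq_iff)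
lemma block_uminus: "- block a b c d = block (- a) (- b) (- c) (- d)" by (rule sum_mor_ext) (simp_all add: fun_eq_iff)

lemma row_msign: "msign k (row a b) = row (msign k a) (msign k (b :: ('g, 'h, 'm, 'r::ab_group_add) gmor))"
  by (simp add: msign_def row_uminus)
lemma col_msign: "msign k (col a b) = col (msign k a) (msign k (b :: ('g, 'h, 'm, 'r::ab_group_add) gmor))"
  by (simp add: msign_def col_uminus)

lemma fs_row [simp]:
  assumes "fs a" "fs b"
  shows "fs (row a b)"
proof (rule fs_imageI[of "(\<lambda>(x, y, \<rho>). (Inl x, y, \<rho>)) ` {(x, y, \<rho>). a x y \<rho> \<noteq> 0} \<union>
    (\<lambda>(x, y, \<rho>). (Inr x, y, \<rho>)) ` {(x, y, \<rho>). b x y \<rho> \<noteq> 0}"], goal_cases)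
  case 1
  then show ?case using assms by (simp add: fs_def)
next
  case (2 x y \<rho>)
  then show ?case by (cases x) (force simp: image_iff)+
qed

lemma mor_row:
  assumes "mor P e G H a" "mor P e G' H b"
  shows "mor P e (msum G G') H (row a b)"
  unfolding mor_def
proof (intro conjI allI impI)
  show "fs (row a b)" using assms by (intro fs_row) (auto simp: mor_fs)
  fix x y \<rho> assume nz: "row a b x y \<rho> \<noteq> 0"
  have "mpath P e \<rho> \<and> msum G G' x = Some (pathstart \<rho>) \<and> H y = Some (pathfinish \<rho>)"
    using nz assms unfolding mor_def by (cases x) auto
  then show "mpath P e \<rho>" "msum G G' x = Some (pathstart \<rho>)" "H y = Some (pathfinish \<rho>)" by auto
qed

lemma sim_row:
  assumes "sim P e a a'" "sim P e b b'"
  shows "sim P e (row a b) (row a' b')"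
  unfolding sim_iff_nul
proof (intro allI)
  fix x y
  show "row a b x y - row a' b' x y \<in> nul P e UNIV"
    using assms by (cases x) (simp_all add: sim_iff_nul)
qed

lemma gcomp_cong: "(\<And>y. f x y = f' x' y) \<Longrightarrow> (\<And>y. g y z = g' y z') \<Longrightarrow> (g \<odot> f) x z = (g' \<odot> f') x' z'"
  by (simp add: gcomp_def)

lemma gcomp_row: "g \<odot> row a b = row (g \<odot> a) (g \<odot> b)"
  by (rule row_ext; intro ext; simp; intro fun_cong[OF gcomp_cong]; simp)

lemma col_gcomp: "col u v \<odot> f = col (u \<odot> f) (v \<odot> f)"
  by (rule col_ext; simp; intro gcomp_cong; simp)

lemma row_col:
  fixes a :: "('g, 'k, 'm::topological_space, 'r::involution_ring) gmor" and b :: "('h, 'k, 'm, 'r) gmor"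
  assumes "fs a" "fs b" "fs u" "fs v"
  shows "row a b \<odot> col u v = a \<odot> u + b \<odot> v"
proof -
  have "col u v = col u 0 + col 0 v" by (simp add: col_add)
  then have "row a b \<odot> col u v = row a b \<odot> col u 0 + row a b \<odot> col 0 v"
    using assms by (simp add: gcomp_add_right fs_col)
  also have "row a b \<odot> col u 0 = a \<odot> u"
  proof (intro ext)
    fix x z \<tau>
    have "(row a b \<odot> col u 0) x z = (a \<odot> u) x z"
    proof (rule gcomp_reindex[of Inl])
      fix w :: "'g + 'h" assume "w \<notin> range Inl"
      then obtain y where "w = Inr y" by (cases w) auto
      then show "col u 0 x w = 0 \<or> row a b w z = 0" by simp
    qed simp_all
    then show "(row a b \<odot> col u 0) x z \<tau> = (a \<odot> u) x z \<tau>" by simp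
  qed
  also have "row a b \<odot> col 0 v = b \<odot> v"
  proof (intro ext)
    fix x z \<tau>
    have "(row a b \<odot> col 0 v) x z = (b \<odot> v) x z"
    proof (rule gcomp_reindex[of Inr])
      fix w :: "'g + 'h" assume "w \<notin> range Inr"
      then obtain y where "w = Inl y" by (cases w) auto
      then show "col 0 v x w = 0 \<or> row a b w z = 0" by simp
    qed simp_all
    then show "(row a b \<odot> col 0 v) x z \<tau> = (b \<odot> v) x z \<tau>" by simp
  qed
  finally show ?thesis .
qed

lemma block_as_col: "block a b c d = col (row a b) (row c d)"
  by (rule sum_mor_ext) simp_all

lemma block_as_row: "block a b c d = row (col a c) (col b d)"
  by (rule sum_mor_ext) simp_all

lemma block_col:
  assumes "fs a" "fs b" "fs c" "fs d" "fs u" "fs v"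
  shows "block a b c d \<odot> col u v = col (a \<odot> u + b \<odot> v) (c \<odot> u + d \<odot> v)"
  unfolding block_as_col col_gcomp using assms by (simp add: row_col)

lemma row_block:
  assumes "fs a" "fs b" "fs a'" "fs b'" "fs c'" "fs d'"
  shows "row a b \<odot> block a' b' c' d' = row (a \<odot> a' + b \<odot> c') (a \<odot> b' + b \<odot> d')"
  unfolding block_as_row gcomp_row using assms by (simp add: row_col)

lemma block_block:
  assumes "fs a" "fs b" "fs c" "fs d" "fs a'" "fs b'" "fs c'" "fs d'"
  shows "block a b c d \<odot> block a' b' c' d' =
    block (a \<odot> a' + b \<odot> c') (a \<odot> b' + b \<odot> d') (c \<odot> a' + d \<odot> c') (c \<odot> b' + d \<odot> d')"
proof -
  have "block a b c d \<odot> block a' b' c' d' = col (row a b \<odot> block a' b' c' d') (row c d \<odot> block a' b' c' d')"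
    unfolding block_as_col[of a b c d] by (rule col_gcomp)
  then show ?thesis using assms by (simp add: row_block block_as_col[symmetric])
qed

lemma gid_msum: "gid (msum G H) = block (gid G) 0 0 (gid H)"
  by (rule sum_mor_ext) (simp_all add: gid_dl split: option.splits)

lemma mrestrict_block: "mrestrict P W (block a b c d) =
    block (mrestrict P W a) (mrestrict P W b) (mrestrict P W c) (mrestrict P W d)"
  by (rule sum_mor_ext) (auto simp: mrestrict_def fun_eq_iff)

lemma mrestrict_row: "mrestrict P W (row a b) = row (mrestrict P W a) (mrestrict P W b)"
  by (rule row_ext) (auto simp: mrestrict_def fun_eq_iff)

lemma mrestrict_col: "mrestrict P W (col a b) = col (mrestrict P W a) (mrestrict P W b)"
  by (rule col_ext) (auto simp: mrestrict_def fun_eq_iff)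

lemma mrestrict_zero [simp]: "mrestrict P W 0 = 0" by (intro ext) (simp add: mrestrict_def)

section \<open>The cylinder as a cobordism from a complex to itself\<close>

section \<open>The trivial cobordism\<close>

lemma fs_comp:
  assumes "fs f" "inj i" "inj j"
  shows "fs (\<lambda>x y. f (i x) (j y))"
proof -
  have "inj (\<lambda>(x, y, \<rho>). (i x, j y, \<rho>))" using assms(2,3) by (auto simp: inj_def)
  from finite_vimageI[OF assms(1)[unfolded fs_def] this]
  show ?thesis unfolding fs_def by (rule back_subst[of finite]) auto
qed

lemma mor_entries:
  assumes "mor P e (msum G G') (msum H H') f"
  shows "mor P e G H (\<lambda>x y. f (Inl x) (Inl y))" "mor P e G' H (\<lambda>x y. f (Inr x) (Inl y))"
    "mor P e G H' (\<lambda>x y. f (Inl x) (Inr y))" "mor P e G' H' (\<lambda>x y. f (Inr x) (Inr y))"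
proof -
  have n: "mpath P e \<rho> \<and> msum G G' x = Some (pathstart \<rho>) \<and> msum H H' y = Some (pathfinish \<rho>)"
    if "f x y \<rho> \<noteq> 0" for x y \<rho> using assms that by (simp add: mor_def)
  note fc = fs_comp[OF mor_fs[OF assms]]
  show "mor P e G H (\<lambda>x y. f (Inl x) (Inl y))"
    unfolding mor_def using fc[of Inl Inl] n[of "Inl x" "Inl y" \<rho> for x y \<rho>] by simp
  show "mor P e G' H (\<lambda>x y. f (Inr x) (Inl y))"
    unfolding mor_def using fc[of Inr Inl] n[of "Inr x" "Inl y" \<rho> for x y \<rho>] by simp
  show "mor P e G H' (\<lambda>x y. f (Inl x) (Inr y))"
    unfolding mor_def using fc[of Inl Inr] n[of "Inl x" "Inr y" \<rho> for x y \<rho>] by simp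
  show "mor P e G' H' (\<lambda>x y. f (Inr x) (Inr y))"
    unfolding mor_def using fc[of Inr Inr] n[of "Inr x" "Inr y" \<rho> for x y \<rho>] by simp
qed

lemma sim_blockD:
  assumes "sim P e (block a b c d) (block a' b' c' d')"
  shows "sim P e a a'" "sim P e b b'" "sim P e c c'" "sim P e d d'"
  unfolding sim_iff_nul
proof (safe)
  note s = assms[unfolded sim_iff_nul, rule_format]
  show "a x y - a' x y \<in> nul P e UNIV" for x y using s[of "Inl x" "Inl y"] by simp
  show "b x y - b' x y \<in> nul P e UNIV" for x y using s[of "Inr x" "Inl y"] by simp
  show "c x y - c' x y \<in> nul P e UNIV" for x y using s[of "Inl x" "Inr y"] by simp
  show "d x y - d' x y \<in> nul P e UNIV" for x y using s[of "Inr x" "Inr y"] by simp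
qed

lemma dual_block: "dual (block a b c d) = block (dual a) (dual c) (dual b) (dual d)"
  by (rule sum_mor_ext) (simp_all add: dual_pushf)

lemma symm_zero [simp]: "symm n 0 r = 0"
  by (simp add: symm_def dualT_def)

lemma symm_qsum: "symm n (qsum \<psi> \<psi>') r = block (symm n \<psi> r) 0 0 (symm n \<psi>' r)"
  by (simp add: symm_def dualT_def qsum_def dual_block msign_def block_add block_uminus)

lemma mrestrict_add: "mrestrict P W (f + g) = mrestrict P W f + mrestrict P W (g :: ('g, 'h, 'm::topological_space, 'r::involution_ring) gmor)"
  by (intro ext) (simp add: mrestrict_def)

lemma mrestrict_uminus: "mrestrict P W (- f) = - mrestrict P W (f :: ('g, 'h, 'm::topological_space, 'r::involution_ring) gmor)"
  by (intro ext) (simp add: mrestrict_def)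

lemma mrestrict_msign: "mrestrict P W (msign k f) = msign k (mrestrict P W (f :: ('g, 'h, 'm::topological_space, 'r::involution_ring) gmor))"
  by (simp add: msign_def mrestrict_uminus)

lemma sim_mrestrict_any:
  fixes f g :: "('g, 'h, 'm::topological_space, 'r::involution_ring) gmor"
  shows "sim P e f g \<Longrightarrow> sim P e (mrestrict P W f) (mrestrict P W g)"
proof -
  assume s: "sim P e f g"
  have "mrestrict P UNIV f = f" for f :: "('g, 'h, 'm, 'r) gmor" by (intro ext) (simp add: mrestrict_def)
  then show ?thesis using sim_mrestrict[of P e UNIV f g W] s by simp
qed

text \<open>A column times a row comes out of \<open>gcomp_row\<close> and \<open>col_gcomp\<close>
  as rows of columns; it has to return to block form before it can be added to the other term of the
  same corner.\<close>

lemma corner_matrix: "row 0 (row (col 0 (col p q)) 0) = block 0 0 0 (block p 0 q 0)"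
  by (auto simp: row_def col_def block_def fun_eq_iff split: sum.splits)

lemmas matrix_simps = corner_matrix fs_block fs_col fs_row block_block block_col row_block row_col gcomp_row col_gcomp
  block_as_col[symmetric] block_as_row[symmetric] block_add row_add col_add row_uminus col_uminus block_uminus
  row_msign col_msign

text \<open>The duality cone of the pair \<open>C \<oplus> C \<rightarrow> C\<close> is the cone of the identity of \<open>C\<close> (the target and one
  copy of \<open>C\<close>) extended by the duality cone of \<open>C\<close>. The matrices below are its differential and the
  contraction assembled from the identities \<open>g0\<close>, \<open>g1\<close> and a contraction with blocks \<open>a b c d\<close> of the
  duality cone of \<open>C\<close>.\<close>

lemma cylinder_dG:
  assumes "fs d0" "fs g0" "fs d1" "fs v" "fs z" "fs a" "fs b" "fs c" "fs d"
  shows "block (block d0 (msign r (row g0 g0)) 0 (block d1 0 0 d1)) (col 0 (col v (- v))) 0 z \<odot>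
      block (block 0 0 (col 0 (msign r g0)) (block a 0 (- a) 0)) (col 0 (col b (- b))) (row 0 (row c 0)) d =
    block (block (g0 \<odot> g0) 0 (col 0 (msign r (d1 \<odot> g0))) (block (d1 \<odot> a + v \<odot> c) 0 (- (d1 \<odot> a + v \<odot> c)) 0))
      (col 0 (col (d1 \<odot> b + v \<odot> d) (- (d1 \<odot> b + v \<odot> d)))) (row 0 (row (z \<odot> c) 0)) (z \<odot> d)"
  using assms by (simp add: matrix_simps)

lemma cylinder_Gd:
  assumes "fs d1" "fs g1" "fs d2" "fs v" "fs z" "fs a" "fs b" "fs c" "fs d"
  shows "block (block 0 0 (col 0 (msign k g1)) (block a 0 (- a) 0)) (col 0 (col b (- b))) (row 0 (row c 0)) d \<odot>
      block (block d1 (msign k (row g1 g1)) 0 (block d2 0 0 d2)) (col 0 (col v (- v))) 0 z =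
    block (block 0 0 (col 0 (msign k (g1 \<odot> d1))) (block (a \<odot> d2) 0 (g1 \<odot> g1 - a \<odot> d2) (g1 \<odot> g1)))
      (col 0 (col (a \<odot> v + b \<odot> z) (- (a \<odot> v + b \<odot> z)))) (row 0 (row (c \<odot> d2) 0)) (c \<odot> v + d \<odot> z)"
  using assms by (simp add: matrix_simps)

text \<open>The contributions are grouped into the blocks of the homotopy formula of the duality
  cone. In the entry \<open>w + - (p + p')\<close>, from the first copy of C to the second, the
  identity cancels against the block p + p'.\<close>

lemma cylinder_sum:
  fixes w :: "('g, 'h, 'm, 'r::ab_group_add) gmor"
  shows "block (block x 0 (col 0 y) (block p 0 (- p) 0)) (col 0 (col q (- q))) (row 0 (row s 0)) t +
      block (block 0 0 (col 0 y') (block p' 0 (w - p') w)) (col 0 (col q' (- q'))) (row 0 (row s' 0)) t' =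
    block (block x 0 (col 0 (y + y')) (block (p + p') 0 (w + - (p + p')) w))
      (col 0 (col (q + q') (- (q + q')))) (row 0 (row (s + s') 0)) (t + t')"
  by (simp add: block_add row_add col_add algebra_simps)

text \<open>The matrix (1 1). It sends \<psi> on the first copy and -\<psi> on the second to \<psi>
  - \<psi>, which vanishes strictly, so the zero structure on the target completes it to a
  pair.\<close>

definition fold :: "('g, 'm, 'r::involution_ring) cplx \<Rightarrow> int \<Rightarrow> ('g + 'g, 'g, 'm, 'r) gmor" where
  "fold C r = row (gid (mods C r)) (gid (mods C r))"

lemma cylinder_simps:
  fixes C :: "('g, 'm::topological_space, 'r::involution_ring) cplx"
  assumes "fcc P e C" "qmor P n e C \<psi>" "0 \<le> e"
  shows "mods (dcone_pair n (csum C C) C (fold C) 0 (qsum \<psi> (- \<psi>))) r =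
      msum (msum (mods C r) (msum (mods C (r - 1)) (mods C (r - 1)))) (mods C (n + 2 - r))"
    "diff (dcone_pair n (csum C C) C (fold C) 0 (qsum \<psi> (- \<psi>))) r =
      block (block (diff C r) (msign (r - 1) (row (gid (mods C (r - 1))) (gid (mods C (r - 1))))) 0
          (block (diff C (r - 1)) 0 0 (diff C (r - 1))))
        (col 0 (col (msign (n + 1) (symm n \<psi> (r - 2) \<odot> gid (mods C (n + 2 - r))))
          (- msign (n + 1) (symm n \<psi> (r - 2) \<odot> gid (mods C (n + 2 - r))))))
        0 (msign (r - 1) (dual (diff C (n + 3 - r))))"
proof -
  have f: "fs (symm n \<psi> (r - 2))" "fs (gid (mods C (n + 2 - r)) :: ('g, 'g, 'm, 'r) gmor)"
    by (rule mor_fs[OF symm_mor[OF assms(2) refl]], rule mor_fs[OF mor_gid[OF fccD(1,2)[OF assms(1)] order_refl]])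
  have i: "r - 1 + (n + 2 - r) = n + 1" by simp
  show "mods (dcone_pair n (csum C C) C (fold C) 0 (qsum \<psi> (- \<psi>))) r =
      msum (msum (mods C r) (msum (mods C (r - 1)) (mods C (r - 1)))) (mods C (n + 2 - r))"
    by (simp add: dcone_pair_simps csum_def)
  show "diff (dcone_pair n (csum C C) C (fold C) 0 (qsum \<psi> (- \<psi>))) r =
      block (block (diff C r) (msign (r - 1) (row (gid (mods C (r - 1))) (gid (mods C (r - 1))))) 0
          (block (diff C (r - 1)) 0 0 (diff C (r - 1))))
        (col 0 (col (msign (n + 1) (symm n \<psi> (r - 2) \<odot> gid (mods C (n + 2 - r))))
          (- msign (n + 1) (symm n \<psi> (r - 2) \<odot> gid (mods C (n + 2 - r))))))
        0 (msign (r - 1) (dual (diff C (n + 3 - r))))"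
    unfolding dcone_pair_simps symm_zero symm_qsum symm_uminus fold_def dual_row dual_gid csum_def cplx.simps
    using f by (simp add: block_col col_msign msign_msign i)
qed

text \<open>The second copy of C contracts against the target through the identity. The antidiagonal
  elements (x, -x), on which \<open>fold\<close> vanishes, form together with the dual summand a
  copy of the duality cone of C, shifted by one degree and contracted by the given
  contraction.\<close>

lemma cylinder_contractible:
  fixes C :: "('g, 'm::topological_space, 'r::involution_ring) cplx"
  assumes C: "fcc P e C" and \<psi>: "qmor P n e C \<psi>" and e: "0 \<le> e"
    and con: "contractible_over P (4 * e) W (dcone n C \<psi>)"
  shows "contractible_over P (4 * e) W (dcone_pair n (csum C C) C (fold C) 0 (qsum \<psi> (- \<psi>)))"
proof -
  let ?F = "dcone n C \<psi>" and ?E = "dcone_pair n (csum C C) C (fold C) 0 (qsum \<psi> (- \<psi>))"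
  note Es = cylinder_simps[OF C \<psi> e]
  obtain \<Gamma> where \<Gamma>0: "\<And>r. emorphism P (4 * e) (mods ?F r) (mods ?F (r + 1)) (\<Gamma> r)"
    and \<Gamma>1: "\<And>r. sim P (2 * (4 * e)) (mrestrict P W (diff ?F (r + 1) \<odot> \<Gamma> r + \<Gamma> (r - 1) \<odot> diff ?F r))
       (mrestrict P W (gid (mods ?F r)))"
    using con unfolding contractible_over_def by blast
  have \<Gamma>: "mor P (4 * e) (mods ?F r) (mods ?F (r + 1)) (\<Gamma> r)" for r
    by (rule emorphism_imp_mor[OF \<Gamma>0 fccD(1)[OF dcone_fcc[OF C \<psi>]]])
  define a where "a r = (\<lambda>x y. \<Gamma> r (Inl x) (Inl y))" for r
  define b where "b r = (\<lambda>x y. \<Gamma> r (Inr x) (Inl y))" for r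
  define c where "c r = (\<lambda>x y. \<Gamma> r (Inl x) (Inr y))" for r
  define d where "d r = (\<lambda>x y. \<Gamma> r (Inr x) (Inr y))" for r
  have \<Gamma>b: "\<Gamma> r = block (a r) (b r) (c r) (d r)" for r
    unfolding a_def b_def c_def d_def by (rule block_eta[symmetric])
  define g where "g r = (gid (mods C r) :: ('g, 'g, 'm, 'r) gmor)" for r
  \<comment> \<open>The entry \<open>g r\<close> goes from the target to the second copy; a and b
    take values in the antidiagonal, hence the pairs a, -a and b, -b. The signs on b, c and d
    compensate for the different signs with which the symmetrization and the dual differential occur
    in the cone of the pair.\<close>
  define G :: "int \<Rightarrow> (('g + 'g + 'g) + 'g, ('g + 'g + 'g) + 'g, 'm, 'r) gmor" where "G r = block (block 0 0 (col 0 (msign r (g r))) (block (a (r - 1)) 0 (- a (r - 1)) 0))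
     (col 0 (col (msign (n + 1 + r) (b (r - 1))) (- msign (n + 1 + r) (b (r - 1)))))
     (row 0 (row (msign (n + r) (c (r - 1))) 0)) (- d (r - 1))" for r
  have gm: "mor P k (mods C r) (mods C r) (g r)" if "0 \<le> k" for r k
    unfolding g_def by (rule mor_gid[OF fccD(1,2)[OF C] that])
  have e4: "0 \<le> 4 * e" "e \<le> 4 * e" using e by auto
  have abcd: "mor P (4 * e) (mods C r) (mods C (r + 1)) (a r)" "mor P (4 * e) (mods C (n + 1 - r)) (mods C (r + 1)) (b r)"
    "mor P (4 * e) (mods C r) (mods C (n - r)) (c r)" "mor P (4 * e) (mods C (n + 1 - r)) (mods C (n - r)) (d r)" for r
  proof -
    have "n + 1 - (r + 1) = n - r" by simp
    note m = \<Gamma>[of r, unfolded dcone_simps this]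
    show "mor P (4 * e) (mods C r) (mods C (r + 1)) (a r)" "mor P (4 * e) (mods C (n + 1 - r)) (mods C (r + 1)) (b r)"
    "mor P (4 * e) (mods C r) (mods C (n - r)) (c r)" "mor P (4 * e) (mods C (n + 1 - r)) (mods C (n - r)) (d r)"
      unfolding a_def b_def c_def d_def by (rule mor_entries[OF m])+
  qed
  show ?thesis unfolding contractible_over_def
  proof (intro exI[of _ G] conjI allI)
    fix r
    have i: "r - 1 + 1 = r" "n + 1 - (r - 1) = n + 2 - r" "n - (r - 1) = n + 1 - r" "r + 1 - 1 = r"
      "n + 2 - (r + 1) = n + 1 - r" "n + 3 - (r + 1) = n + 2 - r" "r + 1 - 2 = r - 1" "r - 1 - 1 = r - 2"
      "n + 2 - (r - 1) = n + 3 - r" "r - 2 + 1 = r - 1" "n + 1 - (r - 2) = n + 3 - r" "n - (r - 2) = n + 2 - r" by simp_all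
    note m1 = abcd[of "r - 1", unfolded i] and m2 = abcd[of "r - 2", unfolded i]
    have "mor P (4 * e) (mods ?E r) (mods ?E (r + 1)) (G r)"
      unfolding Es G_def i
      by (intro mor_block mor_col mor_row mor_zero mor_msign[THEN iffD2] mor_uminus[THEN iffD2] gm m1 e4)
    then show "emorphism P (4 * e) (mods ?E r) (mods ?E (r + 1)) (G r)" by (rule mor_imp_emorphism)
    let ?\<phi>1 = "symm n \<psi> (r - 1)" and ?\<phi>2 = "symm n \<psi> (r - 2)" and ?d1 = "diff C r" and ?d2 = "diff C (r - 1)"
    let ?u1 = "dual (diff C (n + 2 - r))" and ?u2 = "dual (diff C (n + 3 - r))"
    let ?a1 = "a (r - 1)" and ?b1 = "b (r - 1)" and ?c1 = "c (r - 1)" and ?d'1 = "d (r - 1)"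
    let ?a2 = "a (r - 2)" and ?b2 = "b (r - 2)" and ?c2 = "c (r - 2)" and ?d'2 = "d (r - 2)"
    let ?v1 = "msign (n + 1) (?\<phi>1 \<odot> g (n + 1 - r))" and ?v2 = "msign (n + 1) (?\<phi>2 \<odot> g (n + 2 - r))"
    have p1: "mor P e (mods C (n + 1 - r)) (mods C (r - 1)) ?\<phi>1" by (rule symm_mor[OF \<psi>]) simp
    have p2: "mor P e (mods C (n + 2 - r)) (mods C (r - 2)) ?\<phi>2" by (rule symm_mor[OF \<psi>]) simp
    have d1: "mor P e (mods C r) (mods C (r - 1)) ?d1" by (rule fccD[OF C])
    have d2: "mor P e (mods C (r - 1)) (mods C (r - 2)) ?d2" using fccD(3)[OF C, of "r - 1"] by simp
    have u1: "mor P e (mods C (n + 1 - r)) (mods C (n + 2 - r)) ?u1"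
      using fccD(5)[OF C, of "n + 2 - r"] by (simp add: algebra_simps)
    have u2: "mor P e (mods C (n + 2 - r)) (mods C (n + 3 - r)) ?u2"
      using fccD(5)[OF C, of "n + 3 - r"] by (simp add: algebra_simps)
    note fss = mor_fs[OF p1] mor_fs[OF p2] mor_fs[OF d1] mor_fs[OF d2] mor_fs[OF u1] mor_fs[OF u2]
      m1[THEN mor_fs] m2[THEN mor_fs] gm[OF order_refl, THEN mor_fs] fccD(4)[OF C, THEN mor_fs]
    \<comment> \<open>The four blocks of the homotopy formula in the duality cone one degree
      lower.\<close>
    define X11 where "X11 = ?d1 \<odot> ?a1 + msign (r - 1) (?\<phi>1 \<odot> ?c1) + ?a2 \<odot> ?d2"
    define X12 where "X12 = ?d1 \<odot> ?b1 + msign (r - 1) (?\<phi>1 \<odot> ?d'1) + msign (r - 2) (?a2 \<odot> ?\<phi>2) + msign (r - 2) (?b2 \<odot> ?u2)"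
    define X21 where "X21 = msign (r - 1) (?u1 \<odot> ?c1) + ?c2 \<odot> ?d2"
    define X22 where "X22 = msign (r - 1) (?u1 \<odot> ?d'1) + msign (r - 2) (?c2 \<odot> ?\<phi>2) + msign (r - 2) (?d'2 \<odot> ?u2)"
    have "diff ?F (r - 1 + 1) \<odot> \<Gamma> (r - 1) + \<Gamma> (r - 1 - 1) \<odot> diff ?F (r - 1) = block X11 X12 X21 X22"
      unfolding \<Gamma>b dcone_simps i X11_def X12_def X21_def X22_def
      using fss by (simp add: block_block block_add add.assoc)
    then have "sim P (2 * (4 * e)) (mrestrict P W (block X11 X12 X21 X22))
        (mrestrict P W (block (g (r - 1)) 0 0 (g (n + 2 - r))))"
      using \<Gamma>1[of "r - 1"] by (simp only: dcone_simps gid_msum i g_def)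
    then have X: "sim P (2 * (4 * e)) (mrestrict P W X11) (mrestrict P W (g (r - 1)))"
      "sim P (2 * (4 * e)) (mrestrict P W X12) 0" "sim P (2 * (4 * e)) (mrestrict P W X21) 0"
      "sim P (2 * (4 * e)) (mrestrict P W X22) (mrestrict P W (g (n + 2 - r)))"
      unfolding mrestrict_block mrestrict_zero by (rule sim_blockD)+
    \<comment> \<open>Identities enter through \<open>fold\<close>; up to reparametrization they
      drop out without increasing the radius.\<close>
    have gr: "sim P (2 * (4 * e)) (T \<odot> g k) T" if T: "mor P l (mods C k) H T" "l \<le> 2 * (4 * e)" for T :: "('g, 'g, 'm, 'r) gmor" and k l H
    proof -
      have "sim P l (T \<odot> gid (mods C k)) (mask (dom (mods C k)) UNIV T)"
        by (rule gcomp_gid_right[OF T(1) map_le_refl fccD(1)[OF C]])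
      then show ?thesis unfolding g_def using mask_mor_id[OF T(1), of "dom (mods C k)" UNIV] sim_mono[OF _ T(2)] by simp
    qed
    have gl: "sim P (2 * (4 * e)) (g k \<odot> T) T" if T: "mor P l H (mods C k) T" "l \<le> 2 * (4 * e)" for T :: "('g, 'g, 'm, 'r) gmor" and k l H
    proof -
      have "sim P l (gid (mods C k) \<odot> T) (mask UNIV (dom (mods C k)) T)"
        by (rule gcomp_gid_left[OF T(1) map_le_refl fccD(1)[OF C]])
      then show ?thesis unfolding g_def using mask_mor_id[OF T(1), of UNIV "dom (mods C k)"] sim_mono[OF _ T(2)] by simp
    qed
    have e8: "e \<le> 2 * (4 * e)" "e + 4 * e \<le> 2 * (4 * e)" using e by auto
    have pg1: "sim P e (?\<phi>1 \<odot> g (n + 1 - r)) ?\<phi>1" "mor P e (mods C (n + 1 - r)) (mods C (r - 1)) (?\<phi>1 \<odot> g (n + 1 - r))"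
      using gcomp_gid_right[OF p1 map_le_refl fccD(1)[OF C]] mask_mor_id[OF p1, of "dom (mods C (n + 1 - r))" UNIV]
        mor_gcomp[OF gm[OF order_refl] p1, of e] by (simp_all add: g_def)
    have pg2: "sim P e (?\<phi>2 \<odot> g (n + 2 - r)) ?\<phi>2" "mor P e (mods C (n + 2 - r)) (mods C (r - 2)) (?\<phi>2 \<odot> g (n + 2 - r))"
      using gcomp_gid_right[OF p2 map_le_refl fccD(1)[OF C]] mask_mor_id[OF p2, of "dom (mods C (n + 2 - r))" UNIV]
        mor_gcomp[OF gm[OF order_refl] p2, of e] by (simp_all add: g_def)
    have v1: "sim P (2 * (4 * e)) (?v1 \<odot> T) (msign (n + 1) (?\<phi>1 \<odot> T))" if "mor P (4 * e) H (mods C (n + 1 - r)) T"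
      for T :: "('g, 'g, 'm, 'r) gmor" and H
      unfolding gcomp_msign by (rule sim_msign[OF sim_gcomp_left[OF pg1 p1 that e8(2)]])
    have v2: "sim P (2 * (4 * e)) (T \<odot> ?v2) (msign (n + 1) (T \<odot> ?\<phi>2))" if "mor P (4 * e) (mods C (r - 2)) H T"
      for T :: "('g, 'g, 'm, 'r) gmor" and H
      unfolding gcomp_msign by (rule sim_msign[OF sim_gcomp_right[OF pg2 p2 that e8(2)]])
    let ?b1' = "msign (n + 1 + r) ?b1" and ?b2' = "msign (n + 1 + (r - 1)) ?b2"
    let ?c1' = "msign (n + r) ?c1" and ?c2' = "msign (n + (r - 1)) ?c2"
    let ?z1 = "msign r ?u1" and ?z2 = "msign (r - 1) ?u2"
    \<comment> \<open>The corresponding blocks in the cone of the pair. They differ from the X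
      blocks by identities composed with the symmetrization and by a sign, which a case distinction
      on the parities of n and r settles.\<close>
    define Y11 where "Y11 = ?d1 \<odot> ?a1 + ?v1 \<odot> ?c1' + ?a2 \<odot> ?d2"
    define Y12 where "Y12 = ?d1 \<odot> ?b1' + ?v1 \<odot> (- ?d'1) + ?a2 \<odot> ?v2 + ?b2' \<odot> ?z2"
    define Y21 where "Y21 = ?z1 \<odot> ?c1' + ?c2' \<odot> ?d2"
    define Y22 where "Y22 = ?z1 \<odot> (- ?d'1) + ?c2' \<odot> ?v2 + (- ?d'2) \<odot> ?z2"
    have XY11: "sim P (2 * (4 * e)) Y11 X11"
    proof -
      have "sim P (2 * (4 * e)) Y11 (?d1 \<odot> ?a1 + msign (n + 1) (?\<phi>1 \<odot> ?c1') + ?a2 \<odot> ?d2)"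
        unfolding Y11_def
        by (rule sim_add[OF sim_add[OF sim_refl v1[OF mor_msign[THEN iffD2, OF m1(3)]]] sim_refl])
      also have "?d1 \<odot> ?a1 + msign (n + 1) (?\<phi>1 \<odot> ?c1') + ?a2 \<odot> ?d2 = X11"
        unfolding X11_def by (cases "even n"; cases "even r") (simp_all add: msign_def)
      finally show ?thesis .
    qed
    have XY12: "sim P (2 * (4 * e)) Y12 (msign (n + 1 + r) X12)"
    proof -
      have "sim P (2 * (4 * e)) Y12 (?d1 \<odot> ?b1' + msign (n + 1) (?\<phi>1 \<odot> (- ?d'1)) + msign (n + 1) (?a2 \<odot> ?\<phi>2) + ?b2' \<odot> ?z2)"
        unfolding Y12_def
        by (rule sim_add[OF sim_add[OF sim_add[OF sim_refl v1[OF mor_uminus[THEN iffD2, OF m1(4)]]] v2[OF m2(1)]] sim_refl])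
      also have "?d1 \<odot> ?b1' + msign (n + 1) (?\<phi>1 \<odot> (- ?d'1)) + msign (n + 1) (?a2 \<odot> ?\<phi>2) + ?b2' \<odot> ?z2 = msign (n + 1 + r) X12"
        unfolding X12_def by (cases "even n"; cases "even r") (simp_all add: msign_def)
      finally show ?thesis .
    qed
    have XY21: "Y21 = msign (n + 1 + r) X21"
      unfolding X21_def Y21_def by (cases "even n"; cases "even r") (simp_all add: msign_def)
    have XY22: "sim P (2 * (4 * e)) Y22 X22"
    proof -
      have "sim P (2 * (4 * e)) Y22 (?z1 \<odot> (- ?d'1) + msign (n + 1) (?c2' \<odot> ?\<phi>2) + (- ?d'2) \<odot> ?z2)"
        unfolding Y22_def
        by (rule sim_add[OF sim_add[OF sim_refl v2[OF mor_msign[THEN iffD2, OF m2(3)]]] sim_refl])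
      also have "?z1 \<odot> (- ?d'1) + msign (n + 1) (?c2' \<odot> ?\<phi>2) + (- ?d'2) \<odot> ?z2 = X22"
        unfolding X22_def by (cases "even n"; cases "even r") (simp_all add: msign_def)
      finally show ?thesis .
    qed
    have "diff ?E (r + 1) \<odot> G r = block (block (g r \<odot> g r) 0 (col 0 (msign r (?d1 \<odot> g r)))
          (block (?d1 \<odot> ?a1 + ?v1 \<odot> ?c1') 0 (- (?d1 \<odot> ?a1 + ?v1 \<odot> ?c1')) 0))
        (col 0 (col (?d1 \<odot> ?b1' + ?v1 \<odot> (- ?d'1)) (- (?d1 \<odot> ?b1' + ?v1 \<odot> (- ?d'1)))))
        (row 0 (row (?z1 \<odot> ?c1') 0)) (?z1 \<odot> (- ?d'1))"
      unfolding Es G_def i g_def[symmetric]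
      by (rule cylinder_dG) (use fss in \<open>simp_all only: fs_msign fs_uminus fs_gcomp\<close>)
    moreover have "G (r - 1) \<odot> diff ?E r = block (block 0 0 (col 0 (msign (r - 1) (g (r - 1) \<odot> ?d1)))
          (block (?a2 \<odot> ?d2) 0 (g (r - 1) \<odot> g (r - 1) - ?a2 \<odot> ?d2) (g (r - 1) \<odot> g (r - 1))))
        (col 0 (col (?a2 \<odot> ?v2 + ?b2' \<odot> ?z2) (- (?a2 \<odot> ?v2 + ?b2' \<odot> ?z2))))
        (row 0 (row (?c2' \<odot> ?d2) 0)) (?c2' \<odot> ?v2 + (- ?d'2) \<odot> ?z2)"
      unfolding Es G_def i g_def[symmetric]
      by (rule cylinder_Gd) (use fss in \<open>simp_all only: fs_msign fs_uminus fs_gcomp\<close>)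
    ultimately have tot: "diff ?E (r + 1) \<odot> G r + G (r - 1) \<odot> diff ?E r =
       block (block (g r \<odot> g r) 0 (col 0 (msign r (?d1 \<odot> g r) + msign (r - 1) (g (r - 1) \<odot> ?d1)))
         (block Y11 0 (g (r - 1) \<odot> g (r - 1) + - Y11) (g (r - 1) \<odot> g (r - 1))))
         (col 0 (col Y12 (- Y12))) (row 0 (row Y21 0)) Y22"
      by (simp only: cylinder_sum Y11_def Y12_def Y21_def Y22_def add.assoc)
    \<comment> \<open>From the target in degree r to the second copy in degree r - 1, the two terms
      are the same differential with the opposite signs of r and r - 1.\<close>
    have dd: "sim P (2 * (4 * e)) (msign r (?d1 \<odot> g r) + msign (r - 1) (g (r - 1) \<odot> ?d1)) 0"
    proof -
      have "sim P (2 * (4 * e)) (msign r (?d1 \<odot> g r) + msign (r - 1) (g (r - 1) \<odot> ?d1)) (msign r ?d1 + msign (r - 1) ?d1)"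
        by (intro sim_add sim_msign gr[OF d1 e8(1)] gl[OF d1 e8(1)])
      also have "msign r ?d1 + msign (r - 1) ?d1 = 0" by (simp add: msign_def)
      finally show ?thesis .
    qed
    have gg: "sim P (2 * (4 * e)) (g k \<odot> g k) (g k)" for k
      by (rule gr[OF gm[OF order_refl]]) (use e in simp)
    \<comment> \<open>The first copy must not map to the second: the identity there cancels against
      \<open>Y11\<close>, which is homotopic to the identity, over W only.\<close>
    have ng: "sim P (2 * (4 * e)) (mrestrict P W (g (r - 1) \<odot> g (r - 1)) + - mrestrict P W Y11) 0"
    proof -
      have "sim P (2 * (4 * e)) (mrestrict P W (g (r - 1) \<odot> g (r - 1)) + - mrestrict P W Y11)
          (mrestrict P W (g (r - 1)) + - mrestrict P W (g (r - 1)))"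
        by (rule sim_add[OF sim_mrestrict_any[OF gg] sim_uminus[OF sim_trans[OF sim_mrestrict_any[OF XY11] X(1)]]])
      then show ?thesis by simp
    qed
    have y12: "sim P (2 * (4 * e)) (mrestrict P W Y12) 0"
      using sim_trans[OF sim_mrestrict_any[OF XY12, of W, unfolded mrestrict_msign] sim_msign[OF X(2)]] by simp
    have y21: "sim P (2 * (4 * e)) (mrestrict P W Y21) 0"
      using sim_msign[OF X(3), of "n + 1 + r"] by (simp add: XY21 mrestrict_msign)
    have "gid (mods ?E r) = block (block (g r) 0 0 (block (g (r - 1)) 0 0 (g (r - 1)))) 0 0 (g (n + 2 - r))"
      unfolding Es gid_msum g_def ..
    also have "\<dots> = block (block (g r) 0 (col 0 0) (block (g (r - 1)) 0 0 (g (r - 1)))) (col 0 (col 0 (- 0))) (row 0 (row 0 0)) (g (n + 2 - r))"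
      by simp
    finally have gE: "gid (mods ?E r) = \<dots>" .
    show "sim P (2 * (4 * e)) (mrestrict P W (diff ?E (r + 1) \<odot> G r + G (r - 1) \<odot> diff ?E r)) (mrestrict P W (gid (mods ?E r)))"
      unfolding tot gE mrestrict_block mrestrict_row mrestrict_col mrestrict_add mrestrict_uminus mrestrict_zero
      using dd ng y12 y21 sim_uminus[OF y12] sim_mrestrict_any[OF gg] sim_trans[OF sim_mrestrict_any[OF XY11] X(1)]
        sim_trans[OF sim_mrestrict_any[OF XY22] X(4)] sim_mrestrict_any[OF dd, of W]
      by (intro sim_block sim_row sim_col sim_refl) (simp_all only: mrestrict_add mrestrict_zero minus_zero)
  qed
qed

lemma gid_empty [simp]: "gid Map.empty = 0"
  by (intro ext) (simp add: gid_def)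

lemma msum_empty [simp]: "msum Map.empty Map.empty = Map.empty"
proof
  fix x show "msum Map.empty Map.empty x = None" by (cases x) simp_all
qed

text \<open>In degree 0 the cone is just C in degree 0, and the second copy of it in degree 1 maps
  onto it by the identity. The section is the inclusion of this copy.\<close>

lemma cylinder_connected:
  fixes C :: "('g, 'm::topological_space, 'r::involution_ring) cplx"
  assumes C: "fcc P e C" and \<psi>: "qmor P n e C \<psi>" and e: "0 \<le> e" and dim: "dimensional n C"
  shows "connected_cplx P e (dcone_pair n (csum C C) C (fold C) 0 (qsum \<psi> (- \<psi>)))"
proof -
  let ?E = "dcone_pair n (csum C C) C (fold C) 0 (qsum \<psi> (- \<psi>))"
  note Es = cylinder_simps[OF C \<psi> e]
  define g where "g r = (gid (mods C r) :: ('g, 'g, 'm, 'r) gmor)" for r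
  have gm: "mor P k (mods C r) (mods C r) (g r)" if "0 \<le> k" for r k
    unfolding g_def by (rule mor_gid[OF fccD(1,2)[OF C] that])
  define h :: "(('g + 'g + 'g) + 'g, ('g + 'g + 'g) + 'g, 'm, 'r) gmor"
    where "h = block (block 0 0 (col 0 (msign 0 (g 0))) (block 0 0 (- 0) 0)) (col 0 (col 0 (- 0))) (row 0 (row 0 0)) 0"
  have em: "mods C r = Map.empty" if "r < 0 \<or> n < r" for r using dim that by (auto simp: dimensional_def)
  have "positive_cplx ?E" unfolding positive_cplx_def
  proof (intro allI impI)
    fix r :: int assume "r < 0"
    then have "mods C r = Map.empty" "mods C (r - 1) = Map.empty" "mods C (n + 2 - r) = Map.empty" by (auto intro!: em)
    then show "mods ?E r = Map.empty" by (simp add: Es)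
  qed
  moreover have "mor P (4 * e) (mods ?E 0) (mods ?E 1) h"
    unfolding Es h_def by (intro mor_block mor_col mor_row mor_zero mor_msign[THEN iffD2] mor_uminus[THEN iffD2]) (use gm e in simp)
  moreover have "sim P (8 * e) (diff ?E 1 \<odot> h) (gid (mods ?E 0))"
  proof -
    have e1: "mods C (- 1) = Map.empty" "mods C (n + 2) = Map.empty" by (auto intro!: em)
    \<comment> \<open>The module in degree -1 is zero, so the remaining entry of the product, which
      involves this differential, disappears.\<close>
    have "diff C 0 = 0"
      using fccD(3)[OF C, of 0] e1 by (intro ext) (auto simp: mor_def)
    moreover have "diff ?E 1 \<odot> h = block (block (g 0 \<odot> g 0) 0 (col 0 (msign 0 (diff C 0 \<odot> g 0))) (block 0 0 (- 0) 0)) (col 0 (col 0 (- 0))) (row 0 (row 0 0)) 0"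
    proof -
      have i: "(1::int) - 1 = 0" "(1::int) - 2 = -1" "n + 2 - 1 = n + 1" "n + 3 - 1 = n + 2" by simp_all
      have f: "fs (diff C 1)" "fs (g 0)" "fs (diff C 0)" "fs (symm n \<psi> (- 1) \<odot> g (n + 1))" "fs (dual (diff C (n + 2)))"
        using fccD(3)[OF C, THEN mor_fs] gm[OF order_refl, THEN mor_fs] symm_mor[OF \<psi> refl, THEN mor_fs] by simp_all
      show ?thesis unfolding Es h_def i g_def[symmetric]
        by (subst cylinder_dG) (use f in simp_all)
    qed
    moreover have "gid (mods ?E 0) = block (block (g 0) 0 0 0) 0 0 0"
      by (simp add: Es gid_msum e1 g_def)
    moreover have "sim P (8 * e) (g 0 \<odot> g 0) (g 0)"
      using gcomp_gid_right[OF gm[OF order_refl] map_le_refl fccD(1)[OF C], of 0] mask_mor_id[OF gm[OF order_refl], of 0 "dom (mods C 0)" UNIV] e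
      by (auto simp: g_def intro: sim_mono)
    ultimately show ?thesis by (simp add: sim_block)
  qed
  ultimately show ?thesis unfolding connected_cplx_def using mor_imp_emorphism by blast
qed

lemma mor_has_radius: "mor P e G H f \<Longrightarrow> has_radius P e f"
  using mor_imp_emorphism emorphism_def by blast

lemma dualT_zero [simp]: "dualT n 0 s r = 0"
  by (simp add: dualT_def)

lemma qrel_zero [simp]: "qrel n C 0 s r = 0"
  by (simp add: qrel_def)

text \<open>Needed twice: to keep one summand fixed when addition is shown to respect classes, and
  as the cobordism which, cut at one end only, joins a complex to its quotient.\<close>

lemma Lcobordant_refl:
  fixes C :: "(nat, 'm::topological_space, 'r::involution_ring) cplx"
  assumes a: "(C, \<psi>) \<in> Lreps n e P Y" and e: "0 \<le> e"
  shows "Lcobordant n e P Y (C, \<psi>) (C, \<psi>)"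
proof -
  note b = Lreps_boundary[OF a a]
  have q: "quad_complex P n e C \<psi>" "fin_gen C" "poincare_over P n e (cbase P - Y) C \<psi>"
    using a by (auto simp: Lreps_def)
  have C: "fcc P e C" and dim: "dimensional n C" and \<psi>: "qmor P n e C \<psi>" and cc: "chain_complex P e C"
    using q fccI qmorI by (auto simp: quad_complex_def quad_structure_def)
  have gm: "mor P 0 (mods C r) (mods C r) (gid (mods C r))" for r
    by (rule mor_gid[OF fccD(1,2)[OF C] order_refl])
  have "chain_map P e (csum C C) C (fold C)" unfolding chain_map_def
  proof (intro allI conjI)
    fix r
    have fs: "fs (gid (mods C r) :: (nat, nat, 'm, 'r) gmor)" "fs (gid (mods C (r - 1)) :: (nat, nat, 'm, 'r) gmor)" "fs (diff C r)"
      using gm fccD(3)[OF C] mor_fs by blast+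
    have 1: "diff C r \<odot> fold C r = row (diff C r \<odot> gid (mods C r)) (diff C r \<odot> gid (mods C r))"
      by (simp add: fold_def gcomp_row)
    have 2: "fold C (r - 1) \<odot> diff (csum C C) r = row (gid (mods C (r - 1)) \<odot> diff C r) (gid (mods C (r - 1)) \<odot> diff C r)"
      using fs by (simp add: fold_def csum_def row_block)
    have m1: "mor P e (mods C r) (mods C (r - 1)) (diff C r \<odot> gid (mods C r))"
      by (rule mor_gcomp[OF gm fccD(3)[OF C]]) simp
    have m2: "mor P e (mods C r) (mods C (r - 1)) (gid (mods C (r - 1)) \<odot> diff C r)"
      by (rule mor_gcomp[OF fccD(3)[OF C] gm]) simp
    have "mor P e (msum (mods C r) (mods C r)) (mods C r) (fold C r)"
      unfolding fold_def by (intro mor_row mor_mono[OF gm e])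
    then show "emorphism P e (mods (csum C C) r) (mods C r) (fold C r)"
      by (intro mor_imp_emorphism) (simp add: csum_def)
    show "has_radius P e (diff C r \<odot> fold C r)" unfolding 1 by (rule mor_has_radius[OF mor_row[OF m1 m1]])
    show "has_radius P e (fold C (r - 1) \<odot> diff (csum C C) r)" unfolding 2 by (rule mor_has_radius[OF mor_row[OF m2 m2]])
    have "sim P e (diff C r \<odot> gid (mods C r)) (diff C r)"
      using gcomp_gid_right[OF fccD(3)[OF C] map_le_refl fccD(1)[OF C], of r]
        mask_mor_id[OF fccD(3)[OF C], of r "dom (mods C r)" UNIV] by simp
    also have "sim P e (diff C r) (gid (mods C (r - 1)) \<odot> diff C r)"
      using gcomp_gid_left[OF fccD(3)[OF C] map_le_refl fccD(1)[OF C], of r]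
        mask_mor_id[OF fccD(3)[OF C], of r UNIV "dom (mods C (r - 1))"] by (simp add: sim_sym)
    finally show "sim P e (diff C r \<odot> fold C r) (fold C (r - 1) \<odot> diff (csum C C) r)"
      unfolding 1 2 by (intro sim_row)
  qed
  moreover have "push n (fold C) (qsum \<psi> (- \<psi>)) s r = 0" for s r
  proof -
    have fs: "fs (gid (mods C k) :: (nat, nat, 'm, 'r) gmor)" "fs (\<psi> s r)" for k
      using gm qmorD[OF \<psi> refl] mor_fs by blast+
    show ?thesis unfolding push_def fold_def qsum_def dual_row dual_gid using fs
      by (simp add: block_col row_col)
  qed
  moreover have "qfamily P (n + 1) e C 0"
    by (simp add: qfamily_def mor_imp_emorphism)
  moreover have "dimensional (n + 1) C" unfolding dimensional_def
  proof (intro allI impI)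
    fix r assume "\<not> (0 \<le> r \<and> r \<le> n + 1)"
    then have "\<not> (0 \<le> r \<and> r \<le> n)" by auto
    then show "mods C r = Map.empty" using dim unfolding dimensional_def by blast
  qed
  ultimately have "quad_pair P n e (csum C C) C (fold C) 0 (qsum \<psi> (- \<psi>))"
    unfolding quad_pair_def using b(1) cc by simp
  moreover have "connected_pair P n e (csum C C) C (fold C) 0 (qsum \<psi> (- \<psi>))"
    unfolding connected_pair_def using b(2) cylinder_connected[OF C \<psi> e dim] by blast
  moreover have "poincare_pair_over P n e (cbase P - Y) (csum C C) C (fold C) 0 (qsum \<psi> (- \<psi>))"
    unfolding poincare_pair_over_def
    using b(3) cylinder_contractible[OF C \<psi> e q(3)[unfolded poincare_over_def]] by blast
  ultimately show ?thesis unfolding Lcobordant_def using q(2) by blast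
qed

section \<open>From representatives to L-groups\<close>

section \<open>Excision for controlled L-groups\<close>

lemma equivclp_map:
  assumes "equivclp R a b" "\<And>x y. R x y \<Longrightarrow> R' (g x) (g y)"
  shows "equivclp R' (g a) (g b)"
  using assms(1)
proof (induction rule: equivclp_induct)
  case base
  then show ?case by simp
next
  case (step y z)
  then have "R' (g y) (g z) \<or> R' (g z) (g y)" using assms(2) by blast
  then show ?case using step.IH equivclp_into_equivclp by metis
qed

text \<open>The relation is generated by single cobordisms, in either direction, between
  representatives. It therefore suffices that \<open>g\<close> preserves representatives and
  cobordisms.\<close>

lemma Lrel_map:
  assumes "(a, b) \<in> Lrel n d e P Y"
    and "\<And>x. x \<in> Lreps n e P Y \<Longrightarrow> g x \<in> Lreps n e' P' Y'"
    and "\<And>x y. x \<in> Lreps n e P Y \<Longrightarrow> y \<in> Lreps n e P Y \<Longrightarrow> Lcobordant n d P Y x y \<Longrightarrow> Lcobordant n d' P' Y' (g x) (g y)"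
  shows "(g a, g b) \<in> Lrel n d' e' P' Y'"
proof -
  have ab: "a \<in> Lreps n e P Y" "b \<in> Lreps n e P Y"
    and eq: "equivclp (\<lambda>x y. x \<in> Lreps n e P Y \<and> y \<in> Lreps n e P Y \<and> Lcobordant n d P Y x y) a b"
    using assms(1) by (auto simp: Lrel_def)
  have "equivclp (\<lambda>x y. x \<in> Lreps n e' P' Y' \<and> y \<in> Lreps n e' P' Y' \<and> Lcobordant n d' P' Y' x y) (g a) (g b)"
    by (rule equivclp_map[OF eq]) (use assms(2,3) in blast)
  then show ?thesis using assms(2)[OF ab(1)] assms(2)[OF ab(2)] by (simp add: Lrel_def)
qed

lemma Lrel_equiv: "equiv (Lreps n e P Y) (Lrel n d e P Y)"
  by (rule equivI) (auto simp: Lrel_def refl_on_def sym_def trans_def intro: equivclp_sym equivclp_trans)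

lemma Lrel_cobordant:
  "a \<in> Lreps n e P Y \<Longrightarrow> b \<in> Lreps n e P Y \<Longrightarrow> Lcobordant n d P Y a b \<Longrightarrow> (a, b) \<in> Lrel n d e P Y"
  unfolding Lrel_def by (auto intro: r_into_equivclp)

lemma Lclass_eq: "(a, b) \<in> Lrel n d e P Y \<Longrightarrow> Lclass n d e P Y a = Lclass n d e P Y b"
  unfolding Lclass_def by (rule equiv_class_eq[OF Lrel_equiv])

lemma mem_Lclass: "b \<in> Lclass n d e P Y a \<longleftrightarrow> (a, b) \<in> Lrel n d e P Y"
  by (simp add: Lclass_def)

lemma Lclass_self: "a \<in> Lreps n e P Y \<Longrightarrow> a \<in> Lclass n d e P Y a"
  unfolding Lclass_def by (rule equiv_class_self[OF Lrel_equiv])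

text \<open>Maps on classes are written as unions over representatives. If \<open>g\<close> respects
  the relation, the union is over equal sets, and it is nonempty because a lies in its own
  class.\<close>

lemma Lclass_UN:
  assumes "a \<in> Lreps n e P Y" "\<And>b. (a, b) \<in> Lrel n d e P Y \<Longrightarrow> (g a, g b) \<in> Lrel n d' e' P' Y'"
  shows "(\<Union>b\<in>Lclass n d e P Y a. Lclass n d' e' P' Y' (g b)) = Lclass n d' e' P' Y' (g a)"
proof -
  have "Lclass n d' e' P' Y' (g b) = Lclass n d' e' P' Y' (g a)" if "b \<in> Lclass n d e P Y a" for b
    using that by (intro Lclass_eq[OF assms(2), symmetric]) (simp only: mem_Lclass)
  then have "(\<Union>b\<in>Lclass n d e P Y a. Lclass n d' e' P' Y' (g b)) = (\<Union>b\<in>Lclass n d e P Y a. Lclass n d' e' P' Y' (g a))"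
    by (intro SUP_cong refl)
  also have "\<dots> = Lclass n d' e' P' Y' (g a)" using Lclass_self[OF assms(1)] by blast
  finally show ?thesis .
qed

lemma Lincl_Lclass:
  assumes "a \<in> Lreps n e P Y" "\<And>b. (a, b) \<in> Lrel n d e P Y \<Longrightarrow> (a, b) \<in> Lrel n d' e' P' Y'"
  shows "Lincl n d' e' P' Y' (Lclass n d e P Y a) = Lclass n d' e' P' Y' a"
  unfolding Lincl_def using Lclass_UN[of a n e P Y d "\<lambda>x. x" d' e' P' Y'] assms by simp

lemma Lrel_le:
  assumes "control_le P Q" "cbase Q - Z \<subseteq> cbase P - Y" "(a, b) \<in> Lrel n d e P Y"
  shows "(a, b) \<in> Lrel n d e Q Z"
  using Lrel_map[OF assms(3), of "\<lambda>x. x" e Q Z d] Lreps_le[OF assms(1) order_refl assms(2)]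
    Lcobordant_le[OF assms(1) order_refl assms(2)] by blast

lemma Lgroup_carrier:
  assumes "c \<in> carrier (Lgroup n d e P Y)"
  obtains a where "a \<in> Lreps n e P Y" "c = Lclass n d e P Y a"
  using assms by (auto simp: Lgroup_def quotient_def Lclass_def)

lemma Lclass_carrier: "a \<in> Lreps n e P Y \<Longrightarrow> Lclass n d e P Y a \<in> carrier (Lgroup n d e P Y)"
  by (auto simp: Lgroup_def quotient_def Lclass_def)

text \<open>One argument is changed at a time, the other carrying the trivial cobordism. This
  cobordism has to have radius d, so a representative of radius e is first regarded as one of radius
  d.\<close>

lemma Lrel_Lsum:
  assumes e: "0 \<le> e" "e \<le> d" and a: "(a, a') \<in> Lrel n d e P Y" and b: "(b, b') \<in> Lrel n d e P Y"
  shows "(Lsum a b, Lsum a' b') \<in> Lrel n d e P Y"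
proof -
  have refl: "Lcobordant n d P Y x x" if "x \<in> Lreps n e P Y" for x
  proof -
    have "x \<in> Lreps n d P Y" by (rule Lreps_le[OF control_le_refl e(2) subset_refl that])
    then show ?thesis using Lcobordant_refl[of "fst x" "snd x" n d P Y] e by simp
  qed
  have r: "a' \<in> Lreps n e P Y" "b \<in> Lreps n e P Y" using a b by (auto simp: Lrel_def)
  have "(Lsum a b, Lsum a' b) \<in> Lrel n d e P Y"
    by (rule Lrel_map[OF a, where g = "\<lambda>x. Lsum x b"])
      (rule Lsum_Lreps[OF _ r(2)] Lcobordant_Lsum[OF _ refl[OF r(2)]]; assumption)+
  moreover have "(Lsum a' b, Lsum a' b') \<in> Lrel n d e P Y"
    by (rule Lrel_map[OF b, where g = "Lsum a'"])
      (rule Lsum_Lreps[OF r(1)] Lcobordant_Lsum[OF refl[OF r(1)]]; assumption)+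
  ultimately show ?thesis by (rule transD[OF equiv_def[THEN iffD1, OF Lrel_equiv, THEN conjunct2, THEN conjunct2, THEN conjunct2]])
qed

lemma Lgroup_mult:
  assumes e: "0 \<le> e" "e \<le> d" and a: "a \<in> Lreps n e P Y" and b: "b \<in> Lreps n e P Y"
  shows "Lclass n d e P Y a \<otimes>\<^bsub>Lgroup n d e P Y\<^esub> Lclass n d e P Y b = Lclass n d e P Y (Lsum a b)"
proof -
  have "Lclass n d e P Y (Lsum x y) = Lclass n d e P Y (Lsum a b)"
    if "x \<in> Lclass n d e P Y a" "y \<in> Lclass n d e P Y b" for x y
    using Lclass_eq[OF Lrel_Lsum[OF e, of a x n P Y b y]] that by (simp add: mem_Lclass)
  then have "(\<Union>x\<in>Lclass n d e P Y a. \<Union>y\<in>Lclass n d e P Y b. Lclass n d e P Y (Lsum x y)) =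
      (\<Union>x\<in>Lclass n d e P Y a. \<Union>y\<in>Lclass n d e P Y b. Lclass n d e P Y (Lsum a b))"
    by (intro SUP_cong refl)
  also have "\<dots> = Lclass n d e P Y (Lsum a b)"
    using Lclass_self[OF a] Lclass_self[OF b] by blast
  finally show ?thesis by (simp add: Lgroup_def)
qed

text \<open>Lets one end of a cobordism stay uncut; the discarded part is then empty as far as
  actual generators go.\<close>

lemma quot_of_refl: "fcc P e C \<Longrightarrow> quot_of C C"
  unfolding quot_of_def
proof (intro allI conjI impI)
  assume C: "fcc P e C"
  show "mods C r \<subseteq>\<^sub>m mods C r" for r by simp
  show "diff C r = mask (dom (mods C r)) (dom (mods C (r - 1))) (diff C r)" for r
    using mask_mor_id[OF fccD(3)[OF C]] by simp
  show "diff C r x y \<rho> = 0" if "x \<notin> dom (mods C r)" for r x y \<rho>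
    using that morD(2)[OF fccD(3)[OF C], of r x y \<rho>] by blast
qed

lemma qsim_refl: "qmor P n e C \<psi> \<Longrightarrow> qsim P n e C \<psi> \<psi>"
  unfolding qsim_def by (simp add: mask_mor_id[OF qmorD[OF _ refl] subset_refl subset_refl])

lemma qmor_mono: "qmor P n d C \<psi> \<Longrightarrow> d \<le> e \<Longrightarrow> qmor P n e C \<psi>"
  unfolding qmor_def using mor_mono by blast

lemma qsim_mono: "qsim P n d C \<psi>' \<psi> \<Longrightarrow> d \<le> e \<Longrightarrow> qsim P n e C \<psi>' \<psi>"
  unfolding qsim_def using sim_mono by blast

lemma quot_of_csum:
  assumes "quot_of E C" "quot_of E' C'"
  shows "quot_of (csum E E') (csum C C')"
  unfolding quot_of_def csum_def cplx.simps dom_msum mask_block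
proof (intro allI conjI impI)
  fix r
  show "msum (mods E r) (mods E' r) \<subseteq>\<^sub>m msum (mods C r) (mods C' r)"
    by (rule msum_le[OF quot_ofD(1)[OF assms(1)] quot_ofD(1)[OF assms(2)]])
  show "block (diff E r) 0 0 (diff E' r) =
     block (mask (dom (mods E r)) (dom (mods E (r - 1))) (diff C r)) (mask (dom (mods E' r)) (dom (mods E (r - 1))) 0)
      (mask (dom (mods E r)) (dom (mods E' (r - 1))) 0) (mask (dom (mods E' r)) (dom (mods E' (r - 1))) (diff C' r))"
    unfolding mask_zero quot_ofD(2)[OF assms(1), of r] quot_ofD(2)[OF assms(2), of r] ..
  fix x y \<rho>
  assume a: "x \<notin> Inl ` dom (mods E r) \<union> Inr ` dom (mods E' r)" "y \<in> Inl ` dom (mods E (r - 1)) \<union> Inr ` dom (mods E' (r - 1))"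
  show "block (diff C r) 0 0 (diff C' r) x y \<rho> = 0"
  proof (cases x; cases y)
    fix i j assume "x = Inl i" "y = Inl j"
    then show ?thesis using a quot_ofD(4)[OF assms(1), of i r j \<rho>] by auto
  next
    fix i j assume "x = Inr i" "y = Inr j"
    then show ?thesis using a quot_ofD(4)[OF assms(2), of i r j \<rho>] by auto
  qed simp_all
qed

lemma qmor_csum:
  assumes "qmor P n e C \<psi>" "qmor P n e C' \<psi>'"
  shows "qmor P n e (csum C C') (qsum \<psi> (- \<psi>'))"
  unfolding qmor_def qsum_def csum_def cplx.simps
  by (intro allI mor_block mor_zero qmorD[OF assms(1) refl]) (simp add: qmorD[OF assms(2) refl])

lemma qsim_csum:
  assumes "qsim P n e E \<phi> \<psi>" "qsim P n e E' \<phi>' \<psi>'"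
  shows "qsim P n e (csum E E') (qsum \<phi> (- \<phi>')) (qsum \<psi> (- \<psi>'))"
  unfolding qsim_def qsum_def csum_def cplx.simps dom_msum mask_block mask_zero
proof (intro allI sim_block sim_refl qsimD[OF assms(1) refl])
  fix s r
  show "sim P e ((- \<phi>') s r) (mask (dom (mods E' (n - r - int s))) (dom (mods E' r)) ((- \<psi>') s r))"
    using sim_uminus[OF qsimD[OF assms(2) refl, of s r]] by simp
qed

lemma dsg_ext:
  assumes "splits i1 i2" "dsg i1 i2 G1 G2 G" "dsg i1 i2 G1 G2 H"
  shows "G = H"
proof
  fix z show "G z = H z"
    by (rule splits_cases[OF assms(1), of z]) (use assms(2,3) in \<open>simp_all add: dsg_def\<close>)
qed

lemma cplx_eqI:
  fixes C D :: "('g, 'm, 'r) cplx"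
  shows "mods C = mods D \<Longrightarrow> diff C = diff D \<Longrightarrow> C = D"
  by simp

text \<open>The injections exhaust the generators, so a direct sum is determined by its blocks. This
  gives equality of complexes and not only isomorphism.\<close>

lemma cds_ext:
  assumes "cds i1 i2 C1 C2 C" "cds i1 i2 C1 C2 D"
  shows "C = D"
proof (rule cplx_eqI)
  note s = cdsD(1)[OF assms(1)]
  show "mods C = mods D" by (rule ext, rule dsg_ext[OF s cdsD(2)[OF assms(1)] cdsD(2)[OF assms(2)]])
  show "diff C = diff D" by (rule ext, rule dsm_ext[OF s s cdsD(3)[OF assms(1)] cdsD(3)[OF assms(2)]])
qed

lemma far_eq': "A \<subseteq> X \<Longrightarrow> A - (A \<inter> closed_nbhd X N k) = far A N k"
  by (auto simp: far_def closed_nbhd_def)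

lemma restr_cbase: "control_map P \<Longrightarrow> restr P (cbase P) = P"
proof -
  assume "control_map P"
  then have "cdom P \<inter> cmap P -` cbase P = cdom P" by (auto simp: control_map_def)
  then show ?thesis by (simp add: restr_def)
qed

lemma quotient_diff:
  "diff (quotient_cplx C C') r x y =
    (if mods (quotient_cplx C C') r x \<noteq> None \<and> mods (quotient_cplx C C') (r - 1) y \<noteq> None then diff C r x y else 0)"
  by (auto simp: quotient_cplx_def domIff fun_eq_iff)

context excision
begin

definition excise :: "int \<Rightarrow> real \<Rightarrow> ('m, 'r::involution_ring) qcplx \<Rightarrow> ('m, 'r) qcplx" where
  "excise n e = (\<lambda>(C, \<psi>). let C' = cut C (\<lambda>r. real_of_int (n + 2 - r) * 4 * e)
     in (quotient_cplx C C', push n (quotient_proj C C') \<psi>))"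

text \<open>Collects for the cut made with e all that \<open>quotient_cobordant\<close> wants to
  know at the larger radius d, in particular that generators beyond the d thresholds are
  retained.\<close>

lemma excise_quotient:
  assumes n: "1 \<le> n" and e: "0 \<le> e" "e \<le> d" and a: "(C, \<psi>) \<in> Lreps n e P B" and E: "excise n e (C, \<psi>) = (E, \<psi>')"
  shows "quot_of E C" "qmor P n d E \<psi>'" "qsim P n d E \<psi>' \<psi>"
    "mods C r x = Some u \<Longrightarrow> cmap P u \<in> far A N (real_of_int (n + 2 - r) * 4 * d) \<Longrightarrow> x \<in> dom (mods E r)"
    "real_of_int (n + 5) * 4 * e \<le> K \<Longrightarrow> (E, \<psi>') \<in> Lreps n e (restr P A) (A \<inter> closed_nbhd (cbase P) N K)"
proof -
  let ?k = "\<lambda>r. real_of_int (n + 2 - r) * 4 * e"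
  have a': "fin_gen C" "quad_complex P n e C \<psi>" "connected_quad P n e C \<psi>" "poincare_over P n e (cbase P - B) C \<psi>"
    using a by (auto simp: Lreps_def)
  have E': "E = quotient_cplx C (cut C ?k)" "\<psi>' = push n (quotient_proj C (cut C ?k)) \<psi>"
    using E by (auto simp: excise_def Let_def)
  note q = quotient_complex[OF n e(1) a'(1,2), folded E']
  show "quot_of E C" by (rule q(1))
  show "qmor P n d E \<psi>'" by (rule qmor_mono[OF q(2) e(2)])
  show "qsim P n d E \<psi>' \<psi>" by (rule qsim_mono[OF q(3) e(2)])
  show "x \<in> dom (mods E r)" if x: "mods C r x = Some u" and u: "cmap P u \<in> far A N (real_of_int (n + 2 - r) * 4 * d)"
  proof -
    \<comment> \<open>The factor n + 2 - r is then positive, so the threshold grows with the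
      radius.\<close>
    have "r \<le> n" using dimD[of n C r x u] a'(2) x by (simp add: quad_complex_def)
    then have "?k r \<le> real_of_int (n + 2 - r) * 4 * d" "0 \<le> ?k r"
      using e by (auto intro!: mult_left_mono)
    then have "cmap P u \<in> far A N (?k r)" using far_mono u by blast
    then show ?thesis
      using quotient_mods[of ?k r C x u] \<open>0 \<le> ?k r\<close> a'(2) x unfolding E'(1)
      by (auto simp: quad_complex_def chain_complex_def)
  qed
  show "(E, \<psi>') \<in> Lreps n e (restr P A) (A \<inter> closed_nbhd (cbase P) N K)" if K: "real_of_int (n + 5) * 4 * e \<le> K"
    using q(4,5) q(6)[OF a'(3)] q(7)[OF a'(4) K] X far_eq'[of A "cbase P" N K] by (auto simp: Lreps_def)
qed

text \<open>The two ends have separate quotients and the control space may be larger than A. With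
  both ends cut this shows that exc is well defined; with one end uncut it compares a complex with
  its quotient.\<close>

lemma quotient_cobordant:
  fixes C1 C2 E1 E2 :: "(nat, 'm, 'r::involution_ring) cplx"
  assumes n: "1 \<le> n" and d: "0 \<le> d" and cob: "Lcobordant n d P B (C1, \<psi>1) (C2, \<psi>2)"
    and fin: "fin_gen C1" "fin_gen C2"
    and q: "quot_of E1 C1" "quot_of E2 C2"
    and m: "qmor P n d E1 \<phi>1" "qmor P n d E2 \<phi>2" "qsim P n d E1 \<phi>1 \<psi>1" "qsim P n d E2 \<phi>2 \<psi>2"
    and mem: "\<And>r x u. mods C1 r x = Some u \<Longrightarrow> cmap P u \<in> far A N (real_of_int (n + 2 - r) * 4 * d) \<Longrightarrow> x \<in> dom (mods E1 r)"
      "\<And>r x u. mods C2 r x = Some u \<Longrightarrow> cmap P u \<in> far A N (real_of_int (n + 2 - r) * 4 * d) \<Longrightarrow> x \<in> dom (mods E2 r)"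
    and A': "A \<subseteq> A'" and K: "real_of_int (n + 5) * 4 * d \<le> K" and Y: "A' - Y = far A N K"
    and L: "(E1, \<phi>1) \<in> Lreps n d (restr P A') Y" "(E2, \<phi>2) \<in> Lreps n d (restr P A') Y"
  shows "Lcobordant n d (restr P A') Y (E1, \<phi>1) (E2, \<phi>2)"
proof -
  obtain D :: "(nat, 'm, 'r) cplx" and f \<delta> where D: "fin_gen D"
       "quad_pair P n d (csum C1 C2) D f \<delta> (qsum \<psi>1 (- \<psi>2))"
       "connected_pair P n d (csum C1 C2) D f \<delta> (qsum \<psi>1 (- \<psi>2))"
       "poincare_pair_over P n d (cbase P - B) (csum C1 C2) D f \<delta> (qsum \<psi>1 (- \<psi>2))"
    using cob unfolding Lcobordant_def by blast
  have fC: "fin_gen (csum C1 C2)" by (rule cds_fin_gen[OF cds_csum fin])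
  have me: "x \<in> dom (mods (csum E1 E2) r)"
    if "mods (csum C1 C2) r x = Some u" "cmap P u \<in> far A N (real_of_int (n + 2 - r) * 4 * d)" for r x u
    using that mem(1)[of r _ u] mem(2)[of r _ u] by (cases x) (auto simp: csum_def dom_msum)
  note b = Lreps_boundary[OF L]
  have Y': "cbase (restr P A') - Y = far A N K" using Y by (simp add: restr_def)
  note b' = b(3)[unfolded Y']
  note r = quotient_pair[OF n d fC D quot_of_csum[OF q] me qmor_csum[OF m(1,2)] qsim_csum[OF m(3,4)] A' K b(1,2) b']
  show ?thesis unfolding Lcobordant_def prod.case Y'
    by (intro exI conjI) (rule r; assumption)+
qed

lemma excise_cobordant:
  assumes n: "1 \<le> n" and e: "0 \<le> e" "e \<le> d" and a: "a \<in> Lreps n e P B" and b: "b \<in> Lreps n e P B"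
    and cob: "Lcobordant n d P B a b"
  defines "Y \<equiv> A \<inter> closed_nbhd (cbase P) N (real_of_int (n + 5) * 4 * d)"
  shows "Lcobordant n d (restr P A) Y (excise n e a) (excise n e b)"
proof -
  obtain C1 \<psi>1 C2 \<psi>2 where ab: "a = (C1, \<psi>1)" "b = (C2, \<psi>2)" by (metis prod.exhaust)
  obtain E1 \<phi>1 E2 \<phi>2 where E: "excise n e (C1, \<psi>1) = (E1, \<phi>1)" "excise n e (C2, \<psi>2) = (E2, \<phi>2)" by (metis prod.exhaust)
  note q1 = excise_quotient[OF n e a[unfolded ab] E(1)] and q2 = excise_quotient[OF n e b[unfolded ab] E(2)]
  have K: "real_of_int (n + 5) * 4 * e \<le> real_of_int (n + 5) * 4 * d"
    using e n by (intro mult_left_mono) auto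
  have L: "(E1, \<phi>1) \<in> Lreps n d (restr P A) Y" "(E2, \<phi>2) \<in> Lreps n d (restr P A) Y"
    unfolding Y_def by (rule Lreps_le[OF control_le_refl e(2) subset_refl], rule q1(5)[OF K] q2(5)[OF K])+
  have d: "0 \<le> d" using e by simp
  have fin: "fin_gen C1" "fin_gen C2" using a b by (auto simp: ab Lreps_def)
  have "A - Y = far A N (real_of_int (n + 5) * 4 * d)" unfolding Y_def using X by (intro far_eq') auto
  then show ?thesis unfolding ab E
    by (intro quotient_cobordant[OF n d cob[unfolded ab] fin q1(1) q2(1) q1(2) q2(2) q1(3) q2(3) q1(4) q2(4)
          subset_refl order_refl _ L])
qed

text \<open>The cylinder on C is cut in its interior and at its second end. The first end keeps its
  generators over B, so the cobordism lives over all of X and is Poincare only off B and the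
  neighbourhood of N.\<close>

lemma excise_self:
  assumes n: "1 \<le> n" and e: "0 \<le> e" "e \<le> d" and a: "a \<in> Lreps n e P B"
  shows "Lcobordant n d P (B \<union> closed_nbhd (cbase P) N (real_of_int (n + 5) * 4 * d)) a (excise n e a)"
proof -
  let ?K = "real_of_int (n + 5) * 4 * d"
  let ?Y = "B \<union> closed_nbhd (cbase P) N ?K"
  obtain C \<psi> where a': "a = (C, \<psi>)" by (metis prod.exhaust)
  obtain E \<phi> where E: "excise n e (C, \<psi>) = (E, \<phi>)" by (metis prod.exhaust)
  note q = excise_quotient[OF n e a[unfolded a'] E]
  have K: "real_of_int (n + 5) * 4 * e \<le> ?K"
    using e n by (intro mult_left_mono) auto
  have d: "0 \<le> d" "0 \<le> ?K" using e n by auto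
  have r: "restr P (cbase P) = P" by (rule restr_cbase[OF P])
  have Y: "cbase P - ?Y = far A N ?K" by (rule far_eq[OF d(2) N X])
  have Y': "A - (A \<inter> closed_nbhd (cbase P) N ?K) = far A N ?K" using X by (intro far_eq') auto
  have ad: "(C, \<psi>) \<in> Lreps n d P B" using Lreps_le[OF control_le_refl e(2) subset_refl a] by (simp add: a')
  \<comment> \<open>Both ends must be representatives over the whole of X: the first by shrinking
    its Poincare region, the quotient by including A into X.\<close>
  have L: "(C, \<psi>) \<in> Lreps n d (restr P (cbase P)) ?Y" "(E, \<phi>) \<in> Lreps n d (restr P (cbase P)) ?Y"
    unfolding r
    by (rule Lreps_le[OF control_le_refl order_refl _ ad], blast)
      (rule Lreps_le[OF control_le_restr e(2) _ q(5)[OF K]], use Y Y' in simp)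
  have C: "fcc P d C" "qmor P n d C \<psi>" "fin_gen C"
    using ad fccI qmorI by (auto simp: Lreps_def quad_complex_def quad_structure_def)
  have "Lcobordant n d (restr P (cbase P)) ?Y (C, \<psi>) (E, \<phi>)"
    by (rule quotient_cobordant[OF n d(1) Lcobordant_refl[OF ad d(1)] C(3,3) quot_of_refl[OF C(1)] q(1) C(2) q(2)
          qsim_refl[OF C(2)] q(3) _ q(4) _ order_refl Y L]) (use X in auto)
  then show ?thesis unfolding a' E r .
qed

lemma excise_Lreps:
  assumes n: "1 \<le> n" and e: "0 \<le> e" "e \<le> d" and a: "a \<in> Lreps n e P B"
  shows "excise n e a \<in> Lreps n e (restr P A) (A \<inter> closed_nbhd (cbase P) N (real_of_int (n + 5) * 4 * d))"
proof -
  obtain C \<psi> where a': "a = (C, \<psi>)" by (metis prod.exhaust)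
  obtain E \<phi> where E: "excise n e (C, \<psi>) = (E, \<phi>)" by (metis prod.exhaust)
  have K: "real_of_int (n + 5) * 4 * e \<le> real_of_int (n + 5) * 4 * d"
    using e n by (intro mult_left_mono) auto
  show ?thesis unfolding a' E by (rule excise_quotient(5)[OF n e a[unfolded a'] E K])
qed

text \<open>Whether a generator is cut depends on its position alone, so the cut is compatible with
  every splitting of the generators.\<close>

lemma quotient_cut_mods:
  "mods (quotient_cplx C (cut C k)) r x = (case mods C r x of None \<Rightarrow> None
     | Some u \<Rightarrow> if cmap P u \<in> B \<union> closed_nbhd (cbase P) N (k r) then None else Some u)"
proof -
  have eq: "mods (quotient_cplx C (cut C k)) r x = (if x \<in> dom (cut C k r) then None else mods C r x)"
    by (simp add: quotient_cplx_def quotient_mod_def restrict_map_def)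
  show ?thesis unfolding eq dom_cut by (cases "mods C r x") simp_all
qed

lemma cds_quotient:
  fixes C1 :: "('g, 'm, 'r::involution_ring) cplx" and C2 :: "('h, 'm, 'r) cplx" and C :: "('k, 'm, 'r) cplx"
  assumes c: "cds i1 i2 C1 C2 C"
  shows "cds i1 i2 (quotient_cplx C1 (cut C1 k)) (quotient_cplx C2 (cut C2 k)) (quotient_cplx C (cut C k))"
proof -
  let ?E1 = "quotient_cplx C1 (cut C1 k)" and ?E2 = "quotient_cplx C2 (cut C2 k)" and ?E = "quotient_cplx C (cut C k)"
  have m: "mods ?E r (i1 x) = mods ?E1 r x" "mods ?E r (i2 y) = mods ?E2 r y" for r x y
    unfolding quotient_cut_mods using cdsD(2)[OF c, of r] by (simp_all add: dsg_def)
  have "dsg i1 i2 (mods ?E1 r) (mods ?E2 r) (mods ?E r)" for r by (simp add: dsg_def m)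
  moreover have "dsm i1 i2 i1 i2 (diff ?E1 r) (diff ?E2 r) (diff ?E r)" for r
    using cdsD(3)[OF c, of r] unfolding dsm_def quotient_diff m by simp
  ultimately show ?thesis using cdsD(1)[OF c] by (simp add: cds_def)
qed

text \<open>Both sides are direct sums of the same blocks along the same injections, hence equal as
  complexes with structure; additivity of exc needs no further cobordism.\<close>

lemma excise_Lsum:
  fixes a b :: "('m, 'r::involution_ring) qcplx"
  shows "excise n e (Lsum a b) = Lsum (excise n e a) (excise n e b)"
proof -
  let ?k = "\<lambda>r. real_of_int (n + 2 - r) * 4 * e"
  obtain C1 \<psi>1 C2 \<psi>2 where ab: "a = (C1, \<psi>1)" "b = (C2, \<psi>2)" by (metis prod.exhaust)
  obtain L \<psi> where L: "Lsum (C1, \<psi>1) (C2, \<psi>2) = (L, \<psi>)" by (metis prod.exhaust)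
  have c: "cds enl enr C1 C2 L" "qds enl enr \<psi>1 \<psi>2 \<psi>"
    using cds_Lsum[of C1 C2 \<psi>1 \<psi>2] qds_Lsum[of \<psi>1 \<psi>2 C1 C2] L by simp_all
  let ?E = "\<lambda>C :: (nat, 'm, 'r) cplx. quotient_cplx C (cut C ?k)"
  let ?p = "\<lambda>C :: (nat, 'm, 'r) cplx. quotient_proj C (cut C ?k)"
  have p: "?p C r = gid (mods (?E C) r)" for C r by (simp add: quotient_proj_def quotient_cplx_def)
  have cE: "cds enl enr (?E C1) (?E C2) (?E L)" by (rule cds_quotient[OF c(1)])
  have "dsm enl enr enl enr (?p C1 r) (?p C2 r) (?p L r)" for r
    unfolding p by (rule dsm_gid[OF cdsD(1,2)[OF cE]])
  then have qE: "qds enl enr (push n (?p C1) \<psi>1) (push n (?p C2) \<psi>2) (push n (?p L) \<psi>)"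
    by (rule qds_push[OF c(1) _ c(2)])
  let ?M = "Lsum (?E C1, push n (?p C1) \<psi>1) (?E C2, push n (?p C2) \<psi>2)"
  have "?E L = fst ?M" by (rule cds_ext[OF cE cds_Lsum])
  moreover have "push n (?p L) \<psi> = snd ?M"
  proof (rule ext, rule ext)
    fix s r
    show "push n (?p L) \<psi> s r = snd ?M s r"
      by (rule dsm_ext[OF splits_en splits_en qdsD[OF qE, of s r]
            qdsD[OF qds_Lsum[of "push n (?p C1) \<psi>1" "push n (?p C2) \<psi>2" "?E C1" "?E C2"], of s r]])
  qed
  ultimately have "(?E L, push n (?p L) \<psi>) = ?M" by (intro prod_eqI) (simp_all only: fst_conv snd_conv)
  then show ?thesis by (simp only: ab L excise_def prod.case Let_def)
qed

end

theorem mainTheorem2: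
  fixes P :: "('m::topological_space, 'x::metric_space) control"
    and A B N N' :: "'x set" and n :: int and \<delta> \<epsilon> :: real
    and C' :: "(nat, 'm, 'r::involution_ring) cplx \<Rightarrow> int \<Rightarrow> (nat, 'm) gmod"
  assumes P: "control_map P"
    and A: "closedin (top_of_set (cbase P)) A"
    and B: "closedin (top_of_set (cbase P)) B"
    and X: "cbase P = A \<union> B"
    and N: "N = A \<inter> B"
    and n: "n \<ge> 1"
    and \<epsilon>: "\<epsilon> \<ge> 0"
    and \<delta>: "\<delta> \<ge> \<epsilon>"
    and N': "N' = closed_nbhd (cbase P) N (real_of_int (n + 5) * 4 * \<delta>)"
    and C': "\<And>C r. C' C r =
      over P (mods C r) (B \<union> closed_nbhd (cbase P) N (real_of_int (n + 2 - r) * 4 * \<epsilon>))"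
  shows "\<exists>exc :: ('m, 'r) qcplx set \<Rightarrow> ('m, 'r) qcplx set.
    exc \<in> hom (Lgroup n \<delta> \<epsilon> P B) (Lgroup n \<delta> \<epsilon> (restr P A) (A \<inter> N')) \<and>
    (\<forall>(C, \<psi>) \<in> Lreps n \<epsilon> P B.
       geom_subcomplex C (C' C) \<and>
       (quotient_cplx C (C' C), push n (quotient_proj C (C' C)) \<psi>)
         \<in> Lreps n \<epsilon> (restr P A) (A \<inter> N') \<and>
       exc (Lclass n \<delta> \<epsilon> P B (C, \<psi>)) =
         Lclass n \<delta> \<epsilon> (restr P A) (A \<inter> N')
           (quotient_cplx C (C' C), push n (quotient_proj C (C' C)) \<psi>)) \<and>
    (\<forall>c \<in> carrier (Lgroup n \<delta> \<epsilon> (restr P A) N).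
       exc (Lincl n \<delta> \<epsilon> P B c) = Lincl n \<delta> \<epsilon> (restr P A) (A \<inter> N') c) \<and>
    (\<forall>c \<in> carrier (Lgroup n \<delta> \<epsilon> P B).
       Lincl n \<delta> \<epsilon> P (B \<union> N') (exc c) = Lincl n \<delta> \<epsilon> P (B \<union> N') c)"
proof -
  interpret excision P A B N by unfold_locales (fact P A B X N)+
  let ?K = "real_of_int (n + 5) * 4 * \<delta>"
  have K: "0 \<le> ?K" using n \<epsilon> \<delta> by simp
  let ?q = "excise n \<epsilon> :: ('m, 'r) qcplx \<Rightarrow> ('m, 'r) qcplx"
  have C'cut: "C' C = cut C (\<lambda>r. real_of_int (n + 2 - r) * 4 * \<epsilon>)" for C
    by (rule ext) (simp add: C' cut_def)
  have q: "(quotient_cplx C (C' C), push n (quotient_proj C (C' C)) \<psi>) = ?q (C, \<psi>)" for C \<psi>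
    by (simp add: excise_def C'cut Let_def)
  \<comment> \<open>A union over representatives, as for \<open>Lincl\<close>; \<open>q_rel\<close>
    makes it a single class.\<close>
  define exc :: "('m, 'r) qcplx set \<Rightarrow> ('m, 'r) qcplx set"
    where "exc U = (\<Union>a\<in>U. Lclass n \<delta> \<epsilon> (restr P A) (A \<inter> N') (?q a))" for U
  have q_reps: "?q a \<in> Lreps n \<epsilon> (restr P A) (A \<inter> N')" if "a \<in> Lreps n \<epsilon> P B" for a
    unfolding N' by (rule excise_Lreps[OF n \<epsilon> \<delta> that])
  have q_rel: "(?q a, ?q b) \<in> Lrel n \<delta> \<epsilon> (restr P A) (A \<inter> N')" if "(a, b) \<in> Lrel n \<delta> \<epsilon> P B" for a b
    by (rule Lrel_map[OF that q_reps]) (use excise_cobordant[OF n \<epsilon> \<delta>] N' in auto)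
  have exc: "exc (Lclass n \<delta> \<epsilon> P B a) = Lclass n \<delta> \<epsilon> (restr P A) (A \<inter> N') (?q a)" if "a \<in> Lreps n \<epsilon> P B" for a
    unfolding exc_def by (rule Lclass_UN[OF that q_rel])
  have "exc \<in> hom (Lgroup n \<delta> \<epsilon> P B) (Lgroup n \<delta> \<epsilon> (restr P A) (A \<inter> N'))"
  proof (rule homI)
    fix c :: "('m, 'r) qcplx set" assume "c \<in> carrier (Lgroup n \<delta> \<epsilon> P B)"
    then obtain a where a: "a \<in> Lreps n \<epsilon> P B" "c = Lclass n \<delta> \<epsilon> P B a" by (rule Lgroup_carrier)
    show "exc c \<in> carrier (Lgroup n \<delta> \<epsilon> (restr P A) (A \<inter> N'))"
      unfolding a(2) exc[OF a(1)] by (rule Lclass_carrier[OF q_reps[OF a(1)]])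
  next
    fix c c' :: "('m, 'r) qcplx set" assume "c \<in> carrier (Lgroup n \<delta> \<epsilon> P B)" "c' \<in> carrier (Lgroup n \<delta> \<epsilon> P B)"
    then obtain a b where a: "a \<in> Lreps n \<epsilon> P B" "c = Lclass n \<delta> \<epsilon> P B a"
      and b: "b \<in> Lreps n \<epsilon> P B" "c' = Lclass n \<delta> \<epsilon> P B b" by (metis Lgroup_carrier)
    show "exc (c \<otimes>\<^bsub>Lgroup n \<delta> \<epsilon> P B\<^esub> c') =
        exc c \<otimes>\<^bsub>Lgroup n \<delta> \<epsilon> (restr P A) (A \<inter> N')\<^esub> exc c'"
      unfolding a(2) b(2) Lgroup_mult[OF \<epsilon> \<delta> a(1) b(1)] exc[OF a(1)] exc[OF b(1)] exc[OF Lsum_Lreps[OF a(1) b(1)]]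
        Lgroup_mult[OF \<epsilon> \<delta> q_reps[OF a(1)] q_reps[OF b(1)]] excise_Lsum ..
  qed
  moreover have "geom_subcomplex C (C' C)" if a: "(C, \<psi>) \<in> Lreps n \<epsilon> P B" for C \<psi>
    unfolding C'cut
  proof (rule geom_subcomplex_cut)
    have "excise n \<epsilon> (C, \<psi>) = (quotient_cplx C (C' C), push n (quotient_proj C (C' C)) \<psi>)" using q by simp
    from excise_quotient(1)[OF n \<epsilon> order_refl a this]
    show "quot_of (quotient_cplx C (cut C (\<lambda>r. real_of_int (n + 2 - r) * 4 * \<epsilon>))) C" by (simp add: C'cut)
  qed
  moreover have "exc (Lincl n \<delta> \<epsilon> P B c) = Lincl n \<delta> \<epsilon> (restr P A) (A \<inter> N') c"
    if "c \<in> carrier (Lgroup n \<delta> \<epsilon> (restr P A) N)" for c :: "('m, 'r) qcplx set"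
  proof -
    obtain a where a: "a \<in> Lreps n \<epsilon> (restr P A) N" "c = Lclass n \<delta> \<epsilon> (restr P A) N a"
      using \<open>c \<in> _\<close> by (rule Lgroup_carrier)
    have s1: "cbase P - B \<subseteq> cbase (restr P A) - N" using X N by auto
    have NN': "N \<subseteq> A \<inter> N'" using N X K by (auto simp: N' closed_nbhd_def)
    have s2: "cbase (restr P A) - A \<inter> N' \<subseteq> cbase (restr P A) - N" using NN' by auto
    have 1: "Lincl n \<delta> \<epsilon> P B c = Lclass n \<delta> \<epsilon> P B a" unfolding a(2)
      by (rule Lincl_Lclass[OF a(1) Lrel_le[OF control_le_restr s1]])
    have 2: "Lincl n \<delta> \<epsilon> (restr P A) (A \<inter> N') c = Lclass n \<delta> \<epsilon> (restr P A) (A \<inter> N') a" unfolding a(2)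
      by (rule Lincl_Lclass[OF a(1) Lrel_le[OF control_le_refl s2]])
    have aP: "a \<in> Lreps n \<epsilon> P B" by (rule Lreps_le[OF control_le_restr order_refl s1 a(1)])
    have aA: "a \<in> Lreps n \<epsilon> (restr P A) (A \<inter> N')" by (rule Lreps_le[OF control_le_refl order_refl s2 a(1)])
    \<comment> \<open>A is itself the union of the closed sets A and N, which meet in N. In this
      setting the cobordism from a complex to its quotient lives over A, as composite (a)
      demands.\<close>
    interpret sub: excision "restr P A" A N N
    proof
      show "control_map (restr P A)" using P continuous_on_subset by (fastforce simp: control_map_def)
      show "closedin (top_of_set (cbase (restr P A))) A" by simp
      show "closedin (top_of_set (cbase (restr P A))) N"
        using B X N by (auto simp: closedin_closed)
    qed (use N in auto)
    \<comment> \<open>Over points of A, membership in B is membership in N, and the neighbourhoods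
      of N in A and in X agree. So for a complex over A both settings give the same cut and the same
      quotient.\<close>
    have nb: "x \<in> N \<union> closed_nbhd A N k \<longleftrightarrow> x \<in> B \<union> closed_nbhd (cbase P) N k" if "x \<in> A" for x k
      using that N X by (auto simp: closed_nbhd_def)
    obtain C \<psi> where C: "a = (C, \<psi>)" by (metis prod.exhaust)
    have pos: "cmap P u \<in> A" if "mods C r x = Some u" for r x u
      using a(1) that unfolding C Lreps_def quad_complex_def chain_complex_def gmodule_def by (fastforce intro: ranI)
    have "sub.cut C k = cut C k" for k
    proof
      fix r
      have "{x. \<exists>u. mods C r x = Some u \<and> cmap P u \<in> N \<union> closed_nbhd A N (k r)} =
          {x. \<exists>u. mods C r x = Some u \<and> cmap P u \<in> B \<union> closed_nbhd (cbase P) N (k r)}"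
        using nb pos by blast
      then show "sub.cut C k r = cut C k r" unfolding sub.cut_def cut_def over_def by simp
    qed
    then have qa: "sub.excise n \<epsilon> a = ?q a" by (simp add: C sub.excise_def excise_def)
    have YN: "N \<union> closed_nbhd (cbase (restr P A)) N ?K = A \<inter> N'"
      using NN' X by (auto simp: N' closed_nbhd_def)
    have "Lcobordant n \<delta> (restr P A) (A \<inter> N') a (?q a)"
      using sub.excise_self[OF n \<epsilon> \<delta> a(1)] unfolding YN qa .
    then have "(a, ?q a) \<in> Lrel n \<delta> \<epsilon> (restr P A) (A \<inter> N')" by (rule Lrel_cobordant[OF aA q_reps[OF aP]])
    then show ?thesis unfolding 1 2 exc[OF aP] by (rule Lclass_eq[symmetric])
  qed
  moreover have "Lincl n \<delta> \<epsilon> P (B \<union> N') (exc c) = Lincl n \<delta> \<epsilon> P (B \<union> N') c"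
    if "c \<in> carrier (Lgroup n \<delta> \<epsilon> P B)" for c :: "('m, 'r) qcplx set"
  proof -
    obtain a where a: "a \<in> Lreps n \<epsilon> P B" "c = Lclass n \<delta> \<epsilon> P B a"
      using \<open>c \<in> _\<close> by (rule Lgroup_carrier)
    \<comment> \<open>The part of X outside B and N' lies in A, so the quotient keeps its Poincare
      region when it is regarded over X.\<close>
    have s1: "cbase P - (B \<union> N') \<subseteq> cbase (restr P A) - A \<inter> N'" using X by auto
    have s2: "cbase P - (B \<union> N') \<subseteq> cbase P - B" by auto
    have "Lincl n \<delta> \<epsilon> P (B \<union> N') (exc c) = Lclass n \<delta> \<epsilon> P (B \<union> N') (?q a)"
      unfolding a(2) exc[OF a(1)] by (rule Lincl_Lclass[OF q_reps[OF a(1)] Lrel_le[OF control_le_restr s1]])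
    also have "\<dots> = Lclass n \<delta> \<epsilon> P (B \<union> N') a"
    proof (rule Lclass_eq[symmetric, OF Lrel_cobordant])
      show "a \<in> Lreps n \<epsilon> P (B \<union> N')" by (rule Lreps_le[OF control_le_refl order_refl s2 a(1)])
      show "?q a \<in> Lreps n \<epsilon> P (B \<union> N')" by (rule Lreps_le[OF control_le_restr order_refl s1 q_reps[OF a(1)]])
      show "Lcobordant n \<delta> P (B \<union> N') a (?q a)" using excise_self[OF n \<epsilon> \<delta> a(1)] unfolding N' .
    qed
    also have "\<dots> = Lincl n \<delta> \<epsilon> P (B \<union> N') c"
      unfolding a(2) by (rule Lincl_Lclass[symmetric, OF a(1) Lrel_le[OF control_le_refl s2]])
    finally show ?thesis .
  qed
  ultimately show ?thesis
    by (intro exI[of _ exc]) (auto simp: q q_reps exc)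
qed

end
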